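(* Let $(\boldsymbol V,\boldsymbol E)$, $o$, $\theta$, $W$, and the heat kernel $p(t,x,y)$ be as in the context. Suppose the large-scale regularity hypothesis stated in the context holds with constants $d\ge3$, $R_0\ge1$, $\alpha_0\in[0,1/2)$. (i) Suppose there exist $m_0>d$, $p\in\bigl(\max\{1,\frac{d}{m_0-2}\},\infty\bigr]$ and $q\in(1,\infty]$ with $\frac1p+\frac1q<\frac2d$ such that $$\sup_{R\ge1}\|\theta\|_{p,B(R)}+\sup_{R\ge1}\|\mu_{m_0}\|_{p,B(R)}+\sup_{R\ge1}\|\nu\|_{q,B(R)}<\infty.\qquad(1)$$ Then there exist $d'=d'(d,p,q)>d$ and $C_3\in(0,\infty)$ such that for every $t>0$, $$p(t,o,o)\;\le\;C_3\,R_0^{(1/p+1/q)m_0\gamma/(2\beta)}\,R_1^{m_0/\beta}\,\mathcal M_0^{(1+m_0\gamma)/\beta}\Bigl(1+\frac{\mu_{m_0}(o)}{\theta(o)}\Bigr)t^{-d/2},$$ where $R_1$ is the constant in part (ii) of the large-scale regularity hypothesis associated with $d'$, $$\mathcal M_0:=\sup_{R\ge1}\Bigl(\bigl(\|1\vee\mu_{m_0}\|_{p,B(R)}+\|1\vee\theta\|_{p,B(R)}\bigr)\cdot\|1\vee\nu\|_{q,B(R)}\Bigr),$$ and $\beta,\gamma\in(0,1)$ are the exponents defined in the context (depending on $d,p,q,m_0$). (ii) Suppose that $W(x,y)\ne0$ only if $x\sim y$ (nearest neighbour case, in which $\mu_m=\mu$ for every $m\ge0$), and that there exist $p,q\in(1,\infty]$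 with $\frac1p+\frac1q<\frac2d$ such that (1) holds (with $\mu_{m_0}=\mu$). Then, for every $m_0>d$, there exist $d'=d'(d,p,q)>d$ and $C_3\in(0,\infty)$ such that for every $t>0$, $$p(t,o,o)\;\le\;C_3\,R_0^{(1/p+1/q)m_0\gamma/(2\beta)}\,R_1^{m_0/\beta}\,\mathcal M_0^{(1+m_0\gamma)/\beta}\Bigl(1+\frac{\mu(o)}{\theta(o)}\Bigr)t^{-d/2},$$ with $R_1$, $\mathcal M_0$, $\beta$, $\gamma$ as in (i).
   Context: $(\boldsymbol V,\boldsymbol E)$ is an infinite, connected, locally finite graph with non-oriented edges; $x\sim y$ means $\{x,y\}\in\boldsymbol E$; $\mathrm{dist}(x,y)$ is the graph distance. Fix $o\in\boldsymbol V$. $B(x,R):=\{y:\mathrm{dist}(x,y)\le\lfloor R\rfloor\}$ and $B(R):=B(o,R)$. Norms: for finite $A\subset\boldsymbol V$ and $1\le p<\infty$, $\|f\|_{p,A}:=\bigl(\frac1{|A|}\sum_{y\in A}|f(y)|^p\bigr)^{1/p}$ (normalized), $\|f\|_{\infty,A}:=\max_{A}|f|$; $\|f\|_{\ell^p(A)}:=(\sum_{y\in A}|f(y)|^p)^{1/p}$ (not normalized). $\theta:\boldsymbol V\to(0,\infty)$ is a positive reference measure. $W:\boldsymbol V\times\boldsymbol V\to[0,\infty)$ satisfies $W(x,y)=W(y,x)$, $W(x,y)>0$ whenever $x\sim y$, and $\mu(x):=\sum_{y\in\boldsymbol V}W(x,y)<\infty$ for all $x$. For $m\ge0$, $\mu_m(x):=\sum_{y\in\boldsymbol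 V}W(x,y)\,\mathrm{dist}(x,y)^m$, and $\nu(x):=\sum_{y\sim x}W(x,y)^{-1}$. Process: the form $\mathcal E(f)=\frac12\sum_{x,y}W(x,y)(f(y)-f(x))^2$ on finitely supported functions extends (by closure) to a regular Dirichlet form on $L^2(\boldsymbol V,\theta)$; $((X_t)_{t\ge0},\{\mathrm P_x\})$ is the associated strong Markov (Hunt) process, with generator $\mathcal Lf(x)=\frac1{\theta(x)}\sum_yW(x,y)(f(y)-f(x))$ on finitely supported $f$. Its (minimal) heat kernel is $p(t,x,y):=\mathrm P_x[X_t=y]/\theta(y)$. Exponents: with $a:=\frac dp+\frac dq$ and $a':=2-\frac dp-\frac dq$, put $\sigma:=2dm_0+a'm_0+2ad+a'd$ and $$\alpha:=\frac{2dm_0}{\sigma},\qquad\beta:=\frac{a'm_0}{\sigma},\qquad\gamma:=\frac{2ad+a'd}{\sigma}.$$ Large-scale regularity hypothesis: there are constants $d\ge2$, $R_0\ge1$, $\alpha_0\in[0,1/2)$ such that (i) there are $c_{\rm reg},C_{\rm reg}\in(0,\infty)$ such that for all $R\ge R_0$, $R^{\alpha_0}\le r\le R$ and $x\in B(R)$: $c_{\rm reg}r^d\le|B(x,r)|\le C_{\rm reg}r^d$; (ii) for every $d'>d$ there is $R_1\ge R_0$ such that for every $1<\rho<d'$ and $\rho_*>\rho$ with $\frac{d'}{\rho_*}=\frac{d'}{\rho}-1$ there are $C_0,C_{\rm S}\in(0,\infty)$ and $\delta_{\rm S}\in[1,\infty)$ such that for all $R\ge R_1$, $x\in B(R)$,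 $C_0R^{\alpha_0}\le r\le R$ and all $f:\boldsymbol V\to\mathbb R$, $$\|f-(f)_{B(x,r)}\|_{\ell^{\rho_*}(B(x,r))}\le C_{\rm S}\,r^{1-d/d'}\Bigl(\sum_{y,z\in B(x,\delta_{\rm S}r),\,y\sim z}|f(y)-f(z)|^\rho\Bigr)^{1/\rho},$$ where $(f)_{B}:=\frac1{|B|}\sum_{y\in B}f(y)$. *)

theory Defs
  imports "HOL-Analysis.Analysis" "HOL-Probability.Probability"
begin

subsection \<open>Graphs, distance, balls\<close>

text \<open>The vertex set is the whole type; an edge is a two-element set, so there are neither loops
  nor multiple edges.\<close>

definition adj :: "'v set set \<Rightarrow> 'v \<Rightarrow> 'v \<Rightarrow> bool" where
  "adj E x y \<longleftrightarrow> {x, y} \<in> E"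

definition adj_rel :: "'v set set \<Rightarrow> ('v \<times> 'v) set" where
  "adj_rel E = {(x, y). adj E x y}"

definition infinite_connected_lf_graph :: "'v set set \<Rightarrow> bool" where
  "infinite_connected_lf_graph E \<longleftrightarrow>
     infinite (UNIV :: 'v set) \<and>
     (\<forall>e\<in>E. card e = 2) \<and>
     (\<forall>x y. (x, y) \<in> (adj_rel E)\<^sup>*) \<and>
     (\<forall>x. finite {y. adj E x y})"

definition gdist :: "'v set set \<Rightarrow> 'v \<Rightarrow> 'v \<Rightarrow> nat" where
  "gdist E x y = (LEAST n. (x, y) \<in> adj_rel E ^^ n)"

definition gball :: "'v set set \<Rightarrow> 'v \<Rightarrow> real \<Rightarrow> 'v set" where
  "gball E x R = {y. int (gdist E x y) \<le> \<lfloor>R\<rfloor>}"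

subsection \<open>Norms\<close>

text \<open>The reciprocal of an extended exponent, with the convention that it vanishes at infinity.\<close>

definition recip :: "ereal \<Rightarrow> real" where
  "recip p = real_of_ereal (1 / p)"

definition avg_norm :: "ereal \<Rightarrow> 'v set \<Rightarrow> ('v \<Rightarrow> real) \<Rightarrow> real" where
  "avg_norm p A f =
     (if p = \<infinity> then Max ((\<lambda>y. \<bar>f y\<bar>) ` A)
      else (1 / card A * (\<Sum>y\<in>A. \<bar>f y\<bar> powr real_of_ereal p)) powr (1 / real_of_ereal p))"

definition lp_norm :: "real \<Rightarrow> 'v set \<Rightarrow> ('v \<Rightarrow> real) \<Rightarrow> real" where
  "lp_norm p A f = (\<Sum>y\<in>A. \<bar>f y\<bar> powr p) powr (1 / p)"

definition average :: "'v set \<Rightarrow> ('v \<Rightarrow> real) \<Rightarrow> real" where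
  "average A f = 1 / card A * (\<Sum>y\<in>A. f y)"

subsection \<open>Large-scale regularity\<close>

text \<open>The constants \<open>R1\<close>, \<open>C0\<close>, \<open>CS\<close>, \<open>dS\<close> whose existence the hypothesis asserts are given as
  functions of the parameters on which they may depend: \<open>R1\<close> on \<open>d'\<close>, the others on \<open>d'\<close> and
  \<open>\<rho>\<close> (which determine \<open>\<rho>s\<close>).\<close>

definition volume_regular ::
  "'v set set \<Rightarrow> 'v \<Rightarrow> real \<Rightarrow> real \<Rightarrow> real \<Rightarrow> real \<Rightarrow> real \<Rightarrow> bool" where
  "volume_regular E v0 d R0 \<alpha>0 creg Creg \<longleftrightarrow>
     0 < creg \<and> 0 < Creg \<and>
     (\<forall>R r x. R0 \<le> R \<and> R powr \<alpha>0 \<le> r \<and> r \<le> R \<and> x \<in> gball E v0 R \<longrightarrow>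
        creg * r powr d \<le> card (gball E x r) \<and> card (gball E x r) \<le> Creg * r powr d)"

definition sobolev_regular ::
  "'v set set \<Rightarrow> 'v \<Rightarrow> real \<Rightarrow> real \<Rightarrow> real \<Rightarrow> (real \<Rightarrow> real) \<Rightarrow> (real \<Rightarrow> real \<Rightarrow> real) \<Rightarrow>
    (real \<Rightarrow> real \<Rightarrow> real) \<Rightarrow> (real \<Rightarrow> real \<Rightarrow> real) \<Rightarrow> bool" where
  "sobolev_regular E v0 d R0 \<alpha>0 R1 C0 CS dS \<longleftrightarrow>
     (\<forall>d'>d. R0 \<le> R1 d' \<and>
       (\<forall>\<rho> \<rho>s. 1 < \<rho> \<and> \<rho> < d' \<and> \<rho> < \<rho>s \<and> d' / \<rho>s = d' / \<rho> - 1 \<longrightarrow>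
          0 < C0 d' \<rho> \<and> 0 < CS d' \<rho> \<and> 1 \<le> dS d' \<rho> \<and>
          (\<forall>R x r f. R1 d' \<le> R \<and> x \<in> gball E v0 R \<and> C0 d' \<rho> * R powr \<alpha>0 \<le> r \<and> r \<le> R \<longrightarrow>
             lp_norm \<rho>s (gball E x r) (\<lambda>y. f y - average (gball E x r) f)
             \<le> CS d' \<rho> * r powr (1 - d / d') *
               (\<Sum>(y, z)\<in>{(y, z). y \<in> gball E x (dS d' \<rho> * r) \<and> z \<in> gball E x (dS d' \<rho> * r)
                                \<and> adj E y z}. \<bar>f y - f z\<bar> powr \<rho>) powr (1 / \<rho>))))"

definition large_scale_regular ::
  "'v set set \<Rightarrow> 'v \<Rightarrow> real \<Rightarrow> real \<Rightarrow> real \<Rightarrow> real \<Rightarrow> real \<Rightarrow> (real \<Rightarrow> real) \<Rightarrow>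
    (real \<Rightarrow> real \<Rightarrow> real) \<Rightarrow> (real \<Rightarrow> real \<Rightarrow> real) \<Rightarrow> (real \<Rightarrow> real \<Rightarrow> real) \<Rightarrow> bool" where
  "large_scale_regular E v0 d R0 \<alpha>0 creg Creg R1 C0 CS dS \<longleftrightarrow>
     2 \<le> d \<and> 1 \<le> R0 \<and> 0 \<le> \<alpha>0 \<and> \<alpha>0 < 1 / 2 \<and>
     volume_regular E v0 d R0 \<alpha>0 creg Creg \<and>
     sobolev_regular E v0 d R0 \<alpha>0 R1 C0 CS dS"

subsection \<open>Conductances\<close>

definition conductances :: "'v set set \<Rightarrow> ('v \<Rightarrow> 'v \<Rightarrow> real) \<Rightarrow> bool" where
  "conductances E W \<longleftrightarrow>
     (\<forall>x y. 0 \<le> W x y) \<and> (\<forall>x y. W x y = W y x) \<and> (\<forall>x y. adj E x y \<longrightarrow> 0 < W x y) \<and>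
     (\<forall>x. W x summable_on UNIV)"

definition mu :: "('v \<Rightarrow> 'v \<Rightarrow> real) \<Rightarrow> 'v \<Rightarrow> real" where
  "mu W x = (\<Sum>\<^sub>\<infinity>y. W x y)"

text \<open>Since \<open>0 powr 0 = 0\<close>, the case \<open>m = 0\<close> is treated separately, so that \<open>mu_m E W 0 = mu W\<close>.
  A divergent \<open>infsum\<close> has the value 0; finiteness of the moment is \<open>finite_moment\<close>.\<close>

definition dist_pow :: "'v set set \<Rightarrow> real \<Rightarrow> 'v \<Rightarrow> 'v \<Rightarrow> real" where
  "dist_pow E m x y = (if m = 0 then 1 else real (gdist E x y) powr m)"

definition mu_m :: "'v set set \<Rightarrow> ('v \<Rightarrow> 'v \<Rightarrow> real) \<Rightarrow> real \<Rightarrow> 'v \<Rightarrow> real" where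
  "mu_m E W m x = (\<Sum>\<^sub>\<infinity>y. W x y * dist_pow E m x y)"

definition finite_moment :: "'v set set \<Rightarrow> ('v \<Rightarrow> 'v \<Rightarrow> real) \<Rightarrow> real \<Rightarrow> bool" where
  "finite_moment E W m \<longleftrightarrow> (\<forall>x. (\<lambda>y. W x y * dist_pow E m x y) summable_on UNIV)"

definition nu :: "'v set set \<Rightarrow> ('v \<Rightarrow> 'v \<Rightarrow> real) \<Rightarrow> 'v \<Rightarrow> real" where
  "nu E W x = (\<Sum>y | adj E x y. inverse (W x y))"

text \<open>In the next two definitions \<open>\<kappa>\<close> is \<open>mu_m E W m0\<close>, or \<open>mu W\<close> for nearest neighbour
  conductances.\<close>

definition norms_bounded ::
  "'v set set \<Rightarrow> 'v \<Rightarrow> ('v \<Rightarrow> real) \<Rightarrow> ('v \<Rightarrow> 'v \<Rightarrow> real) \<Rightarrow> ('v \<Rightarrow> real) \<Rightarrow> ereal \<Rightarrow> ereal \<Rightarrow> bool" where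
  "norms_bounded E v0 \<theta> W \<kappa> p q \<longleftrightarrow>
     (SUP R\<in>{1..}. ereal (avg_norm p (gball E v0 R) \<theta>)) +
     (SUP R\<in>{1..}. ereal (avg_norm p (gball E v0 R) \<kappa>)) +
     (SUP R\<in>{1..}. ereal (avg_norm q (gball E v0 R) (nu E W))) < \<infinity>"

text \<open>The real supremum below is a genuine one, as the family is bounded under \<open>norms_bounded\<close>.\<close>

definition M_zero ::
  "'v set set \<Rightarrow> 'v \<Rightarrow> ('v \<Rightarrow> real) \<Rightarrow> ('v \<Rightarrow> 'v \<Rightarrow> real) \<Rightarrow> ('v \<Rightarrow> real) \<Rightarrow> ereal \<Rightarrow> ereal \<Rightarrow> real" where
  "M_zero E v0 \<theta> W \<kappa> p q =
     (SUP R\<in>{1..}.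
        (avg_norm p (gball E v0 R) (\<lambda>x. max 1 (\<kappa> x)) + avg_norm p (gball E v0 R) (\<lambda>x. max 1 (\<theta> x))) *
        avg_norm q (gball E v0 R) (\<lambda>x. max 1 (nu E W x)))"

subsection \<open>Exponents\<close>

definition exp_a :: "real \<Rightarrow> ereal \<Rightarrow> ereal \<Rightarrow> real" where
  "exp_a d p q = d * recip p + d * recip q"

definition exp_a' :: "real \<Rightarrow> ereal \<Rightarrow> ereal \<Rightarrow> real" where
  "exp_a' d p q = 2 - d * recip p - d * recip q"

definition exp_\<sigma> :: "real \<Rightarrow> ereal \<Rightarrow> ereal \<Rightarrow> real \<Rightarrow> real" where
  "exp_\<sigma> d p q m0 = 2 * d * m0 + exp_a' d p q * m0 + 2 * exp_a d p q * d + exp_a' d p q * d"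

definition exp_\<beta> :: "real \<Rightarrow> ereal \<Rightarrow> ereal \<Rightarrow> real \<Rightarrow> real" where
  "exp_\<beta> d p q m0 = exp_a' d p q * m0 / exp_\<sigma> d p q m0"

definition exp_\<gamma> :: "real \<Rightarrow> ereal \<Rightarrow> ereal \<Rightarrow> real \<Rightarrow> real" where
  "exp_\<gamma> d p q m0 = (2 * exp_a d p q * d + exp_a' d p q * d) / exp_\<sigma> d p q m0"

subsection \<open>The Dirichlet form and its semigroup\<close>

text \<open>As \<open>\<theta>\<close> charges every vertex, elements of the \<open>L2\<close> space are functions rather than classes.\<close>

definition L2 :: "('v \<Rightarrow> real) \<Rightarrow> ('v \<Rightarrow> real) set" where
  "L2 \<theta> = {f. (\<lambda>x. \<theta> x * (f x)\<^sup>2) summable_on UNIV}"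

definition L2_inner :: "('v \<Rightarrow> real) \<Rightarrow> ('v \<Rightarrow> real) \<Rightarrow> ('v \<Rightarrow> real) \<Rightarrow> real" where
  "L2_inner \<theta> f g = (\<Sum>\<^sub>\<infinity>x. \<theta> x * f x * g x)"

definition L2_norm :: "('v \<Rightarrow> real) \<Rightarrow> ('v \<Rightarrow> real) \<Rightarrow> real" where
  "L2_norm \<theta> f = sqrt (L2_inner \<theta> f f)"

definition fin_supp :: "('v \<Rightarrow> real) \<Rightarrow> bool" where
  "fin_supp f \<longleftrightarrow> finite {x. f x \<noteq> 0}"

definition energy :: "('v \<Rightarrow> 'v \<Rightarrow> real) \<Rightarrow> ('v \<Rightarrow> real) \<Rightarrow> real" where
  "energy W f = 1 / 2 * infsum (\<lambda>(x, y). W x y * (f y - f x)\<^sup>2) UNIV"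

text \<open>The closure of \<open>energy W\<close> restricted to finitely supported functions.\<close>

definition form_approx ::
  "('v \<Rightarrow> 'v \<Rightarrow> real) \<Rightarrow> ('v \<Rightarrow> real) \<Rightarrow> ('v \<Rightarrow> real) \<Rightarrow> (nat \<Rightarrow> 'v \<Rightarrow> real) \<Rightarrow> bool" where
  "form_approx W \<theta> f u \<longleftrightarrow>
     (\<forall>n. fin_supp (u n)) \<and>
     (\<forall>e>0. \<exists>N. \<forall>m\<ge>N. \<forall>n\<ge>N. energy W (\<lambda>x. u m x - u n x) < e) \<and>
     (\<lambda>n. L2_norm \<theta> (\<lambda>x. u n x - f x)) \<longlonglongrightarrow> 0"

definition form_dom :: "('v \<Rightarrow> 'v \<Rightarrow> real) \<Rightarrow> ('v \<Rightarrow> real) \<Rightarrow> ('v \<Rightarrow> real) set" where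
  "form_dom W \<theta> = {f \<in> L2 \<theta>. \<exists>u. form_approx W \<theta> f u}"

definition form_val :: "('v \<Rightarrow> 'v \<Rightarrow> real) \<Rightarrow> ('v \<Rightarrow> real) \<Rightarrow> ('v \<Rightarrow> real) \<Rightarrow> real" where
  "form_val W \<theta> f = (THE l. \<exists>u. form_approx W \<theta> f u \<and> (\<lambda>n. energy W (u n)) \<longlonglongrightarrow> l)"

definition symmetric_semigroup ::
  "('v \<Rightarrow> real) \<Rightarrow> (real \<Rightarrow> ('v \<Rightarrow> real) \<Rightarrow> ('v \<Rightarrow> real)) \<Rightarrow> bool" where
  "symmetric_semigroup \<theta> T \<longleftrightarrow>
     (\<forall>t\<ge>0. \<forall>f\<in>L2 \<theta>. T t f \<in> L2 \<theta> \<and> L2_norm \<theta> (T t f) \<le> L2_norm \<theta> f) \<and>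
     (\<forall>t\<ge>0. \<forall>f\<in>L2 \<theta>. \<forall>g\<in>L2 \<theta>. \<forall>a b.
        T t (\<lambda>x. a * f x + b * g x) = (\<lambda>x. a * T t f x + b * T t g x)) \<and>
     (\<forall>t\<ge>0. \<forall>f\<in>L2 \<theta>. \<forall>g\<in>L2 \<theta>. L2_inner \<theta> (T t f) g = L2_inner \<theta> f (T t g)) \<and>
     (\<forall>f\<in>L2 \<theta>. T 0 f = f) \<and>
     (\<forall>s\<ge>0. \<forall>t\<ge>0. \<forall>f\<in>L2 \<theta>. T (s + t) f = T s (T t f)) \<and>
     (\<forall>f\<in>L2 \<theta>. ((\<lambda>t. L2_norm \<theta> (\<lambda>x. T t f x - f x)) \<longlongrightarrow> 0) (at_right 0))"

text \<open>The correspondence between closed symmetric forms and strongly continuous symmetric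
  contraction semigroups: \<open>f\<close> lies in the form domain iff \<open>(f - T\<^sub>t f, f) / t\<close>, which increases as
  \<open>t\<close> decreases to 0, has a finite limit, and this limit is then the value of the form at \<open>f\<close>.\<close>

definition semigroup_of_form ::
  "('v \<Rightarrow> 'v \<Rightarrow> real) \<Rightarrow> ('v \<Rightarrow> real) \<Rightarrow> (real \<Rightarrow> ('v \<Rightarrow> real) \<Rightarrow> ('v \<Rightarrow> real)) \<Rightarrow> bool" where
  "semigroup_of_form W \<theta> T \<longleftrightarrow>
     symmetric_semigroup \<theta> T \<and>
     (\<forall>f\<in>L2 \<theta>. \<forall>l. ((\<lambda>t. L2_inner \<theta> (\<lambda>x. f x - T t f x) f / t) \<longlongrightarrow> l) (at_right 0) \<longleftrightarrow>
                  f \<in> form_dom W \<theta> \<and> l = form_val W \<theta> f)"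

subsection \<open>The process and its heat kernel\<close>

text \<open>The state space is \<open>'v option\<close>, with \<open>None\<close> the cemetery, topologised as the one-point
  compactification of the discrete space of vertices.\<close>

definition state_top :: "'v option topology" where
  "state_top = Alexandroff_compactification (discrete_topology UNIV)"

definition nonneg_stopping_time :: "'w measure \<Rightarrow> (real \<Rightarrow> 'w measure) \<Rightarrow> ('w \<Rightarrow> real) \<Rightarrow> bool" where
  "nonneg_stopping_time M F \<tau> \<longleftrightarrow> stopping_time F \<tau> \<and> (\<forall>\<omega>\<in>space M. 0 \<le> \<tau> \<omega>)"

text \<open>Stopping times are real-valued. This loses nothing: for a stopping time with values in
  \<open>[0, \<infinity>]\<close>, apply the strong Markov property and quasi-left-continuity to its truncations
  at integers. The values of \<open>F\<close> at negative times play no role.\<close>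

definition strong_markov ::
  "'w measure \<Rightarrow> (real \<Rightarrow> 'w measure) \<Rightarrow> (real \<Rightarrow> 'w \<Rightarrow> 'v option) \<Rightarrow> ('v option \<Rightarrow> 'w measure) \<Rightarrow> bool" where
  "strong_markov M F X P \<longleftrightarrow>
     (\<forall>\<tau> s x B. nonneg_stopping_time M F \<tau> \<and> 0 \<le> s \<longrightarrow>
        (AE \<omega> in P x.
           real_cond_exp (P x) (filtration.pre_sigma (space M) F \<tau>)
             (indicator {\<omega>\<in>space M. X (\<tau> \<omega> + s) \<omega> \<in> B}) \<omega>
           = measure (P (X (\<tau> \<omega>) \<omega>)) {\<omega>'\<in>space M. X s \<omega>' \<in> B}))"

definition quasi_left_continuous ::
  "'w measure \<Rightarrow> (real \<Rightarrow> 'w measure) \<Rightarrow> (real \<Rightarrow> 'w \<Rightarrow> 'v option) \<Rightarrow> ('v option \<Rightarrow> 'w measure) \<Rightarrow> bool" where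
  "quasi_left_continuous M F X P \<longleftrightarrow>
     (\<forall>\<tau>s \<tau> x. (\<forall>n. nonneg_stopping_time M F (\<tau>s n)) \<and> nonneg_stopping_time M F \<tau> \<and>
        (\<forall>\<omega>\<in>space M. incseq (\<lambda>n. \<tau>s n \<omega>) \<and> (\<lambda>n. \<tau>s n \<omega>) \<longlonglongrightarrow> \<tau> \<omega>) \<longrightarrow>
        (AE \<omega> in P x. limitin state_top (\<lambda>n. X (\<tau>s n \<omega>) \<omega>) (X (\<tau> \<omega>) \<omega>) sequentially))"

definition hunt_process ::
  "'w measure \<Rightarrow> (real \<Rightarrow> 'w measure) \<Rightarrow> (real \<Rightarrow> 'w \<Rightarrow> 'v option) \<Rightarrow> ('v option \<Rightarrow> 'w measure) \<Rightarrow> bool" where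
  "hunt_process M F X P \<longleftrightarrow>
     (\<forall>x. prob_space (P x) \<and> sets (P x) = sets M) \<and>
     filtration (space M) F \<and>
     (\<forall>t. sets (F t) \<subseteq> sets M) \<and>
     (\<forall>t\<ge>0. sets (F t) = (\<Inter>s\<in>{t<..}. sets (F s))) \<and>
     (\<forall>t\<ge>0. X t \<in> measurable (F t) (count_space UNIV)) \<and>
     (\<forall>x. AE \<omega> in P x. X 0 \<omega> = x) \<and>
     (\<forall>\<omega>\<in>space M. \<forall>s t. 0 \<le> s \<and> s \<le> t \<and> X s \<omega> = None \<longrightarrow> X t \<omega> = None) \<and>
     (\<forall>\<omega>\<in>space M. \<forall>t\<ge>0. limitin state_top (\<lambda>s. X s \<omega>) (X t \<omega>) (at_right t)) \<and>
     (\<forall>\<omega>\<in>space M. \<forall>t>0. \<exists>l. limitin state_top (\<lambda>s. X s \<omega>) l (at_left t)) \<and>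
     strong_markov M F X P \<and>
     quasi_left_continuous M F X P"

text \<open>Functions on the vertices vanish at the cemetery.\<close>

definition associated_process ::
  "('v \<Rightarrow> 'v \<Rightarrow> real) \<Rightarrow> ('v \<Rightarrow> real) \<Rightarrow>
    'w measure \<Rightarrow> (real \<Rightarrow> 'w measure) \<Rightarrow> (real \<Rightarrow> 'w \<Rightarrow> 'v option) \<Rightarrow> ('v option \<Rightarrow> 'w measure) \<Rightarrow> bool" where
  "associated_process W \<theta> M F X P \<longleftrightarrow>
     hunt_process M F X P \<and>
     (\<exists>T. semigroup_of_form W \<theta> T \<and>
        (\<forall>t\<ge>0. \<forall>f\<in>L2 \<theta>. bounded (range f) \<longrightarrow>
           (\<forall>x. (\<integral>\<omega>. case_option 0 f (X t \<omega>) \<partial>P (Some x)) = T t f x)))"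

definition heat_kernel ::
  "('v \<Rightarrow> real) \<Rightarrow> (real \<Rightarrow> 'w \<Rightarrow> 'v option) \<Rightarrow> ('v option \<Rightarrow> 'w measure) \<Rightarrow> real \<Rightarrow> 'v \<Rightarrow> 'v \<Rightarrow> real" where
  "heat_kernel \<theta> X P t x y = measure (P (Some x)) {\<omega>\<in>space (P (Some x)). X t \<omega> = Some y} / \<theta> y"

definition random_walk_setting ::
  "'v set set \<Rightarrow> ('v \<Rightarrow> real) \<Rightarrow> ('v \<Rightarrow> 'v \<Rightarrow> real) \<Rightarrow>
    'w measure \<Rightarrow> (real \<Rightarrow> 'w measure) \<Rightarrow> (real \<Rightarrow> 'w \<Rightarrow> 'v option) \<Rightarrow> ('v option \<Rightarrow> 'w measure) \<Rightarrow> bool" where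
  "random_walk_setting E \<theta> W M F X P \<longleftrightarrow>
     infinite_connected_lf_graph E \<and> (\<forall>x. 0 < \<theta> x) \<and> conductances E W \<and>
     associated_process W \<theta> M F X P"

end

theory Submission
  imports Defs
begin

text \<open>
  Let \<open>B\<close> be the ball around \<open>o\<close> of radius comparable to \<open>\<surd>t\<close>, let \<open>p\<^sup>B\<close> be the heat kernel killed
  outside \<open>B\<close>, and let \<open>U\<close> and \<open>U\<^sup>B\<close> be the resolvent kernels at \<open>(o, o)\<close> with parameter \<open>1 / t\<close>. Since
  \<open>p\<close> decreases in time and dominates \<open>p\<^sup>B\<close>,
  \<open>p(2t) \<le> p\<^sup>B(t) + (e\<^sup>2 / t) (U - U\<^sup>B)\<close>.
  The first term is bounded by Nash's argument: the Sobolev inequality in \<open>B\<close> holds for functions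
  vanishing outside \<open>B\<close> without subtracting averages, because for \<open>d \<ge> 3\<close> the averages over dyadic
  balls form a summable telescoping series. For the second term, \<open>U - U\<^sup>B\<close> is at most the energy
  \<open>I\<^sub>R\<close> of the resolvent against a cutoff that vanishes near \<open>o\<close> and equals \<open>1\<close> outside \<open>B\<close>.
  The weak type estimate from truncations \<open>min U h\<close>, whose energy is at most \<open>h\<close>, and the Sobolev
  inequality for the cut off resolvent turn into a recursion of the form
  \<open>J(4R) \<le> A J(R)\<^sup>\<tau> + \<dots>\<close> with \<open>\<tau> < 1\<close> for \<open>J(R) = R\<^sup>d\<^sup>-\<^sup>2 I\<^sub>R\<close>, which keeps \<open>J\<close> bounded. Long jumps enter this
  recursion only through the factor \<open>R\<^sup>d\<^sup>-\<^sup>m\<close>, which is bounded because \<open>m\<^sub>0 > d\<close>.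
\<close>

text \<open>The process enters only through a semigroup \<open>T\<close> tied to the form by the
  limits of \<open>(f - T t f, f) / t\<close>; there is no spectral calculus to start from. The
  differential equation of the kernel \<open>v t\<close> is therefore extracted from positivity: the
  pairing of \<open>v s\<close> with \<open>v r\<close> is \<open>v (s + r) orig\<close>, so
  \<open>v t orig\<close> is midpoint convex, difference quotients are monotone, and the form limit
  exists. Kernels killed outside finite sets are explicit power series whose pairings are finite
  sums. The resolvent \<open>U\<close> itself is never formed: it is replaced by resolvents on an
  exhaustion, with estimates uniform along it, and the limit uses that finitely supported functions
  are dense in the form domain. The constants \<open>K1\<close> to \<open>K10\<close> depend on
  exponents and regularity constants only; powers of \<open>M\<close> and \<open>r0\<close> are
  carried along explicitly. The power \<open>3 + 2 / \<omega>\<close> of \<open>M\<close> is forced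
  by the fixed point of the recursion, and \<open>sobolev_dim\<close> is chosen so that it stays
  below the power in the theorem. The factor \<open>1 + \<mu>(o) / \<theta>(o)\<close> pays for
  times below the scale of \<open>r0\<close>.\<close>

section \<open>One-sided derivatives, midpoint convexity and unordered sums\<close>

text \<open>The semigroup only gives right-hand difference quotients, so the mean value theorem is
  not at hand. For each slope \<open>e\<close> the set of points up to which \<open>f\<close> stays
  within \<open>e * (y - a)\<close> of \<open>f a\<close> is closed by continuity, and a vanishing
  right derivative pushes its supremum further to the right.\<close>

lemma right_derivative_zero_imp_const:
  fixes f :: "real \<Rightarrow> real"
  assumes "a \<le> b" and cont: "continuous_on {a..b} f"
    and der: "\<And>x. a \<le> x \<Longrightarrow> x < b \<Longrightarrow> ((\<lambda>h. (f (x + h) - f x) / h) \<longlongrightarrow> 0) (at_right 0)"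
  shows "f b = f a"
proof -
  have *: "\<bar>f b - f a\<bar> \<le> e * (b - a)" if e: "e > 0" for e
  proof -
    define S where "S = {x \<in> {a..b}. \<forall>y\<in>{a..x}. \<bar>f y - f a\<bar> \<le> e * (y - a)}"
    have aS: "a \<in> S" using \<open>a \<le> b\<close> by (auto simp: S_def)
    have bdd: "bdd_above S" by (rule bdd_aboveI[of _ b]) (auto simp: S_def)
    define c where "c = Sup S"
    have ac: "a \<le> c" unfolding c_def using aS bdd by (rule cSup_upper)
    have cb: "c \<le> b" unfolding c_def using aS by (intro cSup_least) (auto simp: S_def)
    note ac = ac cb
    have below: "\<bar>f y - f a\<bar> \<le> e * (y - a)" if y: "a \<le> y" "y < c" for y
    proof -
      obtain x where "x \<in> S" "y < x" using less_cSupD[of S y] aS y(2) unfolding c_def by blast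
      then show ?thesis using y(1) unfolding S_def by auto
    qed
    have at_c: "\<bar>f c - f a\<bar> \<le> e * (c - a)"
    proof (cases "a = c")
      case False
      then have less: "a < c" using ac by simp
      have "continuous (at c within {a..b}) f"
        using cont ac unfolding continuous_on_eq_continuous_within by auto
      then have "(f \<longlongrightarrow> f c) (at c within {a..<c})"
        unfolding continuous_within by (rule tendsto_within_subset) (use ac in auto)
      then have 1: "((\<lambda>y. \<bar>f y - f a\<bar>) \<longlongrightarrow> \<bar>f c - f a\<bar>) (at c within {a..<c})"
        by (intro tendsto_intros)
      have 2: "((\<lambda>y. e * (y - a)) \<longlongrightarrow> e * (c - a)) (at c within {a..<c})"
        by (intro tendsto_intros)
      have "at c within {a..<c} \<noteq> bot"
        using less by (simp add: trivial_limit_within islimpt_Ico)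
      then show ?thesis
        by (rule tendsto_le[OF _ 2 1]) (auto simp: eventually_at_filter below)
    qed simp
    have cS: "c \<in> S"
    proof -
      have "\<bar>f y - f a\<bar> \<le> e * (y - a)" if "y \<in> {a..c}" for y
        using that at_c below[of y] by (cases "y = c") auto
      then show ?thesis using ac unfolding S_def by simp
    qed
    have "c = b"
    proof (rule ccontr)
      assume "c \<noteq> b"
      then have cb: "c < b" using ac by simp
      have "eventually (\<lambda>h. \<bar>(f (c + h) - f c) / h\<bar> < e) (at_right 0)"
        using tendstoD[OF der[OF ac(1) cb] e] by (simp add: dist_real_def)
      then obtain d where d: "d > 0" "\<And>h. 0 < h \<Longrightarrow> h < d \<Longrightarrow> \<bar>(f (c + h) - f c) / h\<bar> < e"
        unfolding eventually_at_right_field by auto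
      define x where "x = min b (c + d / 2)"
      have x: "c < x" "x \<le> b" using cb d by (auto simp: x_def)
      have "\<bar>f y - f a\<bar> \<le> e * (y - a)" if y: "a \<le> y" "y \<le> x" for y
      proof (cases "y \<le> c")
        case True
        then show ?thesis using cS y unfolding S_def by auto
      next
        case False
        then have "\<bar>(f (c + (y - c)) - f c) / (y - c)\<bar> < e"
          using y d by (intro d(2)) (auto simp: x_def)
        then have "\<bar>f y - f c\<bar> \<le> e * (y - c)" using False by (simp add: field_simps)
        then show ?thesis using at_c by (simp add: algebra_simps)
      qed
      then have "x \<in> S" using x ac unfolding S_def by auto
      then have "x \<le> c" unfolding c_def using bdd by (rule cSup_upper)
      with x show False by simp
    qed
    with at_c show ?thesis by simp
  qed
  show ?thesis
  proof (rule ccontr)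
    assume ne: "f b \<noteq> f a"
    then have pos: "b - a > 0" using \<open>a \<le> b\<close> by (cases "a = b") auto
    have half: "c / (2 * k) * k = c / 2" if "k > 0" for c k :: real using that by simp
    have "\<bar>f b - f a\<bar> / (2 * (b - a)) > 0" using ne pos by (intro divide_pos_pos) auto
    from *[OF this] have "\<bar>f b - f a\<bar> \<le> \<bar>f b - f a\<bar> / 2"
      unfolding half[OF pos] .
    then show False using ne by simp
  qed
qed

text \<open>Subtracting the integral of \<open>g\<close> leaves a function with right derivative 0,
  hence a constant, and the integral of a continuous function is differentiable from both
  sides.\<close>

lemma right_derivative_continuous_imp_derivative:
  fixes f g :: "real \<Rightarrow> real"
  assumes cont: "continuous_on {a<..} f" and g: "continuous_on {a<..} g"
    and der: "\<And>x. a < x \<Longrightarrow> ((\<lambda>h. (f (x + h) - f x) / h) \<longlongrightarrow> g x) (at_right 0)"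
    and x: "a < x"
  shows "(f has_real_derivative g x) (at x)"
proof -
  define c d where "c = (a + x) / 2" and "d = x + 1"
  have cd: "a < c" "c < x" "x < d" using x by (auto simp: c_def d_def)
  define G where "G = (\<lambda>u. integral {c..u} g)"
  have gc: "continuous_on {c..d} g" using g by (rule continuous_on_subset) (use cd in auto)
  have G: "(G has_real_derivative g u) (at u within {c..d})" if "u \<in> {c..d}" for u
    using integral_has_real_derivative[OF gc that] unfolding G_def .
  have eq: "f u = f c + G u" if u: "u \<in> {c..d}" for u
  proof -
    have "f u - G u = f c - G c"
    proof (rule right_derivative_zero_imp_const[where f = "\<lambda>u. f u - G u"])
      show "c \<le> u" using u by auto
      show "continuous_on {c..u} (\<lambda>u. f u - G u)"
      proof (intro continuous_on_diff)
        show "continuous_on {c..u} f" using cont by (rule continuous_on_subset) (use cd in auto)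
        show "continuous_on {c..u} G"
          using G u by (intro DERIV_continuous_on[of _ _ g])
            (meson DERIV_subset atLeastatMost_subset_iff atLeastAtMost_iff order_refl order_trans)
      qed
      fix y assume y: "c \<le> y" "y < u"
      have "(G has_real_derivative g y) (at y within {y..d})"
        using G[of y] by (rule DERIV_subset) (use y u in auto)
      moreover have "at y within {y..d} = at_right y"
        using y u by (simp add: at_within_Icc_at_right)
      ultimately have "((\<lambda>h. (G (y + h) - G y) / h) \<longlongrightarrow> g y) (at_right 0)"
        unfolding has_field_derivative_iff by (simp add: filterlim_at_right_to_0[where a = y] add.commute)
      then have "((\<lambda>h. (f (y + h) - f y) / h - (G (y + h) - G y) / h) \<longlongrightarrow> g y - g y) (at_right 0)"
        using y cd by (intro tendsto_diff der) auto
      moreover have "(f (y + h) - f y) / h - (G (y + h) - G y) / h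
          = (f (y + h) - G (y + h) - (f y - G y)) / h" for h
        by (simp add: diff_divide_distrib)
      ultimately show "((\<lambda>h. (f (y + h) - G (y + h) - (f y - G y)) / h) \<longlongrightarrow> 0) (at_right 0)"
        by simp
    qed
    then show ?thesis by (simp add: G_def)
  qed
  have "(G has_real_derivative g x) (at x)"
    using G[of x] cd by (simp add: at_within_Icc_at)
  then have "((\<lambda>u. f c + G u) has_real_derivative g x) (at x)"
    by (auto intro!: derivative_eq_intros)
  then show ?thesis
    by (rule has_field_derivative_transform_within_open[where S = "{c<..<d}"])
      (use cd in \<open>auto simp flip: eq\<close>)
qed

text \<open>If the excess over the chord had a positive maximum, it would be attained at a leftmost
  interior point, and the midpoint inequality on a symmetric interval around that point would fail
  strictly.\<close>

lemma midpoint_convex_imp_convex: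
  fixes f :: "real \<Rightarrow> real"
  assumes cont: "continuous_on {a..b} f"
    and mid: "\<And>x y. a \<le> x \<Longrightarrow> x \<le> y \<Longrightarrow> y \<le> b \<Longrightarrow> 2 * f ((x + y) / 2) \<le> f x + f y"
    and "a < b" "x \<in> {a..b}"
  shows "f x \<le> f a + (f b - f a) / (b - a) * (x - a)"
proof (rule ccontr)
  define g where "g = (\<lambda>x. f x - (f a + (f b - f a) / (b - a) * (x - a)))"
  assume "\<not> ?thesis"
  then have gx: "g x > 0" by (simp add: g_def)
  have gc: "continuous_on {a..b} g" unfolding g_def by (intro continuous_intros cont)
  have gmid: "2 * g ((x + y) / 2) \<le> g x + g y" if "a \<le> x" "x \<le> y" "y \<le> b" for x y
  proof -
    define k z where "k = (f b - f a) / (b - a)" and "z = (x + y) / 2"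
    have "2 * z = x + y" by (simp add: z_def)
    then have "k * (2 * z) = k * (x + y)" by simp
    then have "2 * (k * (z - a)) = k * (x - a) + k * (y - a)" by (simp add: algebra_simps)
    then show ?thesis using mid[OF that] unfolding g_def k_def[symmetric] z_def[symmetric] by (simp add: algebra_simps)
  qed
  have ends: "g a = 0" "g b = 0" using \<open>a < b\<close> by (simp_all add: g_def)
  obtain m where m: "m \<in> {a..b}" "\<And>y. y \<in> {a..b} \<Longrightarrow> g y \<le> g m"
    using continuous_attains_sup[OF _ _ gc] \<open>a < b\<close> by auto
  define S where "S = {y \<in> {a..b}. g y = g m}"
  have "compact S"
  proof -
    have "closed S" unfolding S_def using gc
      by (intro continuous_closed_preimage_constant) auto
    moreover have "bounded S" by (rule bounded_subset[of "{a..b}"]) (auto simp: S_def)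
    ultimately show ?thesis by (simp add: compact_eq_bounded_closed)
  qed
  moreover have "S \<noteq> {}" using m(1) by (auto simp: S_def)
  ultimately obtain c where c: "c \<in> S" "\<And>y. y \<in> S \<Longrightarrow> c \<le> y"
    using compact_attains_inf[of S] by auto
  have gm: "g m > 0" using m(2)[OF \<open>x \<in> {a..b}\<close>] gx by simp
  have "a \<noteq> c" "b \<noteq> c" using c(1) gm ends by (auto simp: S_def)
  then have ac: "a < c" "c < b" using c(1) by (auto simp: S_def)
  \<comment> \<open>Half the length of the longest symmetric interval around \<open>c\<close> inside
    \<open>[a, b]\<close>; its left end lies strictly below the maximum.\<close>
  define h where "h = min (c - a) (b - c)"
  have h: "0 < h" "a \<le> c - h" "c + h \<le> b" using ac by (auto simp: h_def)
  have "c - h \<notin> S" using c(2)[of "c - h"] h(1) by auto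
  then have "g (c - h) < g m" using h m(2)[of "c - h"] ac by (auto simp: S_def order_le_less)
  moreover have "g (c + h) \<le> g m" using h ac by (intro m(2)) auto
  moreover have "2 * g c \<le> g (c - h) + g (c + h)"
    using gmid[of "c - h" "c + h"] h by simp
  ultimately show False using c(1) by (simp add: S_def)
qed

text \<open>The two slope comparisons serve different ends: the first makes difference quotients
  monotone as the increment shrinks, the second bounds them by the slope of a chord to the
  left.\<close>

lemma midpoint_convex_slope:
  fixes f :: "real \<Rightarrow> real"
  assumes cont: "continuous_on {a..} f"
    and mid: "\<And>x y. a \<le> x \<Longrightarrow> x \<le> y \<Longrightarrow> 2 * f ((x + y) / 2) \<le> f x + f y"
    and "a \<le> x" "x < y" "y < z"
  shows "(f x - f y) / (y - x) \<ge> (f x - f z) / (z - x)"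
    and "(f x - f y) / (y - x) \<ge> (f y - f z) / (z - y)"
proof -
  have "f y \<le> f x + (f z - f x) / (z - x) * (y - x)"
    by (rule midpoint_convex_imp_convex[of x z])
      (use assms in \<open>auto intro: continuous_on_subset[OF cont]\<close>)
  then have *: "f y * (z - x) \<le> f x * (z - x) + (f z - f x) * (y - x)"
    using assms by (simp add: field_simps)
  then show "(f x - f y) / (y - x) \<ge> (f x - f z) / (z - x)"
    and "(f x - f y) / (y - x) \<ge> (f y - f z) / (z - y)"
    using assms by (simp_all add: frac_le_eq divide_le_eq le_divide_eq field_simps)
qed

lemma at_right_limit_of_antimono:
  fixes f :: "real \<Rightarrow> real"
  assumes mono: "\<And>s t. 0 < s \<Longrightarrow> s < t \<Longrightarrow> f t \<le> f s" and bdd: "\<And>t. 0 < t \<Longrightarrow> f t \<le> B"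
  obtains l where "(f \<longlongrightarrow> l) (at_right 0)" "l \<le> B"
proof -
  define l where "l = (SUP t\<in>{0<..}. f t)"
  have bd: "bdd_above (f ` {0<..})" by (rule bdd_aboveI[of _ B]) (use bdd in auto)
  have up: "f t \<le> l" if "0 < t" for t
    unfolding l_def using bd that by (intro cSUP_upper) auto
  have "(f \<longlongrightarrow> l) (at_right 0)"
  proof (rule order_tendstoI)
    fix a assume "a < l"
    then obtain s where s: "s > 0" "a < f s"
      unfolding l_def using less_cSUP_iff[OF _ bd] by auto
    have "a < f t" if "0 < t" "t < s" for t using mono[of t s] s that by linarith
    then show "\<forall>\<^sub>F x in at_right 0. a < f x"
      unfolding eventually_at_right_field using s by blast
  next
    fix a assume "l < a"
    then have "f t < a" if "0 < t" for t using up[OF that] by simp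
    then show "\<forall>\<^sub>F x in at_right 0. f x < a"
      unfolding eventually_at_right_field by (intro exI[of _ 1]) auto
  qed
  moreover have "l \<le> B" unfolding l_def using bdd by (intro cSUP_least) auto
  ultimately show ?thesis using that by blast
qed

lemma summable_on_abs_le:
  fixes f g :: "'a \<Rightarrow> real"
  assumes "g summable_on A" and "\<And>x. x \<in> A \<Longrightarrow> \<bar>f x\<bar> \<le> g x"
  shows "f summable_on A"
  by (rule abs_summable_summable, rule Infinite_Sum.abs_summable_on_comparison_test'[of g])
    (use assms in auto)

text \<open>The support of \<open>k\<close> leaves finitely many rows, so the double family is
  summable as soon as each of these rows is, even though the rows themselves are infinite.\<close>

lemma has_sum_finite_rows:
  fixes k :: "'a \<Rightarrow> real" and h :: "'a \<Rightarrow> 'b \<Rightarrow> real"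
  assumes "finite A" and "\<And>x. x \<in> A \<Longrightarrow> (h x has_sum S x) UNIV" and "\<And>x. x \<notin> A \<Longrightarrow> k x = 0"
  shows "((\<lambda>(x, y). k x * h x y) has_sum (\<Sum>x\<in>A. k x * S x)) UNIV"
proof -
  have "((\<lambda>(x, y). k x * h x y) has_sum (\<Sum>x\<in>A. k x * S x)) (\<Union>x\<in>A. {x} \<times> UNIV)"
  proof (rule sum_has_sum)
    fix x assume "x \<in> A"
    then have "((\<lambda>y. k x * h x y) has_sum (k x * S x)) UNIV"
      by (intro has_sum_cmult_right assms)
    then have "((\<lambda>(x, y). k x * h x y) has_sum (k x * S x)) (range (Pair x))"
      by (subst has_sum_reindex) (auto simp: inj_on_def o_def)
    also have "range (Pair x) = {x} \<times> UNIV" by auto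
    finally show "((\<lambda>(x, y). k x * h x y) has_sum (k x * S x)) ({x} \<times> UNIV)" .
  qed (use \<open>finite A\<close> in auto)
  also have "?this \<longleftrightarrow> ?thesis"
    by (rule has_sum_cong_neutral) (use assms in auto)
  finally show ?thesis .
qed

subsection \<open>The space of square summable functions\<close>

locale weighted_L2 =
  fixes \<theta> :: "'v \<Rightarrow> real"
  assumes \<theta>_pos: "\<And>x. 0 < \<theta> x"
begin

lemma L2_mult_summable:
  assumes "f \<in> L2 \<theta>" "g \<in> L2 \<theta>"
  shows "(\<lambda>x. \<theta> x * f x * g x) summable_on UNIV"
proof (rule summable_on_abs_le)
  show "(\<lambda>x. \<theta> x * (f x)\<^sup>2 + \<theta> x * (g x)\<^sup>2) summable_on UNIV"
    using assms by (intro summable_on_add) (auto simp: L2_def)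
  fix x
  have "\<bar>f x * g x\<bar> \<le> (f x)\<^sup>2 + (g x)\<^sup>2"
    using sum_squares_bound[of "\<bar>f x\<bar>" "\<bar>g x\<bar>"] mult_nonneg_nonneg[of "\<bar>f x\<bar>" "\<bar>g x\<bar>"]
    unfolding abs_mult power2_abs mult.assoc by linarith
  then have "\<theta> x * \<bar>f x * g x\<bar> \<le> \<theta> x * ((f x)\<^sup>2 + (g x)\<^sup>2)"
    using \<theta>_pos[of x] by (intro mult_left_mono) auto
  then show "\<bar>\<theta> x * f x * g x\<bar> \<le> \<theta> x * (f x)\<^sup>2 + \<theta> x * (g x)\<^sup>2"
    using \<theta>_pos[of x] by (simp add: abs_mult algebra_simps)
qed

lemma L2_lin:
  assumes "f \<in> L2 \<theta>" "g \<in> L2 \<theta>"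
  shows "(\<lambda>x. a * f x + b * g x) \<in> L2 \<theta>"
proof -
  have "(\<lambda>x. a\<^sup>2 * (\<theta> x * (f x)\<^sup>2) + b\<^sup>2 * (\<theta> x * (g x)\<^sup>2) + 2 * a * b * (\<theta> x * f x * g x)) summable_on UNIV"
    using assms by (intro summable_on_add summable_on_cmult_right L2_mult_summable) (auto simp: L2_def)
  also have "(\<lambda>x. a\<^sup>2 * (\<theta> x * (f x)\<^sup>2) + b\<^sup>2 * (\<theta> x * (g x)\<^sup>2) + 2 * a * b * (\<theta> x * f x * g x))
      = (\<lambda>x. \<theta> x * (a * f x + b * g x)\<^sup>2)"
    by (simp add: fun_eq_iff power2_eq_square algebra_simps)
  finally show ?thesis by (simp add: L2_def)
qed

lemma L2_add: "f \<in> L2 \<theta> \<Longrightarrow> g \<in> L2 \<theta> \<Longrightarrow> (\<lambda>x. f x + g x) \<in> L2 \<theta>"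
  using L2_lin[of f g 1 1] by simp

lemma L2_diff: "f \<in> L2 \<theta> \<Longrightarrow> g \<in> L2 \<theta> \<Longrightarrow> (\<lambda>x. f x - g x) \<in> L2 \<theta>"
  using L2_lin[of f g 1 "-1"] by simp

lemma L2_fin_supp: "fin_supp f \<Longrightarrow> f \<in> L2 \<theta>"
  unfolding L2_def fin_supp_def
  by (auto intro!: finite_nonzero_values_imp_summable_on elim: finite_subset[rotated])

lemma inner_commute: "L2_inner \<theta> f g = L2_inner \<theta> g f"
  unfolding L2_inner_def by (simp add: mult.commute mult.left_commute mult.assoc)

lemma inner_lin_left:
  assumes "f \<in> L2 \<theta>" "g \<in> L2 \<theta>" "h \<in> L2 \<theta>"
  shows "L2_inner \<theta> (\<lambda>x. a * f x + b * g x) h = a * L2_inner \<theta> f h + b * L2_inner \<theta> g h"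
proof -
  have "L2_inner \<theta> (\<lambda>x. a * f x + b * g x) h
      = (\<Sum>\<^sub>\<infinity>x. a * (\<theta> x * f x * h x) + b * (\<theta> x * g x * h x))"
    unfolding L2_inner_def by (simp add: algebra_simps)
  also have "\<dots> = (\<Sum>\<^sub>\<infinity>x. a * (\<theta> x * f x * h x)) + (\<Sum>\<^sub>\<infinity>x. b * (\<theta> x * g x * h x))"
    using assms by (intro infsum_add summable_on_cmult_right L2_mult_summable)
  finally show ?thesis by (simp add: infsum_cmult_right' L2_inner_def)
qed

lemma inner_diff_left:
  assumes "f \<in> L2 \<theta>" "g \<in> L2 \<theta>" "h \<in> L2 \<theta>"
  shows "L2_inner \<theta> (\<lambda>x. f x - g x) h = L2_inner \<theta> f h - L2_inner \<theta> g h"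
  using inner_lin_left[OF assms, of 1 "-1"] by simp

lemma inner_self: "L2_inner \<theta> f f = (\<Sum>\<^sub>\<infinity>x. \<theta> x * (f x)\<^sup>2)"
  by (simp add: L2_inner_def power2_eq_square mult.assoc)

lemma inner_self_nonneg: "0 \<le> L2_inner \<theta> f f"
  unfolding inner_self by (intro infsum_nonneg) (simp add: \<theta>_pos less_imp_le)

lemma L2_norm_nonneg: "0 \<le> L2_norm \<theta> f"
  by (simp add: L2_norm_def inner_self_nonneg)

lemma L2_norm_sq: "(L2_norm \<theta> f)\<^sup>2 = L2_inner \<theta> f f"
  by (simp add: L2_norm_def inner_self_nonneg)

lemma point_le_inner:
  assumes "f \<in> L2 \<theta>"
  shows "\<theta> x * (f x)\<^sup>2 \<le> L2_inner \<theta> f f"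
  using finite_sum_le_infsum[of "\<lambda>x. \<theta> x * (f x)\<^sup>2" UNIV "{x}"] assms \<theta>_pos
  unfolding inner_self L2_def by (auto simp: less_imp_le)

lemma Cauchy_Schwarz:
  assumes f: "f \<in> L2 \<theta>" and g: "g \<in> L2 \<theta>"
  shows "\<bar>L2_inner \<theta> f g\<bar> \<le> L2_norm \<theta> f * L2_norm \<theta> g"
proof (cases "L2_inner \<theta> g g = 0")
  case True
  have "\<theta> x * (g x)\<^sup>2 \<le> 0" for x using point_le_inner[OF g, of x] True by simp
  then have "g x = 0" for x using \<theta>_pos[of x] by (smt (verit) mult_pos_pos zero_less_power2)
  then have "L2_inner \<theta> f g = 0" by (simp add: L2_inner_def)
  then show ?thesis by (simp add: L2_norm_nonneg)
next
  case False
  then have pos: "L2_inner \<theta> g g > 0" using inner_self_nonneg[of g] by simp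
  define t where "t = - L2_inner \<theta> f g / L2_inner \<theta> g g"
  define h where "h = (\<lambda>x. 1 * f x + t * g x)"
  have h: "h \<in> L2 \<theta>" unfolding h_def using f g by (rule L2_lin)
  have "L2_inner \<theta> h h = L2_inner \<theta> f h + t * L2_inner \<theta> g h"
    using inner_lin_left[OF f g h, of 1 t] by (simp add: h_def)
  also have "L2_inner \<theta> f h = L2_inner \<theta> f f + t * L2_inner \<theta> f g"
    using inner_lin_left[OF f g f, of 1 t] by (simp add: h_def inner_commute)
  also have "L2_inner \<theta> g h = L2_inner \<theta> f g + t * L2_inner \<theta> g g"
    using inner_lin_left[OF f g g, of 1 t] by (simp add: h_def inner_commute)
  finally have "0 \<le> L2_inner \<theta> f f + t * L2_inner \<theta> f g + t * (L2_inner \<theta> f g + t * L2_inner \<theta> g g)"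
    using inner_self_nonneg[of h] by simp
  also have "\<dots> = L2_inner \<theta> f f - (L2_inner \<theta> f g)\<^sup>2 / L2_inner \<theta> g g"
    using pos by (simp add: t_def power2_eq_square field_simps)
  finally have "(L2_inner \<theta> f g)\<^sup>2 \<le> L2_inner \<theta> f f * L2_inner \<theta> g g"
    using pos by (simp add: field_simps)
  then have "(L2_inner \<theta> f g)\<^sup>2 \<le> (L2_norm \<theta> f * L2_norm \<theta> g)\<^sup>2"
    by (simp add: power_mult_distrib L2_norm_sq)
  then show ?thesis
    by (rule abs_le_square_iff[THEN iffD2, THEN order_trans]) (simp add: L2_norm_nonneg)
qed

text \<open>As each vertex has positive mass, convergence in the \<open>L2\<close> norm implies
  pointwise convergence, with an explicit rate at each vertex.\<close>

lemma point_le_norm: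
  assumes "f \<in> L2 \<theta>"
  shows "\<bar>f x\<bar> \<le> L2_norm \<theta> f / sqrt (\<theta> x)"
proof -
  have "sqrt (\<theta> x) * \<bar>f x\<bar> = sqrt (\<theta> x * (f x)\<^sup>2)" by (simp add: real_sqrt_mult)
  also have "\<dots> \<le> L2_norm \<theta> f"
    unfolding L2_norm_def using point_le_inner[OF assms] by (rule real_sqrt_le_mono)
  finally show ?thesis using \<theta>_pos[of x] by (simp add: field_simps)
qed

lemma inner_point: "L2_inner \<theta> f (\<lambda>y. if y = x then c else 0) = \<theta> x * f x * c"
proof -
  have "L2_inner \<theta> f (\<lambda>y. if y = x then c else 0) = (\<Sum>\<^sub>\<infinity>y\<in>{x}. \<theta> y * f y * c)"
    unfolding L2_inner_def by (rule infsum_cong_neutral) auto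
  then show ?thesis by simp
qed

lemma inner_finite:
  assumes "finite A" "\<And>x. x \<notin> A \<Longrightarrow> g x = 0"
  shows "L2_inner \<theta> f g = (\<Sum>x\<in>A. \<theta> x * f x * g x)"
proof -
  have "L2_inner \<theta> f g = (\<Sum>\<^sub>\<infinity>x\<in>A. \<theta> x * f x * g x)"
    unfolding L2_inner_def by (rule infsum_cong_neutral) (use assms in auto)
  then show ?thesis using assms by simp
qed

end

subsection \<open>Energy\<close>

locale network =
  fixes W :: "'v \<Rightarrow> 'v \<Rightarrow> real"
  assumes W_nonneg: "\<And>x y. 0 \<le> W x y" and W_sym: "\<And>x y. W x y = W y x"
    and W_summable: "\<And>x. W x summable_on UNIV"
begin

text \<open>The factor \<open>1 / \<theta> x\<close> of the generator of the process is left out, so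
  that symmetry refers to \<open>W\<close> alone.\<close>

definition generator :: "('v \<Rightarrow> real) \<Rightarrow> 'v \<Rightarrow> real" where
  "generator f x = (\<Sum>\<^sub>\<infinity>y. W x y * (f y - f x))"

text \<open>Written after summation by parts, so that it makes sense for any bounded
  \<open>f\<close> when \<open>k\<close> lives on the finite set \<open>A\<close>;
  \<open>form_has_sum\<close> identifies it with half the sum of
  \<open>W x y * (f y - f x) * (k y - k x)\<close> over all pairs.\<close>

definition form :: "'v set \<Rightarrow> ('v \<Rightarrow> real) \<Rightarrow> ('v \<Rightarrow> real) \<Rightarrow> real" where
  "form A k f = - (\<Sum>x\<in>A. k x * generator f x)"

lemma summable_bounded:
  assumes "\<And>y. \<bar>f y\<bar> \<le> C"
  shows "(\<lambda>y. W x y * f y) summable_on UNIV"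
proof (rule summable_on_abs_le)
  show "(\<lambda>y. W x y * C) summable_on UNIV" by (intro summable_on_cmult_left W_summable)
  show "\<bar>W x y * f y\<bar> \<le> W x y * C" for y
    using assms[of y] W_nonneg[of x y] by (auto simp: abs_mult intro: mult_left_mono)
qed

lemma generator_has_sum:
  assumes "\<And>y. \<bar>f y\<bar> \<le> C"
  shows "((\<lambda>y. W x y * (f y - f x)) has_sum generator f x) UNIV"
  unfolding generator_def
proof (rule has_sum_infsum)
  have "\<bar>f y - f x\<bar> \<le> 2 * C" for y using assms[of y] assms[of x] by linarith
  then show "(\<lambda>y. W x y * (f y - f x)) summable_on UNIV" by (rule summable_bounded)
qed

lemma generator_eq:
  assumes "\<And>y. \<bar>f y\<bar> \<le> C"
  shows "generator f x = (\<Sum>\<^sub>\<infinity>y. W x y * f y) - mu W x * f x"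
proof -
  have "generator f x = (\<Sum>\<^sub>\<infinity>y. W x y * f y + - (W x y * f x))"
    unfolding generator_def by (simp add: algebra_simps)
  also have "\<dots> = (\<Sum>\<^sub>\<infinity>y. W x y * f y) + (\<Sum>\<^sub>\<infinity>y. - (W x y * f x))"
    by (intro infsum_add summable_bounded[OF assms] summable_on_uminus[THEN iffD2]
        summable_on_cmult_left W_summable)
  also have "\<dots> = (\<Sum>\<^sub>\<infinity>y. W x y * f y) - mu W x * f x"
    unfolding mu_def by (simp add: infsum_uminus infsum_cmult_left')
  finally show ?thesis .
qed

text \<open>The increment of \<open>k\<close> splits into two families, one with finitely many rows
  and one with finitely many columns, which the symmetry of \<open>W\<close> exchanges.\<close>

lemma form_has_sum:
  assumes "finite A" and k: "\<And>x. x \<notin> A \<Longrightarrow> k x = 0" and f: "\<And>y. \<bar>f y\<bar> \<le> C"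
  shows "((\<lambda>(x, y). W x y * (f y - f x) * (k y - k x)) has_sum 2 * form A k f) UNIV"
proof -
  have 1: "((\<lambda>(x, y). k x * (W x y * (f y - f x))) has_sum - form A k f) (UNIV \<times> UNIV)"
    using has_sum_finite_rows[of A "\<lambda>x y. W x y * (f y - f x)" "generator f" k]
      \<open>finite A\<close> k generator_has_sum[where f = f and C = C, OF f] by (simp add: form_def)
  from this[THEN has_sum_swap[THEN iffD1]]
  have 2: "((\<lambda>(x, y). k y * (W y x * (f x - f y))) has_sum - form A k f) (UNIV \<times> UNIV)"
    by simp
  have "((\<lambda>z. - (case z of (x, y) \<Rightarrow> k x * (W x y * (f y - f x))) +
      - (case z of (x, y) \<Rightarrow> k y * (W y x * (f x - f y)))) has_sum - (- form A k f) + - (- form A k f))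
      (UNIV \<times> UNIV)"
    using 1 2 by (intro has_sum_add) (simp_all only: has_sum_uminus minus_minus)
  also have "(\<lambda>z. - (case z of (x, y) \<Rightarrow> k x * (W x y * (f y - f x))) +
      - (case z of (x, y) \<Rightarrow> k y * (W y x * (f x - f y)))) = (\<lambda>(x, y). W x y * (f y - f x) * (k y - k x))"
    using W_sym by (auto simp: fun_eq_iff algebra_simps)
  finally show ?thesis by simp
qed

lemma fin_supp_bounded:
  assumes "finite A" "\<And>x. x \<notin> A \<Longrightarrow> k x = (0 :: real)"
  obtains C where "\<And>y. \<bar>k y\<bar> \<le> C"
proof -
  have "\<bar>k y\<bar> \<le> (\<Sum>x\<in>A. \<bar>k x\<bar>)" for y
    by (cases "y \<in> A") (auto simp: assms member_le_sum sum_nonneg intro!: member_le_sum)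
  then show ?thesis using that by blast
qed

definition finite_energy :: "('v \<Rightarrow> real) \<Rightarrow> bool" where
  "finite_energy f \<longleftrightarrow> (\<lambda>(x, y). W x y * (f y - f x)\<^sup>2) summable_on UNIV"

lemma finite_energy_fin_supp:
  assumes "finite A" "\<And>x. x \<notin> A \<Longrightarrow> k x = 0"
  shows "finite_energy k" "energy W k = form A k k"
proof -
  obtain C where C: "\<And>y. \<bar>k y\<bar> \<le> C" using fin_supp_bounded[where A = A and k = k] assms by blast
  have "((\<lambda>(x, y). W x y * (k y - k x)\<^sup>2) has_sum 2 * form A k k) UNIV"
    using form_has_sum[OF assms C] by (simp add: power2_eq_square mult.assoc)
  then show "finite_energy k" "energy W k = form A k k"
    unfolding finite_energy_def energy_def by (auto simp: has_sum_imp_summable infsumI)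
qed

lemma energy_nonneg: "0 \<le> energy W f"
  unfolding energy_def using W_nonneg by (auto intro!: infsum_nonneg)

lemma finite_energy_lin:
  assumes "finite_energy f" "finite_energy g"
  shows "finite_energy (\<lambda>x. a * f x + b * g x)"
  unfolding finite_energy_def
proof (rule summable_on_abs_le)
  show "(\<lambda>z. 2 * a\<^sup>2 * (case z of (x, y) \<Rightarrow> W x y * (f y - f x)\<^sup>2)
      + 2 * b\<^sup>2 * (case z of (x, y) \<Rightarrow> W x y * (g y - g x)\<^sup>2)) summable_on UNIV"
    using assms unfolding finite_energy_def by (intro summable_on_add summable_on_cmult_right)
  fix z :: "'v \<times> 'v"
  obtain x y where z: "z = (x, y)" by (cases z)
  define u v where "u = a * (f y - f x)" and "v = b * (g y - g x)"
  have "(u + v)\<^sup>2 \<le> 2 * u\<^sup>2 + 2 * v\<^sup>2"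
    using zero_le_power2[of "u - v"] by (simp add: power2_sum power2_diff)
  then have "W x y * (u + v)\<^sup>2 \<le> W x y * (2 * u\<^sup>2 + 2 * v\<^sup>2)"
    by (intro mult_left_mono W_nonneg)
  moreover have "a * f y + b * g y - (a * f x + b * g x) = u + v"
    by (simp add: u_def v_def algebra_simps)
  moreover have "W x y * (2 * u\<^sup>2 + 2 * v\<^sup>2)
      = 2 * a\<^sup>2 * (W x y * (f y - f x)\<^sup>2) + 2 * b\<^sup>2 * (W x y * (g y - g x)\<^sup>2)"
    unfolding u_def v_def power_mult_distrib distrib_left by (simp only: mult_ac)
  ultimately show "\<bar>case z of (x, y) \<Rightarrow> W x y * (a * f y + b * g y - (a * f x + b * g x))\<^sup>2\<bar>
      \<le> 2 * a\<^sup>2 * (case z of (x, y) \<Rightarrow> W x y * (f y - f x)\<^sup>2)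
      + 2 * b\<^sup>2 * (case z of (x, y) \<Rightarrow> W x y * (g y - g x)\<^sup>2)"
    using W_nonneg[of x y] unfolding z prod.case by (simp only: abs_mult abs_power2 abs_of_nonneg)
qed

lemma finite_energy_add: "finite_energy f \<Longrightarrow> finite_energy g \<Longrightarrow> finite_energy (\<lambda>x. f x + g x)"
  and finite_energy_diff: "finite_energy f \<Longrightarrow> finite_energy g \<Longrightarrow> finite_energy (\<lambda>x. f x - g x)"
  using finite_energy_lin[of f g 1 1] finite_energy_lin[of f g 1 "-1"] by simp_all

text \<open>The mixed term of the quadratic expansion is \<open>form\<close>. This serves twice: to
  polarize the form limit of the semigroup, and to prove a Cauchy-Schwarz inequality.\<close>

lemma energy_add_fin_supp:
  assumes "finite A" "\<And>x. x \<notin> A \<Longrightarrow> k x = 0" "\<And>y. \<bar>f y\<bar> \<le> C" "finite_energy f"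
  shows "energy W (\<lambda>x. f x + c * k x) = energy W f + 2 * c * form A k f + c\<^sup>2 * energy W k"
proof -
  note k = finite_energy_fin_supp[OF assms(1,2)]
  have 1: "((\<lambda>(x, y). W x y * (f y - f x)\<^sup>2) has_sum 2 * energy W f) UNIV"
    using assms(4) unfolding finite_energy_def energy_def by simp
  have 2: "((\<lambda>(x, y). W x y * (k y - k x)\<^sup>2) has_sum 2 * energy W k) UNIV"
    using k(1) unfolding finite_energy_def energy_def by simp
  have "((\<lambda>z. (case z of (x, y) \<Rightarrow> W x y * (f y - f x)\<^sup>2)
      + 2 * c * (case z of (x, y) \<Rightarrow> W x y * (f y - f x) * (k y - k x))
      + c\<^sup>2 * (case z of (x, y) \<Rightarrow> W x y * (k y - k x)\<^sup>2))
      has_sum 2 * energy W f + 2 * c * (2 * form A k f) + c\<^sup>2 * (2 * energy W k)) UNIV"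
    by (intro has_sum_add has_sum_cmult_right 1 2 form_has_sum[OF assms(1-3)])
  also have "(\<lambda>z. (case z of (x, y) \<Rightarrow> W x y * (f y - f x)\<^sup>2)
      + 2 * c * (case z of (x, y) \<Rightarrow> W x y * (f y - f x) * (k y - k x))
      + c\<^sup>2 * (case z of (x, y) \<Rightarrow> W x y * (k y - k x)\<^sup>2))
      = (\<lambda>(x, y). W x y * (f y + c * k y - (f x + c * k x))\<^sup>2)"
    by (auto simp: fun_eq_iff power2_eq_square algebra_simps)
  finally show ?thesis unfolding energy_def by (simp add: infsumI)
qed

text \<open>Fatou's lemma for sums: finite partial sums pass to the pointwise limit and bound the
  whole.\<close>

lemma energy_lsc:
  assumes fe: "\<And>n. finite_energy (u n)" and le: "\<And>n. n \<ge> N \<Longrightarrow> energy W (u n) \<le> c"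
    and lim: "\<And>x. (\<lambda>n. u n x) \<longlonglongrightarrow> f x"
  shows "finite_energy f" "energy W f \<le> c"
proof -
  have fin: "(\<Sum>(x, y)\<in>S. W x y * (f y - f x)\<^sup>2) \<le> 2 * c" if "finite S" for S
  proof (rule LIMSEQ_le_const2)
    show "(\<lambda>n. \<Sum>(x, y)\<in>S. W x y * (u n y - u n x)\<^sup>2) \<longlonglongrightarrow> (\<Sum>(x, y)\<in>S. W x y * (f y - f x)\<^sup>2)"
      by (auto simp: split_beta intro!: tendsto_intros lim)
    show "\<exists>N. \<forall>n\<ge>N. (\<Sum>(x, y)\<in>S. W x y * (u n y - u n x)\<^sup>2) \<le> 2 * c"
    proof (intro exI allI impI)
      fix n assume n: "n \<ge> N"
      have "(\<Sum>(x, y)\<in>S. W x y * (u n y - u n x)\<^sup>2) \<le> (\<Sum>\<^sub>\<infinity>(x, y). W x y * (u n y - u n x)\<^sup>2)"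
        using fe[of n] that W_nonneg unfolding finite_energy_def by (intro finite_sum_le_infsum) auto
      then show "(\<Sum>(x, y)\<in>S. W x y * (u n y - u n x)\<^sup>2) \<le> 2 * c"
        using le[OF n] unfolding energy_def by simp
    qed
  qed
  show fef: "finite_energy f"
    unfolding finite_energy_def
  proof (rule nonneg_bdd_above_summable_on)
    show "bdd_above (sum (\<lambda>(x, y). W x y * (f y - f x)\<^sup>2) ` {F. F \<subseteq> UNIV \<and> finite F})"
      using fin by (intro bdd_aboveI[of _ "2 * c"]) auto
  qed (use W_nonneg in auto)
  have "(\<Sum>\<^sub>\<infinity>(x, y). W x y * (f y - f x)\<^sup>2) \<le> 2 * c"
    using fef fin unfolding finite_energy_def by (intro infsum_le_finite_sums) auto
  then show "energy W f \<le> c" unfolding energy_def by simp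
qed

text \<open>Young's inequality on each increment. For small \<open>e\<close> the first factor is
  close to 1, which gives continuity of the energy.\<close>

lemma energy_triangle:
  assumes "finite_energy f" "finite_energy g" "e > 0"
  shows "energy W (\<lambda>x. f x + g x) \<le> (1 + e) * energy W f + (1 + 1 / e) * energy W g"
proof -
  have "energy W (\<lambda>x. f x + g x) \<le> 1 / 2 *
    (\<Sum>\<^sub>\<infinity>z. (1 + e) * (case z of (x, y) \<Rightarrow> W x y * (f y - f x)\<^sup>2)
      + (1 + 1 / e) * (case z of (x, y) \<Rightarrow> W x y * (g y - g x)\<^sup>2))"
    unfolding energy_def
  proof (intro mult_left_mono infsum_mono)
    show "(\<lambda>(x, y). W x y * (f y + g y - (f x + g x))\<^sup>2) summable_on UNIV"
      using finite_energy_add[OF assms(1,2)] unfolding finite_energy_def .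
    show "(\<lambda>z. (1 + e) * (case z of (x, y) \<Rightarrow> W x y * (f y - f x)\<^sup>2)
      + (1 + 1 / e) * (case z of (x, y) \<Rightarrow> W x y * (g y - g x)\<^sup>2)) summable_on UNIV"
      using assms unfolding finite_energy_def by (intro summable_on_add summable_on_cmult_right)
    fix z :: "'v \<times> 'v"
    obtain x y where z: "z = (x, y)" by (cases z)
    define u v where "u = f y - f x" and "v = g y - g x"
    have "0 \<le> e * (u - v / e)\<^sup>2" using \<open>e > 0\<close> by simp
    also have "\<dots> = e * u\<^sup>2 - 2 * u * v + 1 / e * v\<^sup>2"
      using \<open>e > 0\<close> by (simp add: power2_eq_square field_simps)
    finally have "(u + v)\<^sup>2 \<le> (1 + e) * u\<^sup>2 + (1 + 1 / e) * v\<^sup>2"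
      by (simp add: power2_sum algebra_simps)
    then have "W x y * (u + v)\<^sup>2 \<le> W x y * ((1 + e) * u\<^sup>2 + (1 + 1 / e) * v\<^sup>2)"
      by (intro mult_left_mono W_nonneg)
    then show "(case z of (x, y) \<Rightarrow> W x y * (f y + g y - (f x + g x))\<^sup>2)
      \<le> (1 + e) * (case z of (x, y) \<Rightarrow> W x y * (f y - f x)\<^sup>2)
      + (1 + 1 / e) * (case z of (x, y) \<Rightarrow> W x y * (g y - g x)\<^sup>2)"
      by (simp add: z u_def v_def algebra_simps)
  qed auto
  also have "\<dots> = 1 / 2 * ((\<Sum>\<^sub>\<infinity>z. (1 + e) * (case z of (x, y) \<Rightarrow> W x y * (f y - f x)\<^sup>2))
      + (\<Sum>\<^sub>\<infinity>z. (1 + 1 / e) * (case z of (x, y) \<Rightarrow> W x y * (g y - g x)\<^sup>2)))"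
    using assms unfolding finite_energy_def
    by (intro arg_cong[where f = "\<lambda>x. 1 / 2 * x"] infsum_add summable_on_cmult_right)
  finally show ?thesis
    unfolding energy_def infsum_cmult_right' distrib_left by (simp only: mult_ac)
qed

end

section \<open>The closure of the form on finitely supported functions\<close>

locale dirichlet_space = network W + weighted_L2 \<theta> for W :: "'v \<Rightarrow> 'v \<Rightarrow> real" and \<theta> :: "'v \<Rightarrow> real"
begin

text \<open>Closability: approximants converge pointwise, so lower semicontinuity turns the Cauchy
  property into convergence of the energy of the difference. Hence the limit of the energies does
  not depend on the approximating sequence; it is the energy of \<open>f\<close>.\<close>

lemma form_approxD:
  assumes f: "f \<in> L2 \<theta>" and u: "form_approx W \<theta> f u"
  shows "finite_energy f" "(\<lambda>n. energy W (\<lambda>x. u n x - f x)) \<longlonglongrightarrow> 0"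
    "(\<lambda>n. energy W (u n)) \<longlonglongrightarrow> energy W f"
proof -
  have fin: "fin_supp (u n)" for n using u by (simp add: form_approx_def)
  have feu: "finite_energy (u n)" for n
    by (rule finite_energy_fin_supp(1)[of "{x. u n x \<noteq> 0}"])
      (use fin[of n] in \<open>simp_all add: fin_supp_def\<close>)
  have lim: "(\<lambda>n. u n x) \<longlonglongrightarrow> f x" for x
  proof (rule Lim_transform)
    show "(\<lambda>n. f x) \<longlonglongrightarrow> f x" by simp
    have "(\<lambda>n. L2_norm \<theta> (\<lambda>x. u n x - f x) / sqrt (\<theta> x)) \<longlonglongrightarrow> 0 / sqrt (\<theta> x)"
      using u \<theta>_pos[of x] unfolding form_approx_def by (intro tendsto_divide tendsto_const) auto
    then have to0: "(\<lambda>n. L2_norm \<theta> (\<lambda>x. u n x - f x) / sqrt (\<theta> x)) \<longlonglongrightarrow> 0" by simp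
    have "(\<lambda>x. u n x - f x) \<in> L2 \<theta>" for n using L2_fin_supp[OF fin] f by (rule L2_diff)
    from point_le_norm[OF this, where x = x]
    have "\<forall>\<^sub>F n in sequentially. norm (u n x - f x) \<le> L2_norm \<theta> (\<lambda>x. u n x - f x) / sqrt (\<theta> x)"
      by simp
    from Lim_null_comparison[OF this to0] show "(\<lambda>n. u n x - f x) \<longlonglongrightarrow> 0" .
  qed
  have small: "\<exists>N. \<forall>n\<ge>N. finite_energy (\<lambda>x. u n x - f x) \<and> energy W (\<lambda>x. u n x - f x) \<le> e"
    if "e > 0" for e
  proof -
    obtain N where N: "\<And>m n. m \<ge> N \<Longrightarrow> n \<ge> N \<Longrightarrow> energy W (\<lambda>x. u m x - u n x) < e"
      using u \<open>e > 0\<close> unfolding form_approx_def by blast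
    have "finite_energy (\<lambda>x. u n x - f x) \<and> energy W (\<lambda>x. u n x - f x) \<le> e" if n: "n \<ge> N" for n
    proof -
      have 1: "finite_energy (\<lambda>x. u n x - u m x)" for m by (intro finite_energy_diff feu)
      have 2: "energy W (\<lambda>x. u n x - u m x) \<le> e" if "m \<ge> N" for m using N[OF n that] by simp
      have 3: "(\<lambda>m. u n x - u m x) \<longlonglongrightarrow> u n x - f x" for x by (intro tendsto_intros lim)
      from energy_lsc[where N = N and u = "\<lambda>m x. u n x - u m x" and c = e, OF 1 2 3] show ?thesis by blast
    qed
    then show ?thesis by blast
  qed
  obtain N where N: "\<And>n. n \<ge> N \<Longrightarrow> finite_energy (\<lambda>x. u n x - f x)" using small[of 1] by auto
  show fef: "finite_energy f"
    using finite_energy_diff[OF feu[of N] N[of N]] by simp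
  have fed: "finite_energy (\<lambda>x. u n x - f x)" for n by (rule finite_energy_diff[OF feu fef])
  show conv: "(\<lambda>n. energy W (\<lambda>x. u n x - f x)) \<longlonglongrightarrow> 0"
  proof (rule LIMSEQ_I)
    fix r :: real assume "r > 0"
    then obtain N where "\<forall>n\<ge>N. energy W (\<lambda>x. u n x - f x) \<le> r / 2" using small[of "r / 2"] by auto
    then show "\<exists>N. \<forall>n\<ge>N. norm (energy W (\<lambda>x. u n x - f x) - 0) < r"
      using \<open>r > 0\<close> energy_nonneg by (intro exI[of _ N]) (auto simp: abs_of_nonneg order.strict_trans1)
  qed
  have minus: "energy W (\<lambda>x. f x - u n x) = energy W (\<lambda>x. u n x - f x)" for n
    unfolding energy_def by (simp add: power2_eq_square algebra_simps)
  show "(\<lambda>n. energy W (u n)) \<longlonglongrightarrow> energy W f"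
  proof (rule LIMSEQ_I)
    fix r :: real assume r: "r > 0"
    \<comment> \<open>\<open>e\<close> makes the relative error \<open>e * energy W f\<close> small;
      \<open>d\<close> then compensates the factor \<open>1 + 1 / e\<close> in front of the energy
      of the difference.\<close>
    define e where "e = min 1 (r / (4 * (energy W f + 1)))"
    have e: "e > 0" "e \<le> 1" "e * energy W f < r / 3"
    proof -
      have 1: "energy W f + 1 > 0" using energy_nonneg[of f] by simp
      then show "e > 0" using r by (simp add: e_def)
      show "e \<le> 1" by (simp add: e_def)
      have "e * energy W f \<le> r / (4 * (energy W f + 1)) * (energy W f + 1)"
        using \<open>e > 0\<close> energy_nonneg[of f] by (intro mult_mono) (auto simp: e_def)
      also have "\<dots> = r / 4"
      proof -
        have "r / (4 * k) * k = r / 4" if "k > 0" for k :: real using that by simp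
        from this[OF 1] show ?thesis .
      qed
      finally show "e * energy W f < r / 3" using r by simp
    qed
    define d where "d = r / (6 * (1 + 1 / e))"
    have pos1: "1 + 1 / e > 0" using e(1) by (simp add: add_pos_pos)
    have "k * (r / (6 * k)) = r / 6" if "k > 0" for k :: real using that by simp
    from this[OF pos1] have d: "d > 0" "(1 + 1 / e) * d = r / 6"
      using r pos1 unfolding d_def by (auto intro!: divide_pos_pos)
    obtain N where N: "\<And>n. n \<ge> N \<Longrightarrow> energy W (\<lambda>x. u n x - f x) \<le> d" using small[OF d(1)] by auto
    show "\<exists>N. \<forall>n\<ge>N. norm (energy W (u n) - energy W f) < r"
    proof (intro exI allI impI)
      fix n assume n: "n \<ge> N"
      have A: "(1 + 1 / e) * energy W (\<lambda>x. u n x - f x) \<le> r / 6"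
        using mult_left_mono[OF N[OF n], of "1 + 1 / e"] pos1 d(2) by simp
      have up: "energy W (u n) \<le> (1 + e) * energy W f + r / 6"
        by (rule order_trans[OF _ add_left_mono[OF A]])
          (use energy_triangle[OF fef fed[of n] e(1)] in simp)
      then have bd: "energy W (u n) \<le> 2 * energy W f + r / 6"
        using mult_right_mono[OF e(2) energy_nonneg[of f]] by (simp add: algebra_simps)
      have "energy W f \<le> (1 + e) * energy W (u n) + r / 6"
        by (rule order_trans[OF _ add_left_mono[OF A]])
          (use energy_triangle[OF feu[of n] finite_energy_diff[OF fef feu[of n]] e(1)] in
            \<open>simp add: minus\<close>)
      moreover have "e * energy W (u n) \<le> e * (2 * energy W f + r / 6)"
        using bd e(1) by (intro mult_left_mono) auto
      moreover have "e * (r / 6) \<le> r / 6" using e(2) r by simp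
      ultimately have "energy W f \<le> energy W (u n) + 2 * (e * energy W f) + r / 6 + r / 6"
        by (simp add: algebra_simps)
      moreover have "energy W (u n) \<le> energy W f + e * energy W f + r / 6"
        using up by (simp add: algebra_simps)
      ultimately show "norm (energy W (u n) - energy W f) < r" using e(3) r by auto
    qed
  qed
qed

lemma form_domE:
  assumes "f \<in> form_dom W \<theta>"
  obtains u where "form_approx W \<theta> f u" "f \<in> L2 \<theta>"
  using assms unfolding form_dom_def by auto

lemma form_val_eq:
  assumes "f \<in> form_dom W \<theta>"
  shows "form_val W \<theta> f = energy W f"
  unfolding form_val_def
proof (rule the_equality)
  obtain u where u: "form_approx W \<theta> f u" "f \<in> L2 \<theta>" using assms by (rule form_domE)
  then show "\<exists>u. form_approx W \<theta> f u \<and> (\<lambda>n. energy W (u n)) \<longlonglongrightarrow> energy W f"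
    using form_approxD(3) by blast
  fix l assume "\<exists>u. form_approx W \<theta> f u \<and> (\<lambda>n. energy W (u n)) \<longlonglongrightarrow> l"
  then show "l = energy W f" using form_approxD(3)[OF u(2)] LIMSEQ_unique by blast
qed

lemma form_dom_finite_energy: "f \<in> form_dom W \<theta> \<Longrightarrow> finite_energy f"
  by (erule form_domE) (rule form_approxD(1))

lemma form_dom_approx:
  assumes "f \<in> form_dom W \<theta>" "e > 0"
  obtains g where "fin_supp g" "energy W (\<lambda>x. g x - f x) < e" "L2_norm \<theta> (\<lambda>x. g x - f x) < e"
proof -
  obtain u where u: "form_approx W \<theta> f u" "f \<in> L2 \<theta>" using assms(1) by (rule form_domE)
  have 1: "\<forall>\<^sub>F n in sequentially. energy W (\<lambda>x. u n x - f x) < e"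
    using order_tendstoD(2)[OF form_approxD(2)[OF u(2,1)] \<open>e > 0\<close>] .
  have 2: "\<forall>\<^sub>F n in sequentially. L2_norm \<theta> (\<lambda>x. u n x - f x) < e"
    using u(1) \<open>e > 0\<close> unfolding form_approx_def by (intro order_tendstoD(2)) auto
  obtain n where "energy W (\<lambda>x. u n x - f x) < e" "L2_norm \<theta> (\<lambda>x. u n x - f x) < e"
    using eventually_happens[OF eventually_conj[OF 1 2]] by auto
  then show ?thesis using that u(1) unfolding form_approx_def by blast
qed

lemma form_dom_add_fin_supp:
  assumes f: "f \<in> form_dom W \<theta>" and k: "fin_supp k"
  shows "(\<lambda>x. f x + k x) \<in> form_dom W \<theta>"
proof -
  obtain u where u: "form_approx W \<theta> f u" "f \<in> L2 \<theta>" using f by (rule form_domE)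
  have "fin_supp (\<lambda>x. u n x + k x)" for n
  proof -
    have "finite ({x. u n x \<noteq> 0} \<union> {x. k x \<noteq> 0})"
      using u(1) k unfolding form_approx_def fin_supp_def by simp
    then show ?thesis unfolding fin_supp_def by (rule rev_finite_subset) auto
  qed
  then have "form_approx W \<theta> (\<lambda>x. f x + k x) (\<lambda>n x. u n x + k x)"
    using u(1) unfolding form_approx_def by simp
  moreover have "(\<lambda>x. f x + k x) \<in> L2 \<theta>" using u(2) L2_fin_supp[OF k] by (rule L2_add)
  ultimately show ?thesis unfolding form_dom_def by blast
qed

end

subsection \<open>The semigroup\<close>

locale form_semigroup = dirichlet_space W \<theta>
  for W :: "'v \<Rightarrow> 'v \<Rightarrow> real" and \<theta> :: "'v \<Rightarrow> real" +
  fixes T :: "real \<Rightarrow> ('v \<Rightarrow> real) \<Rightarrow> 'v \<Rightarrow> real"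
  assumes semigroup_form: "semigroup_of_form W \<theta> T"
begin

lemma semigroup: "symmetric_semigroup \<theta> T"
  using semigroup_form by (simp add: semigroup_of_form_def)

lemma T_L2: "0 \<le> t \<Longrightarrow> f \<in> L2 \<theta> \<Longrightarrow> T t f \<in> L2 \<theta>"
  and T_contraction: "0 \<le> t \<Longrightarrow> f \<in> L2 \<theta> \<Longrightarrow> L2_norm \<theta> (T t f) \<le> L2_norm \<theta> f"
  and T_lin: "0 \<le> t \<Longrightarrow> f \<in> L2 \<theta> \<Longrightarrow> g \<in> L2 \<theta> \<Longrightarrow>
    T t (\<lambda>x. a * f x + b * g x) = (\<lambda>x. a * T t f x + b * T t g x)"
  and T_sym: "0 \<le> t \<Longrightarrow> f \<in> L2 \<theta> \<Longrightarrow> g \<in> L2 \<theta> \<Longrightarrow> L2_inner \<theta> (T t f) g = L2_inner \<theta> f (T t g)"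
  and T_0: "f \<in> L2 \<theta> \<Longrightarrow> T 0 f = f"
  and T_add: "0 \<le> s \<Longrightarrow> 0 \<le> t \<Longrightarrow> f \<in> L2 \<theta> \<Longrightarrow> T (s + t) f = T s (T t f)"
  and T_cont: "f \<in> L2 \<theta> \<Longrightarrow> ((\<lambda>t. L2_norm \<theta> (\<lambda>x. T t f x - f x)) \<longlongrightarrow> 0) (at_right 0)"
  using semigroup by (simp_all add: symmetric_semigroup_def)

lemma T_diff:
  assumes "0 \<le> t" "f \<in> L2 \<theta>" "g \<in> L2 \<theta>"
  shows "T t (\<lambda>x. f x - g x) = (\<lambda>x. T t f x - T t g x)"
  using T_lin[OF assms, of 1 "-1"] by simp

text \<open>The semigroup law and contractivity carry strong continuity at time 0 to every time, at
  the same rate. A later time is always compared with an earlier one, which settles both sides at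
  once.\<close>

lemma T_continuous:
  assumes f: "f \<in> L2 \<theta>"
  shows "continuous_on {0..} (\<lambda>t. T t f x)"
  unfolding continuous_on_iff
proof (intro ballI allI impI)
  fix s e :: real assume s: "s \<in> {0..}" and e: "e > 0"
  have "\<forall>\<^sub>F t in at_right 0. L2_norm \<theta> (\<lambda>x. T t f x - f x) < e * sqrt (\<theta> x)"
    using order_tendstoD(2)[OF T_cont[OF f]] e \<theta>_pos[of x] by simp
  then obtain d where d: "d > 0" "\<And>t. 0 < t \<Longrightarrow> t < d \<Longrightarrow> L2_norm \<theta> (\<lambda>x. T t f x - f x) < e * sqrt (\<theta> x)"
    unfolding eventually_at_right_field by auto
  have *: "\<bar>T t f x - T r f x\<bar> < e" if rt: "0 \<le> r" "r < t" "t - r < d" for r t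
  proof -
    have "T t f = T r (T (t - r) f)" using T_add[of r "t - r" f] rt f by simp
    then have eq: "(\<lambda>x. T t f x - T r f x) = T r (\<lambda>x. T (t - r) f x - f x)"
      using T_diff[of r "T (t - r) f" f] rt f T_L2 by simp
    have L2: "(\<lambda>x. T (t - r) f x - f x) \<in> L2 \<theta>" using rt f by (intro L2_diff T_L2) auto
    have "(\<lambda>x. T t f x - T r f x) \<in> L2 \<theta>" unfolding eq using rt(1) L2 by (rule T_L2)
    from point_le_norm[OF this, where x = x]
    have "\<bar>T t f x - T r f x\<bar> \<le> L2_norm \<theta> (T r (\<lambda>x. T (t - r) f x - f x)) / sqrt (\<theta> x)"
      unfolding eq .
    also have "\<dots> \<le> L2_norm \<theta> (\<lambda>x. T (t - r) f x - f x) / sqrt (\<theta> x)"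
      using \<theta>_pos[of x] rt(1) L2 by (intro divide_right_mono T_contraction) auto
    also have "\<dots> < e" using d(2)[of "t - r"] rt \<theta>_pos[of x] by (simp add: divide_less_eq)
    finally show ?thesis .
  qed
  show "\<exists>d>0. \<forall>t\<in>{0..}. dist t s < d \<longrightarrow> dist (T t f x) (T s f x) < e"
  proof (intro exI[of _ d] conjI ballI impI)
    fix t assume t: "t \<in> {0..}" "dist t s < d"
    consider "t < s" | "t = s" | "s < t" by linarith
    then show "dist (T t f x) (T s f x) < e"
    proof cases
      case 1
      then show ?thesis using *[of t s] t by (simp add: dist_real_def abs_minus_commute)
    next
      case 3
      then show ?thesis using *[of s t] t s by (simp add: dist_real_def)
    qed (use e in auto)
  qed (use d in auto)
qed

lemma T_inner_half:
  assumes f: "f \<in> L2 \<theta>" and "0 \<le> s" "0 \<le> t"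
  shows "L2_inner \<theta> (T (s + t) f) f = L2_inner \<theta> (T s f) (T t f)"
  using T_sym[of s "T t f" f] T_add[of s t f] assms T_L2 by (simp add: inner_commute)

end

text \<open>The bounds express that \<open>T t\<close> applied to the normalized point mass is a
  transition probability divided by \<open>\<theta> orig\<close>; nothing else about the process is
  carried into the analysis.\<close>

locale point_evolution = form_semigroup W \<theta> T
  for W :: "'v \<Rightarrow> 'v \<Rightarrow> real" and \<theta> T +
  fixes orig :: 'v
  assumes bounds: "\<And>t x. 0 \<le> t \<Longrightarrow>
    0 \<le> T t (\<lambda>y. if y = orig then 1 / \<theta> orig else 0) x \<and> T t (\<lambda>y. if y = orig then 1 / \<theta> orig else 0) x \<le> 1 / \<theta> orig"
begin

definition \<delta> :: "'v \<Rightarrow> real" where "\<delta> = (\<lambda>y. if y = orig then 1 / \<theta> orig else 0)"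

text \<open>The heat kernel with pole \<open>orig\<close>: \<open>v t x\<close> is p(t, x,
  o).\<close>

definition v :: "real \<Rightarrow> 'v \<Rightarrow> real" where "v t = T t \<delta>"

lemma v_bounds: "0 \<le> t \<Longrightarrow> 0 \<le> v t x" "0 \<le> t \<Longrightarrow> v t x \<le> 1 / \<theta> orig"
  using bounds[of t x] by (simp_all add: v_def \<delta>_def)

lemma v_abs: "0 \<le> t \<Longrightarrow> \<bar>v t x\<bar> \<le> 1 / \<theta> orig"
  using v_bounds by simp

lemma \<delta>_L2: "\<delta> \<in> L2 \<theta>"
  by (rule L2_fin_supp) (simp add: fin_supp_def \<delta>_def)

lemma v_L2: "0 \<le> t \<Longrightarrow> v t \<in> L2 \<theta>"
  unfolding v_def by (intro T_L2 \<delta>_L2)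

lemma v_0: "v 0 = \<delta>"
  unfolding v_def by (rule T_0[OF \<delta>_L2])

lemma inner_\<delta>: "L2_inner \<theta> f \<delta> = f orig"
  unfolding \<delta>_def inner_point using \<theta>_pos[of orig] by simp

lemma v_continuous: "continuous_on {0..} (\<lambda>t. v t x)"
  unfolding v_def by (rule T_continuous[OF \<delta>_L2])

lemma v_inner: "0 \<le> s \<Longrightarrow> 0 \<le> t \<Longrightarrow> L2_inner \<theta> (v s) (v t) = v (s + t) orig"
  unfolding v_def using T_inner_half[OF \<delta>_L2, of s t] by (simp add: inner_\<delta>)

text \<open>The squared norm of \<open>v (x / 2) - v (y / 2)\<close> is nonnegative, and all
  pairings in its expansion are values of \<open>v\<close> at \<open>orig\<close>.\<close>

lemma v_midpoint:
  assumes "0 \<le> x" "x \<le> y"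
  shows "2 * v ((x + y) / 2) orig \<le> v x orig + v y orig"
proof -
  have L: "v (x / 2) \<in> L2 \<theta>" "v (y / 2) \<in> L2 \<theta>" using assms by (auto intro: v_L2)
  define D where "D = (\<lambda>z. v (x / 2) z - v (y / 2) z)"
  have d: "D \<in> L2 \<theta>" unfolding D_def using L by (rule L2_diff)
  have "0 \<le> L2_inner \<theta> D D" by (rule inner_self_nonneg)
  also have "L2_inner \<theta> D D = L2_inner \<theta> (v (x / 2)) D - L2_inner \<theta> (v (y / 2)) D"
    using inner_diff_left[OF L d] by (simp only: D_def)
  also have "L2_inner \<theta> (v (x / 2)) D = L2_inner \<theta> (v (x / 2)) (v (x / 2)) - L2_inner \<theta> (v (y / 2)) (v (x / 2))"
    unfolding inner_commute[of "v (x / 2)" D] unfolding D_def by (rule inner_diff_left[OF L L(1)])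
  also have "L2_inner \<theta> (v (y / 2)) D = L2_inner \<theta> (v (x / 2)) (v (y / 2)) - L2_inner \<theta> (v (y / 2)) (v (y / 2))"
    unfolding inner_commute[of "v (y / 2)" D] unfolding D_def by (rule inner_diff_left[OF L L(2)])
  finally show ?thesis
    using assms v_inner[of "x / 2" "x / 2"] v_inner[of "x / 2" "y / 2"] v_inner[of "y / 2" "x / 2"]
      v_inner[of "y / 2" "y / 2"] by (simp add: add_divide_distrib add.commute)
qed

text \<open>\<open>v t orig\<close> is the squared norm of \<open>v (t / 2)\<close>, which
  contractions cannot increase.\<close>

lemma v_antimono:
  assumes "0 \<le> s" "s \<le> t"
  shows "v t orig \<le> v s orig"
proof -
  have "v (t / 2) = T (t / 2 - s / 2) (v (s / 2))"
    unfolding v_def using assms T_add[of "t / 2 - s / 2" "s / 2" \<delta>] \<delta>_L2 by simp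
  then have "L2_norm \<theta> (v (t / 2)) \<le> L2_norm \<theta> (v (s / 2))"
    using assms by (simp add: T_contraction v_L2)
  then have "(L2_norm \<theta> (v (t / 2)))\<^sup>2 \<le> (L2_norm \<theta> (v (s / 2)))\<^sup>2"
    by (intro power_mono L2_norm_nonneg)
  then show ?thesis
    using v_inner[of "t / 2" "t / 2"] v_inner[of "s / 2" "s / 2"] assms by (simp add: L2_norm_sq)
qed

text \<open>The quotient that defines the form at \<open>v s\<close> is a difference quotient of
  \<open>v t orig\<close> at time \<open>2 * s\<close>. Convexity makes it monotone and bounds it by
  the slope of the chord over \<open>[0, 2 * s]\<close>, so it converges: the smoothing property of
  a symmetric semigroup without the spectral theorem.\<close>

lemma v_form_dom:
  assumes s: "0 < s"
  shows "v s \<in> form_dom W \<theta>" "energy W (v s) \<le> 1 / (2 * s * \<theta> orig)"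
proof -
  define \<psi> where "\<psi> = (\<lambda>t. L2_inner \<theta> (\<lambda>x. v s x - T t (v s) x) (v s) / t)"
  have \<psi>_eq: "\<psi> t = (v (2 * s) orig - v (2 * s + t) orig) / t" if "t > 0" for t
  proof -
    have "T t (v s) = v (t + s)" unfolding v_def using that s T_add[of t s \<delta>] \<delta>_L2 by simp
    then show ?thesis
      unfolding \<psi>_def using inner_diff_left[of "v s" "v (t + s)" "v s"] v_L2 that s
        v_inner[of s s] v_inner[of "t + s" s] by (simp add: algebra_simps)
  qed
  have c: "continuous_on {0..} (\<lambda>t. v t orig)" by (rule v_continuous)
  note slope = midpoint_convex_slope[where f = "\<lambda>t. v t orig" and a = 0, OF c v_midpoint]
  have anti: "\<psi> t \<le> \<psi> r" if "0 < r" "r < t" for r t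
    using slope(1)[of "2 * s" "2 * s + r" "2 * s + t"] that s \<psi>_eq by simp
  have bd: "\<psi> t \<le> 1 / (2 * s * \<theta> orig)" if t: "0 < t" for t
  proof -
    have "\<psi> t \<le> (v 0 orig - v (2 * s) orig) / (2 * s)"
      using slope(2)[of 0 "2 * s" "2 * s + t"] t s \<psi>_eq by simp
    also have "\<dots> \<le> (1 / \<theta> orig) / (2 * s)"
      using v_bounds[of 0 orig] v_bounds[of "2 * s" orig] s by (intro divide_right_mono) auto
    finally show ?thesis by (simp add: mult.commute)
  qed
  obtain l where l: "(\<psi> \<longlongrightarrow> l) (at_right 0)" "l \<le> 1 / (2 * s * \<theta> orig)"
    using at_right_limit_of_antimono[of \<psi>, OF anti bd] by blast
  have "v s \<in> L2 \<theta>" using s by (simp add: v_L2)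
  then have *: "v s \<in> form_dom W \<theta>" "l = form_val W \<theta> (v s)"
    using semigroup_form l(1) unfolding semigroup_of_form_def \<psi>_def by blast+
  show "v s \<in> form_dom W \<theta>" by fact
  show "energy W (v s) \<le> 1 / (2 * s * \<theta> orig)" using *(2) l(2) form_val_eq[OF *(1)] by simp
qed

lemma form_limit:
  assumes "f \<in> form_dom W \<theta>"
  shows "((\<lambda>t. L2_inner \<theta> (\<lambda>x. f x - T t f x) f / t) \<longlongrightarrow> energy W f) (at_right 0)"
proof -
  have "f \<in> L2 \<theta>" using assms by (auto simp: form_dom_def)
  then have "((\<lambda>t. L2_inner \<theta> (\<lambda>x. f x - T t f x) f / t) \<longlongrightarrow> form_val W \<theta> f) (at_right 0)"
    using semigroup_form assms unfolding semigroup_of_form_def by blast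
  then show ?thesis by (simp add: form_val_eq[OF assms])
qed

text \<open>The monotone limits defining the form are polarized against a point mass at \<open>x\<close>.\<close>

lemma v_right_derivative:
  assumes s: "0 < s"
  shows "((\<lambda>h. (v (s + h) x - v s x) / h) \<longlongrightarrow> generator (v s) x / \<theta> x) (at_right 0)"
proof -
  define k :: "'v \<Rightarrow> real" where "k = (\<lambda>y. if y = x then 1 else 0)"
  have fk: "fin_supp k" "fin_supp (\<lambda>y. - k y)" by (simp_all add: fin_supp_def k_def)
  have kL: "k \<in> L2 \<theta>" by (rule L2_fin_supp[OF fk(1)])
  have vL: "v s \<in> L2 \<theta>" using s by (simp add: v_L2)
  have k0: "\<And>y. y \<notin> {x} \<Longrightarrow> k y = 0" by (simp add: k_def)
  have dom: "(\<lambda>y. v s y + c * k y) \<in> form_dom W \<theta>" for c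
    by (rule form_dom_add_fin_supp[OF v_form_dom(1)[OF s]]) (simp add: fin_supp_def k_def)
  define q where "q = (\<lambda>c t. L2_inner \<theta> (\<lambda>y. (v s y + c * k y) - T t (\<lambda>y. v s y + c * k y) y) (\<lambda>y. v s y + c * k y) / t)"
  have lim: "(q c \<longlongrightarrow> energy W (\<lambda>y. v s y + c * k y)) (at_right 0)" for c
    unfolding q_def by (rule form_limit[OF dom])
  have en: "energy W (\<lambda>y. v s y + c * k y)
      = energy W (v s) + 2 * c * form {x} k (v s) + c\<^sup>2 * energy W k" for c
  proof (rule energy_add_fin_supp)
    show "\<bar>v s y\<bar> \<le> 1 / \<theta> orig" for y using s by (simp add: v_abs)
    show "finite_energy (v s)" by (rule form_dom_finite_energy[OF v_form_dom(1)[OF s]])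
  qed (use k0 in auto)
  have fv: "form {x} k (v s) = - generator (v s) x" by (simp add: form_def k_def)
  have "((\<lambda>t. (q 1 t - q (-1) t) / 4) \<longlongrightarrow>
      (energy W (\<lambda>y. v s y + 1 * k y) - energy W (\<lambda>y. v s y + (-1) * k y)) / 4) (at_right 0)"
    by (intro tendsto_intros lim) simp
  then have lim2: "((\<lambda>t. (q 1 t - q (-1) t) / 4) \<longlongrightarrow> - generator (v s) x) (at_right 0)"
    unfolding en fv by simp
  have qd: "(q 1 t - q (-1) t) / 4 = - \<theta> x * ((v (s + t) x - v s x) / t)" if t: "t > 0" for t
  proof -
    have Tk: "T t k \<in> L2 \<theta>" and Tv: "T t (v s) \<in> L2 \<theta>" using t kL vL by (simp_all add: T_L2)
    have TT: "T t (v s) = v (s + t)"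
      unfolding v_def using t s T_add[of t s \<delta>] \<delta>_L2 by (simp add: add.commute)
    define a b where "a = (\<lambda>y. v s y - T t (v s) y)" and "b = (\<lambda>y. k y - T t k y)"
    have ab: "a \<in> L2 \<theta>" "b \<in> L2 \<theta>" unfolding a_def b_def using vL kL Tk Tv by (auto intro: L2_diff)
    have "q c t = (L2_inner \<theta> a (v s) + c * L2_inner \<theta> a k + c * L2_inner \<theta> b (v s) + c\<^sup>2 * L2_inner \<theta> b k) / t" for c
    proof -
      have "T t (\<lambda>y. v s y + c * k y) = (\<lambda>y. T t (v s) y + c * T t k y)"
        using T_lin[of t "v s" k 1 c] t vL kL by simp
      then have "(\<lambda>y. (v s y + c * k y) - T t (\<lambda>y. v s y + c * k y) y) = (\<lambda>y. 1 * a y + c * b y)"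
        by (simp add: a_def b_def algebra_simps)
      moreover have vk: "(\<lambda>y. 1 * v s y + c * k y) \<in> L2 \<theta>" using vL kL by (rule L2_lin)
      ultimately have "q c t = (L2_inner \<theta> a (\<lambda>y. 1 * v s y + c * k y) + c * L2_inner \<theta> b (\<lambda>y. 1 * v s y + c * k y)) / t"
        unfolding q_def using inner_lin_left[OF ab vk, of 1 c] by simp
      also have "L2_inner \<theta> a (\<lambda>y. 1 * v s y + c * k y) = L2_inner \<theta> a (v s) + c * L2_inner \<theta> a k"
        using inner_lin_left[OF vL kL ab(1), of 1 c] by (simp add: inner_commute)
      also have "L2_inner \<theta> b (\<lambda>y. 1 * v s y + c * k y) = L2_inner \<theta> b (v s) + c * L2_inner \<theta> b k"
        using inner_lin_left[OF vL kL ab(2), of 1 c] by (simp add: inner_commute)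
      finally show ?thesis by (simp add: power2_eq_square algebra_simps)
    qed
    note q = this
    \<comment> \<open>Self-adjointness of \<open>T t\<close> merges the two mixed terms, leaving
      only the pairing of \<open>k\<close> with the increment of \<open>v\<close>.\<close>
    have sym: "L2_inner \<theta> b (v s) = L2_inner \<theta> a k"
      unfolding a_def b_def using inner_diff_left[OF kL Tk vL] inner_diff_left[OF vL Tv kL] T_sym[of t k "v s"] t vL kL
      by (simp add: inner_commute)
    have "L2_inner \<theta> a k = \<theta> x * (v s x - v (s + t) x)"
      unfolding k_def inner_point a_def TT by simp
    then show ?thesis using q[of 1] q[of "-1"] sym t by (simp add: field_simps)
  qed
  have "((\<lambda>t. - \<theta> x * ((v (s + t) x - v s x) / t)) \<longlongrightarrow> - generator (v s) x) (at_right 0)"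
  proof (rule Lim_transform_eventually[OF lim2])
    show "\<forall>\<^sub>F t in at_right 0. (q 1 t - q (-1) t) / 4 = - \<theta> x * ((v (s + t) x - v s x) / t)"
      by (rule eventually_mono[OF eventually_at_right_less]) (rule qd)
  qed
  then have "((\<lambda>t. (- \<theta> x * ((v (s + t) x - v s x) / t)) / (- \<theta> x)) \<longlongrightarrow> (- generator (v s) x) / (- \<theta> x)) (at_right 0)"
    using \<theta>_pos[of x] by (intro tendsto_divide tendsto_const) auto
  then show ?thesis using \<theta>_pos[of x] by (simp add: less_imp_neq[symmetric])
qed

text \<open>The uniform bound on \<open>v\<close> makes the defining series converge uniformly in
  \<open>s\<close>. This continuity is what turns the right derivative into a derivative.\<close>

lemma generator_v_continuous: "continuous_on {0..} (\<lambda>s. generator (v s) x)"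
proof -
  have "uniform_limit {0..} (\<lambda>X s. \<Sum>y\<in>X. W x y * (v s y - v s x))
      (\<lambda>s. generator (v s) x) (finite_subsets_at_top UNIV)"
    unfolding generator_def
  proof (rule Weierstrass_m_test_general)
    show "(\<lambda>y. W x y * (2 / \<theta> orig)) summable_on UNIV" by (intro summable_on_cmult_left W_summable)
    fix y s assume "s \<in> {0 :: real ..}"
    then have "\<bar>v s y - v s x\<bar> \<le> 2 / \<theta> orig" using v_abs[of s y] v_abs[of s x] by (simp add: abs_le_iff)
    then show "norm (W x y * (v s y - v s x)) \<le> W x y * (2 / \<theta> orig)"
      using W_nonneg[of x y] mult_left_mono[of "\<bar>v s y - v s x\<bar>" "2 / \<theta> orig" "W x y"]
      unfolding real_norm_def abs_mult by (simp only: abs_of_nonneg)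
  qed
  then show ?thesis
    by (rule uniform_limit_theorem[rotated])
      (auto intro!: always_eventually continuous_intros v_continuous)
qed

lemma v_derivative:
  assumes "0 < s"
  shows "((\<lambda>s. v s x) has_real_derivative generator (v s) x / \<theta> x) (at s)"
proof (rule right_derivative_continuous_imp_derivative[where a = 0])
  show "continuous_on {0<..} (\<lambda>s. v s x)"
    by (rule continuous_on_subset[OF v_continuous]) auto
  show "continuous_on {0<..} (\<lambda>s. generator (v s) x / \<theta> x)"
    using \<theta>_pos[of x]
    by (intro continuous_intros continuous_on_subset[OF generator_v_continuous]) auto
qed (use assms v_right_derivative in auto)

lemma v_norm_0: "((\<lambda>t. L2_norm \<theta> (\<lambda>x. v t x - \<delta> x)) \<longlongrightarrow> 0) (at_right 0)"
  unfolding v_def by (rule T_cont[OF \<delta>_L2])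

end

subsection \<open>The process killed outside a finite set\<close>

context network
begin

lemma form_sym:
  assumes "finite A" "\<And>x. x \<notin> A \<Longrightarrow> k x = 0" "\<And>x. x \<notin> A \<Longrightarrow> f x = 0"
  shows "form A k f = form A f k"
proof -
  obtain C where C: "\<And>y. \<bar>k y\<bar> \<le> C" using fin_supp_bounded[where A = A and k = k] assms by blast
  obtain D where D: "\<And>y. \<bar>f y\<bar> \<le> D" using fin_supp_bounded[where A = A and k = f] assms by blast
  have "((\<lambda>(x, y). W x y * (f y - f x) * (k y - k x)) has_sum 2 * form A k f) UNIV"
    using assms by (intro form_has_sum[where C = D] D) auto
  moreover have "((\<lambda>(x, y). W x y * (k y - k x) * (f y - f x)) has_sum 2 * form A f k) UNIV"
    using assms by (intro form_has_sum[where C = C] C) auto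
  ultimately have "2 * form A k f = 2 * form A f k"
    by (intro has_sum_unique) (auto simp: mult_ac)
  then show ?thesis by simp
qed

lemma generator_fin:
  assumes "finite A" "\<And>x. x \<notin> A \<Longrightarrow> f x = 0"
  shows "generator f x = (\<Sum>y\<in>A. W x y * f y) - mu W x * f x"
proof -
  obtain C where C: "\<And>y. \<bar>f y\<bar> \<le> C" using fin_supp_bounded[where A = A and k = f] assms by blast
  have "(\<Sum>\<^sub>\<infinity>y. W x y * f y) = (\<Sum>\<^sub>\<infinity>y\<in>A. W x y * f y)"
    by (rule infsum_cong_neutral) (use assms in auto)
  then show ?thesis using generator_eq[where f = f and C = C, OF C, of x] assms(1) by simp
qed

lemma sum_W_le_mu: "finite A \<Longrightarrow> (\<Sum>x\<in>A. W x y) \<le> mu W y"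
  unfolding mu_def W_sym[of _ y] using W_nonneg W_summable by (intro finite_sum_le_infsum) auto

lemma mu_nonneg: "0 \<le> mu W x"
  unfolding mu_def using W_nonneg by (intro infsum_nonneg) auto

end

locale killed = dirichlet_space W \<theta>
  for W :: "'v \<Rightarrow> 'v \<Rightarrow> real" and \<theta> :: "'v \<Rightarrow> real" +
  fixes A :: "'v set" and orig :: 'v
  assumes finite_A: "finite A" and orig_A: "orig \<in> A"
begin

text \<open>A crude common upper bound of the jump rates on \<open>A\<close>. Adding it to the
  killed generator gives an operator with nonnegative entries.\<close>

definition rate :: real where "rate = (\<Sum>x\<in>A. mu W x / \<theta> x)"

primrec coef :: "nat \<Rightarrow> 'v \<Rightarrow> real" where
  "coef 0 x = (if x = orig then 1 / \<theta> orig else 0)"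
| "coef (Suc n) x = (if x \<in> A then rate * coef n x + ((\<Sum>y\<in>A. W x y * coef n y) - mu W x * coef n x) / \<theta> x else 0)"

text \<open>Uniformization: \<open>coef n\<close> is the \<open>n\<close>-th power of \<open>rate + generator\<close> applied to the point
  mass, so these are the exponential and the resolvent of the killed generator.\<close>

definition u :: "real \<Rightarrow> 'v \<Rightarrow> real" where
  "u s x = exp (- rate * s) * (\<Sum>n. coef n x / fact n * s ^ n)"

definition U :: "real \<Rightarrow> 'v \<Rightarrow> real" where
  "U \<eta> x = (\<Sum>n. coef n x / (rate + \<eta>) ^ Suc n)"

lemma rate_nonneg: "0 \<le> rate"
  unfolding rate_def using mu_nonneg \<theta>_pos by (intro sum_nonneg divide_nonneg_nonneg) (auto simp: less_imp_le)

lemma rate_ge: "x \<in> A \<Longrightarrow> mu W x / \<theta> x \<le> rate"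
  unfolding rate_def using mu_nonneg \<theta>_pos finite_A
  by (intro member_le_sum divide_nonneg_nonneg) (auto simp: less_imp_le)

lemma coef_off: "x \<notin> A \<Longrightarrow> coef n x = 0"
  using orig_A by (cases n) auto

lemma coef_nonneg: "0 \<le> coef n x"
proof (induction n arbitrary: x)
  case 0
  then show ?case using \<theta>_pos[of orig] by simp
next
  case (Suc n)
  show ?case
  proof (cases "x \<in> A")
    case True
    have "0 \<le> (\<Sum>y\<in>A. W x y * coef n y) / \<theta> x"
      using Suc W_nonneg \<theta>_pos[of x] by (intro divide_nonneg_pos sum_nonneg mult_nonneg_nonneg) auto
    moreover have "mu W x / \<theta> x * coef n x \<le> rate * coef n x"
      using rate_ge[OF True] Suc by (intro mult_right_mono) auto
    ultimately show ?thesis using True by (simp add: diff_divide_distrib)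
  qed simp
qed

text \<open>Mass balance: the weights \<open>W x y\<close> with \<open>x\<close> in \<open>A\<close>
  add up to at most \<open>mu W y\<close>, so mass can only be lost through the boundary of
  \<open>A\<close>.\<close>

lemma sum_coef_le: "(\<Sum>x\<in>A. \<theta> x * coef n x) \<le> rate ^ n"
proof (induction n)
  case 0
  have "(\<Sum>x\<in>A. \<theta> x * coef 0 x) = (\<Sum>x\<in>A. if x = orig then 1 else 0)"
    using \<theta>_pos[of orig] by (intro sum.cong) auto
  also have "\<dots> = 1" using finite_A orig_A by simp
  finally show ?case by simp
next
  case (Suc n)
  have "(\<Sum>x\<in>A. \<theta> x * coef (Suc n) x)
      = (\<Sum>x\<in>A. rate * (\<theta> x * coef n x) + ((\<Sum>y\<in>A. W x y * coef n y) - mu W x * coef n x))"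
    using \<theta>_pos by (intro sum.cong) (auto simp: field_simps less_imp_neq[symmetric])
  also have "\<dots> = rate * (\<Sum>x\<in>A. \<theta> x * coef n x)
      + ((\<Sum>x\<in>A. \<Sum>y\<in>A. W x y * coef n y) - (\<Sum>x\<in>A. mu W x * coef n x))"
    by (simp add: sum.distrib sum_subtractf sum_distrib_left)
  also have "(\<Sum>x\<in>A. \<Sum>y\<in>A. W x y * coef n y) = (\<Sum>y\<in>A. (\<Sum>x\<in>A. W x y) * coef n y)"
    by (subst sum.swap) (simp add: sum_distrib_right)
  also have "\<dots> \<le> (\<Sum>y\<in>A. mu W y * coef n y)"
    using coef_nonneg sum_W_le_mu[OF finite_A] by (intro sum_mono mult_right_mono) auto
  also have "rate * (\<Sum>x\<in>A. \<theta> x * coef n x) \<le> rate * rate ^ n"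
    using Suc rate_nonneg by (rule mult_left_mono)
  finally show ?case by simp
qed

lemma coef_le: "coef n x \<le> rate ^ n / \<theta> x"
proof (cases "x \<in> A")
  case True
  have "\<theta> x * coef n x \<le> (\<Sum>x\<in>A. \<theta> x * coef n x)"
    using True finite_A coef_nonneg \<theta>_pos by (intro member_le_sum) (auto simp: less_imp_le)
  also have "\<dots> \<le> rate ^ n" by (rule sum_coef_le)
  finally show ?thesis using \<theta>_pos[of x] by (simp add: field_simps)
next
  case False
  then show ?thesis using rate_nonneg \<theta>_pos[of x] by (simp add: coef_off)
qed

lemma u_summable: "summable (\<lambda>n. coef n x / fact n * s ^ n)"
proof (rule summable_comparison_test')
  show "summable (\<lambda>n. 1 / \<theta> x * (inverse (fact n) * (rate * \<bar>s\<bar>) ^ n))"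
    by (intro summable_mult summable_exp)
  show "norm (coef n x / fact n * s ^ n) \<le> 1 / \<theta> x * (inverse (fact n) * (rate * \<bar>s\<bar>) ^ n)" for n
    using mult_right_mono[OF coef_le[of n x], of "\<bar>s\<bar> ^ n / fact n"] coef_nonneg[of n x]
    by (simp add: abs_mult power_abs power_mult_distrib field_simps)
qed

lemma u_off: "x \<notin> A \<Longrightarrow> u s x = 0"
  by (simp add: u_def coef_off)

lemma u_nonneg: "0 \<le> s \<Longrightarrow> 0 \<le> u s x"
  unfolding u_def using coef_nonneg u_summable by (intro mult_nonneg_nonneg suminf_nonneg) auto

lemma u_0: "u 0 x = (if x = orig then 1 / \<theta> orig else 0)"
  unfolding u_def by (simp only: powser_zero) simp

text \<open>Sub-Markov property: the masses of the coefficients add up to at most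
  \<open>exp (rate * s)\<close>, which the exponential prefactor cancels.\<close>

lemma sum_u_le: 
  assumes "0 \<le> s"
  shows "(\<Sum>x\<in>A. \<theta> x * u s x) \<le> 1"
proof -
  have "(\<Sum>x\<in>A. \<theta> x * u s x) = exp (- rate * s) * (\<Sum>x\<in>A. \<Sum>n. \<theta> x * (coef n x / fact n * s ^ n))"
    unfolding u_def sum_distrib_left
    by (intro sum.cong refl) (simp only: suminf_mult u_summable mult.left_commute)
  also have "(\<Sum>x\<in>A. \<Sum>n. \<theta> x * (coef n x / fact n * s ^ n))
      = (\<Sum>n. \<Sum>x\<in>A. \<theta> x * (coef n x / fact n * s ^ n))"
    by (intro suminf_sum[symmetric] summable_mult u_summable)
  also have "\<dots> \<le> (\<Sum>n. inverse (fact n) * (rate * s) ^ n)"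
  proof (rule suminf_le)
    show "summable (\<lambda>n. \<Sum>x\<in>A. \<theta> x * (coef n x / fact n * s ^ n))"
      by (intro summable_sum summable_mult u_summable)
    show "summable (\<lambda>n. inverse (fact n) * (rate * s) ^ n)" by (rule summable_exp)
    fix n
    have "(\<Sum>x\<in>A. \<theta> x * (coef n x / fact n * s ^ n)) = (\<Sum>x\<in>A. \<theta> x * coef n x) * (s ^ n / fact n)"
      by (simp add: sum_distrib_right sum_divide_distrib mult.assoc)
    also have "\<dots> \<le> rate ^ n * (s ^ n / fact n)"
      using assms by (intro mult_right_mono sum_coef_le) auto
    finally show "(\<Sum>x\<in>A. \<theta> x * (coef n x / fact n * s ^ n)) \<le> inverse (fact n) * (rate * s) ^ n"
      by (simp add: power_mult_distrib field_simps)
  qed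
  also have "(\<Sum>n. inverse (fact n) * (rate * s) ^ n) = exp (rate * s)"
    by (simp add: exp_def scaleR_conv_of_real divide_inverse mult.commute)
  finally show ?thesis by (simp add: mult_exp_exp flip: exp_minus)
qed

lemma u_derivative:
  assumes "x \<in> A"
  shows "((\<lambda>s. u s x) has_real_derivative generator (u s) x / \<theta> x) (at s)"
proof -
  define S where "S = (\<lambda>x s. \<Sum>n. coef n x / fact n * s ^ n)"
  have "(S x has_real_derivative (\<Sum>n. diffs (\<lambda>n. coef n x / fact n) n * s ^ n)) (at s)"
    unfolding S_def by (rule termdiffs_strong_converges_everywhere) (rule u_summable)
  also have "(\<lambda>n. diffs (\<lambda>n. coef n x / fact n) n * s ^ n) = (\<lambda>n. coef (Suc n) x / fact n * s ^ n)"
    by (simp add: diffs_def fun_eq_iff del: coef.simps of_nat_Suc)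
  also have "(\<Sum>n. coef (Suc n) x / fact n * s ^ n)
      = (\<Sum>n. rate * (coef n x / fact n * s ^ n)
         + (1 / \<theta> x) * ((\<Sum>y\<in>A. W x y * (coef n y / fact n * s ^ n)) - mu W x * (coef n x / fact n * s ^ n)))"
  proof (rule suminf_cong)
    fix n
    have "(\<Sum>y\<in>A. W x y * (coef n y / fact n * s ^ n)) = (\<Sum>y\<in>A. W x y * coef n y) * (s ^ n / fact n)"
      by (simp add: sum_distrib_right sum_divide_distrib mult.assoc)
    then show "coef (Suc n) x / fact n * s ^ n = rate * (coef n x / fact n * s ^ n)
         + (1 / \<theta> x) * ((\<Sum>y\<in>A. W x y * (coef n y / fact n * s ^ n)) - mu W x * (coef n x / fact n * s ^ n))"
      using assms \<theta>_pos[of x] by (simp add: field_simps)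
  qed
  also have "\<dots> = rate * S x s + (1 / \<theta> x) * ((\<Sum>y\<in>A. W x y * S y s) - mu W x * S x s)"
  proof (rule sums_unique[symmetric])
    have "(\<lambda>n. coef n y / fact n * s ^ n) sums S y s" for y
      unfolding S_def by (rule summable_sums[OF u_summable])
    then show "(\<lambda>n. rate * (coef n x / fact n * s ^ n)
         + (1 / \<theta> x) * ((\<Sum>y\<in>A. W x y * (coef n y / fact n * s ^ n)) - mu W x * (coef n x / fact n * s ^ n)))
      sums (rate * S x s + (1 / \<theta> x) * ((\<Sum>y\<in>A. W x y * S y s) - mu W x * S x s))"
      by (intro sums_add sums_mult sums_diff sums_sum)
  qed
  finally have S: "(S x has_real_derivative rate * S x s + (1 / \<theta> x) * ((\<Sum>y\<in>A. W x y * S y s) - mu W x * S x s)) (at s)" .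
  have u: "u s y = exp (- rate * s) * S y s" for s y by (simp add: u_def S_def)
  have "((\<lambda>s. u s x) has_real_derivative
      exp (- rate * s) * (- rate) * S x s + exp (- rate * s) *
        (rate * S x s + (1 / \<theta> x) * ((\<Sum>y\<in>A. W x y * S y s) - mu W x * S x s))) (at s)"
    unfolding u by (rule derivative_eq_intros S refl | simp)+
  also have "exp (- rate * s) * (- rate) * S x s + exp (- rate * s) *
        (rate * S x s + (1 / \<theta> x) * ((\<Sum>y\<in>A. W x y * S y s) - mu W x * S x s))
      = (1 / \<theta> x) * (exp (- rate * s) * (\<Sum>y\<in>A. W x y * S y s) - mu W x * (exp (- rate * s) * S x s))"
    by (simp add: algebra_simps)
  also have "exp (- rate * s) * (\<Sum>y\<in>A. W x y * S y s) = (\<Sum>y\<in>A. W x y * u s y)"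
    by (simp add: u sum_distrib_left mult_ac)
  also have "(1 / \<theta> x) * ((\<Sum>y\<in>A. W x y * u s y) - mu W x * (exp (- rate * s) * S x s)) = generator (u s) x / \<theta> x"
    using generator_fin[OF finite_A, of "u s" x] u_off by (simp add: u)
  finally show ?thesis .
qed

lemma U_summable: "0 < \<eta> \<Longrightarrow> summable (\<lambda>n. coef n x / (rate + \<eta>) ^ Suc n)"
proof (rule summable_comparison_test')
  assume l: "0 < \<eta>"
  then have pos: "0 < rate + \<eta>" using rate_nonneg by simp
  show "summable (\<lambda>n. 1 / (\<theta> x * (rate + \<eta>)) * (rate / (rate + \<eta>)) ^ n)"
    using l rate_nonneg by (intro summable_mult summable_geometric) auto
  fix n
  have "coef n x / (rate + \<eta>) ^ Suc n \<le> rate ^ n / \<theta> x / (rate + \<eta>) ^ Suc n"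
    using pos by (intro divide_right_mono coef_le) auto
  then show "norm (coef n x / (rate + \<eta>) ^ Suc n) \<le> 1 / (\<theta> x * (rate + \<eta>)) * (rate / (rate + \<eta>)) ^ n"
    using pos coef_nonneg[of n x] by (simp add: power_divide abs_mult mult_ac)
qed

lemma U_off: "x \<notin> A \<Longrightarrow> U \<eta> x = 0"
  by (simp add: U_def coef_off)

lemma U_nonneg: "0 < \<eta> \<Longrightarrow> 0 \<le> U \<eta> x"
  unfolding U_def using coef_nonneg U_summable rate_nonneg
  by (intro suminf_nonneg) (auto simp: less_imp_le)

text \<open>Shifting the index of the Neumann series by one applies \<open>rate\<close> plus the
  killed generator to it; the term of index 0 is the point mass on the right-hand side.\<close>

lemma U_equation:
  assumes l: "0 < \<eta>" and x: "x \<in> A"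
  shows "\<eta> * \<theta> x * U \<eta> x - generator (U \<eta>) x = (if x = orig then 1 else 0)"
proof -
  have pos: "0 < rate + \<eta>" using l rate_nonneg by simp
  define b where "b = (\<lambda>x n. coef n x / (rate + \<eta>) ^ Suc n)"
  have sb: "summable (b y)" for y unfolding b_def using U_summable[OF l] .
  have "(\<Sum>n. coef n x / (rate + \<eta>) ^ n) = (\<Sum>n. (rate + \<eta>) * b x n)"
    using pos by (simp add: b_def)
  also have "\<dots> = (rate + \<eta>) * U \<eta> x" by (simp add: suminf_mult sb) (simp add: U_def b_def)
  finally have 1: "(\<Sum>n. coef n x / (rate + \<eta>) ^ n) = (rate + \<eta>) * U \<eta> x" .
  have s1: "summable (\<lambda>n. coef n x / (rate + \<eta>) ^ n)"
    using summable_mult[OF sb[of x], of "rate + \<eta>"] pos by (simp add: b_def)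
  have "(\<Sum>n. coef n x / (rate + \<eta>) ^ n) = coef 0 x + (\<Sum>n. coef (Suc n) x / (rate + \<eta>) ^ Suc n)"
    using suminf_split_head[OF s1] by simp
  also have "(\<Sum>n. coef (Suc n) x / (rate + \<eta>) ^ Suc n)
      = (\<Sum>n. rate * b x n + (1 / \<theta> x) * ((\<Sum>y\<in>A. W x y * b y n) - mu W x * b x n))"
  proof (rule suminf_cong)
    fix n
    have "(\<Sum>y\<in>A. W x y * b y n) = (\<Sum>y\<in>A. W x y * coef n y) / (rate + \<eta>) ^ Suc n"
      by (simp add: b_def sum_divide_distrib)
    then show "coef (Suc n) x / (rate + \<eta>) ^ Suc n
        = rate * b x n + (1 / \<theta> x) * ((\<Sum>y\<in>A. W x y * b y n) - mu W x * b x n)"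
      using x \<theta>_pos[of x] pos unfolding b_def coef.simps by (simp add: add_divide_distrib diff_divide_distrib mult_ac)
  qed
  also have "\<dots> = rate * U \<eta> x + (1 / \<theta> x) * ((\<Sum>y\<in>A. W x y * U \<eta> y) - mu W x * U \<eta> x)"
  proof (rule sums_unique[symmetric])
    have "b y sums U \<eta> y" for y using summable_sums[OF sb[of y]] by (simp only: U_def b_def)
    then show "(\<lambda>n. rate * b x n + (1 / \<theta> x) * ((\<Sum>y\<in>A. W x y * b y n) - mu W x * b x n))
      sums (rate * U \<eta> x + (1 / \<theta> x) * ((\<Sum>y\<in>A. W x y * U \<eta> y) - mu W x * U \<eta> x))"
      by (intro sums_add sums_mult sums_diff sums_sum)
  qed
  finally have "(rate + \<eta>) * U \<eta> x = coef 0 x + (rate * U \<eta> x + (1 / \<theta> x) * generator (U \<eta>) x)"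
    using 1 generator_fin[OF finite_A, of "U \<eta>" x] U_off by simp
  then have "\<theta> x * (\<eta> * U \<eta> x) = \<theta> x * (coef 0 x + (1 / \<theta> x) * generator (U \<eta>) x)"
    by (simp add: algebra_simps)
  then show ?thesis using \<theta>_pos[of x] by (auto simp: algebra_simps)
qed

text \<open>Weak form of the resolvent equation. The maximum principle, the energy of truncations
  and the cutoff identity all arise from special test functions \<open>g\<close>.\<close>

lemma U_form:
  assumes l: "0 < \<eta>" and g: "\<And>x. x \<notin> A \<Longrightarrow> g x = 0"
  shows "form A (U \<eta>) g + \<eta> * (\<Sum>x\<in>A. \<theta> x * U \<eta> x * g x) = g orig"
proof -
  have "form A (U \<eta>) g = form A g (U \<eta>)" by (rule form_sym) (use finite_A g U_off in auto)
  then have "form A (U \<eta>) g + \<eta> * (\<Sum>x\<in>A. \<theta> x * U \<eta> x * g x)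
      = (\<Sum>x\<in>A. g x * (\<eta> * \<theta> x * U \<eta> x - generator (U \<eta>) x))"
    unfolding form_def by (simp add: sum_distrib_left sum_subtractf algebra_simps)
  also have "\<dots> = (\<Sum>x\<in>A. if x = orig then g orig else 0)"
    by (intro sum.cong) (auto simp: U_equation[OF l])
  also have "\<dots> = g orig" using finite_A orig_A by simp
  finally show ?thesis .
qed

text \<open>Chapman-Kolmogorov equation: the derivative in \<open>s\<close> is the difference of the
  form at \<open>(u s, u (t - s))\<close> and at the exchanged pair, which vanishes by
  symmetry.\<close>

lemma u_pair_constant:
  assumes "0 \<le> s" "s \<le> t"
  shows "(\<Sum>x\<in>A. \<theta> x * u s x * u (t - s) x) = u t orig"
proof -
  define F where "F = (\<lambda>s. \<Sum>x\<in>A. \<theta> x * u s x * u (t - s) x)"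
  have "(F has_real_derivative 0) (at s)" for s
  proof -
    have "(F has_real_derivative (\<Sum>x\<in>A. \<theta> x * (generator (u s) x / \<theta> x) * u (t - s) x
        + \<theta> x * u s x * (generator (u (t - s)) x / \<theta> x * (-1)))) (at s)"
      unfolding F_def
    proof (rule DERIV_sum)
      fix x assume x: "x \<in> A"
      have 1: "((\<lambda>s. u (t - s) x) has_real_derivative generator (u (t - s)) x / \<theta> x * (-1)) (at s)"
        by (rule DERIV_chain2[OF u_derivative[OF x]]) (auto intro!: derivative_eq_intros)
      show "((\<lambda>s. \<theta> x * u s x * u (t - s) x) has_real_derivative
        \<theta> x * (generator (u s) x / \<theta> x) * u (t - s) x + \<theta> x * u s x * (generator (u (t - s)) x / \<theta> x * (-1))) (at s)"
        by (rule derivative_eq_intros u_derivative[OF x] 1 refl)+ simp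
    qed
    also have "(\<Sum>x\<in>A. \<theta> x * (generator (u s) x / \<theta> x) * u (t - s) x
        + \<theta> x * u s x * (generator (u (t - s)) x / \<theta> x * (-1)))
      = (\<Sum>x\<in>A. u (t - s) x * generator (u s) x - u s x * generator (u (t - s)) x)"
      using \<theta>_pos by (intro sum.cong) (auto simp: less_imp_neq[symmetric])
    also have "\<dots> = form A (u s) (u (t - s)) - form A (u (t - s)) (u s)"
      by (simp add: form_def sum_subtractf)
    also have "\<dots> = 0" using form_sym[OF finite_A, of "u s" "u (t - s)"] u_off by simp
    finally show ?thesis .
  qed
  then have "F s = F 0" using DERIV_isconst_all by blast
  also have "F 0 = (\<Sum>x\<in>A. if x = orig then u t orig else 0)"
    unfolding F_def using \<theta>_pos by (intro sum.cong) (auto simp: u_0 less_imp_neq[symmetric])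
  also have "\<dots> = u t orig" using finite_A orig_A by simp
  finally show ?thesis by (simp add: F_def)
qed

lemma u_square:
  "0 \<le> t \<Longrightarrow> (\<Sum>x\<in>A. \<theta> x * (u t x)\<^sup>2) = u (2 * t) orig"
  using u_pair_constant[of t "2 * t"] by (simp add: power2_eq_square mult.assoc)

lemma u_square_derivative:
  "((\<lambda>s. \<Sum>x\<in>A. \<theta> x * (u s x)\<^sup>2) has_real_derivative - 2 * energy W (u s)) (at s)"
proof -
  have "((\<lambda>s. \<Sum>x\<in>A. \<theta> x * (u s x)\<^sup>2) has_real_derivative
      (\<Sum>x\<in>A. \<theta> x * (2 * u s x * (generator (u s) x / \<theta> x)))) (at s)"
    by (rule DERIV_sum, rule DERIV_cmult, rule derivative_eq_intros, rule u_derivative)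
      (auto simp: mult_ac)
  also have "(\<Sum>x\<in>A. \<theta> x * (2 * u s x * (generator (u s) x / \<theta> x)))
      = (\<Sum>x\<in>A. 2 * (u s x * generator (u s) x))"
    using \<theta>_pos by (intro sum.cong) (auto simp: less_imp_neq[symmetric])
  also have "\<dots> = - 2 * form A (u s) (u s)"
    by (simp add: form_def sum_distrib_left[symmetric])
  also have "form A (u s) (u s) = energy W (u s)"
    using finite_energy_fin_supp(2)[OF finite_A, of "u s"] u_off by simp
  finally show ?thesis .
qed

lemma u_antimono:
  assumes "0 \<le> s" "s \<le> t"
  shows "u t orig \<le> u s orig"
proof -
  have "(\<Sum>x\<in>A. \<theta> x * (u (t / 2) x)\<^sup>2) \<le> (\<Sum>x\<in>A. \<theta> x * (u (s / 2) x)\<^sup>2)"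
    by (rule DERIV_nonpos_imp_nonincreasing[where f = "\<lambda>s. \<Sum>x\<in>A. \<theta> x * (u s x)\<^sup>2"])
      (use assms u_square_derivative energy_nonneg in \<open>auto intro!: exI\<close>)
  then show ?thesis using u_square[of "t / 2"] u_square[of "s / 2"] assms by simp
qed

end

subsection \<open>Comparison of the semigroup with the killed process\<close>

context network
begin

text \<open>The energy plus \<open>\<eta>\<close> times the squared norm is nonnegative at
  \<open>f + c * k\<close> and at \<open>f - c * k\<close>. The free parameter \<open>c\<close>
  stands in for the optimal one of the Cauchy-Schwarz inequality: later \<open>f\<close> is small
  and the energy of \<open>k\<close> merely bounded.\<close>

lemma form_bound:
  assumes A: "finite A" "\<And>x. x \<notin> A \<Longrightarrow> k x = 0" and f: "\<And>y. \<bar>f y\<bar> \<le> C" "finite_energy f"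
    and \<theta>: "weighted_L2 \<theta>" "f \<in> L2 \<theta>" and c: "c > 0" and \<eta>: "\<eta> \<ge> 0"
  shows "2 * \<bar>form A k f + \<eta> * (\<Sum>x\<in>A. \<theta> x * k x * f x)\<bar>
    \<le> (energy W f + \<eta> * L2_inner \<theta> f f) / c + c * (energy W k + \<eta> * (\<Sum>x\<in>A. \<theta> x * (k x)\<^sup>2))"
proof -
  interpret weighted_L2 \<theta> by (rule \<theta>(1))
  have kL: "k \<in> L2 \<theta>"
    by (rule L2_fin_supp) (use A in \<open>auto simp: fin_supp_def intro!: finite_subset[of _ A]\<close>)
  define B where "B = form A k f + \<eta> * (\<Sum>x\<in>A. \<theta> x * k x * f x)"
  define qf where "qf = energy W f + \<eta> * L2_inner \<theta> f f"
  define qk where "qk = energy W k + \<eta> * (\<Sum>x\<in>A. \<theta> x * (k x)\<^sup>2)"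
  have *: "0 \<le> qf + 2 * b * B + b\<^sup>2 * qk" for b
  proof -
    define g where "g = (\<lambda>x. 1 * f x + b * k x)"
    have gL: "g \<in> L2 \<theta>" unfolding g_def using \<theta>(2) kL by (rule L2_lin)
    have "0 \<le> energy W (\<lambda>x. f x + b * k x) + \<eta> * L2_inner \<theta> g g"
      using energy_nonneg inner_self_nonneg \<eta> by (intro add_nonneg_nonneg mult_nonneg_nonneg) auto
    also have "energy W (\<lambda>x. f x + b * k x) = energy W f + 2 * b * form A k f + b\<^sup>2 * energy W k"
      by (rule energy_add_fin_supp[OF A f])
    also have "L2_inner \<theta> g g = L2_inner \<theta> f f + 2 * b * L2_inner \<theta> f k + b\<^sup>2 * L2_inner \<theta> k k"
    proof -
      have "L2_inner \<theta> g g = 1 * L2_inner \<theta> f g + b * L2_inner \<theta> k g"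
        unfolding g_def by (rule inner_lin_left[OF \<theta>(2) kL gL[unfolded g_def]])
      also have "L2_inner \<theta> f g = 1 * L2_inner \<theta> f f + b * L2_inner \<theta> k f"
        unfolding inner_commute[of f g] unfolding g_def by (rule inner_lin_left[OF \<theta>(2) kL \<theta>(2)])
      also have "L2_inner \<theta> k g = 1 * L2_inner \<theta> f k + b * L2_inner \<theta> k k"
        unfolding inner_commute[of k g] unfolding g_def by (rule inner_lin_left[OF \<theta>(2) kL kL])
      also have "L2_inner \<theta> k f = L2_inner \<theta> f k" by (rule inner_commute)
      finally show ?thesis by (simp add: power2_eq_square algebra_simps)
    qed
    also have "L2_inner \<theta> f k = (\<Sum>x\<in>A. \<theta> x * k x * f x)"
      using inner_finite[OF A, where f = f] by (simp add: mult_ac)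
    also have "L2_inner \<theta> k k = (\<Sum>x\<in>A. \<theta> x * (k x)\<^sup>2)"
      using inner_finite[OF A, where f = k] by (simp add: power2_eq_square mult_ac)
    finally show ?thesis unfolding qf_def B_def qk_def by (simp add: algebra_simps)
  qed
  have "0 \<le> qf + 2 * c * B + c\<^sup>2 * qk" "0 \<le> qf - 2 * c * B + c\<^sup>2 * qk"
    using *[of c] *[of "- c"] by simp_all
  then have "2 * c * \<bar>B\<bar> \<le> qf + c\<^sup>2 * qk" by (auto simp: abs_if)
  then have "2 * c * \<bar>B\<bar> / c \<le> (qf + c\<^sup>2 * qk) / c" using c by (intro divide_right_mono) auto
  then show ?thesis unfolding B_def[symmetric] qf_def[symmetric] qk_def[symmetric] using c
    by (simp add: add_divide_distrib power2_eq_square)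
qed

end

lemma (in killed) U_energy:
  assumes "0 < \<eta>"
  shows "energy W (U \<eta>) + \<eta> * (\<Sum>x\<in>A. \<theta> x * (U \<eta> x)\<^sup>2) = U \<eta> orig"
  using U_form[OF assms, of "U \<eta>"] finite_energy_fin_supp(2)[OF finite_A, of "U \<eta>"] U_off
  by (simp add: power2_eq_square mult.assoc)

context point_evolution
begin

text \<open>Duhamel's interpolation \<open>F\<close> runs from \<open>v t orig\<close> at time 0 to
  the killed kernel at time \<open>t\<close>. By the symmetry of \<open>W\<close> its derivative is
  minus the flow across the boundary of \<open>B\<close>, which has a sign since both kernels are
  nonnegative.\<close>

lemma killed_le:
  assumes "killed W \<theta> B orig" and t: "0 \<le> t"
  shows "killed.u W \<theta> B orig t orig \<le> v t orig"
proof (cases "t = 0")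
  case True
  interpret killed W \<theta> B orig by fact
  show ?thesis using True by (simp add: u_0 v_0 \<delta>_def)
next
  case False
  then have t: "0 < t" using t by simp
  interpret killed W \<theta> B orig by fact
  define F where "F = (\<lambda>s. \<Sum>x\<in>B. \<theta> x * v (t - s) x * u s x)"
  have cu: "continuous_on S (\<lambda>s. u s x)" if "x \<in> B" for S x
    by (rule continuous_on_subset[of UNIV])
      (auto intro!: DERIV_continuous_on[OF DERIV_subset[OF u_derivative[OF that]]])
  have cont: "continuous_on {0..t} F"
    unfolding F_def
    by (intro continuous_on_sum continuous_on_mult continuous_on_const cu
        continuous_on_compose2[OF v_continuous]) (auto intro!: continuous_intros)
  have der: "\<exists>y. (F has_real_derivative y) (at s) \<and> y \<le> 0" if s: "0 < s" "s < t" for s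
  proof (intro exI conjI)
    have "0 < t - s" using s by simp
    show "(F has_real_derivative (\<Sum>x\<in>B. \<theta> x * (generator (v (t - s)) x / \<theta> x * (-1)) * u s x
        + \<theta> x * v (t - s) x * (generator (u s) x / \<theta> x))) (at s)"
      unfolding F_def
    proof (rule DERIV_sum)
      fix x assume x: "x \<in> B"
      have 1: "((\<lambda>s. v (t - s) x) has_real_derivative generator (v (t - s)) x / \<theta> x * (-1)) (at s)"
        by (rule DERIV_chain2[OF v_derivative]) (use s in \<open>auto intro!: derivative_eq_intros\<close>)
      show "((\<lambda>s. \<theta> x * v (t - s) x * u s x) has_real_derivative
        \<theta> x * (generator (v (t - s)) x / \<theta> x * (-1)) * u s x + \<theta> x * v (t - s) x * (generator (u s) x / \<theta> x)) (at s)"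
        by (rule derivative_eq_intros u_derivative[OF x] 1 refl)+ simp
    qed
    have eq: "(\<Sum>x\<in>B. \<theta> x * (generator (v (t - s)) x / \<theta> x * (-1)) * u s x
        + \<theta> x * v (t - s) x * (generator (u s) x / \<theta> x))
      = (\<Sum>x\<in>B. v (t - s) x * generator (u s) x) - (\<Sum>x\<in>B. u s x * generator (v (t - s)) x)"
      using \<theta>_pos unfolding sum_subtractf[symmetric] by (intro sum.cong) (auto simp: less_imp_neq[symmetric])
    have g1: "(\<Sum>x\<in>B. v (t - s) x * generator (u s) x)
        = (\<Sum>x\<in>B. v (t - s) x * (\<Sum>y\<in>B. W x y * u s y)) - (\<Sum>x\<in>B. mu W x * v (t - s) x * u s x)"
    proof -
      have gen: "generator (u s) x = (\<Sum>y\<in>B. W x y * u s y) - mu W x * u s x" for x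
        using generator_fin[OF finite_A, of "u s"] u_off by simp
      show ?thesis unfolding gen right_diff_distrib sum_subtractf by (simp only: mult_ac)
    qed
    have "(\<Sum>x\<in>B. v (t - s) x * (\<Sum>y\<in>B. W x y * u s y))
        = (\<Sum>y\<in>B. u s y * (\<Sum>x\<in>B. W y x * v (t - s) x))"
      unfolding sum_distrib_left by (subst sum.swap) (simp add: mult_ac W_sym)
    also have "\<dots> \<le> (\<Sum>y\<in>B. u s y * (\<Sum>\<^sub>\<infinity>x. W y x * v (t - s) x))"
    proof (intro sum_mono mult_left_mono u_nonneg finite_sum_le_infsum)
      show "(\<lambda>x. W y x * v (t - s) x) summable_on UNIV" for y
        using s by (intro summable_bounded[where C = "1 / \<theta> orig"] v_abs) auto
    qed (use s finite_A W_nonneg v_bounds in auto)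
    finally have g2: "(\<Sum>x\<in>B. v (t - s) x * (\<Sum>y\<in>B. W x y * u s y))
        \<le> (\<Sum>y\<in>B. u s y * (\<Sum>\<^sub>\<infinity>x. W y x * v (t - s) x))" .
    have g3: "(\<Sum>y\<in>B. u s y * (\<Sum>\<^sub>\<infinity>x. W y x * v (t - s) x)) - (\<Sum>x\<in>B. mu W x * v (t - s) x * u s x)
        = (\<Sum>x\<in>B. u s x * generator (v (t - s)) x)"
      unfolding sum_subtractf[symmetric]
      using s by (intro sum.cong refl, subst generator_eq[where C = "1 / \<theta> orig"])
        (auto intro!: v_abs simp: algebra_simps)
    show "(\<Sum>x\<in>B. \<theta> x * (generator (v (t - s)) x / \<theta> x * (-1)) * u s x
        + \<theta> x * v (t - s) x * (generator (u s) x / \<theta> x)) \<le> 0"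
      unfolding eq using g1 g2 g3 by linarith
  qed
  have "F t \<le> F 0"
  proof -
    obtain l z where lz: "0 < z" "z < t" "DERIV F z :> l" "F t - F 0 = (t - 0) * l"
      using MVT[OF t cont] der real_differentiable_def by blast
    then have "l \<le> 0" using der[of z] DERIV_unique by blast
    then have "t * l \<le> 0" using t by (simp add: mult_nonneg_nonpos)
    then show ?thesis using lz(4) by simp
  qed
  moreover have "F t = u t orig"
  proof -
    have "F t = (\<Sum>x\<in>B. if x = orig then u t orig else 0)"
      unfolding F_def using \<theta>_pos by (intro sum.cong) (auto simp: v_0 \<delta>_def less_imp_neq[symmetric])
    then show ?thesis using finite_A orig_A by simp
  qed
  moreover have "F 0 = v t orig"
  proof -
    have "F 0 = (\<Sum>x\<in>B. if x = orig then v t orig else 0)"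
      unfolding F_def using \<theta>_pos by (intro sum.cong) (auto simp: u_0 less_imp_neq[symmetric])
    then show ?thesis using finite_A orig_A by simp
  qed
  ultimately show ?thesis by simp
qed

text \<open>\<open>\<Phi> s\<close> is, in closed form, the Laplace integral of the killed kernel
  over the times beyond \<open>s\<close>; this comes from testing the resolvent equation with the
  killed kernel itself.\<close>

lemma killed_integral:
  assumes "killed W \<theta> B orig" and \<eta>: "0 < \<eta>" and ab: "a \<le> b"
  defines "\<Phi> \<equiv> \<lambda>s. exp (- \<eta> * s) * (\<Sum>x\<in>B. \<theta> x * killed.u W \<theta> B orig s x * killed.U W \<theta> B orig \<eta> x)"
  shows "((\<lambda>s. exp (- \<eta> * s) * killed.u W \<theta> B orig s orig) has_integral \<Phi> a - \<Phi> b) {a..b}"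
proof -
  interpret killed W \<theta> B orig by fact
  have "((\<lambda>s. - \<Phi> s) has_real_derivative exp (- \<eta> * s) * u s orig) (at s within {a..b})" for s
  proof -
    have "((\<lambda>s. \<Sum>x\<in>B. \<theta> x * u s x * U \<eta> x) has_real_derivative
        (\<Sum>x\<in>B. \<theta> x * (generator (u s) x / \<theta> x) * U \<eta> x)) (at s)"
      by (intro DERIV_sum DERIV_cmult DERIV_cmult_right u_derivative)
    also have "(\<Sum>x\<in>B. \<theta> x * (generator (u s) x / \<theta> x) * U \<eta> x) = (\<Sum>x\<in>B. U \<eta> x * generator (u s) x)"
      using \<theta>_pos by (intro sum.cong) (auto simp: less_imp_neq[symmetric])
    also have "\<dots> = - form B (U \<eta>) (u s)" by (simp add: form_def)
    also have "form B (U \<eta>) (u s) = u s orig - \<eta> * (\<Sum>x\<in>B. \<theta> x * u s x * U \<eta> x)"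
      using U_form[OF \<eta>, of "u s"] u_off by (simp add: mult_ac)
    finally have 1: "((\<lambda>s. \<Sum>x\<in>B. \<theta> x * u s x * U \<eta> x) has_real_derivative
        - (u s orig - \<eta> * (\<Sum>x\<in>B. \<theta> x * u s x * U \<eta> x))) (at s)" .
    have "(\<Phi> has_real_derivative - (exp (- \<eta> * s) * u s orig)) (at s)"
      unfolding \<Phi>_def by (rule derivative_eq_intros 1 refl)+ (simp add: algebra_simps)
    then have "((\<lambda>s. - \<Phi> s) has_real_derivative exp (- \<eta> * s) * u s orig) (at s)"
      by (auto intro: derivative_eq_intros)
    then show ?thesis by (rule DERIV_subset) auto
  qed
  then have "((\<lambda>s. exp (- \<eta> * s) * u s orig) has_integral - \<Phi> b - - \<Phi> a) {a..b}"
    using ab by (intro fundamental_theorem_of_calculus) (auto simp: has_real_derivative_iff_has_vector_derivative)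
  then show ?thesis by simp
qed

text \<open>Since \<open>v s\<close> does not vanish off \<open>A\<close>, the integrand is the
  pairing in the form rather than \<open>v s orig\<close>; only along an exhaustion does it become
  that value.\<close>

lemma resolvent_integral:
  assumes "killed W \<theta> A orig" and \<eta>: "0 < \<eta>" and ab: "0 < a" "a \<le> b"
  defines "\<Psi> \<equiv> \<lambda>s. exp (- \<eta> * s) * (\<Sum>x\<in>A. \<theta> x * killed.U W \<theta> A orig \<eta> x * v s x)"
  shows "((\<lambda>s. exp (- \<eta> * s) * (form A (killed.U W \<theta> A orig \<eta>) (v s)
      + \<eta> * (\<Sum>x\<in>A. \<theta> x * killed.U W \<theta> A orig \<eta> x * v s x))) has_integral \<Psi> a - \<Psi> b) {a..b}"
proof -
  interpret killed W \<theta> A orig by fact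
  define B where "B = (\<lambda>s. form A (U \<eta>) (v s) + \<eta> * (\<Sum>x\<in>A. \<theta> x * U \<eta> x * v s x))"
  have "((\<lambda>s. - \<Psi> s) has_real_derivative exp (- \<eta> * s) * B s) (at s within {a..b})" if s: "s \<in> {a..b}" for s
  proof -
    have "0 < s" using s ab by simp
    then have "((\<lambda>s. \<Sum>x\<in>A. \<theta> x * U \<eta> x * v s x) has_real_derivative
        (\<Sum>x\<in>A. \<theta> x * U \<eta> x * (generator (v s) x / \<theta> x))) (at s)"
      by (intro DERIV_sum DERIV_cmult v_derivative)
    also have "(\<Sum>x\<in>A. \<theta> x * U \<eta> x * (generator (v s) x / \<theta> x)) = (\<Sum>x\<in>A. U \<eta> x * generator (v s) x)"
      using \<theta>_pos by (intro sum.cong) (auto simp: less_imp_neq[symmetric])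
    also have "\<dots> = - form A (U \<eta>) (v s)" by (simp add: form_def)
    finally have 1: "((\<lambda>s. \<Sum>x\<in>A. \<theta> x * U \<eta> x * v s x) has_real_derivative - form A (U \<eta>) (v s)) (at s)" .
    have "(\<Psi> has_real_derivative - (exp (- \<eta> * s) * B s)) (at s)"
      unfolding \<Psi>_def B_def by (rule derivative_eq_intros 1 refl)+ (simp add: algebra_simps)
    then have "((\<lambda>s. - \<Psi> s) has_real_derivative exp (- \<eta> * s) * B s) (at s)"
      by (auto intro: derivative_eq_intros)
    then show ?thesis by (rule DERIV_subset) auto
  qed
  then have "((\<lambda>s. exp (- \<eta> * s) * B s) has_integral - \<Psi> b - - \<Psi> a) {a..b}"
    using ab by (intro fundamental_theorem_of_calculus) (auto simp: has_real_derivative_iff_has_vector_derivative)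
  then show ?thesis by (simp add: B_def)
qed

text \<open>The pairing of the evolution with the resolvents of an exhaustion, in the energy form,
  tends to the evaluation at the origin because the evolution is approximated by finitely
  supported functions.\<close>

lemma resolvent_pairing_limit:
  fixes An :: "nat \<Rightarrow> 'v set"
  assumes killed: "\<And>n. killed W \<theta> (An n) orig" and ex: "\<And>S. finite S \<Longrightarrow> \<exists>N. \<forall>n\<ge>N. S \<subseteq> An n"
    and \<eta>: "0 < \<eta>" and Q: "\<And>n. killed.U W \<theta> (An n) orig \<eta> orig \<le> Q" and s: "0 < s"
  defines "P \<equiv> \<lambda>n. form (An n) (killed.U W \<theta> (An n) orig \<eta>) (v s)
      + \<eta> * (\<Sum>x\<in>An n. \<theta> x * killed.U W \<theta> (An n) orig \<eta> x * v s x)"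
  shows "P \<longlonglongrightarrow> v s orig" "\<And>n. \<bar>P n\<bar> \<le> 1 / (2 * s * \<theta> orig) + \<eta> / \<theta> orig + Q"
proof -
  have bound: "2 * \<bar>form (An n) (killed.U W \<theta> (An n) orig \<eta>) f
      + \<eta> * (\<Sum>x\<in>An n. \<theta> x * killed.U W \<theta> (An n) orig \<eta> x * f x)\<bar>
      \<le> (energy W f + \<eta> * L2_inner \<theta> f f) / c + c * Q"
    if "\<And>y. \<bar>f y\<bar> \<le> C" "finite_energy f" "f \<in> L2 \<theta>" "c > 0" for n f c C
  proof -
    interpret killed W \<theta> "An n" orig by (rule killed)
    have "2 * \<bar>form (An n) (U \<eta>) f + \<eta> * (\<Sum>x\<in>An n. \<theta> x * U \<eta> x * f x)\<bar>
      \<le> (energy W f + \<eta> * L2_inner \<theta> f f) / c + c * (energy W (U \<eta>) + \<eta> * (\<Sum>x\<in>An n. \<theta> x * (U \<eta> x)\<^sup>2))"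
      by (rule form_bound[where C = C]) (use finite_A U_off that \<eta> weighted_L2_axioms in auto)
    also have "c * (energy W (U \<eta>) + \<eta> * (\<Sum>x\<in>An n. \<theta> x * (U \<eta> x)\<^sup>2)) \<le> c * Q"
      unfolding U_energy[OF \<eta>] using Q[of n] \<open>c > 0\<close> by (intro mult_left_mono) auto
    finally show ?thesis by simp
  qed
  have Q0: "0 \<le> Q"
  proof -
    interpret killed W \<theta> "An 0" orig by (rule killed)
    show ?thesis using Q[of 0] U_nonneg[OF \<eta>, of orig] by linarith
  qed
  have vs: "v s \<in> L2 \<theta>" "finite_energy (v s)" "\<And>y. \<bar>v s y\<bar> \<le> 1 / \<theta> orig"
    using s by (auto intro: v_L2 v_abs form_dom_finite_energy v_form_dom)
  show "\<bar>P n\<bar> \<le> 1 / (2 * s * \<theta> orig) + \<eta> / \<theta> orig + Q" for n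
  proof -
    have "2 * \<bar>P n\<bar> \<le> (energy W (v s) + \<eta> * L2_inner \<theta> (v s) (v s)) / 1 + 1 * Q"
      unfolding P_def by (rule bound) (use vs in auto)
    moreover have "\<eta> * L2_inner \<theta> (v s) (v s) \<le> \<eta> * (1 / \<theta> orig)"
      using v_inner[of s s] v_bounds(2)[of "s + s" orig] s \<eta> by (intro mult_left_mono) auto
    ultimately show ?thesis using v_form_dom(2)[OF s] Q0 abs_ge_zero[of "P n"] by simp
  qed
  show "P \<longlonglongrightarrow> v s orig"
  proof (rule LIMSEQ_I)
    fix r :: real assume r: "r > 0"
    \<comment> \<open>\<open>c\<close> keeps the share \<open>c * Q\<close> of the resolvent below
      \<open>r / 2\<close>; \<open>e\<close> is then so small that the errors coming from
      \<open>w\<close>, among them one divided by \<open>c\<close>, stay below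
      \<open>r / 4\<close>.\<close>
    define c where "c = r / (2 * (Q + 1))"
    have c: "c > 0" "c * Q \<le> r / 2"
    proof -
      show "c > 0" using r Q0 by (simp add: c_def)
      have "c * Q \<le> c * (Q + 1)" using \<open>c > 0\<close> by (intro mult_left_mono) auto
      also have "c * (Q + 1) = r / 2" using Q0 by (simp add: c_def add_nonneg_pos less_imp_neq[symmetric] field_simps)
      finally show "c * Q \<le> r / 2" .
    qed
    define K where "K = (1 + \<eta>) / c + 1 / sqrt (\<theta> orig) + 1"
    have K: "K > 0" using c(1) \<eta> \<theta>_pos[of orig] unfolding K_def by (intro add_nonneg_pos) auto
    define e where "e = min 1 (r / (4 * K))"
    have e: "0 < e" "e \<le> 1" "e * K \<le> r / 4"
    proof -
      show "0 < e" using r K by (simp add: e_def)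
      show "e \<le> 1" by (simp add: e_def)
      have "e * K \<le> r / (4 * K) * K" using K by (intro mult_right_mono) (auto simp: e_def)
      then show "e * K \<le> r / 4" using K by simp
    qed
    obtain g where g: "fin_supp g" "energy W (\<lambda>x. g x - v s x) < e" "L2_norm \<theta> (\<lambda>x. g x - v s x) < e"
      using form_dom_approx[OF v_form_dom(1)[OF s] e(1)] by blast
    define S where "S = {x. g x \<noteq> 0}"
    have S: "finite S" "\<And>x. x \<notin> S \<Longrightarrow> g x = 0" using g(1) by (auto simp: S_def fin_supp_def)
    obtain C where C: "\<And>y. \<bar>g y\<bar> \<le> C" using fin_supp_bounded[where A = S and k = g] S by blast
    obtain N where N: "\<And>n. n \<ge> N \<Longrightarrow> S \<subseteq> An n" using ex[OF S(1)] by blast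
    define w where "w = (\<lambda>x. g x - v s x)"
    have gL: "g \<in> L2 \<theta>" by (rule L2_fin_supp[OF g(1)])
    have w: "w \<in> L2 \<theta>" "finite_energy w" "\<And>y. \<bar>w y\<bar> \<le> C + 1 / \<theta> orig"
    proof -
      show "w \<in> L2 \<theta>" unfolding w_def using gL vs(1) by (rule L2_diff)
      show "finite_energy w" unfolding w_def
        using finite_energy_fin_supp(1)[where A = S and k = g] S vs(2) by (intro finite_energy_diff) auto
      show "\<bar>w y\<bar> \<le> C + 1 / \<theta> orig" for y
        unfolding w_def using C[of y] vs(3)[of y] by linarith
    qed
    have qw: "energy W w + \<eta> * L2_inner \<theta> w w \<le> e * (1 + \<eta>)"
    proof -
      have "L2_inner \<theta> w w = (L2_norm \<theta> w)\<^sup>2" by (simp add: L2_norm_sq)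
      also have "\<dots> \<le> e\<^sup>2" using g(3) L2_norm_nonneg by (intro power_mono) (auto simp: w_def)
      also have "\<dots> \<le> e" using e by (simp add: power2_eq_square mult_left_le)
      finally have "\<eta> * L2_inner \<theta> w w \<le> \<eta> * e" using \<eta> by (intro mult_left_mono) auto
      then show ?thesis using g(2) by (simp add: w_def algebra_simps)
    qed
    show "\<exists>N. \<forall>n\<ge>N. norm (P n - v s orig) < r"
    proof (intro exI allI impI)
      fix n assume n: "n \<ge> N"
      interpret killed W \<theta> "An n" orig by (rule killed)
      define R where "R = form (An n) (U \<eta>) w + \<eta> * (\<Sum>x\<in>An n. \<theta> x * U \<eta> x * w x)"
      have g0: "\<And>x. x \<notin> An n \<Longrightarrow> g x = 0" using N[OF n] S(2) by blast
      have "form (An n) (U \<eta>) w = form (An n) (U \<eta>) g - form (An n) (U \<eta>) (v s)"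
      proof -
        have gen: "generator w x = generator g x - generator (v s) x" for x
        proof -
          have 1: "((\<lambda>y. W x y * (g y - g x)) has_sum generator g x) UNIV"
            using C by (rule generator_has_sum)
          have 2: "((\<lambda>y. W x y * (v s y - v s x)) has_sum generator (v s) x) UNIV"
            using vs(3) by (rule generator_has_sum)
          have "((\<lambda>y. W x y * (g y - g x) + - 1 * (W x y * (v s y - v s x))) has_sum
              generator g x + - 1 * generator (v s) x) UNIV"
            by (intro has_sum_add has_sum_cmult_right 1 2)
          also have "(\<lambda>y. W x y * (g y - g x) + - 1 * (W x y * (v s y - v s x))) = (\<lambda>y. W x y * (w y - w x))"
            by (simp add: w_def fun_eq_iff algebra_simps)
          finally show ?thesis unfolding generator_def[of w] by (simp add: infsumI)
        qed
        show ?thesis unfolding form_def gen right_diff_distrib sum_subtractf by simp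
      qed
      \<comment> \<open>Once \<open>An n\<close> contains the support of \<open>g\<close>, the
        resolvent equation evaluates the pairing with \<open>g\<close> exactly; only the small
        remainder \<open>w\<close> has to be estimated.\<close>
      then have "R = g orig - P n"
        using U_form[where g = g, OF \<eta> g0] unfolding R_def P_def
        by (simp add: w_def algebra_simps sum_subtractf)
      define a b X where "a = e * ((1 + \<eta>) / c)" and "b = e * (1 / sqrt (\<theta> orig))"
        and "X = (energy W w + \<eta> * L2_inner \<theta> w w) / c"
      have 1: "2 * \<bar>R\<bar> \<le> X + c * Q"
        unfolding R_def X_def by (rule bound[OF w(3,2,1) c(1)])
      have 2: "X \<le> a"
        using divide_right_mono[OF qw, of c] c(1) by (simp add: X_def a_def)
      have 3: "\<bar>g orig - v s orig\<bar> \<le> b"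
      proof -
        have "\<bar>w orig\<bar> \<le> L2_norm \<theta> w / sqrt (\<theta> orig)" using w(1) by (rule point_le_norm)
        also have "\<dots> \<le> e / sqrt (\<theta> orig)"
          using g(3) \<theta>_pos[of orig] by (intro divide_right_mono) (auto simp: w_def)
        finally show ?thesis by (simp add: w_def b_def)
      qed
      have 4: "a + b \<le> e * K"
        using e(1) by (simp add: K_def a_def b_def algebra_simps)
      have 5: "0 \<le> a" using e(1) c(1) \<eta> by (simp add: a_def)
      have "\<bar>P n - v s orig\<bar> \<le> \<bar>R\<bar> + \<bar>g orig - v s orig\<bar>"
        using \<open>R = g orig - P n\<close> by linarith
      then have "\<bar>P n - v s orig\<bar> \<le> r / 4 + r / 4 + r / 4"
        using 1 2 3 4 5 c(2) e(3) r by linarith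
      then show "norm (P n - v s orig) < r" using r by simp
    qed
  qed
qed

text \<open>At \<open>orig\<close> both kernels decrease in time, so on the times between
  \<open>t\<close> and \<open>2 * t\<close> their difference is at least the bracket, and it is
  nonnegative at all times. Hence the Laplace integral of the difference, which is at most
  \<open>K\<close>, dominates the left-hand side.\<close>

theorem killed_comparison:
  fixes An :: "nat \<Rightarrow> 'v set"
  assumes killed: "\<And>n. killed W \<theta> (An n) orig" and ex: "\<And>S. finite S \<Longrightarrow> \<exists>N. \<forall>n\<ge>N. S \<subseteq> An n"
    and B: "killed W \<theta> B orig" and \<eta>: "0 < \<eta>" and t: "0 < t" and K: "0 \<le> K"
    and le: "\<And>n. killed.U W \<theta> (An n) orig \<eta> orig - killed.U W \<theta> B orig \<eta> orig \<le> K"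
  shows "t * exp (- \<eta> * (2 * t)) * (v (2 * t) orig - killed.u W \<theta> B orig t orig) \<le> K"
proof (cases "v (2 * t) orig \<le> killed.u W \<theta> B orig t orig")
  case True
  then have "t * exp (- \<eta> * (2 * t)) * (v (2 * t) orig - killed.u W \<theta> B orig t orig) \<le> 0"
    using t by (intro mult_nonneg_nonpos) auto
  then show ?thesis using K by simp
next
  case False
  interpret B: killed W \<theta> B orig by (rule B)
  define Q where "Q = B.U \<eta> orig + K"
  have Q: "killed.U W \<theta> (An n) orig \<eta> orig \<le> Q" for n using le[of n] by (simp add: Q_def)
  have Q0: "0 \<le> Q" using B.U_nonneg[OF \<eta>, of orig] K by (simp add: Q_def)
  define \<Phi> where "\<Phi> = (\<lambda>s. exp (- \<eta> * s) * (\<Sum>x\<in>B. \<theta> x * B.u s x * B.U \<eta> x))"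
  define n0 where "n0 = (\<lambda>s. L2_norm \<theta> (\<lambda>x. v s x - \<delta> x))"
  define L where "L = t * exp (- \<eta> * (2 * t)) * (v (2 * t) orig - B.u t orig)"
  define D where "D = (\<Sum>x\<in>B. B.U \<eta> x)"
  \<comment> \<open>Times below \<open>a\<close> are cut off because the bound on the energy of
    \<open>v s\<close> degenerates like \<open>1 / s\<close>, while dominated convergence needs a
    constant bound. The loss is measured by \<open>n0 a\<close>, the distance of \<open>v a\<close>
    from the point mass.\<close>
  have main: "L \<le> Q + n0 a * sqrt (Q / \<eta>) - \<Phi> a + exp (- \<eta> * b) * D" if a: "0 < a" "a \<le> t" and b: "2 * t \<le> b" for a b
  proof -
    have ab: "a \<le> b" using a b t by simp
    define P where "P = (\<lambda>n s. form (An n) (killed.U W \<theta> (An n) orig \<eta>) (v s)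
      + \<eta> * (\<Sum>x\<in>An n. \<theta> x * killed.U W \<theta> (An n) orig \<eta> x * v s x))"
    define \<Psi> where "\<Psi> = (\<lambda>n s. exp (- \<eta> * s) * (\<Sum>x\<in>An n. \<theta> x * killed.U W \<theta> (An n) orig \<eta> x * v s x))"
    have I: "((\<lambda>s. exp (- \<eta> * s) * P n s) has_integral \<Psi> n a - \<Psi> n b) {a..b}" for n
      unfolding P_def \<Psi>_def by (rule resolvent_integral[OF killed \<eta> a(1) ab])
    have \<Psi>: "\<Psi> n a - \<Psi> n b \<le> Q + n0 a * sqrt (Q / \<eta>)" for n
    proof -
      interpret killed W \<theta> "An n" orig by (rule killed)
      have "0 \<le> \<Psi> n b"
        unfolding \<Psi>_def using U_nonneg[OF \<eta>] \<theta>_pos v_bounds(1)[of b] ab a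
        by (intro mult_nonneg_nonneg sum_nonneg) (auto simp: less_imp_le)
      moreover have "\<Psi> n a \<le> 1 * (\<Sum>x\<in>An n. \<theta> x * U \<eta> x * v a x)"
        unfolding \<Psi>_def using U_nonneg[OF \<eta>] \<theta>_pos v_bounds(1)[of a] a \<eta>
        by (intro mult_right_mono sum_nonneg mult_nonneg_nonneg) (auto simp: less_imp_le)
      moreover have "(\<Sum>x\<in>An n. \<theta> x * U \<eta> x * v a x) = L2_inner \<theta> (v a) (U \<eta>)"
        using inner_finite[OF finite_A U_off, where f = "v a"] by (simp add: mult_ac)
      moreover have "L2_inner \<theta> (v a) (U \<eta>) \<le> Q + n0 a * sqrt (Q / \<eta>)"
      proof -
        have UL: "U \<eta> \<in> L2 \<theta>"
          by (rule L2_fin_supp) (use finite_A U_off in \<open>auto simp: fin_supp_def intro!: finite_subset[of _ "An n"]\<close>)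
        have vL: "v a \<in> L2 \<theta>" using a by (simp add: v_L2)
        have "L2_inner \<theta> (v a) (U \<eta>) - L2_inner \<theta> \<delta> (U \<eta>) \<le> n0 a * L2_norm \<theta> (U \<eta>)"
          using Cauchy_Schwarz[OF L2_diff[OF vL \<delta>_L2] UL] inner_diff_left[OF vL \<delta>_L2 UL]
          by (simp add: n0_def)
        moreover have "L2_inner \<theta> \<delta> (U \<eta>) \<le> Q"
          unfolding inner_commute[of \<delta>] inner_\<delta> by (rule Q)
        moreover have "L2_norm \<theta> (U \<eta>) \<le> sqrt (Q / \<eta>)"
        proof -
          have "L2_inner \<theta> (U \<eta>) (U \<eta>) = (\<Sum>x\<in>An n. \<theta> x * (U \<eta> x)\<^sup>2)"
            using inner_finite[OF finite_A U_off, where f = "U \<eta>"] by (simp add: power2_eq_square mult.assoc)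
          moreover have "\<eta> * (\<Sum>x\<in>An n. \<theta> x * (U \<eta> x)\<^sup>2) \<le> Q"
            using U_energy[OF \<eta>] energy_nonneg[of "U \<eta>"] Q[of n] by simp
          ultimately show ?thesis unfolding L2_norm_def using \<eta> by (simp add: le_divide_eq mult.commute)
        qed
        moreover have "n0 a * L2_norm \<theta> (U \<eta>) \<le> n0 a * sqrt (Q / \<eta>)"
          using calculation(3) by (intro mult_left_mono) (simp_all add: n0_def L2_norm_nonneg)
        ultimately show ?thesis by linarith
      qed
      ultimately show ?thesis by linarith
    qed
    have c1: "(\<lambda>s. exp (- \<eta> * s) * P n s) integrable_on {a..b}" for n using I by blast
    have c2: "(\<lambda>s. 1 / (2 * a * \<theta> orig) + \<eta> / \<theta> orig + Q) integrable_on {a..b}" by (rule integrable_const_ivl)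
    have c3: "(\<lambda>n. exp (- \<eta> * s) * P n s) \<longlonglongrightarrow> exp (- \<eta> * s) * v s orig" if s: "s \<in> {a..b}" for s
      unfolding P_def using s a by (intro tendsto_mult tendsto_const resolvent_pairing_limit(1)[OF killed ex \<eta> Q]) auto
    have c4: "norm (exp (- \<eta> * s) * P n s) \<le> 1 / (2 * a * \<theta> orig) + \<eta> / \<theta> orig + Q" if s: "s \<in> {a..b}" for n s
    proof -
      have s0: "0 < s" using s a by simp
      note lim = resolvent_pairing_limit[OF killed ex \<eta> Q s0]
      have "norm (exp (- \<eta> * s) * P n s) \<le> 1 * \<bar>P n s\<bar>"
        unfolding norm_mult using \<eta> s0 by (intro mult_mono) auto
      also have "\<dots> \<le> 1 / (2 * s * \<theta> orig) + \<eta> / \<theta> orig + Q"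
        unfolding P_def using lim(2)[of n] by simp
      also have "1 / (2 * s * \<theta> orig) \<le> 1 / (2 * a * \<theta> orig)"
        using s a \<theta>_pos[of orig] by (intro divide_left_mono mult_right_mono mult_pos_pos) auto
      finally show ?thesis by simp
    qed
    have conv: "(\<lambda>s. exp (- \<eta> * s) * v s orig) integrable_on {a..b}"
      "(\<lambda>n. integral {a..b} (\<lambda>s. exp (- \<eta> * s) * P n s)) \<longlonglongrightarrow> integral {a..b} (\<lambda>s. exp (- \<eta> * s) * v s orig)"
      by (rule dominated_convergence[OF c1 c2 c4 c3]; assumption)+
    have "integral {a..b} (\<lambda>s. exp (- \<eta> * s) * v s orig) \<le> Q + n0 a * sqrt (Q / \<eta>)"
      by (rule LIMSEQ_le_const2[OF conv(2)]) (use \<Psi> integral_unique[OF I] in auto)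
    moreover have Iu: "((\<lambda>s. exp (- \<eta> * s) * B.u s orig) has_integral \<Phi> a - \<Phi> b) {a..b}"
      unfolding \<Phi>_def by (rule killed_integral[OF B \<eta> ab])
    have diff: "((\<lambda>s. exp (- \<eta> * s) * v s orig - exp (- \<eta> * s) * B.u s orig) has_integral
        integral {a..b} (\<lambda>s. exp (- \<eta> * s) * v s orig) - (\<Phi> a - \<Phi> b)) {a..b}"
      by (intro has_integral_diff integrable_integral conv(1) Iu)
    moreover have "L \<le> integral {a..b} (\<lambda>s. exp (- \<eta> * s) * v s orig) - (\<Phi> a - \<Phi> b)"
    proof (rule has_integral_le)
      show "((\<lambda>s. if s \<in> {t..2 * t} then exp (- \<eta> * (2 * t)) * (v (2 * t) orig - B.u t orig) else 0) has_integral L) {a..b}"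
      proof -
        have "((\<lambda>s. exp (- \<eta> * (2 * t)) * (v (2 * t) orig - B.u t orig)) has_integral L) {t..2 * t}"
          using has_integral_const_real[of "exp (- \<eta> * (2 * t)) * (v (2 * t) orig - B.u t orig)" t "2 * t"] t
          by (simp add: L_def mult.assoc)
        moreover have "{t..2 * t} \<subseteq> {a..b}" using a b by auto
        ultimately show ?thesis by (simp only: has_integral_restrict)
      qed
      fix s assume s: "s \<in> {a..b}"
      show "(if s \<in> {t..2 * t} then exp (- \<eta> * (2 * t)) * (v (2 * t) orig - B.u t orig) else 0)
        \<le> exp (- \<eta> * s) * v s orig - exp (- \<eta> * s) * B.u s orig"
      proof (cases "s \<in> {t..2 * t}")
        case True
        have "exp (- \<eta> * (2 * t)) * (v (2 * t) orig - B.u t orig) \<le> exp (- \<eta> * s) * (v (2 * t) orig - B.u t orig)"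
          using True \<eta> \<open>\<not> v (2 * t) orig \<le> _\<close> by (intro mult_right_mono) auto
        also have "\<dots> \<le> exp (- \<eta> * s) * (v s orig - B.u s orig)"
          using v_antimono[of s "2 * t"] B.u_antimono[of t s] True t by (intro mult_left_mono) auto
        finally show ?thesis using True by (simp add: algebra_simps)
      next
        case False
        have "B.u s orig \<le> v s orig" using killed_le[OF B, of s] s a by simp
        then have "exp (- \<eta> * s) * B.u s orig \<le> exp (- \<eta> * s) * v s orig" by simp
        then show ?thesis using False by auto
      qed
    qed (rule diff)
    moreover have "\<Phi> b \<le> exp (- \<eta> * b) * D"
      unfolding \<Phi>_def D_def
    proof (intro mult_left_mono sum_mono)
      fix x assume x: "x \<in> B"
      have b0: "0 \<le> b" using a b t by simp
      have "\<theta> x * B.u b x \<le> (\<Sum>x\<in>B. \<theta> x * B.u b x)"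
        using x B.finite_A B.u_nonneg[OF b0] \<theta>_pos by (intro member_le_sum) (auto simp: less_imp_le)
      also have "\<dots> \<le> 1" by (rule B.sum_u_le[OF b0])
      finally show "\<theta> x * B.u b x * B.U \<eta> x \<le> B.U \<eta> x"
        using mult_right_mono[of "\<theta> x * B.u b x" 1 "B.U \<eta> x"] B.U_nonneg[OF \<eta>, of x] by simp
    qed simp
    ultimately show ?thesis by linarith
  qed
  have \<Phi>0: "(\<Phi> \<longlongrightarrow> B.U \<eta> orig) (at_right 0)"
  proof -
    have "isCont (\<lambda>s. B.u s x) 0" if "x \<in> B" for x
      by (rule DERIV_isCont[OF B.u_derivative[OF that]])
    then have "isCont \<Phi> 0" unfolding \<Phi>_def by (intro continuous_intros) auto
    then have "(\<Phi> \<longlongrightarrow> \<Phi> 0) (at_right 0)"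
      unfolding isCont_def by (rule tendsto_within_subset) auto
    also have "\<Phi> 0 = (\<Sum>x\<in>B. if x = orig then B.U \<eta> orig else 0)"
      unfolding \<Phi>_def using \<theta>_pos by (simp add: B.u_0 less_imp_neq[symmetric] cong: if_cong sum.cong)
        (intro sum.cong, auto simp: less_imp_neq[symmetric])
    also have "\<dots> = B.U \<eta> orig" using B.finite_A B.orig_A by simp
    finally show ?thesis .
  qed
  have n0: "(n0 \<longlongrightarrow> 0) (at_right 0)" unfolding n0_def by (rule v_norm_0)
  have e0: "((\<lambda>a. exp (- \<eta> * inverse a)) \<longlongrightarrow> 0) (at_right 0)"
  proof -
    have "filterlim (\<lambda>a. \<eta> * inverse a) at_top (at_right 0)"
      using \<eta> by (intro filterlim_tendsto_pos_mult_at_top[OF tendsto_const] filterlim_inverse_at_top_right)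
    then have "filterlim (\<lambda>a. - (\<eta> * inverse a)) at_bot (at_right 0)"
      by (simp add: filterlim_uminus_at_bot)
    then show ?thesis using filterlim_compose[OF exp_at_bot] by (simp add: o_def)
  qed
  \<comment> \<open>With \<open>b = inverse a\<close>, a single limit removes both ends of the time
    interval.\<close>
  have "((\<lambda>a. Q + n0 a * sqrt (Q / \<eta>) - \<Phi> a + exp (- \<eta> * inverse a) * D)
      \<longlongrightarrow> Q + 0 * sqrt (Q / \<eta>) - B.U \<eta> orig + 0 * D) (at_right 0)"
    by (intro tendsto_intros n0 e0 \<Phi>0)
  moreover have "\<forall>\<^sub>F a in at_right 0. L \<le> Q + n0 a * sqrt (Q / \<eta>) - \<Phi> a + exp (- \<eta> * inverse a) * D"
  proof -
    define d where "d = min t (inverse (2 * t))"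
    have d: "0 < d" using t by (simp add: d_def)
    have "L \<le> Q + n0 a * sqrt (Q / \<eta>) - \<Phi> a + exp (- \<eta> * inverse a) * D" if a: "0 < a" "a < d" for a
    proof (rule main)
      have "a \<le> inverse (2 * t)" using a by (simp add: d_def)
      then show "2 * t \<le> inverse a" using a(1) t by (simp add: field_simps)
    qed (use a in \<open>auto simp: d_def\<close>)
    then show ?thesis unfolding eventually_at_right_field using d by blast
  qed
  ultimately have "L \<le> Q + 0 * sqrt (Q / \<eta>) - B.U \<eta> orig + 0 * D"
    by (intro tendsto_lowerbound[of _ _ "at_right 0"]) auto
  then show ?thesis by (simp add: L_def Q_def)
qed

end

subsection \<open>Weighted power means\<close>

lemma Holder_sum:
  fixes a b :: "'a \<Rightarrow> real"
  assumes "finite S" and a: "\<And>i. i \<in> S \<Longrightarrow> 0 \<le> a i" and b: "\<And>i. i \<in> S \<Longrightarrow> 0 \<le> b i"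
    and \<alpha>: "0 < \<alpha>" "\<alpha> < 1"
  shows "(\<Sum>i\<in>S. a i powr \<alpha> * b i powr (1 - \<alpha>)) \<le> (\<Sum>i\<in>S. a i) powr \<alpha> * (\<Sum>i\<in>S. b i) powr (1 - \<alpha>)"
proof (cases "(\<Sum>i\<in>S. a i) = 0 \<or> (\<Sum>i\<in>S. b i) = 0")
  case True
  have "a i powr \<alpha> * b i powr (1 - \<alpha>) = 0" if "i \<in> S" for i
    using True that assms by (auto simp: sum_nonneg_eq_0_iff)
  then have "(\<Sum>i\<in>S. a i powr \<alpha> * b i powr (1 - \<alpha>)) = 0" by (intro sum.neutral ballI)
  then show ?thesis by simp
next
  case False
  define X where "X = (\<Sum>i\<in>S. a i)"
  define Y where "Y = (\<Sum>i\<in>S. b i)"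
  have pos: "0 < X" "0 < Y"
    using False a b sum_nonneg[of S a] sum_nonneg[of S b] unfolding X_def Y_def by force+
  have "(\<Sum>i\<in>S. a i powr \<alpha> * b i powr (1 - \<alpha>))
      \<le> (\<Sum>i\<in>S. X powr \<alpha> * Y powr (1 - \<alpha>) * (\<alpha> * (a i / X) + (1 - \<alpha>) * (b i / Y)))"
  proof (rule sum_mono)
    fix i assume i: "i \<in> S"
    have "(a i / X) powr \<alpha> * (b i / Y) powr (1 - \<alpha>) \<le> \<alpha> * (a i / X) + (1 - \<alpha>) * (b i / Y)"
    proof (cases "a i = 0 \<or> b i = 0")
      case True
      then show ?thesis using a[OF i] b[OF i] pos \<alpha> by auto
    next
      case False
      then show ?thesis using a[OF i] b[OF i] pos \<alpha> by (intro Youngs_inequality_0) auto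
    qed
    then have "X powr \<alpha> * Y powr (1 - \<alpha>) * ((a i / X) powr \<alpha> * (b i / Y) powr (1 - \<alpha>))
        \<le> X powr \<alpha> * Y powr (1 - \<alpha>) * (\<alpha> * (a i / X) + (1 - \<alpha>) * (b i / Y))"
      by (intro mult_left_mono) auto
    then show "a i powr \<alpha> * b i powr (1 - \<alpha>)
        \<le> X powr \<alpha> * Y powr (1 - \<alpha>) * (\<alpha> * (a i / X) + (1 - \<alpha>) * (b i / Y))"
      using pos a[OF i] b[OF i] by (simp add: powr_divide)
  qed
  also have "\<dots> = X powr \<alpha> * Y powr (1 - \<alpha>) * (\<alpha> * (X / X) + (1 - \<alpha>) * (Y / Y))"
    by (simp only: sum_distrib_left[symmetric] sum.distrib sum_divide_distrib[symmetric] X_def[symmetric] Y_def[symmetric])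
  also have "\<dots> = X powr \<alpha> * Y powr (1 - \<alpha>)" using pos by simp
  finally show ?thesis by (simp add: X_def Y_def)
qed

lemma power_mean_le:
  fixes f :: "'a \<Rightarrow> real"
  assumes S: "finite S" and f: "\<And>i. i \<in> S \<Longrightarrow> 0 \<le> f i" and s: "1 < s"
  shows "(\<Sum>i\<in>S. f i) \<le> real (card S) powr (1 - 1 / s) * (\<Sum>i\<in>S. f i powr s) powr (1 / s)"
proof -
  have "(\<Sum>i\<in>S. f i) = (\<Sum>i\<in>S. (f i powr s) powr (1 / s) * 1 powr (1 - 1 / s))"
    using f s by (intro sum.cong) (auto simp: powr_powr)
  also have "\<dots> \<le> (\<Sum>i\<in>S. f i powr s) powr (1 / s) * (\<Sum>i\<in>S. 1) powr (1 - 1 / s)"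
    using S s by (intro Holder_sum) auto
  finally show ?thesis by (simp add: mult.commute)
qed

lemma recip_cases:
  assumes "1 < p"
  obtains (infinite) "p = \<infinity>" "recip p = 0"
  | (finite) r where "p = ereal r" "1 < r" "recip p = 1 / r" "0 < recip p" "recip p < 1"
proof (cases p)
  case (real r)
  then have "1 < r" using assms by (simp add: one_ereal_def)
  moreover from this have "recip p = 1 / r" using real by (simp add: recip_def one_ereal_def)
  ultimately show ?thesis using finite[of r] real by simp
next
  case PInf
  then show ?thesis using infinite by (simp add: recip_def)
qed (use assms in simp)

lemma recip_bounds: "1 < p \<Longrightarrow> 0 \<le> recip p" "1 < p \<Longrightarrow> recip p < 1"
  by (erule recip_cases; simp)+

lemma avg_norm_nonneg:
  assumes "finite B" "B \<noteq> {}"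
  shows "0 \<le> avg_norm p B f"
proof (cases "p = \<infinity>")
  case True
  obtain x where "x \<in> B" using assms by blast
  then have "\<bar>f x\<bar> \<le> Max ((\<lambda>y. \<bar>f y\<bar>) ` B)" using assms by (intro Max_ge) auto
  then show ?thesis using True abs_ge_zero[of "f x"] by (simp add: avg_norm_def)
qed (simp add: avg_norm_def)

text \<open>Hoelder's inequality with \<open>recip p\<close> in the role of \<open>1 / p\<close>,
  for finite and infinite \<open>p\<close> alike; the power of \<open>card B\<close> undoes the
  normalization of \<open>avg_norm\<close>.\<close>

lemma sum_mult_le_avg_norm:
  assumes B: "finite B" "B \<noteq> {}" and p: "1 < p" and f: "\<And>x. x \<in> B \<Longrightarrow> 0 \<le> f x" and g: "\<And>x. x \<in> B \<Longrightarrow> 0 \<le> g x"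
  shows "(\<Sum>x\<in>B. g x * f x)
    \<le> avg_norm p B g * real (card B) powr recip p * (\<Sum>x\<in>B. f x powr (1 / (1 - recip p))) powr (1 - recip p)"
  using p
proof (cases rule: recip_cases)
  case infinite
  have "g x \<le> Max ((\<lambda>y. \<bar>g y\<bar>) ` B)" if "x \<in> B" for x
    by (rule order_trans[OF abs_ge_self Max_ge]) (use B that in auto)
  then have "(\<Sum>x\<in>B. g x * f x) \<le> (\<Sum>x\<in>B. avg_norm p B g * f x)"
    using f infinite by (intro sum_mono mult_right_mono) (auto simp: avg_norm_def)
  also have "\<dots> = avg_norm p B g * (\<Sum>x\<in>B. f x)" by (simp add: sum_distrib_left)
  finally show ?thesis using infinite B f sum_nonneg[of B f] by (simp add: card_gt_0_iff)
next
  case (finite r)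
  define P where "P = recip p"
  have P: "0 < P" "P < 1" "1 / P = r" using finite by (auto simp: P_def)
  have c: "0 < real (card B)" using B by (simp add: card_gt_0_iff)
  have "(\<Sum>x\<in>B. g x * f x) = (\<Sum>x\<in>B. (g x powr r) powr P * (f x powr (1 / (1 - P))) powr (1 - P))"
    using f g P finite by (intro sum.cong) (auto simp: powr_powr P_def)
  also have "\<dots> \<le> (\<Sum>x\<in>B. g x powr r) powr P * (\<Sum>x\<in>B. f x powr (1 / (1 - P))) powr (1 - P)"
    using P B by (intro Holder_sum) auto
  also have "(\<Sum>x\<in>B. g x powr r) powr P = avg_norm p B g * real (card B) powr P"
  proof -
    have "avg_norm p B g = (1 / card B * (\<Sum>x\<in>B. g x powr r)) powr P"
      using finite g by (simp add: avg_norm_def P_def)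
    then show ?thesis using c g by (simp add: powr_mult[symmetric] sum_nonneg)
  qed
  finally show ?thesis by (simp add: P_def)
qed

lemma avg_norm_mono:
  assumes B: "finite B" "B \<noteq> {}" and p: "1 < p" and fg: "\<And>x. x \<in> B \<Longrightarrow> \<bar>f x\<bar> \<le> \<bar>g x\<bar>"
  shows "avg_norm p B f \<le> avg_norm p B g"
  using p
proof (cases rule: recip_cases)
  case infinite
  have "\<bar>f x\<bar> \<le> Max ((\<lambda>y. \<bar>g y\<bar>) ` B)" if "x \<in> B" for x
    by (rule order_trans[OF fg Max_ge]) (use B that in auto)
  then show ?thesis using infinite B by (simp add: avg_norm_def)
next
  case (finite r)
  then show ?thesis using fg by (auto simp: avg_norm_def intro!: powr_mono2 sum_mono sum_nonneg divide_nonneg_nonneg divide_right_mono)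
qed

lemma avg_norm_const:
  assumes "finite B" "B \<noteq> {}" "1 < p"
  shows "avg_norm p B (\<lambda>_. 1) = 1"
  using \<open>1 < p\<close>
proof (cases rule: recip_cases)
  case infinite
  then show ?thesis using assms by (simp add: avg_norm_def image_constant_conv)
next
  case (finite r)
  then show ?thesis using assms by (simp add: avg_norm_def card_gt_0_iff)
qed

text \<open>Rests on \<open>(1 + a) powr (1 / r) \<le> 1 + a powr (1 / r)\<close>. It carries
  finiteness of the norms over to functions truncated from below by 1, from which
  \<open>M_zero\<close> is built.\<close>

lemma avg_norm_max_one:
  assumes B: "finite B" "B \<noteq> {}" and p: "1 < p"
  shows "avg_norm p B (\<lambda>x. max 1 (f x)) \<le> 1 + avg_norm p B f"
  using p
proof (cases rule: recip_cases)
  case infinite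
  have "\<bar>max 1 (f x)\<bar> \<le> 1 + Max ((\<lambda>y. \<bar>f y\<bar>) ` B)" if "x \<in> B" for x
  proof -
    have "\<bar>f x\<bar> \<le> Max ((\<lambda>y. \<bar>f y\<bar>) ` B)" using B that by (intro Max_ge) auto
    then show ?thesis by (auto simp: max_def abs_if split: if_splits)
  qed
  then show ?thesis using infinite B by (simp add: avg_norm_def)
next
  case (finite r)
  define c where "c = real (card B)"
  have c: "c > 0" using B by (simp add: c_def card_gt_0_iff)
  define a where "a = 1 / c * (\<Sum>y\<in>B. \<bar>f y\<bar> powr r)"
  have a: "0 \<le> a" using c unfolding a_def by (intro mult_nonneg_nonneg sum_nonneg) auto
  have av: "avg_norm p B f = a powr (1 / r)" using finite by (simp add: avg_norm_def a_def c_def)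
  have "avg_norm p B (\<lambda>x. max 1 (f x)) = (1 / c * (\<Sum>y\<in>B. \<bar>max 1 (f y)\<bar> powr r)) powr (1 / r)"
    using finite by (simp add: avg_norm_def c_def)
  also have "\<dots> \<le> (1 / c * (\<Sum>y\<in>B. 1 + \<bar>f y\<bar> powr r)) powr (1 / r)"
    using finite c by (intro powr_mono2 mult_left_mono sum_mono mult_nonneg_nonneg sum_nonneg) (auto simp: max_def)
  also have "1 / c * (\<Sum>y\<in>B. 1 + \<bar>f y\<bar> powr r) = 1 + a"
    using c by (simp add: sum.distrib a_def c_def distrib_left)
  also have "(1 + a) powr (1 / r) \<le> 1 + a powr (1 / r)"
  proof -
    have "1 + a = 1 powr r + (a powr (1 / r)) powr r" using a finite by (simp add: powr_powr)
    also have "\<dots> \<le> (1 + a powr (1 / r)) powr 1 * (1 + a powr (1 / r)) powr (r - 1)"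
    proof -
      have "1 powr r + (a powr (1 / r)) powr r
          = 1 * 1 powr (r - 1) + a powr (1 / r) * (a powr (1 / r)) powr (r - 1)"
        using powr_mult_base[of "a powr (1 / r)" "r - 1"] by simp
      also have "\<dots> \<le> 1 * (1 + a powr (1 / r)) powr (r - 1) + a powr (1 / r) * (1 + a powr (1 / r)) powr (r - 1)"
        using finite by (intro add_mono mult_left_mono powr_mono2) auto
      finally show ?thesis by (simp add: algebra_simps)
    qed
    also have "\<dots> = (1 + a powr (1 / r)) powr r"
      using powr_mult_base[of "1 + a powr (1 / r)" "r - 1"] by simp
    finally have "(1 + a) powr (1 / r) \<le> ((1 + a powr (1 / r)) powr r) powr (1 / r)"
      using a finite by (intro powr_mono2) auto
    then show ?thesis using finite by (simp add: powr_powr)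
  qed
  finally show ?thesis using av by simp
qed

text \<open>For finite \<open>q\<close>, Hoelder's inequality with
  \<open>\<alpha> = \<rho> / 2\<close> splits the power of each increment into
  \<open>(W y z * (f z - f y)\<^sup>2) powr \<alpha>\<close> and
  \<open>W y z powr (- \<alpha>)\<close>. The choice of \<open>\<rho>\<close> turns the latter into
  \<open>(W y z powr (- q)) powr (1 - \<alpha>)\<close>, and the sum of the powers
  \<open>W y z powr (- q)\<close> is controlled by \<open>nu\<close>. For infinite \<open>q\<close>,
  \<open>\<rho>\<close> is 2.\<close>

lemma edge_Holder:
  fixes E :: "'v set set"
  assumes B: "finite B" "B \<noteq> {}" and q: "1 < q"
    and W: "\<And>x y. 0 \<le> W x y" "\<And>x y. adj E x y \<Longrightarrow> 0 < W x y" and fin: "\<And>x. finite {y. adj E x y}"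
  defines "S \<equiv> {(y, z). y \<in> B \<and> z \<in> B \<and> adj E y z}" and "\<rho> \<equiv> 2 / (1 + recip q)"
  shows "(\<Sum>(y, z)\<in>S. \<bar>f y - f z\<bar> powr \<rho>) powr (1 / \<rho>)
    \<le> sqrt (avg_norm q B (nu E W) * real (card B) powr recip q * (\<Sum>(y, z)\<in>S. W y z * (f z - f y)\<^sup>2))"
proof -
  have S: "finite S" by (rule finite_subset[of _ "B \<times> B"]) (use B in \<open>auto simp: S_def\<close>)
  have Wpos: "0 < W y z" if "(y, z) \<in> S" for y z using that W(2) by (auto simp: S_def)
  define D where "D = (\<Sum>(y, z)\<in>S. W y z * (f z - f y)\<^sup>2)"
  have D0: "0 \<le> D" unfolding D_def using W(1) by (intro sum_nonneg) auto
  have nu_nn: "0 \<le> nu E W y" for y unfolding nu_def using W by (intro sum_nonneg) auto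
  have nu_ge: "inverse (W y z) \<le> nu E W y" if "(y, z) \<in> S" for y z
    unfolding nu_def using that W fin by (intro member_le_sum) (auto simp: S_def)
  show ?thesis using q
  proof (cases rule: recip_cases)
    case infinite
    define N where "N = avg_norm q B (nu E W)"
    have "\<bar>f y - f z\<bar> powr \<rho> \<le> N * (W y z * (f z - f y)\<^sup>2)" if yz: "(y, z) \<in> S" for y z
    proof -
      have "\<bar>f y - f z\<bar> powr \<rho> = \<bar>f y - f z\<bar>\<^sup>2"
        using infinite by (cases "f y = f z") (auto simp: \<rho>_def powr_numeral)
      also have "\<dots> = inverse (W y z) * (W y z * (f z - f y)\<^sup>2)"
        using Wpos[OF yz] by (simp add: power2_commute)
      also have "\<dots> \<le> N * (W y z * (f z - f y)\<^sup>2)"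
      proof (intro mult_right_mono)
        have "y \<in> B" using yz by (auto simp: S_def)
        then have "\<bar>nu E W y\<bar> \<le> N" unfolding N_def avg_norm_def using infinite B by auto
        then show "inverse (W y z) \<le> N" using nu_ge[OF yz] by simp
      qed (use W in auto)
      finally show ?thesis .
    qed
    then have "(\<Sum>(y, z)\<in>S. \<bar>f y - f z\<bar> powr \<rho>) \<le> N * D"
      unfolding D_def sum_distrib_left by (intro sum_mono) auto
    then have "(\<Sum>(y, z)\<in>S. \<bar>f y - f z\<bar> powr \<rho>) powr (1 / 2) \<le> (N * D) powr (1 / 2)"
      by (intro powr_mono2) (auto intro!: sum_nonneg)
    moreover have "0 \<le> N * D" using D0 avg_norm_nonneg[OF B] by (simp add: N_def)
    ultimately show ?thesis using infinite B
      by (simp add: \<rho>_def powr_half_sqrt N_def D_def card_gt_0_iff)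
  next
    case (finite r)
    define Q where "Q = recip q"
    have Q: "0 < Q" "Q < 1" "r = 1 / Q" using finite by (auto simp: Q_def)
    define \<alpha> where "\<alpha> = 1 / (1 + Q)"
    have \<alpha>: "0 < \<alpha>" "\<alpha> < 1" "\<rho> = 2 * \<alpha>" "1 - \<alpha> = Q * \<alpha>"
      using Q by (auto simp: \<alpha>_def \<rho>_def Q_def[symmetric] field_simps)
    define V where "V = (\<Sum>(y, z)\<in>S. W y z powr (- r))"
    define N where "N = (\<Sum>y\<in>B. nu E W y powr r)"
    have V0: "0 \<le> V" unfolding V_def by (intro sum_nonneg) auto
    have "(\<Sum>(y, z)\<in>S. \<bar>f y - f z\<bar> powr \<rho>)
        = (\<Sum>(y, z)\<in>S. (W y z * (f z - f y)\<^sup>2) powr \<alpha> * (W y z powr (- r)) powr (1 - \<alpha>))"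
    proof (intro sum.cong refl, clarify)
      fix y z assume yz: "(y, z) \<in> S"
      have "(W y z * (f z - f y)\<^sup>2) powr \<alpha> = W y z powr \<alpha> * \<bar>f y - f z\<bar> powr \<rho>"
      proof -
        have e: "(f z - f y)\<^sup>2 = \<bar>f y - f z\<bar> powr 2"
          by (cases "f y = f z") (simp_all add: powr_numeral power2_commute)
        show ?thesis unfolding e \<alpha>(3) by (subst powr_mult) (simp_all only: powr_powr powr_ge_zero W(1))
      qed
      moreover have "(W y z powr (- r)) powr (1 - \<alpha>) = W y z powr (- \<alpha>)"
        using Q \<alpha> by (simp add: powr_powr)
      moreover have "W y z powr \<alpha> * W y z powr (- \<alpha>) = 1"
        using Wpos[OF yz] by (simp add: powr_add[symmetric])
      ultimately show "\<bar>f y - f z\<bar> powr \<rho> = (W y z * (f z - f y)\<^sup>2) powr \<alpha> * (W y z powr (- r)) powr (1 - \<alpha>)"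
        by (simp add: mult_ac)
    qed
    also have "\<dots> \<le> D powr \<alpha> * V powr (1 - \<alpha>)"
      unfolding D_def V_def split_beta using S \<alpha> W by (intro Holder_sum) auto
    finally have "(\<Sum>(y, z)\<in>S. \<bar>f y - f z\<bar> powr \<rho>) powr (1 / \<rho>) \<le> (D powr \<alpha> * V powr (1 - \<alpha>)) powr (1 / \<rho>)"
      using \<alpha> by (intro powr_mono2 sum_nonneg) auto
    also have "\<dots> = D powr (1 / 2) * V powr (Q / 2)"
      using D0 V0 \<alpha> by (simp add: powr_mult powr_powr)
    also have "\<dots> \<le> D powr (1 / 2) * (N powr Q) powr (1 / 2)"
    proof -
      have "V \<le> N"
      proof -
        have SB: "S \<subseteq> Sigma B (\<lambda>y. {z. adj E y z})" by (auto simp: S_def)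
        have "V \<le> (\<Sum>(y, z)\<in>Sigma B (\<lambda>y. {z. adj E y z}). W y z powr (- r))"
          unfolding V_def using B fin SB by (intro sum_mono2) auto
        also have "\<dots> = (\<Sum>y\<in>B. \<Sum>z | adj E y z. W y z powr (- r))"
          using B fin by (intro sum.Sigma[symmetric]) auto
        also have "\<dots> \<le> N" unfolding N_def
        proof (intro sum_mono)
          fix y
          have r: "1 < r" using finite by simp
          \<comment> \<open>Of the power \<open>r\<close> of \<open>inverse (W y z)\<close>, the
            part \<open>r - 1\<close> is estimated by \<open>nu E W y\<close>; the remaining first
            powers add up to \<open>nu E W y\<close>.\<close>
          have "(\<Sum>z | adj E y z. W y z powr (- r)) \<le> (\<Sum>z | adj E y z. inverse (W y z) * nu E W y powr (r - 1))"
          proof (intro sum_mono)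
            fix z assume z: "z \<in> {z. adj E y z}"
            then have w: "0 < W y z" using W by auto
            have "W y z powr (- r) = (inverse (W y z)) powr (1 + (r - 1))"
              using w by (simp add: powr_minus inverse_powr)
            also have "\<dots> = inverse (W y z) * inverse (W y z) powr (r - 1)"
              using w by (subst powr_add) simp
            also have "\<dots> \<le> inverse (W y z) * nu E W y powr (r - 1)"
            proof (intro mult_left_mono powr_mono2)
              show "inverse (W y z) \<le> nu E W y"
                unfolding nu_def using z W fin by (intro member_le_sum) auto
            qed (use w r in auto)
            finally show "W y z powr (- r) \<le> inverse (W y z) * nu E W y powr (r - 1)" .
          qed
          also have "\<dots> = nu E W y * nu E W y powr (r - 1)" by (simp add: nu_def sum_distrib_right)
          also have "\<dots> = nu E W y powr r" using nu_nn[of y] powr_mult_base[of "nu E W y" "r - 1"] by simp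
          finally show "(\<Sum>z | adj E y z. W y z powr (- r)) \<le> nu E W y powr r" .
        qed
        finally show ?thesis .
      qed
      then have "V powr (Q / 2) \<le> N powr (Q / 2)" using V0 Q by (intro powr_mono2) auto
      then show ?thesis by (simp add: powr_powr mult_left_mono)
    qed
    also have "N powr Q = avg_norm q B (nu E W) * real (card B) powr Q"
    proof -
      have "avg_norm q B (nu E W) = (1 / card B * N) powr Q"
        using finite nu_nn by (simp add: avg_norm_def Q_def N_def)
      moreover have "0 \<le> N" unfolding N_def by (intro sum_nonneg) auto
      ultimately show ?thesis using B by (simp add: powr_mult[symmetric] card_gt_0_iff)
    qed
    finally show ?thesis
      using D0 avg_norm_nonneg[OF B, of q "nu E W"]
      by (simp add: powr_half_sqrt real_sqrt_mult Q_def D_def mult_ac)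
  qed
qed

subsection \<open>Sobolev inequality\<close>

text \<open>The radius \<open>len\<close> and the distance \<open>dst\<close> are kept abstract; \<open>s\<close> is the Sobolev exponent
  and \<open>\<pi>\<close> the exponent conjugate to \<open>p\<close>, where \<open>P = 1/p\<close> and \<open>Q = 1/q\<close>.\<close>

locale regular_network = dirichlet_space W \<theta>
  for W :: "'v \<Rightarrow> 'v \<Rightarrow> real" and \<theta> :: "'v \<Rightarrow> real" +
  fixes orig :: 'v and len :: "'v \<Rightarrow> real" and dst :: "'v \<Rightarrow> 'v \<Rightarrow> real" and \<kappa> :: "'v \<Rightarrow> real"
    and d d' P Q m M r0 creg Creg CS dS s \<pi> :: real
  assumes len_orig: "len orig = 0"
    and len_dst: "\<And>x y. \<bar>len x - len y\<bar> \<le> dst x y"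
    and dst_sym: "\<And>x y. dst x y = dst y x"
    and dst_ge_1: "\<And>x y. x \<noteq> y \<Longrightarrow> 1 \<le> dst x y"
    and finite_ball: "\<And>r. finite {x. len x \<le> r}"
    and parameters: "3 \<le> d" "d < d'" "0 \<le> P" "P < 1" "0 \<le> Q" "Q < 1" "P + Q < 2 / d'" "d \<le> m"
      "1 \<le> M" "1 \<le> r0" "0 < creg" "0 < CS" "1 \<le> dS"
    and s_def: "1 / s = (1 + Q) / 2 - 1 / d'" and \<pi>_def: "\<pi> = 1 / (1 - P)"
    and volume: "\<And>r. r0 \<le> r \<Longrightarrow> creg * r powr d \<le> card {x. len x \<le> r}"
      "\<And>r. r0 \<le> r \<Longrightarrow> card {x. len x \<le> r} \<le> Creg * r powr d"
    and sobolev: "\<And>r f. r0 \<le> r \<Longrightarrow> fin_supp f \<Longrightarrow>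
      lp_norm s {x. len x \<le> r} (\<lambda>y. f y - average {x. len x \<le> r} f)
      \<le> CS * r powr (1 - d / d') * sqrt (2 * M * real (card {x. len x \<le> dS * r}) powr Q * energy W f)"
    and \<kappa>_sum: "\<And>r f. r0 \<le> r \<Longrightarrow> (\<And>x. 0 \<le> f x) \<Longrightarrow> (\<Sum>x | len x \<le> r. \<kappa> x * f x)
      \<le> M * real (card {x. len x \<le> r}) powr P * (\<Sum>x | len x \<le> r. f x powr \<pi>) powr (1 - P)"
    and \<theta>_sum: "\<And>r f. r0 \<le> r \<Longrightarrow> (\<And>x. 0 \<le> f x) \<Longrightarrow> (\<Sum>x | len x \<le> r. \<theta> x * f x)
      \<le> M * real (card {x. len x \<le> r}) powr P * (\<Sum>x | len x \<le> r. f x powr \<pi>) powr (1 - P)"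
    and moment: "\<And>F x. finite F \<Longrightarrow> (\<Sum>y\<in>F. W x y * dst x y powr m) \<le> \<kappa> x"
begin

abbreviation ball :: "real \<Rightarrow> 'v set" where "ball r \<equiv> {x. len x \<le> r}"

text \<open>\<open>c1\<close> belongs to the oscillation on a ball, \<open>c2\<close> to one
  doubling of the radius, and \<open>K1\<close> to the final Sobolev inequality. None contains
  \<open>M\<close> or \<open>r0\<close>, whose powers must remain visible.\<close>

definition "c1 = CS * sqrt (2 * (Creg * dS powr d) powr Q)"
definition "c2 = creg powr (- (1 / s)) * c1 * 2 powr (d / s + 1 - d / 2)"
definition "K1 = 2 powr s * (c1 powr s + Creg * (4 * c2) powr s)"

text \<open>\<open>2 * \<pi> < s\<close> is the assumption \<open>P + Q < 2 / d'\<close> in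
  disguise, since \<open>2 / s = 1 + Q - 2 / d'\<close> and \<open>1 / \<pi> = 1 - P\<close>. The
  level sums, the recursion and Nash's argument all live on this gap.\<close>

lemma exponents:
  shows "1 < s" "0 < s" "2 * \<pi> < s" "1 \<le> \<pi>" "d / s + 1 - d / 2 = 1 - d / d' + d * Q / 2" "0 < d" "0 < d'"
    "1 / \<pi> = 1 - P"
proof -
  show d: "0 < d" "0 < d'" using parameters by auto
  have i: "1 / d' \<le> 1 / 3" using parameters by (simp add: divide_simps)
  have pos: "1 / s > 0" 
  proof -
    have "0 < (1 + Q) / 2 - e" if "e \<le> 1 / 3" for e using that parameters(5) by (simp add: field_simps)
    from this[OF i] show ?thesis unfolding s_def .
  qed
  then show s: "0 < s" by (simp add: zero_less_divide_iff)
  have "1 / s < 1" 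
  proof -
    have "(1 + Q) / 2 - e < 1" if "0 < e" for e using that parameters(6) by (simp add: field_simps)
    moreover have "0 < 1 / d'" using d by simp
    ultimately show ?thesis unfolding s_def by blast
  qed
  then show "1 < s" using s by (simp add: divide_simps split: if_splits)
  have \<pi>: "0 < \<pi>" using parameters by (simp add: \<pi>_def)
  show ip: "1 / \<pi> = 1 - P" by (simp add: \<pi>_def)
  have "2 / s < 1 - P" using s_def parameters(7) by (simp add: add_divide_distrib diff_divide_distrib)
  then have "2 / s < 1 / \<pi>" by (simp add: ip)
  then show "2 * \<pi> < s" using s \<pi> by (simp add: divide_simps mult.commute)
  show "1 \<le> \<pi>" using parameters by (simp add: \<pi>_def)
  have "d / s = d * ((1 + Q) / 2 - 1 / d')" using s_def by (metis times_divide_eq_right mult.right_neutral)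
  then show "d / s + 1 - d / 2 = 1 - d / d' + d * Q / 2"
    by (simp add: algebra_simps add_divide_distrib)
qed

lemma Creg_pos: "0 < Creg"
proof -
  have "0 < creg * r0 powr d" using parameters by simp
  also have "\<dots> \<le> Creg * r0 powr d" using volume[of r0] by simp
  finally show ?thesis using parameters by (simp add: zero_less_mult_iff)
qed

lemma c1_pos: "0 < c1"
  using Creg_pos parameters by (simp add: c1_def)

lemma c2_pos: "0 < c2"
  using c1_pos parameters by (simp add: c2_def)

lemma K1_pos: "0 < K1"
  using c1_pos Creg_pos by (simp add: K1_def add_pos_nonneg)

lemma oscillation_bound:
  assumes r: "r0 \<le> r" and f: "fin_supp f"
  shows "(\<Sum>x\<in>ball r. \<bar>f x - average (ball r) f\<bar> powr s) powr (1 / s)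
    \<le> c1 * r powr (d / s + 1 - d / 2) * sqrt (M * energy W f)"
proof -
  have r0: "0 < r" "1 \<le> r" using r parameters by auto
  have dr: "r0 \<le> dS * r" using r parameters mult_mono[of 1 dS r0 r] by simp
  have "real (card (ball (dS * r))) powr Q \<le> (Creg * (dS * r) powr d) powr Q"
    using volume(2)[OF dr] parameters by (intro powr_mono2) auto
  also have "\<dots> = (Creg * dS powr d) powr Q * r powr (d * Q)"
    using Creg_pos parameters r0 by (simp add: powr_mult powr_powr)
  finally have "2 * M * real (card (ball (dS * r))) powr Q * energy W f
      \<le> 2 * M * ((Creg * dS powr d) powr Q * r powr (d * Q)) * energy W f"
    using parameters energy_nonneg by (intro mult_right_mono mult_left_mono) auto
  then have "sqrt (2 * M * real (card (ball (dS * r))) powr Q * energy W f)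
      \<le> sqrt (2 * M * ((Creg * dS powr d) powr Q * r powr (d * Q)) * energy W f)"
    by (rule real_sqrt_le_mono)
  also have "\<dots> = sqrt (2 * (Creg * dS powr d) powr Q) * r powr (d * Q / 2) * sqrt (M * energy W f)"
  proof -
    have "sqrt (r powr (d * Q)) = r powr (d * Q / 2)"
      using r0 by (simp add: powr_half_sqrt[symmetric] powr_powr)
    then show ?thesis by (simp add: real_sqrt_mult mult_ac)
  qed
  finally have *: "sqrt (2 * M * real (card (ball (dS * r))) powr Q * energy W f)
    \<le> sqrt (2 * (Creg * dS powr d) powr Q) * r powr (d * Q / 2) * sqrt (M * energy W f)" .
  have "(\<Sum>x\<in>ball r. \<bar>f x - average (ball r) f\<bar> powr s) powr (1 / s)
      \<le> CS * r powr (1 - d / d') * sqrt (2 * M * real (card (ball (dS * r))) powr Q * energy W f)"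
    using sobolev[OF r f] by (simp add: lp_norm_def)
  also have "\<dots> \<le> CS * r powr (1 - d / d') *
      (sqrt (2 * (Creg * dS powr d) powr Q) * r powr (d * Q / 2) * sqrt (M * energy W f))"
    using parameters by (intro mult_left_mono *) auto
  also have "\<dots> = c1 * (r powr (1 - d / d') * r powr (d * Q / 2)) * sqrt (M * energy W f)"
    by (simp add: c1_def mult_ac)
  also have "r powr (1 - d / d') * r powr (d * Q / 2) = r powr (d / s + 1 - d / 2)"
    unfolding exponents(5) by (simp add: powr_add)
  finally show ?thesis .
qed

text \<open>Taking the mean over the smaller ball costs the factor
  \<open>r powr (- (d / s))\<close>, after which the exponent \<open>1 - d / 2\<close> no longer
  remembers \<open>d'\<close> and \<open>Q\<close>: it is the scaling of the energy in dimension
  \<open>d\<close>.\<close>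

lemma average_step:
  assumes r: "r0 \<le> r" and f: "fin_supp f"
  shows "\<bar>average (ball r) f - average (ball (2 * r)) f\<bar> \<le> c2 * r powr (1 - d / 2) * sqrt (M * energy W f)"
proof -
  have r0: "0 < r" "1 \<le> r" using r parameters by auto
  define c where "c = average (ball (2 * r)) f"
  define n where "n = real (card (ball r))"
  have "creg * r powr d \<le> n" using volume(1)[OF r] by (simp add: n_def)
  moreover have cr: "0 < creg * r powr d" using parameters r0 by simp
  ultimately have n: "0 < n" by linarith
  have "average (ball r) f - c = 1 / n * (\<Sum>x\<in>ball r. f x - c)"
    using n by (simp add: average_def n_def sum_subtractf right_diff_distrib)
  then have "\<bar>average (ball r) f - c\<bar> \<le> 1 / n * (\<Sum>x\<in>ball r. \<bar>f x - c\<bar>)"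
    using n sum_abs[of "\<lambda>x. f x - c" "ball r"] by (simp add: abs_mult divide_right_mono)
  also have "\<dots> \<le> 1 / n * (n powr (1 - 1 / s) * (\<Sum>x\<in>ball r. \<bar>f x - c\<bar> powr s) powr (1 / s))"
    unfolding n_def using finite_ball exponents by (intro mult_left_mono power_mean_le) auto
  also have "\<dots> = n powr (- (1 / s)) * (\<Sum>x\<in>ball r. \<bar>f x - c\<bar> powr s) powr (1 / s)"
    using n by (simp add: powr_diff powr_minus field_simps)
  also have "\<dots> \<le> (creg * r powr d) powr (- (1 / s)) *
      (c1 * (2 * r) powr (d / s + 1 - d / 2) * sqrt (M * energy W f))"
  proof (intro mult_mono)
    show "n powr (- (1 / s)) \<le> (creg * r powr d) powr (- (1 / s))"
      using \<open>creg * r powr d \<le> n\<close> cr exponents by (intro powr_mono2') auto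
    have "(\<Sum>x\<in>ball r. \<bar>f x - c\<bar> powr s) \<le> (\<Sum>x\<in>ball (2 * r). \<bar>f x - c\<bar> powr s)"
      using r0 finite_ball by (intro sum_mono2) auto
    then have "(\<Sum>x\<in>ball r. \<bar>f x - c\<bar> powr s) powr (1 / s) \<le> (\<Sum>x\<in>ball (2 * r). \<bar>f x - c\<bar> powr s) powr (1 / s)"
      using exponents by (intro powr_mono2 sum_nonneg) auto
    also have "\<dots> \<le> c1 * (2 * r) powr (d / s + 1 - d / 2) * sqrt (M * energy W f)"
      unfolding c_def using r r0 f by (intro oscillation_bound) auto
    finally show "(\<Sum>x\<in>ball r. \<bar>f x - c\<bar> powr s) powr (1 / s)
      \<le> c1 * (2 * r) powr (d / s + 1 - d / 2) * sqrt (M * energy W f)" .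
  qed auto
  also have "\<dots> = c2 * (r powr (- (d / s)) * r powr (d / s + 1 - d / 2)) * sqrt (M * energy W f)"
    using parameters r0 by (simp add: powr_mult powr_powr c2_def mult_ac)
  also have "r powr (- (d / s)) * r powr (d / s + 1 - d / 2) = r powr (1 - d / 2)"
    by (simp add: powr_add[symmetric])
  finally show ?thesis by (simp add: c_def)
qed

text \<open>Since \<open>d \<ge> 3\<close>, the differences of the averages over dyadic balls are summable up to
  infinity, where the averages vanish.\<close>

lemma average_bound:
  assumes r: "r0 \<le> r" and f: "fin_supp f"
  shows "\<bar>average (ball r) f\<bar> \<le> 4 * c2 * r powr (1 - d / 2) * sqrt (M * energy W f)"
proof -
  define X where "X = c2 * sqrt (M * energy W f)"
  have X: "0 \<le> X" using c2_pos parameters energy_nonneg by (simp add: X_def)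
  \<comment> \<open>The constant 4 reproduces itself as \<open>1 + 4 * (3 / 4)\<close>: doubling the
    radius multiplies \<open>r powr (1 - d / 2)\<close> by at most
    \<open>2 powr (- (1 / 2))\<close>, which is below \<open>3 / 4\<close>.\<close>
  have step: "\<bar>average (ball r) f\<bar> \<le> \<bar>average (ball (2 ^ k * r)) f\<bar> + 4 * X * r powr (1 - d / 2)"
    if "r0 \<le> r" for k r
    using that
  proof (induction k arbitrary: r)
    case 0
    then show ?case using X by simp
  next
    case (Suc k)
    have r0: "0 < r" "r0 \<le> 2 * r" using Suc.prems parameters by auto
    have "\<bar>average (ball r) f\<bar> \<le> X * r powr (1 - d / 2) + \<bar>average (ball (2 * r)) f\<bar>"
      using average_step[OF Suc.prems f] by (simp add: X_def mult_ac)
    also have "\<bar>average (ball (2 * r)) f\<bar> \<le> \<bar>average (ball (2 ^ k * (2 * r))) f\<bar> + 4 * X * (2 * r) powr (1 - d / 2)"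
      by (rule Suc.IH[OF r0(2)])
    also have "4 * X * (2 * r) powr (1 - d / 2) \<le> 4 * X * (3 / 4 * r powr (1 - d / 2))"
    proof (intro mult_left_mono)
      have "2 powr (1 - d / 2) \<le> 2 powr (- (1 / 2) :: real)"
        using parameters by (intro powr_mono) auto
      also have "\<dots> = 1 / sqrt 2"
        using powr_minus[of 2 "1 / 2 :: real"] powr_half_sqrt[of 2] by (simp only: inverse_eq_divide)
      also have "\<dots> \<le> 3 / 4"
      proof -
        have "4 / 3 \<le> sqrt 2" by (rule real_le_rsqrt) (simp add: power2_eq_square)
        then have "1 / sqrt 2 \<le> 1 / (4 / 3)" by (intro divide_left_mono) auto
        then show ?thesis by simp
      qed
      finally show "(2 * r) powr (1 - d / 2) \<le> 3 / 4 * r powr (1 - d / 2)"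
        using r0 by (simp add: powr_mult mult_right_mono)
    qed (use X in auto)
    finally show ?case by (simp add: algebra_simps)
  qed
  have "(\<lambda>k. \<bar>average (ball (2 ^ k * r)) f\<bar> + 4 * X * r powr (1 - d / 2))
      \<longlonglongrightarrow> 0 + 4 * X * r powr (1 - d / 2)"
  proof (intro tendsto_add tendsto_const)
    define T where "T = (\<Sum>x | f x \<noteq> 0. \<bar>f x\<bar>)"
    have r0: "1 \<le> r" using r parameters by auto
    have "\<forall>\<^sub>F k in sequentially. norm \<bar>average (ball (2 ^ k * r)) f\<bar> \<le> T / creg * (1 / 2) ^ k"
    proof (intro always_eventually allI)
      fix k :: nat
      define R where "R = 2 ^ k * r"
      have R: "2 ^ k \<le> R" "r0 \<le> R" "1 \<le> R"
        using r r0 mult_mono[of 1 "2 ^ k" r0 r] parameters mult_mono[of 1 "2 ^ k" 1 r] by (auto simp: R_def)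
      have n: "creg * 2 ^ k \<le> card (ball R)"
      proof -
        have "creg * 2 ^ k \<le> creg * R powr d"
          using R parameters powr_mono[of 1 d R] by (intro mult_left_mono) auto
        then show ?thesis using volume(1)[OF R(2)] by simp
      qed
      have "0 < creg * 2 ^ k" using parameters by simp
      have "\<bar>\<Sum>x\<in>ball R. f x\<bar> \<le> T"
      proof -
        have "\<bar>\<Sum>x\<in>ball R. f x\<bar> \<le> (\<Sum>x\<in>ball R. \<bar>f x\<bar>)" by (rule sum_abs)
        also have "\<dots> = (\<Sum>x\<in>ball R \<inter> {x. f x \<noteq> 0}. \<bar>f x\<bar>)"
          using finite_ball by (intro sum.mono_neutral_right) auto
        also have "\<dots> \<le> T" unfolding T_def using f by (intro sum_mono2) (auto simp: fin_supp_def)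
        finally show ?thesis .
      qed
      moreover have "norm \<bar>average (ball R) f\<bar> = \<bar>\<Sum>x\<in>ball R. f x\<bar> / card (ball R)"
        by (simp add: average_def abs_mult)
      moreover have "\<bar>\<Sum>x\<in>ball R. f x\<bar> / card (ball R) \<le> T / (creg * 2 ^ k)"
        using calculation(1) n \<open>0 < creg * 2 ^ k\<close> by (intro frac_le) auto
      ultimately show "norm \<bar>average (ball (2 ^ k * r)) f\<bar> \<le> T / creg * (1 / 2) ^ k"
        by (simp add: R_def power_divide)
    qed
    moreover have "(\<lambda>k. T / creg * (1 / 2) ^ k) \<longlonglongrightarrow> 0"
      by (rule tendsto_eq_intros LIMSEQ_power_zero | simp)+
    ultimately show "(\<lambda>k. \<bar>average (ball (2 ^ k * r)) f\<bar>) \<longlonglongrightarrow> 0"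
      by (rule Lim_null_comparison)
  qed
  then have "\<bar>average (ball r) f\<bar> \<le> 0 + 4 * X * r powr (1 - d / 2)"
    by (rule LIMSEQ_le_const) (use step[OF r] in auto)
  then show ?thesis by (simp add: X_def mult_ac)
qed

text \<open>The support of \<open>f\<close> may reach far beyond the ball, as
  \<open>average_bound\<close> controls the mean on every large ball. This matters because
  resolvents of large sets are estimated on much smaller balls.\<close>

lemma global_sobolev:
  assumes r: "r0 \<le> r" and f: "fin_supp f"
  shows "(\<Sum>x\<in>ball r. \<bar>f x\<bar> powr s) \<le> K1 * r powr d * (r powr (2 - d) * M * energy W f) powr (s / 2)"
proof -
  have r0: "0 < r" using r parameters by auto
  have s: "0 < s" using exponents by simp
  define X where "X = sqrt (M * energy W f)"
  have X: "0 \<le> X" using parameters energy_nonneg by (simp add: X_def)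
  define c where "c = average (ball r) f"
  define Z where "Z = (\<Sum>x\<in>ball r. \<bar>f x - c\<bar> powr s)"
  have Z0: "0 \<le> Z" unfolding Z_def by (intro sum_nonneg) auto
  have Zs: "Z \<le> (c1 * r powr (d / s + 1 - d / 2) * X) powr s"
  proof -
    have "Z = (Z powr (1 / s)) powr s" using Z0 s by (simp add: powr_powr)
    also have "\<dots> \<le> (c1 * r powr (d / s + 1 - d / 2) * X) powr s"
      using oscillation_bound[OF r f] s unfolding Z_def c_def X_def by (intro powr_mono2) auto
    finally show ?thesis .
  qed
  have "(\<Sum>x\<in>ball r. \<bar>f x\<bar> powr s) \<le> (\<Sum>x\<in>ball r. 2 powr s * (\<bar>f x - c\<bar> powr s + \<bar>c\<bar> powr s))"
  proof (intro sum_mono)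
    fix x
    have "\<bar>f x\<bar> \<le> 2 * max \<bar>f x - c\<bar> \<bar>c\<bar>"
      using abs_triangle_ineq[of "f x - c" c] by (auto simp: max_def)
    then have "\<bar>f x\<bar> powr s \<le> (2 * max \<bar>f x - c\<bar> \<bar>c\<bar>) powr s" using s by (intro powr_mono2) auto
    also have "\<dots> = 2 powr s * max \<bar>f x - c\<bar> \<bar>c\<bar> powr s" by (simp add: powr_mult)
    also have "\<dots> \<le> 2 powr s * (\<bar>f x - c\<bar> powr s + \<bar>c\<bar> powr s)"
      by (intro mult_left_mono) (auto simp: max_def)
    finally show "\<bar>f x\<bar> powr s \<le> 2 powr s * (\<bar>f x - c\<bar> powr s + \<bar>c\<bar> powr s)" .
  qed
  also have "\<dots> = 2 powr s * (Z + real (card (ball r)) * \<bar>c\<bar> powr s)"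
    by (simp add: Z_def sum_distrib_left[symmetric] sum.distrib)
  also have "\<dots> \<le> 2 powr s * ((c1 * r powr (d / s + 1 - d / 2) * X) powr s
      + Creg * r powr d * (4 * c2 * r powr (1 - d / 2) * X) powr s)"
  proof (intro mult_left_mono add_mono mult_mono powr_mono2 Zs volume(2)[OF r])
    show "\<bar>c\<bar> \<le> 4 * c2 * r powr (1 - d / 2) * X"
      unfolding c_def X_def by (rule average_bound[OF r f])
  qed (use s Creg_pos in auto)
  also have "(c1 * r powr (d / s + 1 - d / 2) * X) powr s = c1 powr s * r powr d * (r powr (1 - d / 2) * X) powr s"
  proof -
    have "r powr (d / s + 1 - d / 2) = r powr (d / s) * r powr (1 - d / 2)"
      by (simp add: powr_add[symmetric] add_diff_eq)
    then show ?thesis using c1_pos X s by (simp add: powr_mult powr_powr mult_ac)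
  qed
  also have "(4 * c2 * r powr (1 - d / 2) * X) powr s = (4 * c2) powr s * (r powr (1 - d / 2) * X) powr s"
    using c2_pos X by (simp add: powr_mult mult_ac)
  also have "2 powr s * (c1 powr s * r powr d * (r powr (1 - d / 2) * X) powr s
      + Creg * r powr d * ((4 * c2) powr s * (r powr (1 - d / 2) * X) powr s))
      = K1 * r powr d * (r powr (1 - d / 2) * X) powr s"
    by (simp add: K1_def algebra_simps)
  also have "(r powr (1 - d / 2) * X) powr s = (r powr (2 - d) * M * energy W f) powr (s / 2)"
  proof -
    have "r powr (1 - d / 2) * X = (r powr (2 - d) * (M * energy W f)) powr (1 / 2)"
      using parameters energy_nonneg
      by (simp add: X_def powr_mult powr_powr powr_half_sqrt[symmetric] diff_divide_distrib)
    then show ?thesis using parameters energy_nonneg by (simp add: powr_powr mult.assoc)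
  qed
  finally show ?thesis .
qed

end

subsection \<open>The resolvent of the killed process\<close>

text \<open>Comparison summand by summand. For truncations the pointwise hypothesis holds because
  increments keep their sign and do not grow.\<close>

lemma (in network) energy_le_form:
  assumes "finite A" "\<And>x. x \<notin> A \<Longrightarrow> f x = 0" "\<And>x. x \<notin> A \<Longrightarrow> g x = 0" "\<And>x. x \<notin> A \<Longrightarrow> h x = 0"
    and le: "\<And>x y. (h y - h x)\<^sup>2 \<le> (f y - f x) * (g y - g x)"
  shows "energy W h \<le> form A g f"
proof -
  obtain C where C: "\<And>y. \<bar>f y\<bar> \<le> C" using fin_supp_bounded[where A = A and k = f] assms by blast
  have 1: "((\<lambda>(x, y). W x y * (f y - f x) * (g y - g x)) has_sum 2 * form A g f) UNIV"
    by (rule form_has_sum[where C = C]) (use assms C in auto)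
  have 2: "((\<lambda>(x, y). W x y * (h y - h x)\<^sup>2) has_sum 2 * energy W h) UNIV"
    using finite_energy_fin_supp(1)[where A = A and k = h] assms unfolding finite_energy_def energy_def by simp
  have "2 * energy W h \<le> 2 * form A g f"
    by (rule has_sum_mono[OF 2 1]) (use le W_nonneg in \<open>auto simp: mult.assoc intro!: mult_left_mono\<close>)
  then show ?thesis by simp
qed

lemma square_le_mult:
  fixes a b :: real
  assumes "0 \<le> a * b" "\<bar>a\<bar> \<le> \<bar>b\<bar>"
  shows "a\<^sup>2 \<le> a * b"
proof -
  have "a\<^sup>2 = \<bar>a\<bar> * \<bar>a\<bar>" by (simp add: power2_eq_square)
  also have "\<dots> \<le> \<bar>a\<bar> * \<bar>b\<bar>" using assms by (intro mult_left_mono) auto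
  also have "\<dots> = a * b" using assms by (simp add: abs_mult[symmetric])
  finally show ?thesis .
qed

context killed
begin

lemma U_fin_supp: "fin_supp (U \<eta>)"
  unfolding fin_supp_def by (rule finite_subset[OF _ finite_A]) (use U_off in auto)

text \<open>Maximum principle: the positive part of the excess over \<open>U \<eta> orig\<close>
  vanishes at \<open>orig\<close>, so testing the resolvent equation with it leaves nonnegative
  terms that add up to 0.\<close>

lemma U_max:
  assumes \<eta>: "0 < \<eta>"
  shows "U \<eta> x \<le> U \<eta> orig"
proof (rule ccontr)
  assume neg: "\<not> U \<eta> x \<le> U \<eta> orig"
  define g where "g = (\<lambda>x. max 0 (U \<eta> x - U \<eta> orig))"
  have h0: "0 \<le> U \<eta> orig" by (rule U_nonneg[OF \<eta>])
  have g_off: "g y = 0" if "y \<notin> A" for y using that h0 by (simp add: g_def U_off)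
  have "0 \<le> energy W g" by (rule energy_nonneg)
  also have "energy W g \<le> form A (U \<eta>) g"
  proof (rule energy_le_form)
    show "(g y - g x)\<^sup>2 \<le> (g y - g x) * (U \<eta> y - U \<eta> x)" for x y
      by (rule square_le_mult) (auto simp: g_def max_def zero_le_mult_iff)
  qed (use finite_A g_off U_off in auto)
  finally have "\<eta> * (\<Sum>x\<in>A. \<theta> x * U \<eta> x * g x) \<le> 0"
    using U_form[where g = g, OF \<eta> g_off] by (simp add: g_def)
  then have "(\<Sum>x\<in>A. \<theta> x * U \<eta> x * g x) \<le> 0" using \<eta> by (simp add: mult_le_0_iff)
  moreover have "\<theta> x * U \<eta> x * g x \<le> (\<Sum>x\<in>A. \<theta> x * U \<eta> x * g x)"
  proof (rule member_le_sum)
    show "x \<in> A" using neg h0 U_off[of x \<eta>] by (cases "x \<in> A") auto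
  qed (use finite_A U_nonneg[OF \<eta>] \<theta>_pos in \<open>auto simp: g_def less_imp_le\<close>)
  moreover have "0 < \<theta> x * U \<eta> x * g x"
    using neg h0 \<theta>_pos[of x] by (intro mult_pos_pos) (auto simp: g_def)
  ultimately show False by linarith
qed

text \<open>Testing the resolvent equation with the truncation leaves its value at
  \<open>orig\<close>, which is at most \<open>h\<close> no matter how large the resolvent is
  there.\<close>

lemma energy_truncation:
  assumes \<eta>: "0 < \<eta>" and h: "0 \<le> h"
  shows "energy W (\<lambda>x. min (U \<eta> x) h) \<le> h"
proof -
  define g where "g = (\<lambda>x. min (U \<eta> x) h)"
  have g_off: "g y = 0" if "y \<notin> A" for y using that h by (simp add: g_def U_off)
  have "energy W g \<le> form A (U \<eta>) g"
  proof (rule energy_le_form)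
    show "(g y - g x)\<^sup>2 \<le> (g y - g x) * (U \<eta> y - U \<eta> x)" for x y
      by (rule square_le_mult) (auto simp: g_def min_def zero_le_mult_iff)
  qed (use finite_A g_off U_off in auto)
  also have "\<dots> = g orig - \<eta> * (\<Sum>x\<in>A. \<theta> x * U \<eta> x * g x)"
    using U_form[where g = g, OF \<eta> g_off] by simp
  also have "\<dots> \<le> g orig"
  proof -
    have "0 \<le> \<eta> * (\<Sum>x\<in>A. \<theta> x * U \<eta> x * g x)"
      using \<eta> h U_nonneg[OF \<eta>] \<theta>_pos
      by (intro mult_nonneg_nonneg sum_nonneg) (auto simp: g_def less_imp_le)
    then show ?thesis by simp
  qed
  also have "\<dots> \<le> h" by (simp add: g_def)
  finally show ?thesis by (simp add: g_def)
qed

text \<open>The weight is the product \<open>U \<eta> x * U \<eta> y\<close> and not a square: this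
  is exactly what remains when the equation is tested with \<open>\<zeta>\<^sup>2 U\<close>, so that
  \<open>energy_cut\<close> is an identity.\<close>

definition cut_energy :: "real \<Rightarrow> ('v \<Rightarrow> real) \<Rightarrow> real" where
  "cut_energy \<eta> \<zeta> = 1 / 2 * (\<Sum>x\<in>A. \<Sum>y\<in>A. W x y * (\<zeta> y - \<zeta> x)\<^sup>2 * (U \<eta> x * U \<eta> y))"

text \<open>Testing the equation of the resolvent with \<open>\<zeta>\<^sup>2 U\<close>, which vanishes at the origin.\<close>

lemma energy_cut:
  assumes \<eta>: "0 < \<eta>" and \<zeta>: "\<zeta> orig = 0"
  shows "energy W (\<lambda>x. \<zeta> x * U \<eta> x) + \<eta> * (\<Sum>x\<in>A. \<theta> x * (\<zeta> x * U \<eta> x)\<^sup>2) = cut_energy \<eta> \<zeta>"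
proof -
  define u where "u = U \<eta>"
  define g where "g = (\<lambda>x. (\<zeta> x)\<^sup>2 * u x)"
  define h where "h = (\<lambda>x. \<zeta> x * u x)"
  have off: "\<And>x. x \<notin> A \<Longrightarrow> g x = 0" "\<And>x. x \<notin> A \<Longrightarrow> h x = 0" "\<And>x. x \<notin> A \<Longrightarrow> u x = 0"
    by (simp_all add: g_def h_def u_def U_off)
  obtain C where C: "\<And>y. \<bar>g y\<bar> \<le> C" using fin_supp_bounded[where A = A and k = g] off finite_A by blast
  have 1: "((\<lambda>(x, y). W x y * (g y - g x) * (u y - u x)) has_sum 2 * form A u g) UNIV"
    by (rule form_has_sum[where C = C]) (use finite_A off C in auto)
  have "((\<lambda>(x, y). W x y * (\<zeta> y - \<zeta> x)\<^sup>2 * (u x * u y)) has_sum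
      (\<Sum>(x, y)\<in>A \<times> A. W x y * (\<zeta> y - \<zeta> x)\<^sup>2 * (u x * u y))) (A \<times> A)"
    using finite_A by (intro has_sum_finite) auto
  also have "?this \<longleftrightarrow> ((\<lambda>(x, y). W x y * (\<zeta> y - \<zeta> x)\<^sup>2 * (u x * u y)) has_sum
      (\<Sum>(x, y)\<in>A \<times> A. W x y * (\<zeta> y - \<zeta> x)\<^sup>2 * (u x * u y))) UNIV"
    by (rule has_sum_cong_neutral) (use off(3) in fastforce)+
  also have "(\<Sum>(x, y)\<in>A \<times> A. W x y * (\<zeta> y - \<zeta> x)\<^sup>2 * (u x * u y)) = 2 * cut_energy \<eta> \<zeta>"
    by (simp add: cut_energy_def sum.cartesian_product u_def)
  finally have 2: "((\<lambda>(x, y). W x y * (\<zeta> y - \<zeta> x)\<^sup>2 * (u x * u y)) has_sum 2 * cut_energy \<eta> \<zeta>) UNIV" .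
  have 3: "((\<lambda>(x, y). W x y * (h y - h x)\<^sup>2) has_sum 2 * energy W h) UNIV"
    using finite_energy_fin_supp(1)[where A = A and k = h] finite_A off unfolding finite_energy_def energy_def by simp
  \<comment> \<open>The pointwise identity behind this: the squared increment of
    \<open>\<zeta> u\<close> is the increment of \<open>\<zeta>\<^sup>2 u\<close> times that of
    \<open>u\<close>, plus the squared increment of \<open>\<zeta>\<close> times
    \<open>u x * u y\<close>.\<close>
  have "((\<lambda>z. (case z of (x, y) \<Rightarrow> W x y * (g y - g x) * (u y - u x))
      + (case z of (x, y) \<Rightarrow> W x y * (\<zeta> y - \<zeta> x)\<^sup>2 * (u x * u y))) has_sum 2 * form A u g + 2 * cut_energy \<eta> \<zeta>) UNIV"
    by (intro has_sum_add 1 2)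
  also have "(\<lambda>z. (case z of (x, y) \<Rightarrow> W x y * (g y - g x) * (u y - u x))
      + (case z of (x, y) \<Rightarrow> W x y * (\<zeta> y - \<zeta> x)\<^sup>2 * (u x * u y))) = (\<lambda>(x, y). W x y * (h y - h x)\<^sup>2)"
    by (auto simp: fun_eq_iff g_def h_def power2_eq_square algebra_simps)
  finally have "2 * energy W h = 2 * form A u g + 2 * cut_energy \<eta> \<zeta>" using 3 has_sum_unique by blast
  moreover have "form A u g + \<eta> * (\<Sum>x\<in>A. \<theta> x * (h x)\<^sup>2) = 0"
    using U_form[where g = g, OF \<eta> off(1)] \<zeta> by (simp add: u_def g_def h_def power2_eq_square mult_ac)
  ultimately show ?thesis by (simp add: h_def u_def)
qed

text \<open>The difference of the resolvents on \<open>A\<close> and on \<open>B\<close> is orthogonal, in the form, to the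
  functions supported in \<open>B\<close>, hence minimizes among functions with the same values off \<open>B\<close>.\<close>

lemma U_diff_le:
  assumes B: "killed W \<theta> B orig" "B \<subseteq> A" and \<eta>: "0 < \<eta>" and \<zeta>: "\<zeta> orig = 0"
    and one: "\<And>x. x \<in> A \<Longrightarrow> x \<notin> B \<Longrightarrow> \<zeta> x = 1"
  shows "U \<eta> orig - killed.U W \<theta> B orig \<eta> orig \<le> cut_energy \<eta> \<zeta>"
proof -
  interpret B: killed W \<theta> B orig by (rule B(1))
  define u v z w where "u = U \<eta>" and "v = B.U \<eta>" and "z = (\<lambda>x. u x - v x)" and "w = (\<lambda>x. \<zeta> x * u x)"
  \<comment> \<open>Competitor minus minimizer. On \<open>A\<close> without \<open>B\<close> both
    equal \<open>u\<close>, so \<open>k\<close> is an admissible test function for the equations on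
    \<open>A\<close> and on \<open>B\<close>.\<close>
  define k where "k = (\<lambda>x. w x - z x)"
  have off: "\<And>x. x \<notin> A \<Longrightarrow> u x = 0" "\<And>x. x \<notin> B \<Longrightarrow> v x = 0"
    by (simp_all add: u_def v_def U_off B.U_off)
  have offA: "\<And>x. x \<notin> A \<Longrightarrow> v x = 0" "\<And>x. x \<notin> A \<Longrightarrow> z x = 0" "\<And>x. x \<notin> A \<Longrightarrow> w x = 0" "\<And>x. x \<notin> A \<Longrightarrow> k x = 0"
    using off B(2) by (auto simp: z_def w_def k_def)
  have kB: "k x = 0" if "x \<notin> B" for x
    using off one that by (cases "x \<in> A") (auto simp: k_def w_def z_def)
  define b where "b = (\<lambda>f g. form A f g + \<eta> * (\<Sum>x\<in>A. \<theta> x * f x * g x))"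
  have gen_diff: "generator (\<lambda>x. f x - g x) x = generator f x - generator g x"
    if "\<And>x. x \<notin> A \<Longrightarrow> f x = 0" "\<And>x. x \<notin> A \<Longrightarrow> g x = 0" for f g x
    using generator_fin[where A = A and f = f and x = x] generator_fin[where A = A and f = g and x = x]
      generator_fin[where A = A and f = "\<lambda>x. f x - g x" and x = x] that finite_A
    by (simp add: sum_subtractf algebra_simps)
  have bU: "b u g = g orig" if "\<And>x. x \<notin> A \<Longrightarrow> g x = 0" for g
    unfolding b_def u_def by (rule U_form[where g = g, OF \<eta> that])
  have bV: "b v g = g orig" if g: "\<And>x. x \<notin> B \<Longrightarrow> g x = 0" for g
  proof -
    have gA: "\<And>x. x \<notin> A \<Longrightarrow> g x = 0" using g B(2) by blast
    have "form A v g = form B v g" unfolding form_def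
      using finite_A B(2) off(2) by (intro arg_cong[where f = uminus] sum.mono_neutral_right) auto
    moreover have "(\<Sum>x\<in>A. \<theta> x * v x * g x) = (\<Sum>x\<in>B. \<theta> x * v x * g x)"
      using finite_A B(2) off(2) by (intro sum.mono_neutral_right) auto
    ultimately show ?thesis unfolding b_def using B.U_form[where g = g, OF \<eta> g] by (simp add: v_def)
  qed
  have b_sym: "b f g = b g f" if "\<And>x. x \<notin> A \<Longrightarrow> f x = 0" "\<And>x. x \<notin> A \<Longrightarrow> g x = 0" for f g
    unfolding b_def using form_sym[OF finite_A, of f g] that by (simp add: mult_ac)
  have b_diff: "b f (\<lambda>x. g x - h x) = b f g - b f h"
    if "\<And>x. x \<notin> A \<Longrightarrow> g x = 0" "\<And>x. x \<notin> A \<Longrightarrow> h x = 0" for f g h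
    unfolding b_def form_def by (simp add: gen_diff[OF that] algebra_simps sum_subtractf)
  have b_self: "b f f = energy W f + \<eta> * (\<Sum>x\<in>A. \<theta> x * (f x)\<^sup>2)" if "\<And>x. x \<notin> A \<Longrightarrow> f x = 0" for f
    unfolding b_def using finite_energy_fin_supp(2)[where A = A and k = f] finite_A that
    by (simp add: power2_eq_square mult.assoc)
  have "b w w - b w z = b w k" unfolding k_def by (rule b_diff[symmetric]) (use offA in auto)
  also have "b w k = b k w" by (rule b_sym) (use offA in auto)
  finally have 0: "b w w - b w z = b k w" .
  have kk: "b k k = b k w - b k z" by (subst (2) k_def, rule b_diff) (use offA in auto)
  have kz: "b k z = 0"
  proof -
    have "b k z = b k u - b k v" unfolding z_def by (rule b_diff) (use off offA in auto)
    also have "b k u = b u k" by (rule b_sym) (use off offA in auto)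
    also have "b k v = b v k" by (rule b_sym) (use off offA in auto)
    also have "b u k = k orig" by (rule bU) (use offA in auto)
    also have "b v k = k orig" by (rule bV) (use kB in auto)
    finally show ?thesis by simp
  qed
  have 1: "b w w - b w z = b k k" using 0 kk kz by simp
  have "b w z - b z z = b z w - b z z"
    using b_sym[of w z] offA by simp
  also have "\<dots> = b z k" unfolding k_def by (rule b_diff[symmetric]) (use offA in auto)
  also have "\<dots> = 0" using b_sym[of z k] offA kz by simp
  finally have 2: "b w z = b z z" by simp
  \<comment> \<open>The energy of the difference is its value at \<open>orig\<close>: the cross
    terms with \<open>v\<close> cancel because the equations on \<open>A\<close> and on
    \<open>B\<close> both evaluate \<open>v\<close> at \<open>orig\<close>.\<close>
  have "b z z = b z u - b z v" by (subst (2) z_def, rule b_diff) (use off offA in auto)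
  also have "b z u = b u z" by (rule b_sym) (use off offA in auto)
  also have "b u z = z orig" by (rule bU) (use offA in auto)
  also have "b z v = b v z" by (rule b_sym) (use off offA in auto)
  also have "b v z = b v u - b v v" unfolding z_def by (rule b_diff) (use off offA in auto)
  also have "b v u = b u v" by (rule b_sym) (use off offA in auto)
  also have "b u v = v orig" by (rule bU) (use offA in auto)
  also have "b v v = v orig" by (rule bV) (use off in auto)
  finally have 3: "b z z = z orig" by simp
  have "b k k = energy W k + \<eta> * (\<Sum>x\<in>A. \<theta> x * (k x)\<^sup>2)"
    by (rule b_self) (use offA in auto)
  moreover have "0 \<le> energy W k + \<eta> * (\<Sum>x\<in>A. \<theta> x * (k x)\<^sup>2)" using energy_nonneg \<eta> \<theta>_pos
    by (intro add_nonneg_nonneg mult_nonneg_nonneg sum_nonneg) (auto simp: less_imp_le)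
  ultimately have "z orig \<le> b w w" using 1 2 3 by simp
  also have "b w w = energy W w + \<eta> * (\<Sum>x\<in>A. \<theta> x * (w x)\<^sup>2)"
    by (rule b_self) (use offA in auto)
  also have "\<dots> = cut_energy \<eta> \<zeta>"
    unfolding w_def u_def by (rule energy_cut[where \<zeta> = \<zeta>, OF \<eta> \<zeta>])
  finally show ?thesis by (simp add: z_def u_def v_def)
qed

end

section \<open>Level sets and weighted sums of the resolvent\<close>

context regular_network
begin

text \<open>\<open>K2\<close> contains the sum of the geometric series over dyadic levels,
  \<open>K3\<close> the weak type bound solved for the level, and \<open>K4\<close> volume and level
  constants with the powers that Hoelder's inequality dictates.\<close>

definition "K2 = Creg + 2 powr \<pi> * K1 / (1 - 2 powr (\<pi> - s / 2))"
definition "K3 = K1 powr (2 / s)"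
definition "K4 = Creg powr P * K2 powr (1 - P)"

lemma K2_pos: "0 < K2"
proof -
  have "2 powr (\<pi> - s / 2) < 2 powr 0" using exponents(3) by (intro powr_less_mono) auto
  then show ?thesis unfolding K2_def using Creg_pos K1_pos by (intro add_pos_nonneg) auto
qed

lemma \<kappa>_nonneg: "0 \<le> \<kappa> x"
  using moment[of "{}" x] by simp

lemma killed_ball: "0 \<le> r \<Longrightarrow> killed W \<theta> (ball r) orig"
  by unfold_locales (simp_all add: finite_ball len_orig)

text \<open>On the level set the truncation equals \<open>h\<close>, so the Sobolev inequality
  weighs \<open>h powr s\<close> times the count against a multiple of
  \<open>h powr (s / 2)\<close>; the quotient of the two is the decay in \<open>h\<close>.\<close>

lemma level_count:
  assumes A: "killed W \<theta> A orig" and \<eta>: "0 < \<eta>" and r: "r0 \<le> r" and h: "0 < h"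
  shows "real (card {x \<in> ball r. h \<le> killed.U W \<theta> A orig \<eta> x})
    \<le> K1 * r powr d * (r powr (2 - d) * M / h) powr (s / 2)"
proof -
  interpret killed W \<theta> A orig by (rule A)
  have r1: "0 < r" using r parameters by auto
  define g where "g = (\<lambda>x. min (U \<eta> x) h)"
  define L where "L = {x \<in> ball r. h \<le> U \<eta> x}"
  have fg: "fin_supp g"
  proof -
    have "{x. g x \<noteq> 0} \<subseteq> A"
    proof
      fix x assume "x \<in> {x. g x \<noteq> 0}"
      then show "x \<in> A" using U_off[of x \<eta>] h by (cases "x \<in> A") (auto simp: g_def)
    qed
    then show ?thesis unfolding fin_supp_def using finite_A by (rule finite_subset)
  qed
  have "real (card L) * h powr s = (\<Sum>x\<in>L. \<bar>g x\<bar> powr s)"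
    using h by (simp add: L_def g_def)
  also have "\<dots> \<le> (\<Sum>x\<in>ball r. \<bar>g x\<bar> powr s)"
    using finite_ball by (intro sum_mono2) (auto simp: L_def)
  also have "\<dots> \<le> K1 * r powr d * (r powr (2 - d) * M * energy W g) powr (s / 2)"
    by (rule global_sobolev[OF r fg])
  also have "\<dots> \<le> K1 * r powr d * (r powr (2 - d) * M * h) powr (s / 2)"
    using K1_pos parameters energy_nonneg energy_truncation[OF \<eta>, of h] h exponents
    by (intro mult_left_mono powr_mono2) (auto simp: g_def)
  also have "\<dots> = K1 * r powr d * (r powr (2 - d) * M / h) powr (s / 2) * h powr s"
  proof -
    have "r powr (2 - d) * M * h = (r powr (2 - d) * M / h) * (h powr 2)"
      using h by (simp add: power2_eq_square powr_numeral)
    then have "(r powr (2 - d) * M * h) powr (s / 2) = (r powr (2 - d) * M / h) powr (s / 2) * (h powr 2) powr (s / 2)"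
      using h parameters by (simp only: powr_mult)
    then show ?thesis by (simp add: powr_powr)
  qed
  finally show ?thesis using h by (simp add: L_def)
qed

text \<open>The weak type bound \<open>level_count\<close> is summed over dyadic levels.\<close>

lemma resolvent_power_sum:
  assumes A: "killed W \<theta> A orig" and \<eta>: "0 < \<eta>" and r: "r0 \<le> r"
  shows "(\<Sum>x\<in>ball r. killed.U W \<theta> A orig \<eta> x powr \<pi>) \<le> K2 * r powr d * (r powr (2 - d) * M) powr \<pi>"
proof -
  interpret killed W \<theta> A orig by (rule A)
  have r1: "0 < r" using r parameters by auto
  \<comment> \<open>The typical size of the resolvent on the ball: points below \<open>N\<close> are
    counted by volume alone, those above by dyadic multiples of \<open>N\<close>.\<close>
  define N where "N = r powr (2 - d) * M"
  have N: "0 < N" using r1 parameters by (simp add: N_def)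
  define lev where "lev = (\<lambda>k x. if 2 ^ k * N \<le> U \<eta> x then 1 else (0 :: real))"
  have \<pi>: "0 < \<pi>" using exponents by simp
  obtain n :: nat where "U \<eta> orig / N < 2 ^ n" using real_arch_pow[of 2 "U \<eta> orig / N"] by auto
  then have n: "U \<eta> orig < 2 ^ n * N" using N by (simp add: divide_less_eq)
  have pointwise: "U \<eta> x powr \<pi> \<le> N powr \<pi> + (\<Sum>k<n. (2 ^ Suc k * N) powr \<pi> * lev k x)" for x
  proof (cases "U \<eta> x < N")
    case True
    then have "U \<eta> x powr \<pi> \<le> N powr \<pi>" using U_nonneg[OF \<eta>] \<pi> by (intro powr_mono2) auto
    moreover have "0 \<le> (\<Sum>k<n. (2 ^ Suc k * N) powr \<pi> * lev k x)" by (intro sum_nonneg) (auto simp: lev_def)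
    ultimately show ?thesis by linarith
  next
    case False
    have less: "U \<eta> x < 2 ^ n * N" using U_max[OF \<eta>, of x] n by linarith
    define j where "j = (LEAST j. U \<eta> x < 2 ^ j * N)"
    have j: "U \<eta> x < 2 ^ j * N" "j \<le> n" unfolding j_def using less by (auto intro: LeastI Least_le)
    have "j \<noteq> 0" using j(1) False by (auto intro: ccontr)
    then obtain k where k: "j = Suc k" by (cases j) auto
    have "\<not> U \<eta> x < 2 ^ k * N" using not_less_Least[of k "\<lambda>j. U \<eta> x < 2 ^ j * N"] k by (simp add: j_def)
    then have lev_k: "lev k x = 1" by (simp add: lev_def)
    have "U \<eta> x powr \<pi> \<le> (2 ^ Suc k * N) powr \<pi> * lev k x"
      using j(1) k lev_k U_nonneg[OF \<eta>] \<pi> by (auto intro!: powr_mono2 simp: less_imp_le)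
    also have "\<dots> \<le> (\<Sum>k<n. (2 ^ Suc k * N) powr \<pi> * lev k x)"
      using j(2) k by (intro member_le_sum) (auto simp: lev_def)
    finally show ?thesis using powr_ge_zero[of N \<pi>] by linarith
  qed
  \<comment> \<open>Level \<open>k\<close> contributes \<open>2 powr (k * \<pi>)\<close> by its
    height and \<open>2 powr (- (k * s / 2))\<close> by its count, so \<open>2 * \<pi> < s\<close>
    makes the ratio smaller than 1.\<close>
  define q where "q = (2 :: real) powr (\<pi> - s / 2)"
  have q: "0 < q" "q < 1"
  proof -
    show "0 < q" by (simp add: q_def)
    have "q < 2 powr 0" unfolding q_def using exponents(3) by (intro powr_less_mono) auto
    then show "q < 1" by simp
  qed
  have "(\<Sum>x\<in>ball r. U \<eta> x powr \<pi>) \<le> (\<Sum>x\<in>ball r. N powr \<pi> + (\<Sum>k<n. (2 ^ Suc k * N) powr \<pi> * lev k x))"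
    by (intro sum_mono pointwise)
  also have "\<dots> = real (card (ball r)) * N powr \<pi> + (\<Sum>k<n. (2 ^ Suc k * N) powr \<pi> * (\<Sum>x\<in>ball r. lev k x))"
    by (simp add: sum.distrib sum_distrib_left sum.swap[of _ "ball r"])
  also have "\<dots> \<le> Creg * r powr d * N powr \<pi> + (\<Sum>k<n. 2 powr \<pi> * K1 * r powr d * N powr \<pi> * q ^ k)"
  proof (intro add_mono mult_right_mono sum_mono volume(2)[OF r])
    fix k
    have pw: "(2 ^ Suc k * N) powr \<pi> = 2 powr \<pi> * 2 powr (real k * \<pi>) * N powr \<pi>"
    proof -
      have "(2 ^ Suc k * N) powr \<pi> = ((2 powr 1 * 2 powr (real k)) * N) powr \<pi>"
        by (simp add: powr_realpow)
      then show ?thesis using N by (simp only: powr_mult powr_powr) simp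
    qed
    have "(\<Sum>x\<in>ball r. lev k x) = real (card {x \<in> ball r. 2 ^ k * N \<le> U \<eta> x})"
      using finite_ball by (simp add: lev_def sum.If_cases Int_def)
    also have "\<dots> \<le> K1 * r powr d * (N / (2 ^ k * N)) powr (s / 2)"
      unfolding N_def using N r1 parameters by (intro level_count[OF A \<eta> r]) (simp add: N_def)
    also have "N / (2 ^ k * N) = 2 powr (- real k)"
      using N by (simp add: powr_minus powr_realpow divide_simps)
    finally have "(2 ^ Suc k * N) powr \<pi> * (\<Sum>x\<in>ball r. lev k x)
        \<le> (2 ^ Suc k * N) powr \<pi> * (K1 * r powr d * (2 powr (- real k)) powr (s / 2))"
      by (intro mult_left_mono) auto
    also have "\<dots>
        = 2 powr \<pi> * K1 * r powr d * N powr \<pi> * (2 powr (real k * \<pi>) * 2 powr (- (real k * (s / 2))))"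
      unfolding pw by (simp add: powr_powr mult_ac)
    also have "2 powr (real k * \<pi>) * 2 powr (- (real k * (s / 2))) = q ^ k"
    proof -
      have "q ^ k = q powr (real k)" using q by (simp add: powr_realpow)
      also have "\<dots> = 2 powr (real k * \<pi> + - (real k * (s / 2)))"
        by (simp add: q_def powr_powr algebra_simps)
      finally show ?thesis by (simp only: powr_add)
    qed
    finally show "(2 ^ Suc k * N) powr \<pi> * (\<Sum>x\<in>ball r. lev k x) \<le> 2 powr \<pi> * K1 * r powr d * N powr \<pi> * q ^ k" .
  qed simp
  also have "(\<Sum>k<n. 2 powr \<pi> * K1 * r powr d * N powr \<pi> * q ^ k) = 2 powr \<pi> * K1 * r powr d * N powr \<pi> * (\<Sum>k<n. q ^ k)"
    by (simp only: sum_distrib_left)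
  also have "(\<Sum>k<n. q ^ k) \<le> 1 / (1 - q)"
    using q by (simp add: sum_gp_strict divide_right_mono)
  finally have "(\<Sum>x\<in>ball r. U \<eta> x powr \<pi>)
      \<le> Creg * r powr d * N powr \<pi> + 2 powr \<pi> * K1 * r powr d * N powr \<pi> * (1 / (1 - q))"
    using K1_pos by (simp add: mult_left_mono)
  also have "\<dots> = K2 * r powr d * N powr \<pi>" by (simp add: K2_def q_def algebra_simps)
  finally show ?thesis by (simp add: N_def)
qed

text \<open>In Hoelder's inequality the powers of the volume add up to \<open>r powr d\<close>,
  which cancels against the decay \<open>r powr (2 - d)\<close> and leaves the square of the
  radius.\<close>

lemma \<kappa>_resolvent_sum:
  assumes A: "killed W \<theta> A orig" and \<eta>: "0 < \<eta>" and r: "r0 \<le> r"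
  shows "(\<Sum>x\<in>ball r. \<kappa> x * killed.U W \<theta> A orig \<eta> x) \<le> K4 * M\<^sup>2 * r\<^sup>2"
proof -
  interpret killed W \<theta> A orig by (rule A)
  have r1: "0 < r" using r parameters by auto
  have M: "0 < M" using parameters by simp
  have "(\<Sum>x\<in>ball r. \<kappa> x * U \<eta> x)
      \<le> M * real (card (ball r)) powr P * (\<Sum>x\<in>ball r. U \<eta> x powr \<pi>) powr (1 - P)"
    by (rule \<kappa>_sum[OF r U_nonneg[OF \<eta>]])
  also have "\<dots> \<le> M * (Creg * r powr d) powr P * (K2 * r powr d * (r powr (2 - d) * M) powr \<pi>) powr (1 - P)"
    using parameters volume(2)[OF r] resolvent_power_sum[OF A \<eta> r]
    by (intro mult_mono mult_left_mono powr_mono2 sum_nonneg) auto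
  also have "(K2 * r powr d * (r powr (2 - d) * M) powr \<pi>) powr (1 - P)
      = K2 powr (1 - P) * r powr (d * (1 - P)) * (r powr (2 - d) * M)"
  proof -
    have "\<pi> * (1 - P) = 1" using parameters by (simp add: \<pi>_def)
    then have "(K2 * r powr d * X powr \<pi>) powr (1 - P) = K2 powr (1 - P) * r powr (d * (1 - P)) * X"
      if "0 < X" for X
      using K2_pos that by (simp add: powr_mult powr_powr)
    moreover have "0 < r powr (2 - d) * M" using M r1 by simp
    ultimately show ?thesis by blast
  qed
  also have "(Creg * r powr d) powr P = Creg powr P * r powr (d * P)"
    using Creg_pos by (simp add: powr_mult powr_powr)
  also have "M * (Creg powr P * r powr (d * P)) * (K2 powr (1 - P) * r powr (d * (1 - P)) * (r powr (2 - d) * M))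
      = K4 * M\<^sup>2 * (r powr (d * P) * r powr (d * (1 - P)) * r powr (2 - d))"
    by (simp add: K4_def power2_eq_square mult_ac)
  also have "r powr (d * P) * r powr (d * (1 - P)) * r powr (2 - d) = r powr 2"
    by (simp add: powr_add[symmetric] algebra_simps)
  also have "r powr 2 = r\<^sup>2" using r1 by (simp add: powr_numeral)
  finally show ?thesis .
qed

text \<open>The level set at height \<open>U \<eta> orig\<close> contains the origin, so its count
  is at least 1. Solving the weak type bound at the smallest admissible radius for the height gives
  a bound independent of \<open>A\<close> and \<open>\<eta>\<close>.\<close>

lemma resolvent_orig_le:
  assumes A: "killed W \<theta> A orig" and \<eta>: "0 < \<eta>"
  shows "killed.U W \<theta> A orig \<eta> orig \<le> K3 * M * r0 ^ 4"
proof -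
  interpret killed W \<theta> A orig by (rule A)
  define h where "h = U \<eta> orig"
  have s: "0 < s" using exponents by simp
  have r0: "1 \<le> r0" and M: "1 \<le> M" using parameters by auto
  show ?thesis
  proof (cases "h = 0")
    case True
    then show ?thesis using r0 M by (simp add: h_def K3_def)
  next
    case False
    then have h: "0 < h" using U_nonneg[OF \<eta>, of orig] by (simp add: h_def)
    have "orig \<in> {x \<in> ball r0. h \<le> U \<eta> x}" using r0 by (simp add: len_orig h_def)
    then have "1 \<le> card {x \<in> ball r0. h \<le> U \<eta> x}"
      using finite_ball by (simp add: Suc_le_eq card_gt_0_iff) blast
    then have "1 \<le> K1 * r0 powr d * (r0 powr (2 - d) * M / h) powr (s / 2)"
      using level_count[OF A \<eta> order_refl h] by linarith
    then have "h powr (s / 2) \<le> K1 * r0 powr d * (r0 powr (2 - d) * M) powr (s / 2)"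
      using h M by (simp add: powr_divide divide_simps)
    then have "(h powr (s / 2)) powr (2 / s) \<le> (K1 * r0 powr d * (r0 powr (2 - d) * M) powr (s / 2)) powr (2 / s)"
      using s by (intro powr_mono2) auto
    also have "(h powr (s / 2)) powr (2 / s) = h" using h s by (simp add: powr_powr)
    also have "(K1 * r0 powr d * (r0 powr (2 - d) * M) powr (s / 2)) powr (2 / s)
        = K3 * M * (r0 powr (d * (2 / s)) * r0 powr (2 - d))"
    proof -
      have "(K1 * r0 powr d * X powr (s / 2)) powr (2 / s) = K1 powr (2 / s) * r0 powr (d * (2 / s)) * X"
        if "0 < X" for X
        using K1_pos s that by (simp add: powr_mult powr_powr)
      moreover have "0 < r0 powr (2 - d) * M" using M r0 by simp
      ultimately have "(K1 * r0 powr d * (r0 powr (2 - d) * M) powr (s / 2)) powr (2 / s)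
        = K1 powr (2 / s) * r0 powr (d * (2 / s)) * (r0 powr (2 - d) * M)" by blast
      then show ?thesis by (simp only: K3_def mult_ac)
    qed
    also have "r0 powr (d * (2 / s)) * r0 powr (2 - d) = r0 powr (2 * (d / s) + 2 - d)"
      by (simp add: powr_add[symmetric] algebra_simps)
    \<comment> \<open>The exponent equals \<open>2 - 2 * d / d' + d * Q\<close>, and
      \<open>d * Q \<le> 2\<close>; only a fixed power of \<open>r0\<close> is wanted here.\<close>
    also have "\<dots> \<le> r0 powr 4"
    proof (rule powr_mono)
      have "d * Q \<le> 2"
      proof -
        have "d * Q \<le> d' * (2 / d')" using parameters by (intro mult_mono) auto
        then show ?thesis using exponents by simp
      qed
      moreover have "0 \<le> d / d'" using exponents by simp
      ultimately show "2 * (d / s) + 2 - d \<le> 4" using exponents(5) by argo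
    qed (use r0 in auto)
    also have "r0 powr 4 = r0 ^ 4" using r0 by (simp add: powr_numeral)
    finally have "h \<le> K3 * M * r0 ^ 4" using M by (simp add: K3_def mult_left_mono)
    then show ?thesis by (simp add: h_def)
  qed
qed

section \<open>The recursion for the energy of the cutoff\<close>

text \<open>\<open>\<omega>\<close> measures the gap in \<open>2 * \<pi> < s\<close>;
  \<open>\<tau>\<close> is the power with which one step of the recursion passes on the previous
  energy. The first summand \<open>L\<close> of \<open>\<Lambda>\<close> solves
  \<open>K5 * M powr (3 - \<tau>) * L powr \<tau> = L / 2\<close>, which fixes \<open>K7\<close> and
  the power \<open>3 + 2 / \<omega>\<close>; the second pays for long jumps and for the start at
  radius \<open>r0\<close>.\<close>

definition "\<omega> = 1 - 2 * \<pi> / s"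
definition "\<tau> = 1 / (1 + \<omega>)"
text \<open>\<open>4 powr (d - 2)\<close> comes from rescaling between the radii \<open>r\<close>
  and \<open>4 * r\<close>, and 10 from the ball of radius \<open>10 * r\<close> that contains the
  nearby pairs separated by the cutoff.\<close>

definition "K5 = 4 powr (d - 2) * ((Creg * 10 powr d) powr P * ((K1 + K2) * 10 powr d) powr (1 - P))"
text \<open>128 is twice the square of 8: the sum for distant pairs extends over the ball of radius
  \<open>8 * r\<close>, and only half of \<open>\<Lambda>\<close> is allotted to them.\<close>

definition "K6 = 128 * 4 powr (d - 2) * K4 * K3"
definition "K7 = (2 * K5) powr (1 / (1 - \<tau>))"
definition "\<Lambda> = K7 * M powr (3 + 2 / \<omega>) + K6 * M ^ 3 * r0 powr (d + 4)"

definition cut :: "real \<Rightarrow> 'v \<Rightarrow> real" where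
  "cut r x = min 1 (max 0 ((len x - r) / r))"

lemma \<omega>_bounds: "0 < \<omega>" "\<omega> < 1"
  using exponents by (auto simp: \<omega>_def divide_simps)

lemma \<tau>_bounds: "0 < \<tau>" "\<tau> < 1"
  using \<omega>_bounds by (auto simp: \<tau>_def)

lemma cut_bounds: "0 \<le> cut r x" "cut r x \<le> 1"
  by (simp_all add: cut_def)

lemma cut_0: "0 < r \<Longrightarrow> len x \<le> r \<Longrightarrow> cut r x = 0"
  by (simp add: cut_def divide_nonpos_pos)

lemma cut_1: "0 < r \<Longrightarrow> 2 * r \<le> len x \<Longrightarrow> cut r x = 1"
  by (simp add: cut_def le_divide_eq min_def max_def)

lemma cut_lipschitz:
  assumes "0 < r"
  shows "\<bar>cut r x - cut r y\<bar> \<le> dst x y / r"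
proof -
  have "\<bar>cut r x - cut r y\<bar> \<le> \<bar>(len x - r) / r - (len y - r) / r\<bar>"
    unfolding cut_def by linarith
  also have "\<dots> = \<bar>len x - len y\<bar> / r" using assms by (simp add: diff_divide_distrib[symmetric])
  also have "\<dots> \<le> dst x y / r" using assms len_dst by (intro divide_right_mono) auto
  finally show ?thesis .
qed

lemma K_nonneg: "0 \<le> K3" "0 \<le> K4" "0 \<le> K6" "0 < K5" "0 < K7"
proof -
  show "0 \<le> K3" "0 \<le> K4" by (simp_all add: K3_def K4_def)
  then show "0 \<le> K6" by (simp add: K6_def)
  show "0 < K5" using K1_pos K2_pos Creg_pos by (simp add: K5_def)
  then show "0 < K7" by (simp add: K7_def)
qed

text \<open>By symmetry the terms \<open>F x\<close> and \<open>F y\<close> contribute equally,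
  which cancels the factor \<open>1 / 2\<close>, and the sum over the other point of the pair is at
  most the moment \<open>\<kappa> x\<close>.\<close>

lemma pair_sum_bound:
  assumes A: "finite A" and F: "\<And>x. 0 \<le> F x"
    and G: "\<And>x y. x \<in> A \<Longrightarrow> y \<in> A \<Longrightarrow> x \<noteq> y \<Longrightarrow> G x y \<le> W x y * dst x y powr m * (F x + F y)"
    and G0: "\<And>x. G x x = 0"
  shows "1 / 2 * (\<Sum>x\<in>A. \<Sum>y\<in>A. G x y) \<le> (\<Sum>x\<in>A. \<kappa> x * F x)"
proof -
  define V where "V = (\<lambda>x y. W x y * dst x y powr m)"
  have V: "V x y = V y x" for x y by (simp add: V_def W_sym[of x y] dst_sym[of x y])
  have "(\<Sum>x\<in>A. \<Sum>y\<in>A. G x y) \<le> (\<Sum>x\<in>A. \<Sum>y\<in>A. V x y * (F x + F y))"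
  proof (intro sum_mono)
    fix x y assume "x \<in> A" "y \<in> A"
    then show "G x y \<le> V x y * (F x + F y)"
      using G[of x y] G0[of x] F W_nonneg[of x y] by (cases "x = y") (auto simp: V_def)
  qed
  also have "\<dots> = (\<Sum>x\<in>A. \<Sum>y\<in>A. V x y * F x) + (\<Sum>x\<in>A. \<Sum>y\<in>A. V x y * F y)"
    by (simp add: distrib_left sum.distrib)
  also have "(\<Sum>x\<in>A. \<Sum>y\<in>A. V x y * F y) = (\<Sum>x\<in>A. \<Sum>y\<in>A. V x y * F x)"
    by (subst sum.swap) (simp add: V)
  also have "(\<Sum>x\<in>A. \<Sum>y\<in>A. V x y * F x) \<le> (\<Sum>x\<in>A. \<kappa> x * F x)"
  proof (rule sum_mono)
    fix x
    have "(\<Sum>y\<in>A. V x y * F x) = (\<Sum>y\<in>A. V x y) * F x" by (simp add: sum_distrib_right)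
    also have "\<dots> \<le> \<kappa> x * F x" unfolding V_def using moment[OF A] F by (intro mult_right_mono) auto
    finally show "(\<Sum>y\<in>A. V x y * F x) \<le> \<kappa> x * F x" .
  qed
  finally show ?thesis by simp
qed

lemma sum_restrict_le:
  fixes f :: "'v \<Rightarrow> real"
  assumes "finite A" "\<And>x. 0 \<le> f x"
  shows "(\<Sum>x\<in>A. if len x \<le> r then f x else 0) \<le> (\<Sum>x\<in>ball r. f x)"
proof -
  have "(\<Sum>x\<in>A. if len x \<le> r then f x else 0) = (\<Sum>x\<in>A \<inter> ball r. f x)"
    using assms(1) by (simp add: sum.If_cases Int_def)
  also have "\<dots> \<le> (\<Sum>x\<in>ball r. f x)" using assms finite_ball by (intro sum_mono2) auto
  finally show ?thesis .
qed

lemma one_le_dst_powr: "x \<noteq> y \<Longrightarrow> 1 \<le> dst x y powr m"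
  using dst_ge_1[of x y] parameters by (intro ge_one_powr_ge_zero) auto

lemma cut_diff_sq_le_1: "(cut r y - cut r x)\<^sup>2 \<le> 1"
  using cut_bounds[of r x] cut_bounds[of r y] by (simp add: abs_square_le_1)

text \<open>Start of the recursion. The cutoff separates only pairs with a point in
  \<open>ball (2 * r)\<close>; the resolvent at the other point is estimated by its maximum
  \<open>U \<eta> orig\<close>, and the increment of the cutoff by 1.\<close>

lemma cut_energy_base:
  assumes A: "killed W \<theta> A orig" and \<eta>: "0 < \<eta>" and r: "0 < r"
  shows "killed.cut_energy W \<theta> A orig \<eta> (cut r)
    \<le> killed.U W \<theta> A orig \<eta> orig * (\<Sum>x\<in>ball (2 * r). \<kappa> x * killed.U W \<theta> A orig \<eta> x)"
proof -
  interpret killed W \<theta> A orig by (rule A)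
  define H where "H = U \<eta> orig"
  have U: "0 \<le> U \<eta> x" "U \<eta> x \<le> H" for x using U_nonneg[OF \<eta>] U_max[OF \<eta>] by (auto simp: H_def)
  have H: "0 \<le> H" using U[of orig] by simp
  define F where "F = (\<lambda>x. if len x \<le> 2 * r then H * U \<eta> x else 0)"
  have F0: "0 \<le> F x" for x using U H by (simp add: F_def)
  have "cut_energy \<eta> (cut r) \<le> (\<Sum>x\<in>A. \<kappa> x * F x)"
    unfolding cut_energy_def
  proof (rule pair_sum_bound[OF finite_A F0])
    fix x y :: 'v assume ne: "x \<noteq> y"
    have "(cut r y - cut r x)\<^sup>2 * (U \<eta> x * U \<eta> y) \<le> F x + F y"
    proof (cases "2 * r < len x \<and> 2 * r < len y")
      case True
      then show ?thesis using cut_1[OF r, of x] cut_1[OF r, of y] F0[of x] F0[of y] by simp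
    next
      case False
      have "(cut r y - cut r x)\<^sup>2 * (U \<eta> x * U \<eta> y) \<le> 1 * (U \<eta> x * U \<eta> y)"
        using U cut_diff_sq_le_1 by (intro mult_right_mono) auto
      also have "\<dots> \<le> F x + F y"
      proof (cases "len x \<le> 2 * r")
        case True
        then show ?thesis using mult_left_mono[OF U(2)[of y] U(1)[of x]] F0[of y] by (simp add: F_def mult.commute)
      next
        case False
        then have "len y \<le> 2 * r" using \<open>\<not> (2 * r < len x \<and> 2 * r < len y)\<close> by simp
        then show ?thesis using mult_right_mono[OF U(2)[of x] U(1)[of y]] F0[of x] by (simp add: F_def)
      qed
      finally show ?thesis .
    qed
    also have "F x + F y \<le> dst x y powr m * (F x + F y)"
      using one_le_dst_powr[OF ne] F0[of x] F0[of y] mult_right_mono[of 1 "dst x y powr m" "F x + F y"] by simp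
    finally show "W x y * (cut r y - cut r x)\<^sup>2 * (U \<eta> x * U \<eta> y) \<le> W x y * dst x y powr m * (F x + F y)"
      using W_nonneg[of x y] by (simp add: mult.assoc mult_left_mono)
  qed simp
  also have "\<dots> = (\<Sum>x\<in>A. if len x \<le> 2 * r then H * (\<kappa> x * U \<eta> x) else 0)"
    by (intro sum.cong) (auto simp: F_def)
  also have "\<dots> \<le> (\<Sum>x\<in>ball (2 * r). H * (\<kappa> x * U \<eta> x))"
    using finite_A H U \<kappa>_nonneg by (intro sum_restrict_le) auto
  finally show ?thesis by (simp add: sum_distrib_left H_def)
qed

text \<open>Pairs at distance at most \<open>2r\<close> see the Lipschitz constant of the cutoff and only involve
  points where \<open>cut r\<close> equals 1; the others are controlled by the moment \<open>\<kappa>\<close>.\<close>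

lemma cut_energy_step:
  assumes A: "killed W \<theta> A orig" and \<eta>: "0 < \<eta>" and r: "1 \<le> r"
  shows "killed.cut_energy W \<theta> A orig \<eta> (cut (4 * r))
    \<le> (1 / r\<^sup>2) * (\<Sum>x\<in>ball (10 * r). \<kappa> x * (cut r x * killed.U W \<theta> A orig \<eta> x)\<^sup>2)
      + r powr (- m) * killed.U W \<theta> A orig \<eta> orig * (\<Sum>x\<in>ball (8 * r). \<kappa> x * killed.U W \<theta> A orig \<eta> x)"
proof -
  interpret killed W \<theta> A orig by (rule A)
  define H where "H = U \<eta> orig"
  have U: "0 \<le> U \<eta> x" "U \<eta> x \<le> H" for x using U_nonneg[OF \<eta>] U_max[OF \<eta>] by (auto simp: H_def)
  have H: "0 \<le> H" using U[of orig] by simp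
  have r': "0 < r" "0 < 4 * r" using r by auto
  define z where "z = cut (4 * r)"
  \<comment> \<open>Origin of the radii: a pair separated by \<open>cut (4 * r)\<close> has a point
    beyond \<open>4 * r\<close> and a point within \<open>8 * r\<close>, so at mutual distance at
    most \<open>2 * r\<close> both points lie between \<open>2 * r\<close> and
    \<open>10 * r\<close>.\<close>
  define G where "G = (\<lambda>x. if len x \<le> 10 * r then (1 / r\<^sup>2) * (cut r x * U \<eta> x)\<^sup>2 else 0)"
  define F where "F = (\<lambda>x. if len x \<le> 8 * r then r powr (- m) * H * U \<eta> x else 0)"
  have FG: "0 \<le> F x" "0 \<le> G x" for x using U H by (auto simp: F_def G_def)
  have "cut_energy \<eta> (cut (4 * r)) \<le> (\<Sum>x\<in>A. \<kappa> x * (G x + F x))"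
    unfolding cut_energy_def z_def[symmetric]
  proof (rule pair_sum_bound[OF finite_A])
    show "0 \<le> G x + F x" for x using FG[of x] by simp
    fix x y :: 'v assume ne: "x \<noteq> y"
    define D where "D = dst x y powr m"
    have D1: "1 \<le> D" unfolding D_def by (rule one_le_dst_powr[OF ne])
    have "(z y - z x)\<^sup>2 * (U \<eta> x * U \<eta> y) \<le> D * ((G x + F x) + (G y + F y))"
    proof (cases "z x = z y")
      case True
      then show ?thesis using D1 FG[of x] FG[of y] by simp
    next
      case False
      have big: "4 * r < len x \<or> 4 * r < len y"
      proof (rule ccontr)
        assume "\<not> ?thesis"
        then have "z x = 0" "z y = 0" unfolding z_def using cut_0[OF r'(2)] by auto
        then show False using False by simp
      qed
      have small: "len x < 8 * r \<or> len y < 8 * r"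
      proof (rule ccontr)
        assume "\<not> ?thesis"
        then have "z x = 1" "z y = 1" unfolding z_def using cut_1[OF r'(2)] by auto
        then show False using False by simp
      qed
      show ?thesis
      proof (cases "dst x y \<le> 2 * r")
        case True
        have lens: "2 * r \<le> len x" "2 * r \<le> len y" "len x \<le> 10 * r" "len y \<le> 10 * r"
          using big small True len_dst[of x y] by (auto simp: abs_le_iff)
        have Gx: "G x = (1 / r\<^sup>2) * (U \<eta> x)\<^sup>2" "G y = (1 / r\<^sup>2) * (U \<eta> y)\<^sup>2"
          using lens cut_1[OF r'(1)] by (simp_all add: G_def)
        have "\<bar>z y - z x\<bar> \<le> dst x y / r"
        proof -
          have "\<bar>z y - z x\<bar> \<le> dst x y / (4 * r)"
            unfolding z_def using cut_lipschitz[OF r'(2), of y x] by (simp add: dst_sym[of x y])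
          also have "\<dots> \<le> dst x y / r" using r' dst_ge_1[OF ne] by (intro divide_left_mono) auto
          finally show ?thesis .
        qed
        then have "\<bar>z y - z x\<bar>\<^sup>2 \<le> (dst x y / r)\<^sup>2" by (intro power_mono) auto
        then have "(z y - z x)\<^sup>2 \<le> (dst x y)\<^sup>2 / r\<^sup>2" by (simp add: power_divide)
        also have "\<dots> \<le> D / r\<^sup>2"
        proof (rule divide_right_mono)
          have "(dst x y)\<^sup>2 = dst x y powr 2" using dst_ge_1[OF ne] by (simp add: powr_numeral)
          also have "\<dots> \<le> D" unfolding D_def using dst_ge_1[OF ne] parameters by (intro powr_mono) auto
          finally show "(dst x y)\<^sup>2 \<le> D" .
        qed simp
        finally have "(z y - z x)\<^sup>2 * (U \<eta> x * U \<eta> y) \<le> D / r\<^sup>2 * (U \<eta> x * U \<eta> y)"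
          using U by (intro mult_right_mono) auto
        also have "\<dots> \<le> D / r\<^sup>2 * ((U \<eta> x)\<^sup>2 + (U \<eta> y)\<^sup>2)"
          using sum_squares_bound[of "U \<eta> x" "U \<eta> y"] mult_nonneg_nonneg[OF U(1)[of x] U(1)[of y]] D1
          by (intro mult_left_mono) auto
        also have "\<dots> = D * (G x + G y)" by (simp add: Gx algebra_simps)
        also have "\<dots> \<le> D * ((G x + F x) + (G y + F y))"
          using D1 FG[of x] FG[of y] by (intro mult_left_mono) auto
        finally show ?thesis .
      next
        case far: False
        have Dr: "1 \<le> D * r powr (- m)"
        proof -
          have "1 \<le> (dst x y / r) powr m"
            using far r' parameters by (intro ge_one_powr_ge_zero) auto
          also have "\<dots> = D * r powr (- m)"
            using r' dst_ge_1[OF ne] by (subst powr_divide) (auto simp: D_def powr_minus divide_inverse)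
          finally show ?thesis .
        qed
        have "(z y - z x)\<^sup>2 * (U \<eta> x * U \<eta> y) \<le> 1 * (U \<eta> x * U \<eta> y)"
          unfolding z_def using U cut_diff_sq_le_1 by (intro mult_right_mono) auto
        also have "\<dots> \<le> (D * r powr (- m)) * (U \<eta> x * U \<eta> y)"
          using Dr U by (intro mult_right_mono) auto
        also have "\<dots> \<le> D * (F x + F y)"
        proof -
          have "r powr (- m) * (U \<eta> x * U \<eta> y) \<le> F x + F y"
          proof (cases "len x \<le> 8 * r")
            case True
            then show ?thesis
              using mult_left_mono[OF mult_left_mono[OF U(2)[of y] U(1)[of x]], of "r powr (- m)"] FG(1)[of y]
              by (simp add: F_def mult_ac)
          next
            case False
            then have "len y \<le> 8 * r" using small by simp
            then show ?thesis
              using mult_left_mono[OF mult_right_mono[OF U(2)[of x] U(1)[of y]], of "r powr (- m)"] FG(1)[of x]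
              by (simp add: F_def mult_ac)
          qed
          then show ?thesis using D1 by (simp add: mult.assoc mult_left_mono)
        qed
        also have "\<dots> \<le> D * ((G x + F x) + (G y + F y))"
          using D1 FG[of x] FG[of y] by (intro mult_left_mono) auto
        finally show ?thesis .
      qed
    qed
    then show "W x y * (z y - z x)\<^sup>2 * (U \<eta> x * U \<eta> y) \<le> W x y * dst x y powr m * (G x + F x + (G y + F y))"
      using W_nonneg[of x y] by (simp add: D_def mult.assoc mult_left_mono)
  qed simp
  also have "\<dots> = (\<Sum>x\<in>A. if len x \<le> 10 * r then (1 / r\<^sup>2) * (\<kappa> x * (cut r x * U \<eta> x)\<^sup>2) else 0)
      + (\<Sum>x\<in>A. if len x \<le> 8 * r then r powr (- m) * H * (\<kappa> x * U \<eta> x) else 0)"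
    unfolding sum.distrib[symmetric] by (intro sum.cong) (auto simp: F_def G_def distrib_left)
  also have "\<dots> \<le> (\<Sum>x\<in>ball (10 * r). (1 / r\<^sup>2) * (\<kappa> x * (cut r x * U \<eta> x)\<^sup>2))
      + (\<Sum>x\<in>ball (8 * r). r powr (- m) * H * (\<kappa> x * U \<eta> x))"
    using finite_A H U \<kappa>_nonneg by (intro add_mono sum_restrict_le) auto
  finally show ?thesis by (simp add: sum_distrib_left H_def)
qed

text \<open>Interpolates the norm of exponent \<open>2 * \<pi>\<close> of the cut off resolvent
  between exponent \<open>\<pi>\<close>, bounded by the level sums, and exponent \<open>s\<close>,
  bounded by the Sobolev inequality. The energy enters through the latter only, hence with a power
  \<open>\<tau>\<close> below 1.\<close>

lemma near_sum:
  assumes A: "killed W \<theta> A orig" and \<eta>: "0 < \<eta>" and r: "r0 \<le> r"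
  defines "J \<equiv> r powr (d - 2) * killed.cut_energy W \<theta> A orig \<eta> (cut r)"
  shows "(\<Sum>x\<in>ball (10 * r). \<kappa> x * (cut r x * killed.U W \<theta> A orig \<eta> x)\<^sup>2)
    \<le> (Creg * 10 powr d) powr P * ((K1 + K2) * 10 powr d) powr (1 - P) * M powr (3 - \<tau>) * J powr \<tau> * r powr (4 - d)"
proof -
  interpret killed W \<theta> A orig by (rule A)
  have r1: "0 < r" and r10: "r0 \<le> 10 * r" using r parameters by auto
  have M: "0 < M" using parameters by simp
  define Y where "Y = (\<lambda>x. cut r x * U \<eta> x)"
  have Y: "0 \<le> Y x" "Y x \<le> U \<eta> x" for x
    using cut_bounds[of r x] U_nonneg[OF \<eta>, of x] by (auto simp: Y_def mult_left_le_one_le)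
  define I where "I = cut_energy \<eta> (cut r)"
  have cut_orig: "cut r orig = 0" using r1 by (simp add: cut_0 len_orig)
  have en: "energy W Y \<le> I"
  proof -
    have "0 \<le> \<eta> * (\<Sum>x\<in>A. \<theta> x * (cut r x * U \<eta> x)\<^sup>2)"
      using \<eta> \<theta>_pos by (intro mult_nonneg_nonneg sum_nonneg) (auto simp: less_imp_le)
    then show ?thesis using energy_cut[where \<zeta> = "cut r", OF \<eta> cut_orig] by (simp add: Y_def I_def)
  qed
  have I0: "0 \<le> I" using en energy_nonneg[of Y] by simp
  define N where "N = r powr (2 - d) * M"
  have N: "0 < N" using r1 M by (simp add: N_def)
  define \<rho> where "\<rho> = 10 * r"
  have \<rho>N: "\<rho> powr (2 - d) * M \<le> N"
    unfolding N_def \<rho>_def using r1 M parameters by (intro mult_right_mono powr_mono2') auto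
  have \<rho>d: "\<rho> powr d = 10 powr d * r powr d" using r1 by (simp add: \<rho>_def powr_mult)
  define K where "K = (K1 + K2) * 10 powr d * r powr d"
  have K: "0 < K" using K1_pos K2_pos r1 by (simp add: K_def)
  have \<pi>: "1 \<le> \<pi>" "2 * \<pi> < s" "\<pi> < s" "0 < s" using exponents by auto
  have fY: "fin_supp Y"
    using U_fin_supp[of \<eta>] unfolding fin_supp_def by (rule rev_finite_subset) (auto simp: Y_def)
  have s1: "(\<Sum>x\<in>ball \<rho>. Y x powr \<pi>) \<le> K * N powr \<pi>"
  proof -
    have "(\<Sum>x\<in>ball \<rho>. Y x powr \<pi>) \<le> (\<Sum>x\<in>ball \<rho>. U \<eta> x powr \<pi>)"
      using Y \<pi> by (intro sum_mono powr_mono2) auto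
    also have "\<dots> \<le> K2 * \<rho> powr d * (\<rho> powr (2 - d) * M) powr \<pi>"
      unfolding \<rho>_def by (rule resolvent_power_sum[OF A \<eta> r10])
    also have "\<dots> \<le> K2 * \<rho> powr d * N powr \<pi>"
      using \<rho>N M \<pi> K2_pos by (intro mult_left_mono powr_mono2) auto
    also have "\<dots> \<le> K * N powr \<pi>"
      unfolding \<rho>d K_def using K1_pos by (intro mult_right_mono) (auto simp: algebra_simps)
    finally show ?thesis .
  qed
  have s2: "(\<Sum>x\<in>ball \<rho>. Y x powr s) \<le> K * (N * I) powr (s / 2)"
  proof -
    have "(\<Sum>x\<in>ball \<rho>. Y x powr s) = (\<Sum>x\<in>ball \<rho>. \<bar>Y x\<bar> powr s)" using Y by simp
    also have "\<dots> \<le> K1 * \<rho> powr d * (\<rho> powr (2 - d) * M * energy W Y) powr (s / 2)"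
      unfolding \<rho>_def by (rule global_sobolev[OF r10 fY])
    also have "\<dots> \<le> K1 * \<rho> powr d * (N * I) powr (s / 2)"
      using \<rho>N M \<pi> K1_pos en energy_nonneg N by (intro mult_left_mono powr_mono2 mult_mono mult_nonneg_nonneg) auto
    also have "\<dots> \<le> K * (N * I) powr (s / 2)"
      unfolding \<rho>d K_def using K2_pos by (intro mult_right_mono) (auto simp: algebra_simps)
    finally show ?thesis .
  qed
  \<comment> \<open>The weight of the exponent \<open>s\<close> in the interpolation, determined by
    \<open>\<pi> * (1 - \<tau>1) + s * \<tau>1 = 2 * \<pi>\<close>.\<close>
  define \<tau>1 where "\<tau>1 = \<pi> / (s - \<pi>)"
  have \<tau>1: "0 < \<tau>1" "\<tau>1 < 1" "\<pi> * (1 - \<tau>1) + s * \<tau>1 = 2 * \<pi>"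
  proof -
    show "0 < \<tau>1" "\<tau>1 < 1" using \<pi> by (auto simp: \<tau>1_def divide_simps)
    have "(s - \<pi>) * \<tau>1 = \<pi>" using \<pi> by (simp add: \<tau>1_def)
    then show "\<pi> * (1 - \<tau>1) + s * \<tau>1 = 2 * \<pi>" by (simp add: algebra_simps)
  qed
  \<comment> \<open>The Sobolev inequality brings the power \<open>s / 2\<close>, Hoelder's
    inequality the power \<open>1 - P = 1 / \<pi>\<close>; together with \<open>\<tau>1\<close> they
    make \<open>\<tau>\<close>.\<close>
  have \<tau>\<tau>1: "s / 2 * \<tau>1 = \<tau> * \<pi>"
  proof -
    have "1 + \<omega> = 2 * (s - \<pi>) / s" using \<pi> by (simp add: \<omega>_def field_simps)
    then have "\<tau> = s / (2 * (s - \<pi>))" by (simp add: \<tau>_def)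
    then show ?thesis by (simp add: \<tau>1_def)
  qed
  have s3: "(\<Sum>x\<in>ball \<rho>. ((Y x)\<^sup>2) powr \<pi>) \<le> K * (N powr \<pi>) powr (1 - \<tau>1) * ((N * I) powr (s / 2)) powr \<tau>1"
  proof -
    have "(\<Sum>x\<in>ball \<rho>. ((Y x)\<^sup>2) powr \<pi>) = (\<Sum>x\<in>ball \<rho>. (Y x powr s) powr \<tau>1 * (Y x powr \<pi>) powr (1 - \<tau>1))"
    proof (rule sum.cong[OF refl])
      fix x
      have "((Y x)\<^sup>2) powr \<pi> = (Y x powr 2) powr \<pi>" using Y(1)[of x] by (cases "Y x = 0") (auto simp: powr_numeral)
      also have "\<dots> = Y x powr (s * \<tau>1 + \<pi> * (1 - \<tau>1))" using \<tau>1(3) by (simp add: powr_powr add.commute)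
      finally show "((Y x)\<^sup>2) powr \<pi> = (Y x powr s) powr \<tau>1 * (Y x powr \<pi>) powr (1 - \<tau>1)"
        by (simp only: powr_powr powr_add)
    qed
    also have "\<dots> \<le> (\<Sum>x\<in>ball \<rho>. Y x powr s) powr \<tau>1 * (\<Sum>x\<in>ball \<rho>. Y x powr \<pi>) powr (1 - \<tau>1)"
      using \<tau>1 finite_ball by (intro Holder_sum) auto
    also have "\<dots> \<le> (K * (N * I) powr (s / 2)) powr \<tau>1 * (K * N powr \<pi>) powr (1 - \<tau>1)"
      using \<tau>1 s1 s2 by (intro mult_mono powr_mono2 sum_nonneg) auto
    also have "\<dots> = (K powr \<tau>1 * K powr (1 - \<tau>1)) * (N powr \<pi>) powr (1 - \<tau>1) * ((N * I) powr (s / 2)) powr \<tau>1"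
      using K by (simp add: powr_mult mult_ac)
    also have "K powr \<tau>1 * K powr (1 - \<tau>1) = K" using K by (simp add: powr_add[symmetric])
    finally show ?thesis .
  qed
  have IJ: "N * I = N powr 2 * (J / M)"
  proof -
    have "r powr (2 - d) * r powr (d - 2) = 1" using r1 by (simp add: powr_add[symmetric])
    then have "N * (N * (J / M)) = N * I"
      using M by (simp add: J_def N_def I_def field_simps)
    then show ?thesis using N by (simp add: powr_numeral power2_eq_square mult.assoc)
  qed
  have J0: "0 \<le> J" using I0 by (simp add: J_def I_def)
  have s4: "(\<Sum>x\<in>ball \<rho>. ((Y x)\<^sup>2) powr \<pi>) powr (1 - P) \<le> K powr (1 - P) * N powr 2 * (J / M) powr \<tau>"
  proof -
    have eqK: "K * (N powr \<pi>) powr (1 - \<tau>1) * ((N * I) powr (s / 2)) powr \<tau>1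
        = K * (N powr 2 * (J / M) powr \<tau>) powr \<pi>"
    proof -
      have "((N * I) powr (s / 2)) powr \<tau>1 = (N powr 2) powr (\<tau> * \<pi>) * (J / M) powr (\<tau> * \<pi>)"
      proof -
        have "0 \<le> J / M" using J0 M by simp
        then show ?thesis unfolding IJ powr_powr[of "N powr 2 * (J / M)"] \<tau>\<tau>1 by (subst powr_mult) auto
      qed
      moreover have "(N powr \<pi>) powr (1 - \<tau>1) * (N powr 2) powr (\<tau> * \<pi>) = N powr (2 * \<pi>)"
      proof -
        have "\<pi> * (1 - \<tau>1) + 2 * (\<tau> * \<pi>) = 2 * \<pi>" using \<tau>1(3) \<tau>\<tau>1 by simp
        then show ?thesis unfolding powr_powr powr_add[symmetric] by (simp only:)
      qed
      ultimately show ?thesis using J0 M by (simp add: powr_mult powr_powr mult_ac)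
    qed
    have "(\<Sum>x\<in>ball \<rho>. ((Y x)\<^sup>2) powr \<pi>) powr (1 - P) \<le> (K * (N powr 2 * (J / M) powr \<tau>) powr \<pi>) powr (1 - P)"
      using s3[unfolded eqK] parameters by (intro powr_mono2 sum_nonneg) auto
    also have "\<dots> = K powr (1 - P) * (N powr 2 * (J / M) powr \<tau>)"
    proof -
      have "\<pi> * (1 - P) = 1" using parameters by (simp add: \<pi>_def)
      then have "(K * X powr \<pi>) powr (1 - P) = K powr (1 - P) * X" if "0 \<le> X" for X
        using K that by (simp add: powr_mult powr_powr)
      moreover have "0 \<le> N powr 2 * (J / M) powr \<tau>" by simp
      ultimately show ?thesis by blast
    qed
    finally show ?thesis by (simp add: mult.assoc)
  qed
  have "(\<Sum>x\<in>ball \<rho>. \<kappa> x * (Y x)\<^sup>2)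
      \<le> M * real (card (ball \<rho>)) powr P * (\<Sum>x\<in>ball \<rho>. ((Y x)\<^sup>2) powr \<pi>) powr (1 - P)"
    unfolding \<rho>_def by (rule \<kappa>_sum[OF r10]) simp
  also have "\<dots> \<le> M * (Creg * \<rho> powr d) powr P * (K powr (1 - P) * N powr 2 * (J / M) powr \<tau>)"
    using parameters volume(2)[OF r10] s4 by (intro mult_mono mult_left_mono powr_mono2) (auto simp: \<rho>_def)
  also have "(Creg * \<rho> powr d) powr P = (Creg * 10 powr d) powr P * r powr (d * P)"
    unfolding \<rho>d using Creg_pos by (simp add: mult.assoc[symmetric] powr_mult powr_powr)
  also have "K powr (1 - P) = ((K1 + K2) * 10 powr d) powr (1 - P) * r powr (d * (1 - P))"
    unfolding K_def using K1_pos K2_pos by (simp add: powr_mult powr_powr)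
  also have "N powr 2 = r powr (4 - 2 * d) * M powr 2"
    unfolding N_def using M by (simp add: powr_mult powr_powr algebra_simps)
  also have "(J / M) powr \<tau> = J powr \<tau> * M powr (- \<tau>)"
    using J0 M by (subst powr_divide) (auto simp: powr_minus divide_inverse)
  also have "M * ((Creg * 10 powr d) powr P * r powr (d * P)) * (((K1 + K2) * 10 powr d) powr (1 - P) * r powr (d * (1 - P))
      * (r powr (4 - 2 * d) * M powr 2) * (J powr \<tau> * M powr (- \<tau>)))
      = (Creg * 10 powr d) powr P * ((K1 + K2) * 10 powr d) powr (1 - P) * (M * M powr 2 * M powr (- \<tau>)) * J powr \<tau>
        * (r powr (d * P) * r powr (d * (1 - P)) * r powr (4 - 2 * d))"
    by (simp only: mult_ac)
  also have "r powr (d * P) * r powr (d * (1 - P)) * r powr (4 - 2 * d) = r powr (4 - d)"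
    by (simp add: powr_add[symmetric] algebra_simps)
  also have "M * M powr 2 * M powr (- \<tau>) = M powr (3 - \<tau>)"
  proof -
    have "M powr 1 * M powr 2 * M powr (- \<tau>) = M powr (3 - \<tau>)" by (simp only: powr_add[symmetric]) simp
    then show ?thesis using M by simp
  qed
  finally show ?thesis by (simp add: Y_def \<rho>_def)
qed

text \<open>\<open>L\<close> solves the equation exactly; as \<open>\<tau> < 1\<close>, the larger
  number \<open>\<Lambda>\<close> satisfies the inequality.\<close>

lemma fixed_point: "K5 * M powr (3 - \<tau>) * \<Lambda> powr \<tau> \<le> \<Lambda> / 2"
proof -
  have M: "0 < M" using parameters by simp
  define L where "L = K7 * M powr (3 + 2 / \<omega>)"
  have L: "0 < L" "L \<le> \<Lambda>" using K_nonneg M parameters by (auto simp: L_def \<Lambda>_def)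
  have e: "(3 + 2 / \<omega>) * (1 - \<tau>) = 3 - \<tau>"
  proof -
    have "\<tau> * (1 + \<omega>) = 1" using \<omega>_bounds by (simp add: \<tau>_def)
    then have 1: "1 - \<tau> = \<omega> * \<tau>" by (simp add: algebra_simps)
    have "(3 + 2 / \<omega>) * (\<omega> * \<tau>) = 3 * (\<omega> * \<tau>) + 2 * \<tau>"
      using \<omega>_bounds by (simp add: distrib_right)
    then show ?thesis unfolding 1 using 1 by simp
  qed
  have "L powr (1 - \<tau>) = 2 * K5 * M powr (3 - \<tau>)"
    using K_nonneg(4) M \<tau>_bounds e by (simp add: L_def K7_def powr_mult powr_powr)
  then have "2 * K5 * M powr (3 - \<tau>) * \<Lambda> powr \<tau> = L powr (1 - \<tau>) * \<Lambda> powr \<tau>" by simp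
  also have "\<dots> \<le> \<Lambda> powr (1 - \<tau>) * \<Lambda> powr \<tau>"
    using L \<tau>_bounds by (intro mult_right_mono powr_mono2) auto
  also have "\<dots> = \<Lambda>" using L by (simp add: powr_add[symmetric])
  finally show ?thesis by simp
qed

text \<open>In each step nearby pairs use at most half of \<open>\<Lambda>\<close>, by
  \<open>fixed_point\<close>, and distant pairs the other half. The bound is uniform in
  \<open>A\<close> and \<open>\<eta>\<close>, as the exhaustion and the later choice of
  \<open>\<eta>\<close> require.\<close>

lemma cut_energy_decay:
  assumes A: "killed W \<theta> A orig" and \<eta>: "0 < \<eta>"
  shows "killed.cut_energy W \<theta> A orig \<eta> (cut (4 ^ k * r0)) \<le> \<Lambda> * (4 ^ k * r0) powr (2 - d)"
proof -
  interpret killed W \<theta> A orig by (rule A)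
  have M: "1 \<le> M" and r0: "1 \<le> r0" using parameters by auto
  have d: "2 \<le> d" using parameters by simp
  define J where "J = (\<lambda>r. r powr (d - 2) * cut_energy \<eta> (cut r))"
  have U0: "0 \<le> U \<eta> orig" by (rule U_nonneg[OF \<eta>])
  have F: "0 \<le> K6 * M ^ 3 * r0 powr (d + 4)" using K_nonneg M by simp
  have M3: "M * M\<^sup>2 = M ^ 3" by (simp add: power2_eq_square power3_eq_cube)
  have four: "(1 :: real) \<le> 4 powr (d - 2)" using d by (intro ge_one_powr_ge_zero) auto
  have "J (4 ^ k * r0) \<le> \<Lambda>"
  proof (induction k)
    case 0
    have "J r0 \<le> r0 powr (d - 2) * (U \<eta> orig * (\<Sum>x\<in>ball (2 * r0). \<kappa> x * U \<eta> x))"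
      unfolding J_def using r0 by (intro mult_left_mono cut_energy_base[OF A \<eta>]) auto
    also have "\<dots> \<le> r0 powr (d - 2) * ((K3 * M * r0 ^ 4) * (K4 * M\<^sup>2 * (2 * r0)\<^sup>2))"
      using r0 U0 K_nonneg M \<kappa>_nonneg U_nonneg[OF \<eta>]
      by (intro mult_left_mono mult_mono resolvent_orig_le[OF A \<eta>] \<kappa>_resolvent_sum[OF A \<eta>] sum_nonneg) auto
    also have "\<dots> = 4 * K3 * K4 * (M * M\<^sup>2) * (r0 powr (d - 2) * r0\<^sup>2 * r0 ^ 4)"
      by (simp add: power_mult_distrib mult_ac)
    also have "r0 powr (d - 2) * r0\<^sup>2 * r0 ^ 4 = r0 powr (d + 4)"
    proof -
      have "r0 powr (d - 2) * r0 powr 2 * r0 powr 4 = r0 powr (d + 4)" by (simp add: powr_add[symmetric])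
      then show ?thesis using r0 by (simp add: powr_numeral)
    qed
    also have "4 * K3 * K4 * (M * M\<^sup>2) * r0 powr (d + 4) \<le> K6 * M ^ 3 * r0 powr (d + 4)"
    proof (intro mult_right_mono)
      have "4 * (K3 * K4) \<le> (128 * 4 powr (d - 2)) * (K3 * K4)"
        using four K_nonneg by (intro mult_right_mono) auto
      then show "4 * K3 * K4 * (M * M\<^sup>2) \<le> K6 * M ^ 3"
        unfolding M3 K6_def using M by (intro mult_right_mono) (auto simp: mult_ac)
    qed simp
    also have "\<dots> \<le> \<Lambda>" using K_nonneg by (simp add: \<Lambda>_def)
    finally show ?case by simp
  next
    case (Suc k)
    define r where "r = 4 ^ k * r0"
    have r: "r0 \<le> r" "1 \<le> r" "0 < r"
      using r0 mult_mono[of 1 "4 ^ k" r0 r0] mult_mono[of 1 "4 ^ k" 1 r0] by (auto simp: r_def)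
    have J0: "0 \<le> J r"
    proof -
      have "0 \<le> cut_energy \<eta> (cut r)"
        unfolding cut_energy_def using U_nonneg[OF \<eta>] W_nonneg by (intro mult_nonneg_nonneg sum_nonneg) auto
      then show ?thesis by (simp add: J_def)
    qed
    have "J (4 * r) \<le> (4 * r) powr (d - 2) *
        ((1 / r\<^sup>2) * (\<Sum>x\<in>ball (10 * r). \<kappa> x * (cut r x * U \<eta> x)\<^sup>2)
          + r powr (- m) * U \<eta> orig * (\<Sum>x\<in>ball (8 * r). \<kappa> x * U \<eta> x))"
      unfolding J_def by (intro mult_left_mono cut_energy_step[OF A \<eta> r(2)]) auto
    also have "\<dots> = (4 * r) powr (d - 2) * (1 / r\<^sup>2) * (\<Sum>x\<in>ball (10 * r). \<kappa> x * (cut r x * U \<eta> x)\<^sup>2)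
        + (4 * r) powr (d - 2) * r powr (- m) * (U \<eta> orig * (\<Sum>x\<in>ball (8 * r). \<kappa> x * U \<eta> x))"
      by (simp only: distrib_left mult.assoc)
    also have "\<dots> \<le> (4 * r) powr (d - 2) * (1 / r\<^sup>2) *
          ((Creg * 10 powr d) powr P * ((K1 + K2) * 10 powr d) powr (1 - P) * M powr (3 - \<tau>) * J r powr \<tau> * r powr (4 - d))
        + (4 * r) powr (d - 2) * r powr (- m) * ((K3 * M * r0 ^ 4) * (K4 * M\<^sup>2 * (8 * r)\<^sup>2))"
      unfolding J_def using r r0 U0 K_nonneg M \<kappa>_nonneg U_nonneg[OF \<eta>]
      by (intro add_mono mult_left_mono mult_mono near_sum[OF A \<eta>] resolvent_orig_le[OF A \<eta>]
          \<kappa>_resolvent_sum[OF A \<eta>] sum_nonneg) auto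
    also have "(4 * r) powr (d - 2) * (1 / r\<^sup>2) *
          ((Creg * 10 powr d) powr P * ((K1 + K2) * 10 powr d) powr (1 - P) * M powr (3 - \<tau>) * J r powr \<tau> * r powr (4 - d))
        = K5 * M powr (3 - \<tau>) * J r powr \<tau> * (r powr (d - 2) * r powr (- 2) * r powr (4 - d))"
      using r by (simp add: K5_def powr_mult powr_minus powr_numeral divide_inverse mult_ac)
    also have "r powr (d - 2) * r powr (- 2) * r powr (4 - d) = 1"
      using r by (simp add: powr_add[symmetric])
    also have "(4 * r) powr (d - 2) * r powr (- m) * ((K3 * M * r0 ^ 4) * (K4 * M\<^sup>2 * (8 * r)\<^sup>2))
        = K6 / 2 * (M * M\<^sup>2) * r0 ^ 4 * (r powr (d - 2) * r powr (- m) * r powr 2)"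
      using r by (simp add: K6_def powr_mult powr_numeral power_mult_distrib mult_ac)
    also have "r powr (d - 2) * r powr (- m) * r powr 2 = r powr (d - m)"
      by (simp add: powr_add[symmetric])
    also have "K6 / 2 * (M * M\<^sup>2) * r0 ^ 4 * r powr (d - m) \<le> K6 / 2 * (M * M\<^sup>2) * r0 powr (d + 4) * 1"
    proof (intro mult_mono mult_left_mono)
      have "r0 ^ 4 = r0 powr 4" using r0 by (simp add: powr_numeral)
      also have "\<dots> \<le> r0 powr (d + 4)" using r0 d by (intro powr_mono) auto
      finally show "r0 ^ 4 \<le> r0 powr (d + 4)" .
      show "r powr (d - m) \<le> 1" using powr_mono[of "d - m" 0 r] r parameters by simp
    qed (use K_nonneg M in auto)
    also have "K5 * M powr (3 - \<tau>) * J r powr \<tau> * 1 + K6 / 2 * (M * M\<^sup>2) * r0 powr (d + 4) * 1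
        \<le> K5 * M powr (3 - \<tau>) * \<Lambda> powr \<tau> + K6 / 2 * M ^ 3 * r0 powr (d + 4)"
      unfolding M3 using Suc.IH J0 \<tau>_bounds K_nonneg
      by (simp add: r_def mult_left_mono powr_mono2)
    also have "\<dots> \<le> \<Lambda> / 2 + \<Lambda> / 2"
      using fixed_point K_nonneg by (intro add_mono) (auto simp: \<Lambda>_def)
    finally show ?case by (simp add: r_def mult_ac)
  qed
  moreover define R where "R = 4 ^ k * r0"
  ultimately have "R powr (2 - d) * (R powr (d - 2) * cut_energy \<eta> (cut R)) \<le> R powr (2 - d) * \<Lambda>"
    by (intro mult_left_mono) (auto simp: J_def)
  moreover have "R powr (2 - d) * R powr (d - 2) = 1"
    using r0 by (simp add: R_def powr_add[symmetric])
  then have "R powr (2 - d) * (R powr (d - 2) * c) = c" for c by (simp add: mult.assoc[symmetric])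
  ultimately have "cut_energy \<eta> (cut R) \<le> R powr (2 - d) * \<Lambda>" by (simp only:)
  then show ?thesis by (simp only: R_def mult.commute)
qed

section \<open>Nash decay of the killed kernel\<close>

definition "K8 = Creg powr P * K1 powr (1 - P)"
text \<open>The 8 is the one in \<open>r\<^sup>2 \<le> 8 * t\<close>, and
  \<open>2 * \<omega>\<close> comes from integrating the differential inequality.\<close>

definition "K9 = (8 * K8 powr (1 - \<omega>) / (2 * \<omega>)) powr (1 / \<omega>)"

text \<open>Nash's argument: \<open>E' = - 2 energy\<close>, and the energy dominates a power of \<open>E\<close>.\<close>

lemma nash_decay:
  assumes B: "killed W \<theta> B orig" "B \<subseteq> ball r" and r: "r0 \<le> r" and t: "r\<^sup>2 \<le> 8 * t"
  shows "killed.u W \<theta> B orig (2 * t) orig \<le> K9 * M powr ((2 - \<omega>) / \<omega>) * r powr (- d)"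
proof -
  interpret killed W \<theta> B orig by (rule B(1))
  have r1: "0 < r" "1 \<le> r" using r parameters by auto
  have t0: "0 < t" using t zero_less_power[OF r1(1), of 2] by linarith
  have M: "0 < M" using parameters by simp
  define E where "E = (\<lambda>t. \<Sum>x\<in>B. \<theta> x * (u t x)\<^sup>2)"
  have E: "E t = u (2 * t) orig" using t0 unfolding E_def by (intro u_square) auto
  \<comment> \<open>The Sobolev exponent with respect to \<open>\<theta>\<close> instead of the
    counting measure: Hoelder's inequality against the norm of \<open>\<theta>\<close> costs the
    factor \<open>1 - P\<close>, and \<open>2 * \<pi> < s\<close> says that \<open>S\<close> still
    exceeds 2.\<close>
  define S where "S = s * (1 - P)"
  have S: "2 < S"
  proof -
    have "2 * \<pi> * (1 - P) < s * (1 - P)" using exponents parameters by (intro mult_strict_right_mono) auto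
    moreover have "\<pi> * (1 - P) = 1" using parameters by (simp add: \<pi>_def)
    ultimately show ?thesis by (simp only: S_def mult.assoc)
  qed
  have S\<pi>: "S * \<pi> = s" using parameters by (simp add: S_def \<pi>_def)
  have \<omega>S: "\<omega> = 1 - 2 / S"
  proof -
    have "2 * \<pi> / (S * \<pi>) = 2 / S" using exponents(4) by simp
    then show ?thesis by (simp only: \<omega>_def S\<pi>)
  qed
  \<comment> \<open>The weight of the exponent \<open>S\<close> when exponent 2 is interpolated
    between \<open>S\<close> and 1, where the total mass is at most 1.\<close>
  define \<alpha> where "\<alpha> = 1 / (S - 1)"
  have \<alpha>: "0 < \<alpha>" "\<alpha> < 1" "1 - \<alpha> + S * \<alpha> = 2"
  proof -
    show "0 < \<alpha>" "\<alpha> < 1" using S by (auto simp: \<alpha>_def)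
    have "(S - 1) * \<alpha> = 1" using S by (simp add: \<alpha>_def)
    then show "1 - \<alpha> + S * \<alpha> = 2" by (simp add: algebra_simps)
  qed
  define G where "G = (K8 * M * r powr d) powr (1 - \<omega>) * (r powr (2 - d) * M)"
  have K8: "0 < K8" using K1_pos Creg_pos by (simp add: K8_def)
  have G: "0 < G" using K8 M r1 by (simp add: G_def)
  have nash: "E t powr (1 + \<omega>) \<le> G * energy W (u t)" if t: "0 \<le> t" for t
  proof -
    have u0: "0 \<le> u t x" for x by (rule u_nonneg[OF t])
    have fu: "fin_supp (u t)"
      unfolding fin_supp_def by (rule finite_subset[OF _ finite_A]) (use u_off in auto)
    have "E t = (\<Sum>x\<in>B. (\<theta> x * u t x powr S) powr \<alpha> * (\<theta> x * u t x) powr (1 - \<alpha>))"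
      unfolding E_def
    proof (rule sum.cong[OF refl])
      fix x
      have "(\<theta> x * u t x powr S) powr \<alpha> * (\<theta> x * u t x) powr (1 - \<alpha>)
          = (\<theta> x powr \<alpha> * \<theta> x powr (1 - \<alpha>)) * (u t x powr (S * \<alpha>) * u t x powr (1 - \<alpha>))"
        using \<theta>_pos[of x] u0[of x] by (simp add: powr_mult powr_powr mult_ac)
      also have "\<theta> x powr \<alpha> * \<theta> x powr (1 - \<alpha>) = \<theta> x" using \<theta>_pos[of x] by (simp add: powr_add[symmetric])
      also have "u t x powr (S * \<alpha>) * u t x powr (1 - \<alpha>) = u t x powr 2"
        using \<alpha>(3) by (simp add: powr_add[symmetric] algebra_simps)
      also have "u t x powr 2 = (u t x)\<^sup>2" using u0[of x] by (cases "u t x = 0") (auto simp: powr_numeral)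
      finally show "\<theta> x * (u t x)\<^sup>2 = (\<theta> x * u t x powr S) powr \<alpha> * (\<theta> x * u t x) powr (1 - \<alpha>)" by simp
    qed
    also have "\<dots> \<le> (\<Sum>x\<in>B. \<theta> x * u t x powr S) powr \<alpha> * (\<Sum>x\<in>B. \<theta> x * u t x) powr (1 - \<alpha>)"
      using \<alpha> finite_A \<theta>_pos u0 by (intro Holder_sum) (auto simp: less_imp_le)
    also have "\<dots> \<le> (\<Sum>x\<in>B. \<theta> x * u t x powr S) powr \<alpha> * 1"
    proof (rule mult_left_mono)
      have "(\<Sum>x\<in>B. \<theta> x * u t x) powr (1 - \<alpha>) \<le> 1 powr (1 - \<alpha>)"
        using sum_u_le[OF t] \<alpha> \<theta>_pos u0 by (intro powr_mono2 sum_nonneg) (auto simp: less_imp_le)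
      then show "(\<Sum>x\<in>B. \<theta> x * u t x) powr (1 - \<alpha>) \<le> 1" by simp
    qed simp
    finally have 1: "E t \<le> (\<Sum>x\<in>B. \<theta> x * u t x powr S) powr \<alpha>" by simp
    have "(\<Sum>x\<in>B. \<theta> x * u t x powr S) \<le> (\<Sum>x\<in>ball r. \<theta> x * u t x powr S)"
      using finite_ball B(2) \<theta>_pos by (intro sum_mono2) (auto simp: less_imp_le)
    also have "\<dots> \<le> M * real (card (ball r)) powr P * (\<Sum>x\<in>ball r. (u t x powr S) powr \<pi>) powr (1 - P)"
      by (rule \<theta>_sum[OF r]) simp
    also have "(\<Sum>x\<in>ball r. (u t x powr S) powr \<pi>) = (\<Sum>x\<in>ball r. \<bar>u t x\<bar> powr s)"
    proof -
      have "S * \<pi> = s" using parameters by (simp add: S_def \<pi>_def)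
      then show ?thesis using u0 by (simp add: powr_powr)
    qed
    also have "M * real (card (ball r)) powr P * (\<Sum>x\<in>ball r. \<bar>u t x\<bar> powr s) powr (1 - P)
        \<le> M * (Creg * r powr d) powr P * (K1 * r powr d * (r powr (2 - d) * M * energy W (u t)) powr (s / 2)) powr (1 - P)"
      using parameters volume(2)[OF r] global_sobolev[OF r fu]
      by (intro mult_mono mult_left_mono powr_mono2 sum_nonneg) auto
    also have "\<dots> = (K8 * M * r powr d) * (r powr (2 - d) * M * energy W (u t)) powr (S / 2)"
    proof -
      have e1: "r powr (d * P) * r powr (d * (1 - P)) = r powr d"
        by (simp add: powr_add[symmetric] algebra_simps)
      have e2: "s / 2 * (1 - P) = S / 2" by (simp add: S_def)
      have e3: "(K1 * r powr d * X powr (s / 2)) powr (1 - P)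
          = K1 powr (1 - P) * r powr (d * (1 - P)) * X powr (s / 2 * (1 - P))" for X
        using K1_pos by (simp add: powr_mult powr_powr)
      have e4: "(Creg * r powr d) powr P = Creg powr P * r powr (d * P)"
        using Creg_pos by (simp add: powr_mult powr_powr)
      show ?thesis unfolding e4 e3 e2 K8_def unfolding e1[symmetric] by (simp only: mult_ac)
    qed
    finally have "E t \<le> ((K8 * M * r powr d) * (r powr (2 - d) * M * energy W (u t)) powr (S / 2)) powr \<alpha>"
      using 1 \<alpha> \<theta>_pos by (smt (verit) powr_mono2 sum_nonneg mult_nonneg_nonneg powr_ge_zero less_imp_le)
    then have "E t powr (1 + \<omega>) \<le>
        (((K8 * M * r powr d) * (r powr (2 - d) * M * energy W (u t)) powr (S / 2)) powr \<alpha>) powr (1 + \<omega>)"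
      using \<omega>_bounds \<theta>_pos by (intro powr_mono2) (auto simp: E_def less_imp_le intro!: sum_nonneg)
    also have "\<dots> = ((K8 * M * r powr d) * (r powr (2 - d) * M * energy W (u t)) powr (S / 2)) powr (1 - \<omega>)"
    proof -
      \<comment> \<open>The power \<open>1 + \<omega>\<close> is chosen so that the energy appears
        linearly, since \<open>S / 2 * (1 - \<omega>) = 1\<close>.\<close>
      have "\<alpha> * (1 + \<omega>) = 1 - \<omega>" using S by (simp add: \<alpha>_def \<omega>S field_simps)
      then show ?thesis by (simp add: powr_powr)
    qed
    also have "\<dots> = (K8 * M * r powr d) powr (1 - \<omega>) * (r powr (2 - d) * M * energy W (u t)) powr (S / 2 * (1 - \<omega>))"
      by (subst powr_mult) (simp_all only: powr_powr)
    also have "S / 2 * (1 - \<omega>) = 1" using S by (simp add: \<omega>S)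
    also have "(r powr (2 - d) * M * energy W (u t)) powr 1 = r powr (2 - d) * M * energy W (u t)"
      using M energy_nonneg[of "u t"] by simp
    finally show ?thesis by (simp add: G_def mult_ac)
  qed
  have E0: "0 \<le> E t" for t unfolding E_def using \<theta>_pos by (intro sum_nonneg) (auto simp: less_imp_le)
  have "E t \<le> (G / (2 * \<omega> * t)) powr (1 / \<omega>)"
  proof (cases "E t = 0")
    case False
    then have Et: "0 < E t" using E0[of t] by simp
    have dE: "(E has_real_derivative - 2 * energy W (u x)) (at x)" for x
      unfolding E_def by (rule u_square_derivative)
    have anti: "E t \<le> E x" if "x \<le> t" for x
      by (rule DERIV_nonpos_imp_nonincreasing[where f = E, OF that]) (use dE energy_nonneg in \<open>auto intro!: exI\<close>)
    \<comment> \<open>By \<open>nash\<close> the derivative of \<open>E x powr (- \<omega>)\<close>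
      is at least \<open>2 * \<omega> / G\<close>; \<open>h\<close> subtracts this slope.\<close>
    define h where "h = (\<lambda>x. E x powr (- \<omega>) - 2 * \<omega> / G * x)"
    have "h 0 \<le> h t"
    proof (rule DERIV_nonneg_imp_nondecreasing[where f = h])
      show "0 \<le> t" using t0 by simp
      fix x assume x: "0 \<le> x" "x \<le> t"
      have Ex: "0 < E x" using anti[OF x(2)] Et by simp
      have "(h has_real_derivative (- \<omega>) * E x powr (- \<omega> - 1) * (- 2 * energy W (u x)) - 2 * \<omega> / G) (at x)"
        unfolding h_def using Ex G by (auto intro!: derivative_eq_intros dE)
      moreover have "0 \<le> (- \<omega>) * E x powr (- \<omega> - 1) * (- 2 * energy W (u x)) - 2 * \<omega> / G"
      proof -
        have "E x powr (- \<omega> - 1) * E x powr (1 + \<omega>) = 1" using Ex by (simp add: powr_add[symmetric])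
        then have "1 \<le> E x powr (- \<omega> - 1) * (G * energy W (u x))"
          using mult_left_mono[OF nash[OF x(1)], of "E x powr (- \<omega> - 1)"] by simp
        then have "1 / G \<le> E x powr (- \<omega> - 1) * energy W (u x)"
          using G by (simp add: divide_le_eq mult_ac)
        then have "2 * \<omega> * (1 / G) \<le> 2 * \<omega> * (E x powr (- \<omega> - 1) * energy W (u x))"
          using \<omega>_bounds by (intro mult_left_mono) auto
        then show ?thesis by (simp add: mult_ac)
      qed
      ultimately show "\<exists>y. (h has_real_derivative y) (at x) \<and> 0 \<le> y" by blast
    qed
    then have "E 0 powr (- \<omega>) \<le> E t powr (- \<omega>) - 2 * \<omega> / G * t" by (simp only: h_def mult_zero_right diff_zero)
    then have "2 * \<omega> / G * t \<le> E t powr (- \<omega>)"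
      using powr_ge_zero[of "E 0" "- \<omega>"] by linarith
    then have "(E t powr (- \<omega>)) powr (- (1 / \<omega>)) \<le> (2 * \<omega> / G * t) powr (- (1 / \<omega>))"
      using \<omega>_bounds G t0 by (intro powr_mono2') auto
    also have "(E t powr (- \<omega>)) powr (- (1 / \<omega>)) = E t" using Et \<omega>_bounds by (simp add: powr_powr)
    also have "(2 * \<omega> / G * t) powr (- (1 / \<omega>)) = (G / (2 * \<omega> * t)) powr (1 / \<omega>)"
      using \<omega>_bounds G t0 by (simp add: powr_minus powr_divide powr_mult)
    finally show ?thesis .
  qed simp
  also have "\<dots> \<le> (8 * G / (2 * \<omega> * r\<^sup>2)) powr (1 / \<omega>)"
  proof (intro powr_mono2)
    have "G / (2 * \<omega> * t) \<le> G / (2 * \<omega> * (r\<^sup>2 / 8))"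
      using t G \<omega>_bounds t0 r1 by (intro divide_left_mono mult_left_mono mult_pos_pos) auto
    then show "G / (2 * \<omega> * t) \<le> 8 * G / (2 * \<omega> * r\<^sup>2)" by (simp add: mult.commute)
  qed (use G t0 \<omega>_bounds in auto)
  also have "8 * G / (2 * \<omega> * r\<^sup>2) = (8 * K8 powr (1 - \<omega>) / (2 * \<omega>)) * (M powr (2 - \<omega>) * r powr (- (d * \<omega>)))"
  proof -
    have "G = K8 powr (1 - \<omega>) * (M powr (1 - \<omega>) * M powr 1) * (r powr (d * (1 - \<omega>)) * r powr (2 - d))"
      using K8 M by (simp add: G_def powr_mult powr_powr mult_ac)
    also have "M powr (1 - \<omega>) * M powr 1 = M powr (2 - \<omega>)" by (simp only: powr_add[symmetric]) simp
    also have "r powr (d * (1 - \<omega>)) * r powr (2 - d) = r powr (- (d * \<omega>)) * r\<^sup>2"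
    proof -
      have "r powr (d * (1 - \<omega>)) * r powr (2 - d) = r powr (- (d * \<omega>) + 2)"
        by (simp add: powr_add[symmetric] algebra_simps)
      also have "\<dots> = r powr (- (d * \<omega>)) * r powr 2" by (rule powr_add)
      also have "r powr 2 = r\<^sup>2" using r1 by (simp add: powr_numeral)
      finally show ?thesis .
    qed
    finally show ?thesis using r1 by simp
  qed
  also have "\<dots> powr (1 / \<omega>) = K9 * M powr ((2 - \<omega>) / \<omega>) * r powr (- d)"
    using K8 M r1 \<omega>_bounds by (simp add: K9_def powr_mult powr_powr powr_divide)
  finally show ?thesis by (simp add: E)
qed

definition "K10 = 4 powr d * (K9 + exp 2 * (K7 + K6))"

end

section \<open>The diagonal of the heat kernel for large times\<close>

locale regular_evolution =
  regular_network W \<theta> orig len dst \<kappa> d d' P Q m M r0 creg Creg CS dS s \<pi> +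
  point_evolution W \<theta> T orig
  for W :: "'v \<Rightarrow> 'v \<Rightarrow> real" and \<theta> orig len dst \<kappa> d d' P Q m M r0 creg Creg CS dS s \<pi> T
begin

lemma diagonal_bound:
  assumes t: "r0\<^sup>2 \<le> t"
  shows "v (2 * t) orig \<le> K10 * (M powr (3 + 2 / \<omega>) + M ^ 3 * r0 powr (d + 4)) * t powr (- d / 2)"
proof -
  have r0: "1 \<le> r0" and M: "1 \<le> M" and d: "2 \<le> d" using parameters by auto
  have t0: "0 < t" using t r0 zero_less_power[of r0 2] by linarith
  have "r0 \<le> sqrt t" using t r0 by (intro real_le_rsqrt) auto
  obtain n0 :: nat where "sqrt t / r0 < 4 ^ n0" using real_arch_pow[of 4 "sqrt t / r0"] by auto
  then have ex: "sqrt t < 4 ^ n0 * r0" using r0 by (simp add: divide_less_eq)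
  \<comment> \<open>The recursion reaches only the radii \<open>4 ^ k * r0\<close>, so
    \<open>R\<close> is the largest of them not above \<open>sqrt t\<close>; the loss of a factor 4
    in the radius is the \<open>4 powr d\<close> in \<open>K10\<close>.\<close>
  define n where "n = (LEAST n. sqrt t < 4 ^ n * r0)"
  have n: "sqrt t < 4 ^ n * r0" unfolding n_def using ex by (rule LeastI)
  have "n \<noteq> 0" using n \<open>r0 \<le> sqrt t\<close> by (auto intro: ccontr)
  then obtain k where k: "n = Suc k" by (cases n) auto
  have "\<not> sqrt t < 4 ^ k * r0" using not_less_Least[of k "\<lambda>n. sqrt t < 4 ^ n * r0"] k by (simp add: n_def)
  define R where "R = 4 ^ k * r0"
  have R: "R \<le> sqrt t" "sqrt t / 4 \<le> R" "r0 \<le> R" "0 < R"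
  proof -
    show "R \<le> sqrt t" using \<open>\<not> sqrt t < 4 ^ k * r0\<close> by (simp add: R_def)
    show "sqrt t / 4 \<le> R" using n by (simp add: R_def k)
    show "r0 \<le> R" using r0 mult_mono[of 1 "4 ^ k" r0 r0] by (auto simp: R_def)
    then show "0 < R" using r0 by simp
  qed
  have R2: "R\<^sup>2 \<le> t" using R power_mono[of R "sqrt t" 2] t0 by simp
  define B where "B = ball (2 * R)"
  define \<eta> where "\<eta> = 1 / t"
  have \<eta>: "0 < \<eta>" using t0 by (simp add: \<eta>_def)
  have kB: "killed W \<theta> B orig" unfolding B_def using R by (intro killed_ball) auto
  define An where "An = (\<lambda>n :: nat. ball (2 * R + real n))"
  have kA: "killed W \<theta> (An n) orig" for n unfolding An_def using R by (intro killed_ball) auto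
  have ex: "\<exists>N. \<forall>n\<ge>N. S \<subseteq> An n" if "finite S" for S
  proof -
    obtain N :: nat where N: "(\<Sum>x\<in>S. \<bar>len x\<bar>) \<le> real N" using real_arch_simple by blast
    have "S \<subseteq> An n" if "n \<ge> N" for n
    proof
      fix x assume "x \<in> S"
      then have "\<bar>len x\<bar> \<le> (\<Sum>x\<in>S. \<bar>len x\<bar>)" using \<open>finite S\<close> by (intro member_le_sum) auto
      then show "x \<in> An n" using N that R by (simp add: An_def)
    qed
    then show ?thesis by blast
  qed
  have \<Lambda>0: "0 \<le> \<Lambda>" using K_nonneg M by (simp add: \<Lambda>_def)
  have le: "killed.U W \<theta> (An n) orig \<eta> orig - killed.U W \<theta> B orig \<eta> orig \<le> \<Lambda> * R powr (2 - d)" for n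
  proof -
    interpret killed W \<theta> "An n" orig by (rule kA)
    have "U \<eta> orig - killed.U W \<theta> B orig \<eta> orig \<le> cut_energy \<eta> (cut R)"
    proof (rule U_diff_le[OF kB _ \<eta>])
      show "B \<subseteq> An n" by (auto simp: B_def An_def)
      show "cut R orig = 0" using R by (simp add: cut_0 len_orig)
      show "cut R x = 1" if "x \<in> An n" "x \<notin> B" for x using that R by (intro cut_1) (auto simp: B_def)
    qed
    also have "\<dots> \<le> \<Lambda> * R powr (2 - d)"
      unfolding R_def by (rule cut_energy_decay[OF kA \<eta>])
    finally show ?thesis .
  qed
  have "t * exp (- \<eta> * (2 * t)) * (v (2 * t) orig - killed.u W \<theta> B orig t orig) \<le> \<Lambda> * R powr (2 - d)"
    by (rule killed_comparison[OF kA ex kB \<eta> t0 _ le]) (use \<Lambda>0 in auto)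
  moreover have "- \<eta> * (2 * t) = - 2" using t0 by (simp add: \<eta>_def)
  ultimately have "t * exp (- 2) * (v (2 * t) orig - killed.u W \<theta> B orig t orig) \<le> \<Lambda> * R powr (2 - d)"
    by (simp only:)
  then have "(exp 2 / t) * (t * exp (- 2) * (v (2 * t) orig - killed.u W \<theta> B orig t orig)) \<le> (exp 2 / t) * (\<Lambda> * R powr (2 - d))"
    using t0 by (intro mult_left_mono) auto
  moreover have "(exp 2 / t) * (t * exp (- 2) * y) = y" for y :: real
    using t0 by (simp add: exp_minus)
  ultimately have 1: "v (2 * t) orig \<le> killed.u W \<theta> B orig t orig + exp 2 * \<Lambda> * (R powr (2 - d) / t)"
    by simp
  have "R powr (2 - d) / t \<le> R powr (2 - d) / R\<^sup>2"
    using R2 R t0 by (intro divide_left_mono mult_pos_pos) auto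
  also have "\<dots> = R powr (- d)"
  proof -
    have "R powr (2 - d) / R powr 2 = R powr (- d)" by (simp add: powr_diff[symmetric])
    then show ?thesis using R by (simp add: powr_numeral)
  qed
  finally have 2: "R powr (2 - d) / t \<le> R powr (- d)" .
  have 3: "killed.u W \<theta> B orig t orig \<le> K9 * M powr (3 + 2 / \<omega>) * R powr (- d)"
  proof -
    \<comment> \<open>The killed kernel at time \<open>t\<close> is reached from
      \<open>nash_decay\<close> at \<open>t / 2\<close>; its condition reads
      \<open>(2 * R)\<^sup>2 \<le> 8 * (t / 2)\<close>, that is,
      \<open>R\<^sup>2 \<le> t\<close>.\<close>
    have "killed.u W \<theta> B orig (2 * (t / 2)) orig \<le> K9 * M powr ((2 - \<omega>) / \<omega>) * (2 * R) powr (- d)"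
      by (rule nash_decay[OF kB]) (use R R2 in \<open>auto simp: B_def power_mult_distrib\<close>)
    also have "\<dots> \<le> K9 * M powr (3 + 2 / \<omega>) * R powr (- d)"
      using \<omega>_bounds M R d
      by (intro mult_mono powr_mono powr_mono2') (auto simp: K9_def diff_divide_distrib)
    finally show ?thesis by simp
  qed
  have 4: "R powr (- d) \<le> 4 powr d * t powr (- d / 2)"
  proof -
    have "R powr (- d) \<le> (sqrt t / 4) powr (- d)" using R t0 d by (intro powr_mono2') auto
    also have "\<dots> = (sqrt t) powr (- d) / 4 powr (- d)" by (rule powr_divide)
    also have "\<dots> = 4 powr d * (sqrt t) powr (- d)"
      using powr_minus_divide[of 4 "- d"] by simp
    also have "(sqrt t) powr (- d) = t powr (- d / 2)"
    proof -
      have "sqrt t = t powr (1 / 2)" using t0 by (simp add: powr_half_sqrt)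
      then show ?thesis by (simp only: powr_powr) simp
    qed
    finally show ?thesis .
  qed
  define X where "X = M powr (3 + 2 / \<omega>) + M ^ 3 * r0 powr (d + 4)"
  have X: "0 \<le> M ^ 3 * r0 powr (d + 4)" "M powr (3 + 2 / \<omega>) \<le> X" "M ^ 3 * r0 powr (d + 4) \<le> X" "0 \<le> X"
    using M by (auto simp: X_def)
  have \<Lambda>X: "\<Lambda> \<le> (K7 + K6) * X"
    unfolding \<Lambda>_def distrib_right mult.assoc using X K_nonneg by (intro add_mono mult_left_mono) auto
  have K9: "0 \<le> K9" by (simp add: K9_def)
  have "exp 2 * \<Lambda> * (R powr (2 - d) / t) \<le> exp 2 * \<Lambda> * R powr (- d)"
    using 2 \<Lambda>0 by (intro mult_left_mono) auto
  then have "v (2 * t) orig \<le> K9 * M powr (3 + 2 / \<omega>) * R powr (- d) + exp 2 * \<Lambda> * R powr (- d)"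
    using 1 3 by linarith
  also have "\<dots> = (K9 * M powr (3 + 2 / \<omega>) + exp 2 * \<Lambda>) * R powr (- d)" by (simp add: distrib_right)
  also have "\<dots> \<le> (K9 * X + exp 2 * ((K7 + K6) * X)) * (4 powr d * t powr (- d / 2))"
  proof (rule mult_mono[OF _ 4])
    have "K9 * M powr (3 + 2 / \<omega>) \<le> K9 * X" using K9 X by (intro mult_left_mono) auto
    moreover have "exp 2 * \<Lambda> \<le> exp 2 * ((K7 + K6) * X)" using \<Lambda>X by (intro mult_left_mono) auto
    ultimately show "K9 * M powr (3 + 2 / \<omega>) + exp 2 * \<Lambda> \<le> K9 * X + exp 2 * ((K7 + K6) * X)"
      by (rule add_mono)
    show "0 \<le> K9 * X + exp 2 * ((K7 + K6) * X)"
      using K9 X K_nonneg by (intro add_nonneg_nonneg mult_nonneg_nonneg) auto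
  qed simp
  also have "\<dots> = K10 * X * t powr (- d / 2)" by (simp add: K10_def algebra_simps)
  finally show ?thesis by (simp add: X_def)
qed

end

subsection \<open>Graphs\<close>

context
  fixes E :: "'v set set"
  assumes graph: "infinite_connected_lf_graph E"
begin

lemma gdist_relpow: "(x, y) \<in> adj_rel E ^^ gdist E x y"
proof -
  have "(x, y) \<in> (adj_rel E)\<^sup>*" using graph by (simp add: infinite_connected_lf_graph_def)
  then obtain n where "(x, y) \<in> adj_rel E ^^ n" using rtrancl_imp_relpow by blast
  then show ?thesis unfolding gdist_def by (rule LeastI)
qed

lemma gdist_le: "(x, y) \<in> adj_rel E ^^ n \<Longrightarrow> gdist E x y \<le> n"
  unfolding gdist_def by (rule Least_le)

lemma gdist_self: "gdist E x x = 0"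
  using gdist_le[of x x 0] by simp

lemma gdist_pos: "x \<noteq> y \<Longrightarrow> 1 \<le> gdist E x y"
  using gdist_relpow[of x y] by (cases "gdist E x y") auto

lemma gdist_triangle: "gdist E x z \<le> gdist E x y + gdist E y z"
  by (rule gdist_le) (use gdist_relpow[of x y] gdist_relpow[of y z] in \<open>auto simp: relpow_add\<close>)

lemma relpow_adj_rel_sym: "(x, y) \<in> adj_rel E ^^ n \<Longrightarrow> (y, x) \<in> adj_rel E ^^ n"
proof (induction n arbitrary: y)
  case (Suc n)
  obtain z where "(x, z) \<in> adj_rel E ^^ n" "(z, y) \<in> adj_rel E"
    using Suc.prems by (rule relpow_Suc_E)
  moreover from this(2) have "(y, z) \<in> adj_rel E" by (simp add: adj_rel_def adj_def insert_commute)
  ultimately show ?case using Suc.IH by (intro relpow_Suc_I2)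
qed simp

lemma gdist_sym: "gdist E x y = gdist E y x"
  by (rule order_antisym; rule gdist_le; rule relpow_adj_rel_sym; rule gdist_relpow)

lemma gdist_adj: "adj E x y \<Longrightarrow> gdist E x y = 1"
proof -
  assume a: "adj E x y"
  then have "{x, y} \<in> E" by (simp add: adj_def)
  then have "card {x, y} = 2" using graph by (simp add: infinite_connected_lf_graph_def)
  then have "x \<noteq> y" by auto
  moreover have "gdist E x y \<le> 1" using a by (intro gdist_le) (simp add: adj_rel_def)
  ultimately show ?thesis using gdist_pos[of x y] by simp
qed

lemma gball_eq: "gball E x r = {y. real (gdist E x y) \<le> r}"
  by (auto simp: gball_def le_floor_iff)

lemma finite_sphere: "finite {y. (x, y) \<in> adj_rel E ^^ n}"
proof (induction n)
  case (Suc n)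
  have "{y. (x, y) \<in> adj_rel E ^^ Suc n} = (\<Union>z\<in>{z. (x, z) \<in> adj_rel E ^^ n}. {y. adj E z y})"
    by (auto simp: adj_rel_def)
  then show ?case using Suc graph by (simp add: infinite_connected_lf_graph_def)
qed simp

lemma finite_gball: "finite (gball E x r)"
proof (rule finite_subset)
  show "gball E x r \<subseteq> (\<Union>n\<le>nat \<lfloor>r\<rfloor>. {y. (x, y) \<in> adj_rel E ^^ n})"
  proof
    fix y assume "y \<in> gball E x r"
    then have "gdist E x y \<le> nat \<lfloor>r\<rfloor>" by (simp add: gball_def)
    then show "y \<in> (\<Union>n\<le>nat \<lfloor>r\<rfloor>. {y. (x, y) \<in> adj_rel E ^^ n})" using gdist_relpow[of x y] by blast
  qed
qed (use finite_sphere in blast)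

lemma gball_center: "0 \<le> r \<Longrightarrow> x \<in> gball E x r"
  by (simp add: gball_eq gdist_self)

lemma adj_exists: "\<exists>y. adj E x y"
proof -
  obtain y where "y \<noteq> x"
    using graph infinite_imp_nonempty[of "UNIV - {x}"] by (auto simp: infinite_connected_lf_graph_def)
  moreover have "(x, y) \<in> (adj_rel E)\<^sup>*" using graph by (simp add: infinite_connected_lf_graph_def)
  ultimately have "(x, y) \<in> (adj_rel E)\<^sup>+" using rtranclD[of x y "adj_rel E"] by blast
  then show ?thesis using tranclD[of x y "adj_rel E"] by (auto simp: adj_rel_def)
qed

end

subsection \<open>The associated process\<close>

text \<open>Testing the association of process and semigroup with a point mass identifies
  \<open>T t \<delta> x\<close> with a transition probability over \<open>\<theta> orig\<close>;
  this gives both the bounds and the heat kernel.\<close>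

lemma process_evolution:
  fixes E :: "'v set set"
  assumes "random_walk_setting E \<theta> W M F X P"
  obtains T where "point_evolution W \<theta> T orig"
    "\<And>t. 0 \<le> t \<Longrightarrow> heat_kernel \<theta> X P t orig orig = T t (\<lambda>y. if y = orig then 1 / \<theta> orig else 0) orig"
proof -
  have \<theta>: "\<And>x. 0 < \<theta> x" and W: "conductances E W" and ap: "associated_process W \<theta> M F X P"
    using assms by (auto simp: random_walk_setting_def)
  obtain T where T: "semigroup_of_form W \<theta> T"
    and TX: "\<And>t f x. 0 \<le> t \<Longrightarrow> f \<in> L2 \<theta> \<Longrightarrow> bounded (range f) \<Longrightarrow>
      (\<integral>\<omega>. case_option 0 f (X t \<omega>) \<partial>P (Some x)) = T t f x"
    using ap unfolding associated_process_def by blast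
  have hunt: "hunt_process M F X P" using ap by (simp add: associated_process_def)
  define \<delta> where "\<delta> = (\<lambda>y. if y = orig then 1 / \<theta> orig else 0)"
  interpret form_semigroup W \<theta> T
    by unfold_locales (use \<theta> W T in \<open>auto simp: conductances_def\<close>)
  have \<delta>: "\<delta> \<in> L2 \<theta>" "bounded (range \<delta>)"
  proof -
    show "\<delta> \<in> L2 \<theta>" by (rule L2_fin_supp) (simp add: fin_supp_def \<delta>_def)
    have "range \<delta> \<subseteq> {0, 1 / \<theta> orig}" by (auto simp: \<delta>_def)
    then show "bounded (range \<delta>)" using finite_imp_bounded finite_subset by blast
  qed
  have T\<delta>: "T t \<delta> x = measure (P (Some x)) {\<omega>\<in>space (P (Some x)). X t \<omega> = Some orig} / \<theta> orig"
    if t: "0 \<le> t" for t x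
  proof -
    interpret prob_space "P (Some x)" using hunt by (simp add: hunt_process_def)
    note h = hunt[unfolded hunt_process_def]
    have s: "sets (P (Some x)) = sets M" by (rule conjunct2[OF spec[OF conjunct1[OF h]]])
    have "filtration (space M) F" by (rule conjunct1[OF conjunct2[OF h]])
    then have sp: "space (F t) = space M" by (rule filtration.space_F)
    have sub: "sets (F t) \<subseteq> sets M" by (rule spec[OF conjunct1[OF conjunct2[OF conjunct2[OF h]]]])
    have "X t \<in> measurable (F t) (count_space UNIV)"
      by (rule mp[OF spec[OF conjunct1[OF conjunct2[OF conjunct2[OF conjunct2[OF conjunct2[OF h]]]]]] t])
    then have "X t -` {Some orig} \<inter> space (F t) \<in> sets (F t)" by (rule measurable_sets) simp
    then have ev: "X t -` {Some orig} \<inter> space M \<in> sets M" using sub sp by auto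
    have A: "{\<omega>\<in>space (P (Some x)). X t \<omega> = Some orig} \<in> events"
    proof -
      have "{\<omega>\<in>space (P (Some x)). X t \<omega> = Some orig} = X t -` {Some orig} \<inter> space M"
        using sets_eq_imp_space_eq[OF s] by blast
      then show ?thesis using ev s by simp
    qed
    have "T t \<delta> x = (\<integral>\<omega>. case_option 0 \<delta> (X t \<omega>) \<partial>P (Some x))"
      using TX[OF t \<delta>] by simp
    also have "\<dots> = (\<integral>\<omega>. indicator {\<omega>\<in>space (P (Some x)). X t \<omega> = Some orig} \<omega> / \<theta> orig \<partial>P (Some x))"
      by (intro Bochner_Integration.integral_cong) (auto simp: \<delta>_def indicator_def split: option.splits)
    also have "\<dots> = prob {\<omega>\<in>space (P (Some x)). X t \<omega> = Some orig} / \<theta> orig"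
      using A by simp
    finally show ?thesis .
  qed
  have "point_evolution W \<theta> T orig"
  proof unfold_locales
    fix t x assume t: "0 \<le> (t :: real)"
    interpret prob_space "P (Some x)" using hunt by (simp add: hunt_process_def)
    show "0 \<le> T t (\<lambda>y. if y = orig then 1 / \<theta> orig else 0) x \<and> T t (\<lambda>y. if y = orig then 1 / \<theta> orig else 0) x \<le> 1 / \<theta> orig"
      using T\<delta>[OF t, of x] \<theta>[of orig] by (simp add: \<delta>_def divide_right_mono)
  qed
  moreover have "heat_kernel \<theta> X P t orig orig = T t (\<lambda>y. if y = orig then 1 / \<theta> orig else 0) orig" if "0 \<le> t" for t
    using T\<delta>[OF that, of orig] by (simp add: heat_kernel_def \<delta>_def)
  ultimately show ?thesis using that by blast
qed

subsection \<open>Norms and exponents\<close>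

text \<open>Each norm in \<open>M_zero\<close> is at least 1, so each is bounded by the whole
  expression. Finiteness of the three suprema makes the real supremum an upper bound.\<close>

lemma M_zero_bounds:
  fixes E :: "'v set set"
  assumes graph: "infinite_connected_lf_graph E" and p: "1 < p" and q: "1 < q"
    and nb: "norms_bounded E v0 \<theta> W \<kappa> p q" and r: "1 \<le> r"
  defines "M \<equiv> M_zero E v0 \<theta> W \<kappa> p q"
  shows "avg_norm p (gball E v0 r) (\<lambda>x. max 1 (\<kappa> x)) \<le> M" "avg_norm p (gball E v0 r) (\<lambda>x. max 1 (\<theta> x)) \<le> M"
    "avg_norm q (gball E v0 r) (\<lambda>x. max 1 (nu E W x)) \<le> M" "1 \<le> M"
proof -
  have fin: "finite (gball E v0 R)" for R by (rule finite_gball[OF graph])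
  have ne: "gball E v0 R \<noteq> {}" if "1 \<le> R" for R using gball_center[OF graph, of R v0] that by auto
  have ge1: "1 \<le> avg_norm p' (gball E v0 R) (\<lambda>x. max 1 (f x))" if "1 \<le> R" "1 < p'" for R p' f
    using avg_norm_mono[OF fin ne[OF that(1)] that(2), of "\<lambda>_. 1" "\<lambda>x. max 1 (f x)"]
      avg_norm_const[OF fin ne[OF that(1)] that(2)] by simp
  define S where "S = (\<lambda>p' f. SUP R\<in>{1..}. ereal (avg_norm p' (gball E v0 R) f))"
  have S: "ereal (avg_norm p' (gball E v0 R) f) \<le> S p' f" if "1 \<le> R" for p' f R
    unfolding S_def using that by (intro SUP_upper) auto
  have S0: "0 \<le> S p' f" for p' f
    by (rule order_trans[OF _ S[of 1]]) (simp_all add: avg_norm_nonneg[OF fin ne])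
  have "S p \<theta> + S p \<kappa> + S q (nu E W) < \<infinity>" using nb by (simp add: norms_bounded_def S_def)
  \<comment> \<open>Finiteness passes from the sum to the summands because all three are
    nonnegative.\<close>
  then have lt: "S p \<theta> < \<infinity>" "S p \<kappa> < \<infinity>" "S q (nu E W) < \<infinity>"
    using S0[of p \<theta>] S0[of p \<kappa>] S0[of q "nu E W"] by auto
  obtain C where C: "\<And>R. 1 \<le> R \<Longrightarrow> avg_norm p (gball E v0 R) \<theta> \<le> C" "0 \<le> C"
    using S[of _ p \<theta>] lt(1) S0[of p \<theta>] by (cases "S p \<theta>") auto
  obtain D where D: "\<And>R. 1 \<le> R \<Longrightarrow> avg_norm p (gball E v0 R) \<kappa> \<le> D" "0 \<le> D"
    using S[of _ p \<kappa>] lt(2) S0[of p \<kappa>] by (cases "S p \<kappa>") auto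
  obtain G where G: "\<And>R. 1 \<le> R \<Longrightarrow> avg_norm q (gball E v0 R) (nu E W) \<le> G" "0 \<le> G"
    using S[of _ q "nu E W"] lt(3) S0[of q "nu E W"] by (cases "S q (nu E W)") auto
  define h where "h = (\<lambda>R. (avg_norm p (gball E v0 R) (\<lambda>x. max 1 (\<kappa> x)) + avg_norm p (gball E v0 R) (\<lambda>x. max 1 (\<theta> x))) *
        avg_norm q (gball E v0 R) (\<lambda>x. max 1 (nu E W x)))"
  have "h R \<le> ((1 + D) + (1 + C)) * (1 + G)" if R: "1 \<le> R" for R
    unfolding h_def
  proof (intro mult_mono add_mono)
    show "avg_norm p (gball E v0 R) (\<lambda>x. max 1 (\<kappa> x)) \<le> 1 + D"
      using avg_norm_max_one[OF fin ne[OF R] p, of \<kappa>] D(1)[OF R] by simp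
    show "avg_norm p (gball E v0 R) (\<lambda>x. max 1 (\<theta> x)) \<le> 1 + C"
      using avg_norm_max_one[OF fin ne[OF R] p, of \<theta>] C(1)[OF R] by simp
    show "avg_norm q (gball E v0 R) (\<lambda>x. max 1 (nu E W x)) \<le> 1 + G"
      using avg_norm_max_one[OF fin ne[OF R] q, of "nu E W"] G(1)[OF R] by simp
  qed (use C D fin ne[OF R] in \<open>auto intro: avg_norm_nonneg\<close>)
  then have "bdd_above (h ` {1..})" by (intro bdd_aboveI2[where M = "((1 + D) + (1 + C)) * (1 + G)"]) auto
  then have "h r \<le> (SUP R\<in>{1..}. h R)" using r by (intro cSUP_upper) auto
  then have hr: "h r \<le> M" by (simp add: M_def M_zero_def h_def)
  define a b c where "a = avg_norm p (gball E v0 r) (\<lambda>x. max 1 (\<kappa> x))"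
    and "b = avg_norm p (gball E v0 r) (\<lambda>x. max 1 (\<theta> x))" and "c = avg_norm q (gball E v0 r) (\<lambda>x. max 1 (nu E W x))"
  have abc: "1 \<le> a" "1 \<le> b" "1 \<le> c" unfolding a_def b_def c_def using ge1[OF r] p q by auto
  have abM: "(a + b) * c \<le> M" using hr by (simp add: h_def a_def b_def c_def)
  have "(a + b) * 1 \<le> (a + b) * c" using abc by (intro mult_left_mono) auto
  with abM have 1: "a + b \<le> M" by simp
  have "1 * c \<le> (a + b) * c" using abc by (intro mult_right_mono) auto
  with abM have 2: "c \<le> M" by simp
  have "a \<le> M \<and> b \<le> M \<and> c \<le> M \<and> 1 \<le> M" using 1 2 abc by auto
  then show "avg_norm p (gball E v0 r) (\<lambda>x. max 1 (\<kappa> x)) \<le> M" "avg_norm p (gball E v0 r) (\<lambda>x. max 1 (\<theta> x)) \<le> M"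
    "avg_norm q (gball E v0 r) (\<lambda>x. max 1 (nu E W x)) \<le> M" "1 \<le> M"
    unfolding a_def[symmetric] b_def[symmetric] c_def[symmetric] by simp_all
qed

text \<open>\<open>exp_a' d p q\<close> equals \<open>d * x\<close> and is at most 2, so dividing by
  it leaves enough room. The lower bounds are what the estimates demand: \<open>d + 4\<close> as the
  power of \<open>r0\<close>, and \<open>3 + 2 / \<omega>\<close> with
  \<open>2 / \<omega> \<le> 2 / x + 1\<close> as the power of \<open>M\<close>.\<close>

lemma exponent_bounds:
  fixes d m0 :: real
  assumes d: "3 \<le> d" and m0: "d < m0" and p: "1 < p" and q: "1 < q" and pq: "recip p + recip q < 2 / d"
  defines "x \<equiv> 2 / d - recip p - recip q"
  shows "0 \<le> (recip p + recip q) * m0 * exp_\<gamma> d p q m0 / (2 * exp_\<beta> d p q m0)"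
    "d + 4 \<le> m0 / exp_\<beta> d p q m0" "4 + 2 / x \<le> (1 + m0 * exp_\<gamma> d p q m0) / exp_\<beta> d p q m0"
proof -
  define A where "A = exp_a d p q"
  define B where "B = exp_a' d p q"
  define \<sigma> where "\<sigma> = exp_\<sigma> d p q m0"
  have PQ: "0 \<le> recip p" "0 \<le> recip q" using recip_bounds p q by auto
  have A: "0 \<le> A" using PQ d by (simp add: A_def exp_a_def)
  have Bx: "B = d * x" using d by (simp add: B_def exp_a'_def x_def algebra_simps)
  have x: "0 < x" using pq by (simp add: x_def)
  have B: "0 < B" "B \<le> 2" using Bx x d A by (auto simp: B_def A_def exp_a_def exp_a'_def)
  have \<sigma>: "\<sigma> = 2 * d * m0 + B * m0 + 2 * A * d + B * d" by (simp add: \<sigma>_def exp_\<sigma>_def A_def B_def)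
  have \<sigma>0: "0 < \<sigma>" unfolding \<sigma> using A B d m0 by (intro add_pos_nonneg) auto
  have \<beta>: "exp_\<beta> d p q m0 = B * m0 / \<sigma>" by (simp add: exp_\<beta>_def B_def \<sigma>_def)
  have \<gamma>: "exp_\<gamma> d p q m0 = (2 * A * d + B * d) / \<sigma>" by (simp add: exp_\<gamma>_def A_def B_def \<sigma>_def)
  show "0 \<le> (recip p + recip q) * m0 * exp_\<gamma> d p q m0 / (2 * exp_\<beta> d p q m0)"
    unfolding \<beta> \<gamma> using PQ A B d m0 \<sigma>0 by (intro divide_nonneg_nonneg mult_nonneg_nonneg add_nonneg_nonneg) auto
  have "m0 / exp_\<beta> d p q m0 = \<sigma> / B" unfolding \<beta> using m0 d \<sigma>0 B by (simp add: field_simps)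
  moreover have "\<sigma> / B = (2 * d * m0 + 2 * A * d) / B + m0 + d" unfolding \<sigma> using B by (simp add: field_simps)
  moreover have "(2 * d * m0 + 2 * A * d) / 2 \<le> (2 * d * m0 + 2 * A * d) / B"
    using A B d m0 by (intro divide_left_mono) auto
  moreover have "1 \<le> (2 * d * m0 + 2 * A * d) / 2"
  proof -
    have "1 \<le> d * m0" using mult_mono[of 1 d 1 m0] d m0 by simp
    moreover have "0 \<le> A * d" using A d by simp
    ultimately show ?thesis by simp
  qed
  ultimately show "d + 4 \<le> m0 / exp_\<beta> d p q m0" using d m0 by linarith
  have "(1 + m0 * exp_\<gamma> d p q m0) / exp_\<beta> d p q m0 = \<sigma> / (B * m0) + (2 * A * d + B * d) / B"
    unfolding \<beta> \<gamma> using m0 d \<sigma>0 B by (simp add: field_simps)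
  moreover have "(2 * d * m0 + B * m0) / (B * m0) \<le> \<sigma> / (B * m0)"
    unfolding \<sigma> using A B d m0 by (intro divide_right_mono) auto
  moreover have "(2 * d * m0 + B * m0) / (B * m0) = 2 / x + 1"
    unfolding Bx using x d m0 by (simp add: field_simps)
  moreover have "d \<le> (2 * A * d + B * d) / B"
    using A B d by (simp add: le_divide_eq)
  ultimately show "4 + 2 / x \<le> (1 + m0 * exp_\<gamma> d p q m0) / exp_\<beta> d p q m0" using d by linarith
qed

subsection \<open>The heat kernel bound\<close>

text \<open>Any \<open>d' > d\<close> close enough to \<open>d\<close> would do; this one makes the exponents of the
  elliptic estimate fit below those of the theorem.\<close>

definition sobolev_dim :: "real \<Rightarrow> ereal \<Rightarrow> ereal \<Rightarrow> real" where
  "sobolev_dim d p q = (let x = 2 / d - recip p - recip q in 2 / (recip p + recip q + 2 * x / (2 + x)))"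

text \<open>With \<open>y = 2 * x / (2 + x)\<close> one has \<open>1 / y = 1 / x + 1 / 2\<close>:
  passing to the larger dimension shrinks the gap from \<open>x\<close> to \<open>y\<close> and
  raises \<open>2 / x\<close> by exactly 1.\<close>

lemma sobolev_dim:
  assumes d: "3 \<le> d" and p: "1 < p" and q: "1 < q" and pq: "recip p + recip q < 2 / d"
  defines "x \<equiv> 2 / d - recip p - recip q"
  shows "d < sobolev_dim d p q" "2 / sobolev_dim d p q - recip p - recip q = 2 * x / (2 + x)" "0 < x"
proof -
  have PQ: "0 \<le> recip p" "0 \<le> recip q" using recip_bounds p q by auto
  show x: "0 < x" using pq by (simp add: x_def)
  define y where "y = 2 * x / (2 + x)"
  have y: "0 < y" "y < x"
  proof -
    show "0 < y" using x by (simp add: y_def)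
    have "y < x * (2 + x) / (2 + x)" unfolding y_def using x by (intro divide_strict_right_mono) (auto simp: algebra_simps)
    then show "y < x" using x by simp
  qed
  have dim: "sobolev_dim d p q = 2 / (recip p + recip q + y)"
    by (simp add: sobolev_dim_def Let_def x_def y_def)
  have pos: "0 < recip p + recip q + y" using PQ y by simp
  have "recip p + recip q + y < 2 / d" using y by (simp add: x_def)
  then have "d * (recip p + recip q + y) < 2" using d by (simp add: less_divide_eq mult.commute)
  then show "d < sobolev_dim d p q" unfolding dim using pos by (simp add: less_divide_eq)
  show "2 / sobolev_dim d p q - recip p - recip q = 2 * x / (2 + x)"
  proof -
    have "2 / (2 / z) = z" for z :: real by simp
    then show ?thesis unfolding dim y_def[symmetric] by (simp only:)
  qed
qed

text \<open>All balls are centred at \<open>v0\<close>, and the outer radius in the regularity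
  hypothesis is taken equal to \<open>r\<close>. The factor
  \<open>max 1 ((C0 d' \<rho>)\<^sup>2)\<close> in \<open>r0\<close> gives
  \<open>C0 d' \<rho> \<le> sqrt r\<close>, and with \<open>\<alpha>0 < 1 / 2\<close> this yields
  the lower bound on the radius that the Sobolev hypothesis asks for.\<close>

lemma regular_evolution_instance:
  fixes E :: "'v set set"
  assumes d: "3 \<le> d" and p: "1 < p" and q: "1 < q" and m0: "d \<le> m0"
    and d': "d < d'" "recip p + recip q < 2 / d'"
    and setting: "random_walk_setting E \<theta> W Me F X Pr"
    and regular: "large_scale_regular E v0 d R0 \<alpha>0 creg Creg R1 C0 CS dS"
    and moment: "finite_moment E W m0" and norms: "norms_bounded E v0 \<theta> W (mu_m E W m0) p q"
    and T: "point_evolution W \<theta> T v0"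
  defines "\<rho> \<equiv> 2 / (1 + recip q)"
  shows "regular_evolution W \<theta> v0 (\<lambda>x. real (gdist E v0 x)) (\<lambda>x y. real (gdist E x y)) (mu_m E W m0)
    d d' (recip p) (recip q) m0 (M_zero E v0 \<theta> W (mu_m E W m0) p q) (max 1 ((C0 d' \<rho>)\<^sup>2) * R1 d')
    creg Creg (CS d' \<rho>) (dS d' \<rho>) (1 / ((1 + recip q) / 2 - 1 / d')) (1 / (1 - recip p)) T"
proof -
  interpret point_evolution W \<theta> T v0 by (rule T)
  define s where "s = 1 / ((1 + recip q) / 2 - 1 / d')"
  define M where "M = M_zero E v0 \<theta> W (mu_m E W m0) p q"
  define r0 where "r0 = max 1 ((C0 d' \<rho>)\<^sup>2) * R1 d'"
  have graph: "infinite_connected_lf_graph E" and W: "conductances E W"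
    using setting by (simp_all add: random_walk_setting_def)
  have PQ: "0 \<le> recip p" "recip p < 1" "0 \<le> recip q" "recip q < 1" using recip_bounds p q by auto
  have vr: "volume_regular E v0 d R0 \<alpha>0 creg Creg" and sr: "sobolev_regular E v0 d R0 \<alpha>0 R1 C0 CS dS"
    and R0: "1 \<le> R0" and \<alpha>0: "0 \<le> \<alpha>0" "\<alpha>0 < 1 / 2"
    using regular by (simp_all add: large_scale_regular_def)
  have R1: "R0 \<le> R1 d'" using sr d'(1) by (simp add: sobolev_regular_def)
  have \<rho>: "1 < \<rho>" "\<rho> \<le> 2" "1 / \<rho> = (1 + recip q) / 2" using PQ by (auto simp: \<rho>_def field_simps)
  have d'3: "3 < d'" using d d' by simp
  have d'i: "0 < 1 / d'" "1 / d' < 1 / 2" using d'3 by (auto simp: divide_simps)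
  have ri: "0 < 1 / \<rho> - 1 / d'"
  proof -
    have "1 / 2 \<le> 1 / \<rho>" using \<rho> by (simp add: divide_simps)
    then show ?thesis using d'i by linarith
  qed
  have s: "s = 1 / (1 / \<rho> - 1 / d')" by (simp add: s_def \<rho>)
  have s0: "0 < s" unfolding s using ri by simp
  have \<rho>s: "\<rho> < s"
  proof -
    have "1 / s < 1 / \<rho>" using d'i by (simp add: s)
    moreover have "1 / \<rho> \<le> 1 / s" if "s \<le> \<rho>" using that s0 by (intro divide_left_mono) auto
    ultimately show ?thesis by linarith
  qed
  have ds: "d' / s = d' / \<rho> - 1" using d'3 by (simp add: s right_diff_distrib)
  have cpos: "0 < C0 d' \<rho>" "0 < CS d' \<rho>" "1 \<le> dS d' \<rho>"
    and sob: "\<And>R x r f. R1 d' \<le> R \<Longrightarrow> x \<in> gball E v0 R \<Longrightarrow> C0 d' \<rho> * R powr \<alpha>0 \<le> r \<Longrightarrow> r \<le> R \<Longrightarrow>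
       lp_norm s (gball E x r) (\<lambda>y. f y - average (gball E x r) f)
         \<le> CS d' \<rho> * r powr (1 - d / d') *
           (\<Sum>(y, z)\<in>{(y, z). y \<in> gball E x (dS d' \<rho> * r) \<and> z \<in> gball E x (dS d' \<rho> * r)
                            \<and> adj E y z}. \<bar>f y - f z\<bar> powr \<rho>) powr (1 / \<rho>)"
    using sr d' \<rho> \<rho>s ds d'3 unfolding sobolev_regular_def by simp_all
  have r0: "R1 d' \<le> r0" "1 \<le> r0" "R0 \<le> r0" "(C0 d' \<rho>)\<^sup>2 \<le> r0"
  proof -
    have R1': "1 \<le> R1 d'" using R0 R1 by simp
    show "R1 d' \<le> r0" unfolding r0_def using mult_right_mono[of 1 "max 1 ((C0 d' \<rho>)\<^sup>2)" "R1 d'"] R1' by simp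
    then show "1 \<le> r0" "R0 \<le> r0" using R1 R1' by simp_all
    have "(C0 d' \<rho>)\<^sup>2 * 1 \<le> r0" unfolding r0_def using R1' by (intro mult_mono) auto
    then show "(C0 d' \<rho>)\<^sup>2 \<le> r0" by simp
  qed
  have fin: "finite (gball E v0 r)" for r by (rule finite_gball[OF graph])
  have ne: "gball E v0 r \<noteq> {}" if "1 \<le> r" for r using gball_center[OF graph, of r v0] that by auto
  have ball: "{x. real (gdist E v0 x) \<le> r} = gball E v0 r" for r by (simp add: gball_eq[OF graph])
  have creg: "0 < creg" using vr by (simp add: volume_regular_def)
  have vol: "creg * r powr d \<le> card (gball E v0 r)" "card (gball E v0 r) \<le> Creg * r powr d" if r: "r0 \<le> r" for r
  proof -
    have "1 \<le> r" "R0 \<le> r" using r r0 by auto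
    moreover from this have "r powr \<alpha>0 \<le> r powr 1" using \<alpha>0 by (intro powr_mono) auto
    moreover have "v0 \<in> gball E v0 r" using \<open>1 \<le> r\<close> by (intro gball_center[OF graph]) simp
    ultimately show "creg * r powr d \<le> card (gball E v0 r)" "card (gball E v0 r) \<le> Creg * r powr d"
      using vr[unfolded volume_regular_def, THEN conjunct2, THEN conjunct2, rule_format, of r r v0] by simp_all
  qed
  have weight_sum: "(\<Sum>x\<in>gball E v0 r. g x * f x)
      \<le> M * real (card (gball E v0 r)) powr recip p * (\<Sum>x\<in>gball E v0 r. f x powr (1 / (1 - recip p))) powr (1 - recip p)"
    if r: "1 \<le> r" and f: "\<And>x. 0 \<le> f x" and g: "\<And>x. 0 \<le> g x" and avg: "avg_norm p (gball E v0 r) (\<lambda>x. max 1 (g x)) \<le> M" for r f g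
  proof -
    have "avg_norm p (gball E v0 r) g \<le> avg_norm p (gball E v0 r) (\<lambda>x. max 1 (g x))"
      using g by (intro avg_norm_mono fin ne r p) (auto simp: max_def)
    then have "avg_norm p (gball E v0 r) g \<le> M" using avg by simp
    then have "avg_norm p (gball E v0 r) g * real (card (gball E v0 r)) powr recip p * (\<Sum>x\<in>gball E v0 r. f x powr (1 / (1 - recip p))) powr (1 - recip p)
      \<le> M * real (card (gball E v0 r)) powr recip p * (\<Sum>x\<in>gball E v0 r. f x powr (1 / (1 - recip p))) powr (1 - recip p)"
      by (intro mult_right_mono) auto
    with sum_mult_le_avg_norm[OF fin ne[OF r] p, of f g] f g show ?thesis by simp
  qed
  have \<kappa>0: "0 \<le> mu_m E W m0 x" for x
    unfolding mu_m_def dist_pow_def using W_nonneg by (intro infsum_nonneg) auto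
  note Mb = M_zero_bounds[OF graph p q norms]
  show ?thesis
    unfolding s_def[symmetric] M_def[symmetric] r0_def[symmetric]
  proof unfold_locales
    show "real (gdist E v0 v0) = 0" by (simp add: gdist_self[OF graph])
    show "\<bar>real (gdist E v0 x) - real (gdist E v0 y)\<bar> \<le> real (gdist E x y)" for x y
      using gdist_triangle[OF graph, of v0 x y] gdist_triangle[OF graph, of v0 y x] gdist_sym[OF graph, of x y] by linarith
    show "real (gdist E x y) = real (gdist E y x)" for x y by (simp add: gdist_sym[OF graph, of x y])
    show "1 \<le> real (gdist E x y)" if "x \<noteq> y" for x y using gdist_pos[OF graph that] by simp
    show "finite {x. real (gdist E v0 x) \<le> r}" for r unfolding ball by (rule fin)
    show "1 \<le> M" unfolding M_def using Mb(4)[of 1] by simp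
    show "1 / s = (1 + recip q) / 2 - 1 / d'" by (simp add: s_def)
    show "creg * r powr d \<le> card {x. real (gdist E v0 x) \<le> r}" "card {x. real (gdist E v0 x) \<le> r} \<le> Creg * r powr d" if "r0 \<le> r" for r
      unfolding ball by (rule vol[OF that])+
    show "(\<Sum>x | real (gdist E v0 x) \<le> r. mu_m E W m0 x * f x)
      \<le> M * real (card {x. real (gdist E v0 x) \<le> r}) powr recip p *
        (\<Sum>x | real (gdist E v0 x) \<le> r. f x powr (1 / (1 - recip p))) powr (1 - recip p)"
      if "r0 \<le> r" "\<And>x. 0 \<le> f x" for r f
      unfolding ball using that r0 \<kappa>0 Mb(1)[of r] by (intro weight_sum) (auto simp: M_def)
    show "(\<Sum>x | real (gdist E v0 x) \<le> r. \<theta> x * f x)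
      \<le> M * real (card {x. real (gdist E v0 x) \<le> r}) powr recip p *
        (\<Sum>x | real (gdist E v0 x) \<le> r. f x powr (1 / (1 - recip p))) powr (1 - recip p)"
      if "r0 \<le> r" "\<And>x. 0 \<le> f x" for r f
      unfolding ball using that r0 \<theta>_pos Mb(2)[of r] by (intro weight_sum) (auto simp: M_def less_imp_le)
    show "(\<Sum>y\<in>S. W x y * real (gdist E x y) powr m0) \<le> mu_m E W m0 x" if "finite S" for S x
    proof -
      have "(\<Sum>y\<in>S. W x y * real (gdist E x y) powr m0) = (\<Sum>y\<in>S. W x y * dist_pow E m0 x y)"
        using m0 d by (simp add: dist_pow_def)
      also have "\<dots> \<le> mu_m E W m0 x"
        unfolding mu_m_def using moment that W_nonneg
        by (intro finite_sum_le_infsum) (auto simp: finite_moment_def dist_pow_def)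
      finally show ?thesis .
    qed
    show "lp_norm s {x. real (gdist E v0 x) \<le> r} (\<lambda>y. f y - average {x. real (gdist E v0 x) \<le> r} f)
      \<le> CS d' \<rho> * r powr (1 - d / d') *
        sqrt (2 * M * real (card {x. real (gdist E v0 x) \<le> dS d' \<rho> * r}) powr recip q * energy W f)"
      if r: "r0 \<le> r" and f: "fin_supp f" for r f
      unfolding ball
    proof -
      define B where "B = gball E v0 (dS d' \<rho> * r)"
      have r1: "1 \<le> r" "R1 d' \<le> r" using r r0 by auto
      have dr: "1 \<le> dS d' \<rho> * r" using mult_mono[of 1 "dS d' \<rho>" 1 r] r1 cpos by simp
      have Cr: "C0 d' \<rho> * r powr \<alpha>0 \<le> r"
      proof -
        have "C0 d' \<rho> = sqrt ((C0 d' \<rho>)\<^sup>2)" using cpos by simp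
        also have "\<dots> \<le> sqrt r" using r r0 by (intro real_sqrt_le_mono) auto
        also have "\<dots> = r powr (1 / 2)" using r1 by (simp add: powr_half_sqrt)
        finally have "C0 d' \<rho> * r powr \<alpha>0 \<le> r powr (1 / 2) * r powr (1 / 2)"
          using r1 \<alpha>0 cpos by (intro mult_mono powr_mono) auto
        also have "\<dots> = r" using r1 by (simp add: powr_add[symmetric])
        finally show ?thesis .
      qed
      have 1: "lp_norm s (gball E v0 r) (\<lambda>y. f y - average (gball E v0 r) f)
         \<le> CS d' \<rho> * r powr (1 - d / d') *
           (\<Sum>(y, z)\<in>{(y, z). y \<in> B \<and> z \<in> B \<and> adj E y z}. \<bar>f y - f z\<bar> powr \<rho>) powr (1 / \<rho>)"
        unfolding B_def using r1 Cr by (intro sob gball_center[OF graph]) auto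
      have "(\<Sum>(y, z)\<in>{(y, z). y \<in> B \<and> z \<in> B \<and> adj E y z}. \<bar>f y - f z\<bar> powr \<rho>) powr (1 / \<rho>)
        \<le> sqrt (avg_norm q B (nu E W) * real (card B) powr recip q *
            (\<Sum>(y, z)\<in>{(y, z). y \<in> B \<and> z \<in> B \<and> adj E y z}. W y z * (f z - f y)\<^sup>2))"
        unfolding \<rho>_def
      proof (rule edge_Holder)
        show "finite B" "B \<noteq> {}" unfolding B_def using fin ne dr by auto
        show "finite {y. adj E x y}" for x using graph by (simp add: infinite_connected_lf_graph_def)
      qed (use q W in \<open>auto simp: conductances_def\<close>)
      also have "\<dots> \<le> sqrt (M * real (card B) powr recip q * (2 * energy W f))"
      proof (intro real_sqrt_le_mono mult_mono)
        have nu0: "0 \<le> nu E W x" for x unfolding nu_def using W_nonneg by (intro sum_nonneg) auto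
        have "avg_norm q B (nu E W) \<le> avg_norm q B (\<lambda>x. max 1 (nu E W x))"
          unfolding B_def using nu0 by (intro avg_norm_mono fin ne dr q) (auto simp: max_def)
        also have "\<dots> \<le> M" unfolding B_def M_def by (rule Mb(3)[OF dr])
        finally show "avg_norm q B (nu E W) \<le> M" .
        have finS: "finite {(y, z). y \<in> B \<and> z \<in> B \<and> adj E y z}"
          by (rule finite_subset[of _ "B \<times> B"]) (use fin in \<open>auto simp: B_def\<close>)
        have "finite_energy f"
          by (rule finite_energy_fin_supp(1)[of "{x. f x \<noteq> 0}"]) (use f in \<open>simp_all add: fin_supp_def\<close>)
        then have "(\<Sum>(y, z)\<in>{(y, z). y \<in> B \<and> z \<in> B \<and> adj E y z}. W y z * (f z - f y)\<^sup>2)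
            \<le> (\<Sum>\<^sub>\<infinity>(y, z). W y z * (f z - f y)\<^sup>2)"
          unfolding finite_energy_def by (rule finite_sum_le_infsum) (use finS W_nonneg in auto)
        then show "(\<Sum>(y, z)\<in>{(y, z). y \<in> B \<and> z \<in> B \<and> adj E y z}. W y z * (f z - f y)\<^sup>2) \<le> 2 * energy W f"
          by (simp add: energy_def)
        show "0 \<le> (\<Sum>(y, z)\<in>{(y, z). y \<in> B \<and> z \<in> B \<and> adj E y z}. W y z * (f z - f y)\<^sup>2)"
          using W_nonneg by (intro sum_nonneg) auto
        show "0 \<le> M" unfolding M_def using Mb(4)[of 1] by simp
        then show "0 \<le> M * real (card B) powr recip q" by simp
      qed simp_all
      finally have 2: "(\<Sum>(y, z)\<in>{(y, z). y \<in> B \<and> z \<in> B \<and> adj E y z}. \<bar>f y - f z\<bar> powr \<rho>) powr (1 / \<rho>)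
        \<le> sqrt (M * real (card B) powr recip q * (2 * energy W f))" .
      have "lp_norm s (gball E v0 r) (\<lambda>y. f y - average (gball E v0 r) f)
        \<le> CS d' \<rho> * r powr (1 - d / d') * sqrt (M * real (card B) powr recip q * (2 * energy W f))"
        using cpos by (intro order_trans[OF 1 mult_left_mono[OF 2]]) auto
      moreover have "M * real (card B) powr recip q * (2 * energy W f) = 2 * M * real (card B) powr recip q * energy W f"
        by (simp only: mult_ac)
      ultimately show "lp_norm s (gball E v0 r) (\<lambda>y. f y - average (gball E v0 r) f)
        \<le> CS d' \<rho> * r powr (1 - d / d') *
          sqrt (2 * M * real (card (gball E v0 (dS d' \<rho> * r))) powr recip q * energy W f)"
        by (simp only: B_def)
    qed
  qed (use PQ d d' m0 creg cpos r0 in auto)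
qed

text \<open>For small times only the trivial bound \<open>p(t,o,o) \<le> 1 / \<theta>(o)\<close> is available; this turns it into
  the factor \<open>\<mu>(o) / \<theta>(o)\<close> of the theorem.\<close>

lemma one_le_moment_nu:
  fixes E :: "'v set set"
  assumes graph: "infinite_connected_lf_graph E" and W: "conductances E W" and m: "m0 \<noteq> 0" and moment: "finite_moment E W m0"
  shows "1 \<le> mu_m E W m0 x * nu E W x"
proof -
  obtain y where y: "adj E x y" using adj_exists[OF graph] by blast
  have w: "0 < W x y" using W y by (simp add: conductances_def)
  have W0: "0 \<le> W a b" for a b using W by (simp add: conductances_def)
  have "W x y = (\<Sum>z\<in>{y}. W x z * dist_pow E m0 x z)"
    using gdist_adj[OF graph y] m by (simp add: dist_pow_def)
  also have "\<dots> \<le> mu_m E W m0 x"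
    unfolding mu_m_def using moment W0
    by (intro finite_sum_le_infsum) (auto simp: finite_moment_def dist_pow_def)
  finally have 1: "W x y \<le> mu_m E W m0 x" .
  have "inverse (W x y) \<le> nu E W x"
    unfolding nu_def using y W0 graph
    by (intro member_le_sum) (auto simp: infinite_connected_lf_graph_def)
  then have "W x y * inverse (W x y) \<le> mu_m E W m0 x * nu E W x"
    using 1 w by (intro mult_mono) auto
  then show ?thesis using w by simp
qed

text \<open>The constant precedes the graph, the conductances, \<open>R0\<close> and
  \<open>R1\<close> in the quantifiers, so it is built from exponents and regularity constants only.
  Times with \<open>2 * r0\<^sup>2 \<le> t\<close> are covered by \<open>diagonal_bound\<close>; for
  smaller ones the kernel is at most \<open>1 / \<theta> v0\<close>, which
  \<open>one_le_moment_nu\<close> and the norm of \<open>nu\<close> convert into the other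
  factors.\<close>

lemma heat_kernel_bound:
  fixes d m0 \<alpha>0 creg Creg :: real and p q :: ereal and C0 CS dS :: "real \<Rightarrow> real \<Rightarrow> real"
  assumes d: "3 \<le> d" and p: "1 < p" and q: "1 < q" and pq: "recip p + recip q < 2 / d" and m0: "d < m0"
  shows "\<exists>C3>0. \<forall>(E :: 'v set set) v0 \<theta> W (M :: 'w measure) F X P R0 R1.
            random_walk_setting E \<theta> W M F X P \<longrightarrow>
            large_scale_regular E v0 d R0 \<alpha>0 creg Creg R1 C0 CS dS \<longrightarrow>
            finite_moment E W m0 \<longrightarrow>
            norms_bounded E v0 \<theta> W (mu_m E W m0) p q \<longrightarrow>
            (\<forall>t>0. heat_kernel \<theta> X P t v0 v0 \<le>
               C3 * R0 powr ((recip p + recip q) * m0 * exp_\<gamma> d p q m0 / (2 * exp_\<beta> d p q m0))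
                  * R1 (sobolev_dim d p q) powr (m0 / exp_\<beta> d p q m0)
                  * M_zero E v0 \<theta> W (mu_m E W m0) p q
                      powr ((1 + m0 * exp_\<gamma> d p q m0) / exp_\<beta> d p q m0)
                  * (1 + mu_m E W m0 v0 / \<theta> v0) * t powr (- d / 2))"
proof -
  define d' where "d' = sobolev_dim d p q"
  define x where "x = 2 / d - recip p - recip q"
  have dim: "d < d'" "2 / d' - recip p - recip q = 2 * x / (2 + x)" "0 < x"
    unfolding d'_def x_def using sobolev_dim[OF d p q pq] by auto
  have d'2: "recip p + recip q < 2 / d'"
  proof -
    have "0 < 2 * x / (2 + x)" using dim(3) by simp
    then show ?thesis using dim(2) by simp
  qed
  have PQ: "0 \<le> recip p" "recip p < 1" "0 \<le> recip q" "recip q < 1" using recip_bounds p q by auto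
  define \<rho> where "\<rho> = 2 / (1 + recip q)"
  define s where "s = 1 / ((1 + recip q) / 2 - 1 / d')"
  define \<pi> where "\<pi> = 1 / (1 - recip p)"
  define K where "K = regular_network.K10 d (recip p) (recip q) creg Creg (CS d' \<rho>) (dS d' \<rho>) s \<pi>"
  define c where "c = max 1 ((C0 d' \<rho>)\<^sup>2)"
  define e0 where "e0 = (recip p + recip q) * m0 * exp_\<gamma> d p q m0 / (2 * exp_\<beta> d p q m0)"
  define e1 where "e1 = m0 / exp_\<beta> d p q m0"
  define e2 where "e2 = (1 + m0 * exp_\<gamma> d p q m0) / exp_\<beta> d p q m0"
  note exps = exponent_bounds[OF d m0 p q pq, folded e0_def e1_def e2_def x_def]
  have e_ge: "4 \<le> e1" "4 \<le> e2"
  proof -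
    show "4 \<le> e1" using exps(2) d by simp
    have "0 < 2 / x" using dim(3) by simp
    then show "4 \<le> e2" using exps(3) by linarith
  qed
  define cd2 where "cd2 = (2 :: real) powr (d / 2)"
  \<comment> \<open>The summands ensure positivity, the bound for large times and the bound for
    small times. The absolute values are there because the regularity constants are arbitrary reals
    until a regular graph is given.\<close>
  define C3 where "C3 = 1 + \<bar>K\<bar> * (2 * c powr (d + 4)) * cd2 + cd2 * c powr d * \<bar>Creg\<bar> powr recip q"
  have c1: "1 \<le> c" by (simp add: c_def)
  have cd20: "0 < cd2" by (simp add: cd2_def)
  have C3: "0 < C3" unfolding C3_def using c1 cd20 by (intro add_pos_nonneg mult_nonneg_nonneg) auto
  have main: "heat_kernel \<theta> X Pr t v0 v0 \<le>
      C3 * R0 powr e0 * R1 d' powr e1 * M_zero E v0 \<theta> W (mu_m E W m0) p q powr e2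
         * (1 + mu_m E W m0 v0 / \<theta> v0) * t powr (- d / 2)"
    if setting: "random_walk_setting E \<theta> W Me F X Pr"
      and regular: "large_scale_regular E v0 d R0 \<alpha>0 creg Creg R1 C0 CS dS"
      and fmoment: "finite_moment E W m0" and norms: "norms_bounded E v0 \<theta> W (mu_m E W m0) p q" and t: "0 < t"
    for E :: "'v set set" and v0 \<theta> W and Me :: "'w measure" and F X Pr R0 R1 t
  proof -
    define M where "M = M_zero E v0 \<theta> W (mu_m E W m0) p q"
    define r0 where "r0 = c * R1 d'"
    obtain T where T: "point_evolution W \<theta> T v0"
      and hk: "\<And>t. 0 \<le> t \<Longrightarrow> heat_kernel \<theta> X Pr t v0 v0 = T t (\<lambda>y. if y = v0 then 1 / \<theta> v0 else 0) v0"
      using process_evolution[OF setting] by metis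
    interpret regular_evolution W \<theta> v0 "\<lambda>x. real (gdist E v0 x)" "\<lambda>x y. real (gdist E x y)" "mu_m E W m0"
      d d' "recip p" "recip q" m0 M r0 creg Creg "CS d' \<rho>" "dS d' \<rho>" s \<pi> T
      unfolding M_def r0_def c_def s_def \<pi>_def \<rho>_def
      by (rule regular_evolution_instance[OF d p q less_imp_le[OF m0] dim(1) d'2 setting regular fmoment norms T])
    have hv: "heat_kernel \<theta> X Pr t v0 v0 = v t v0" using hk t by (simp add: v_def \<delta>_def)
    have graph: "infinite_connected_lf_graph E" and W: "conductances E W"
      using setting by (simp_all add: random_walk_setting_def)
    have R0: "1 \<le> R0" and vr: "volume_regular E v0 d R0 \<alpha>0 creg Creg" and sr: "sobolev_regular E v0 d R0 \<alpha>0 R1 C0 CS dS"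
      and \<alpha>0: "0 \<le> \<alpha>0" "\<alpha>0 < 1 / 2"
      using regular by (simp_all add: large_scale_regular_def)
    have R1: "R0 \<le> R1 d'" "1 \<le> R1 d'" using sr dim(1) R0 by (auto simp: sobolev_regular_def intro: order_trans)
    have M: "1 \<le> M" and r0: "1 \<le> r0" using parameters by auto
    have \<theta>: "0 < \<theta> v0" by (rule \<theta>_pos)
    have \<mu>: "0 \<le> mu_m E W m0 v0" by (rule \<kappa>_nonneg)
    define Y where "Y = R1 d' powr e1 * M powr e2 * (1 + mu_m E W m0 v0 / \<theta> v0)"
    have ge1: "1 \<le> R1 d' powr e1" "1 \<le> M powr e2" "1 \<le> R0 powr e0" "1 \<le> 1 + mu_m E W m0 v0 / \<theta> v0"
      using R1 M R0 exps(1) e_ge \<mu> \<theta> by (auto intro!: ge_one_powr_ge_zero)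
    have key: "heat_kernel \<theta> X Pr t v0 v0 \<le> C3 * Y * t powr (- d / 2)"
    proof (cases "2 * r0\<^sup>2 \<le> t")
      case True
      have KK: "K10 = K" by (simp add: K_def)
      have "v (2 * (t / 2)) v0 \<le> K * (M powr (3 + 2 / \<omega>) + M ^ 3 * r0 powr (d + 4)) * (t / 2) powr (- d / 2)"
        unfolding KK[symmetric] by (rule diagonal_bound) (use True in simp)
      also have "\<dots> \<le> \<bar>K\<bar> * (2 * c powr (d + 4) * (R1 d' powr e1 * M powr e2)) * (cd2 * t powr (- d / 2))"
      proof (intro mult_mono)
        have cd: "1 \<le> c powr (d + 4)" using c1 d by (intro ge_one_powr_ge_zero) auto
        have "3 + 2 / \<omega> \<le> e2"
        proof -
          \<comment> \<open>\<open>\<omega>\<close> is \<open>\<pi>\<close> times the gap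
            \<open>2 / d' - recip p - recip q\<close>, and \<open>\<pi> \<ge> 1\<close>.\<close>
          have "2 * x / (2 + x) \<le> \<omega>"
          proof -
            have "1 / s = (1 + recip q) / 2 - 1 / d'" by (simp add: s_def)
            then have "2 / s = 1 + recip q - 2 / d'" by (simp add: field_simps)
            moreover have "\<pi> * (1 - recip p) = 1" using parameters by (simp add: \<pi>_def)
            ultimately have "\<omega> = \<pi> * (1 - recip p) - \<pi> * (1 + recip q - 2 / d')"
              unfolding \<omega>_def by (metis times_divide_eq_right mult.commute)
            also have "\<dots> = \<pi> * (2 / d' - recip p - recip q)" by (simp add: algebra_simps)
            also have "\<dots> \<ge> 1 * (2 / d' - recip p - recip q)"
              using exponents(4) d'2 by (intro mult_right_mono) auto
            finally show ?thesis using dim(2) by simp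
          qed
          moreover have "0 < 2 * x / (2 + x)" using dim(3) by simp
          ultimately have "2 / \<omega> \<le> 2 / (2 * x / (2 + x))" by (intro divide_left_mono mult_pos_pos) auto
          also have "\<dots> = 2 / x + 1" using dim(3) by (simp add: field_simps)
          finally show ?thesis using exps(3) by simp
        qed
        then have M1: "M powr (3 + 2 / \<omega>) \<le> M powr e2" using M by (intro powr_mono) auto
        have "M ^ 3 = M powr 3" using M by (simp add: powr_numeral)
        also have "\<dots> \<le> M powr e2" using M e_ge by (intro powr_mono) auto
        finally have M3: "M ^ 3 \<le> M powr e2" .
        have "M powr (3 + 2 / \<omega>) \<le> c powr (d + 4) * (R1 d' powr e1 * M powr e2)"
        proof -
          have "1 * (1 * M powr (3 + 2 / \<omega>)) \<le> c powr (d + 4) * (R1 d' powr e1 * M powr e2)"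
            using cd ge1 M1 by (intro mult_mono) auto
          then show ?thesis by simp
        qed
        moreover have "M ^ 3 * r0 powr (d + 4) \<le> c powr (d + 4) * (R1 d' powr e1 * M powr e2)"
        proof -
          have "r0 powr (d + 4) = c powr (d + 4) * R1 d' powr (d + 4)"
            by (simp add: r0_def powr_mult)
          also have "\<dots> \<le> c powr (d + 4) * R1 d' powr e1"
            using R1 exps(2) by (intro mult_left_mono powr_mono) auto
          finally have "M ^ 3 * r0 powr (d + 4) \<le> M powr e2 * (c powr (d + 4) * R1 d' powr e1)"
            using M3 M by (intro mult_mono) auto
          then show ?thesis by (simp add: mult_ac)
        qed
        ultimately show "M powr (3 + 2 / \<omega>) + M ^ 3 * r0 powr (d + 4) \<le> 2 * c powr (d + 4) * (R1 d' powr e1 * M powr e2)"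
          by simp
        show "(t / 2) powr (- d / 2) \<le> cd2 * t powr (- d / 2)"
        proof -
          have "(t / 2) powr (- d / 2) = t powr (- d / 2) / 2 powr (- d / 2)" by (rule powr_divide)
          also have "\<dots> = cd2 * t powr (- d / 2)" using powr_minus_divide[of 2 "d / 2"] by (simp add: cd2_def)
          finally show ?thesis by simp
        qed
      qed (use M in \<open>auto intro!: add_nonneg_nonneg\<close>)
      also have "\<dots> = (\<bar>K\<bar> * (2 * c powr (d + 4)) * cd2) * (R1 d' powr e1 * M powr e2 * 1) * t powr (- d / 2)"
        by (simp add: mult_ac)
      also have "\<dots> \<le> C3 * Y * t powr (- d / 2)"
        unfolding Y_def using ge1 c1 cd20 C3
        by (intro mult_right_mono mult_mono mult_left_mono) (auto simp: C3_def intro!: mult_nonneg_nonneg)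
      finally show ?thesis using hv by simp
    next
      case False
      have tpos: "0 < t powr (- d / 2)" using t by simp
      \<comment> \<open>For \<open>t < 2 * r0\<^sup>2\<close> the decay in time is still bounded
        below, at the price of \<open>r0 powr d\<close>.\<close>
      have "1 \<le> cd2 * r0 powr d * t powr (- d / 2)"
      proof -
        have "t powr (d / 2) \<le> (2 * r0\<^sup>2) powr (d / 2)" using False t d by (intro powr_mono2) auto
        also have "\<dots> = cd2 * (r0 powr 2) powr (d / 2)" using r0 by (simp add: cd2_def powr_mult powr_numeral)
        also have "(r0 powr 2) powr (d / 2) = r0 powr d" by (simp only: powr_powr) simp
        finally have "t powr (d / 2) * t powr (- d / 2) \<le> cd2 * r0 powr d * t powr (- d / 2)"
          by (intro mult_right_mono) auto
        moreover have "t powr (d / 2) * t powr (- d / 2) = 1" using t by (simp add: powr_add[symmetric])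
        ultimately show ?thesis by simp
      qed
      then have "1 / \<theta> v0 * 1 \<le> 1 / \<theta> v0 * (cd2 * r0 powr d * t powr (- d / 2))"
        using \<theta> by (intro mult_left_mono) auto
      then have 1: "v t v0 \<le> 1 / \<theta> v0 * (cd2 * r0 powr d * t powr (- d / 2))"
        using v_bounds(2)[of t v0] t by simp
      have nu0: "0 \<le> nu E W y" for y unfolding nu_def using W_nonneg by (intro sum_nonneg) auto
      \<comment> \<open>A value at one point is bounded by the norm over the ball of radius
        \<open>R0\<close> times a power of its volume: Hoelder's inequality against the indicator of
        \<open>v0\<close>.\<close>
      have nu: "nu E W v0 \<le> (Creg * R0 powr d) powr recip q * M"
      proof -
        define B where "B = gball E v0 R0"
        have B: "finite B" "B \<noteq> {}" "v0 \<in> B"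
          unfolding B_def using finite_gball[OF graph] gball_center[OF graph, of R0 v0] R0 by auto
        have "nu E W v0 = (\<Sum>y\<in>B. nu E W y * (if y = v0 then 1 else 0))" using B by (simp add: if_distrib cong: if_cong)
        also have "\<dots> \<le> avg_norm q B (nu E W) * real (card B) powr recip q *
            (\<Sum>y\<in>B. (if y = v0 then 1 else 0) powr (1 / (1 - recip q))) powr (1 - recip q)"
          using B q nu0 by (intro sum_mult_le_avg_norm) auto
        also have "(\<Sum>y\<in>B. (if y = v0 then 1 else (0 :: real)) powr (1 / (1 - recip q))) = 1"
          using B by (simp add: if_distrib[of "\<lambda>z. z powr _"] cong: if_cong)
        also have "avg_norm q B (nu E W) * real (card B) powr recip q * 1 powr (1 - recip q)
            \<le> M * (Creg * R0 powr d) powr recip q"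
        proof -
          have "avg_norm q B (nu E W) \<le> avg_norm q B (\<lambda>x. max 1 (nu E W x))"
            using nu0 by (intro avg_norm_mono B q) (auto simp: max_def)
          also have "\<dots> \<le> M" unfolding B_def M_def by (rule M_zero_bounds(3)[OF graph p q norms R0])
          finally have "avg_norm q B (nu E W) \<le> M" .
          moreover have "real (card B) \<le> Creg * R0 powr d"
          proof -
            have "R0 powr \<alpha>0 \<le> R0 powr 1" using \<alpha>0 R0 by (intro powr_mono) auto
            then show ?thesis
              using vr[unfolded volume_regular_def, THEN conjunct2, THEN conjunct2, rule_format, of R0 R0 v0] B(3) R0
              by (simp add: B_def)
          qed
          ultimately show ?thesis using PQ M by (simp add: mult_mono powr_mono2)
        qed
        finally show ?thesis by (simp add: mult.commute)
      qed
      have "1 \<le> mu_m E W m0 v0 * nu E W v0"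
        using d m0 by (intro one_le_moment_nu graph W fmoment) auto
      also have "\<dots> \<le> mu_m E W m0 v0 * ((Creg * R0 powr d) powr recip q * M)"
        using \<mu> nu by (intro mult_left_mono) auto
      finally have "1 / \<theta> v0 \<le> mu_m E W m0 v0 * ((Creg * R0 powr d) powr recip q * M) / \<theta> v0"
        using \<theta> by (intro divide_right_mono) auto
      also have "\<dots> = mu_m E W m0 v0 / \<theta> v0 * (Creg powr recip q * R0 powr (d * recip q) * M)"
        by (simp add: powr_mult powr_powr)
      also have "\<dots> \<le> (1 + mu_m E W m0 v0 / \<theta> v0) * (\<bar>Creg\<bar> powr recip q * R1 d' powr 2 * M powr e2)"
      proof (intro mult_mono)
        have "R0 powr (d * recip q) \<le> R0 powr 2"
        proof (rule powr_mono)
          have "recip q \<le> 2 / d" using pq PQ by simp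
          then have "d * recip q \<le> d * (2 / d)" using d by (intro mult_left_mono) auto
          then show "d * recip q \<le> 2" using d by simp
        qed (use R0 in auto)
        also have "\<dots> \<le> R1 d' powr 2" using R0 R1 by (intro powr_mono2) auto
        finally show "R0 powr (d * recip q) \<le> R1 d' powr 2" .
        have "M powr 1 \<le> M powr e2" using M e_ge by (intro powr_mono) auto
        then show "M \<le> M powr e2" using M by simp
        show "Creg powr recip q \<le> \<bar>Creg\<bar> powr recip q" using Creg_pos by simp
      qed (use M \<mu> \<theta> in auto)
      finally have 2: "1 / \<theta> v0 \<le> (1 + mu_m E W m0 v0 / \<theta> v0) * (\<bar>Creg\<bar> powr recip q * R1 d' powr 2 * M powr e2)" .
      have "v t v0 \<le> (1 + mu_m E W m0 v0 / \<theta> v0) * (\<bar>Creg\<bar> powr recip q * R1 d' powr 2 * M powr e2)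
          * (cd2 * r0 powr d * t powr (- d / 2))"
        by (rule order_trans[OF 1 mult_right_mono[OF 2]]) (use cd20 in auto)
      also have "\<dots> = (cd2 * c powr d * \<bar>Creg\<bar> powr recip q) * ((R1 d' powr 2 * R1 d' powr d) * M powr e2 * (1 + mu_m E W m0 v0 / \<theta> v0)) * t powr (- d / 2)"
        by (simp add: r0_def powr_mult mult_ac)
      also have "\<dots> \<le> C3 * Y * t powr (- d / 2)"
      proof (intro mult_right_mono mult_mono)
        show "cd2 * c powr d * \<bar>Creg\<bar> powr recip q \<le> C3" using cd20 c1 by (simp add: C3_def)
        have "R1 d' powr 2 * R1 d' powr d = R1 d' powr (2 + d)" by (rule powr_add[symmetric])
        also have "\<dots> \<le> R1 d' powr e1" using R1 exps(2) by (intro powr_mono) auto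
        finally have "R1 d' powr 2 * R1 d' powr d \<le> R1 d' powr e1" .
        then show "R1 d' powr 2 * R1 d' powr d * M powr e2 * (1 + mu_m E W m0 v0 / \<theta> v0) \<le> Y"
          unfolding Y_def using ge1 by (intro mult_right_mono) auto
      qed (use C3 ge1 in auto)
      finally show ?thesis using hv by simp
    qed
    \<comment> \<open>Inserting the power of \<open>R0\<close> only enlarges the right-hand side, as
      its exponent is nonnegative.\<close>
    have "C3 * Y * t powr (- d / 2) \<le> C3 * (R0 powr e0 * Y) * t powr (- d / 2)"
    proof (intro mult_right_mono mult_left_mono)
      have "0 \<le> Y" unfolding Y_def using ge1 by (intro mult_nonneg_nonneg) auto
      then show "Y \<le> R0 powr e0 * Y" using mult_right_mono[OF ge1(3), of Y] by simp
    qed (use C3 in auto)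
    with key show ?thesis by (simp add: Y_def M_def mult_ac)
  qed
  show ?thesis
    by (intro exI[of _ C3] conjI[OF C3] allI impI) (rule main[unfolded e0_def e1_def e2_def d'_def])
qed

text \<open>Every jump has length 1, so the weight \<open>dist_pow\<close> is 1 wherever
  \<open>W\<close> does not vanish. This reduces nearest neighbour conductances to the general
  estimate, for any \<open>m\<close>.\<close>

lemma nearest_neighbour_moment:
  fixes E :: "'v set set"
  assumes graph: "infinite_connected_lf_graph E" and W: "conductances E W" and nn: "\<And>x y. W x y \<noteq> 0 \<Longrightarrow> adj E x y"
  shows "finite_moment E W m" "mu_m E W m = mu W"
proof -
  have eq: "(\<lambda>y. W x y * dist_pow E m x y) = W x" for x
  proof
    fix y
    show "W x y * dist_pow E m x y = W x y"
      using nn[of x y] gdist_adj[OF graph, of x y] by (cases "W x y = 0") (auto simp: dist_pow_def)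
  qed
  show "finite_moment E W m" using W by (simp add: finite_moment_def eq conductances_def)
  show "mu_m E W m = mu W" by (rule ext) (simp add: mu_m_def mu_def eq)
qed

theorem theorem1p5:
  fixes d :: real and p q :: ereal
  assumes "3 \<le> d" and "1 < p" and "1 < q" and "recip p + recip q < 2 / d"
  shows
    "(\<exists>d'>d. \<forall>m0>d. ereal (max 1 (d / (m0 - 2))) < p \<longrightarrow>
       (\<forall>\<alpha>0 creg Creg C0 CS dS. \<exists>C3>0.
          \<forall>(E :: 'v set set) v0 \<theta> W (M :: 'w measure) F X P R0 R1.
            random_walk_setting E \<theta> W M F X P \<longrightarrow>
            large_scale_regular E v0 d R0 \<alpha>0 creg Creg R1 C0 CS dS \<longrightarrow>
            finite_moment E W m0 \<longrightarrow>
            norms_bounded E v0 \<theta> W (mu_m E W m0) p q \<longrightarrow>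
            (\<forall>t>0. heat_kernel \<theta> X P t v0 v0 \<le>
               C3 * R0 powr ((recip p + recip q) * m0 * exp_\<gamma> d p q m0 / (2 * exp_\<beta> d p q m0))
                  * R1 d' powr (m0 / exp_\<beta> d p q m0)
                  * M_zero E v0 \<theta> W (mu_m E W m0) p q
                      powr ((1 + m0 * exp_\<gamma> d p q m0) / exp_\<beta> d p q m0)
                  * (1 + mu_m E W m0 v0 / \<theta> v0) * t powr (- d / 2))))
     \<and>
     (\<exists>d'>d. \<forall>m0>d.
       \<forall>\<alpha>0 creg Creg C0 CS dS. \<exists>C3>0.
          \<forall>(E :: 'v set set) v0 \<theta> W (M :: 'w measure) F X P R0 R1.
            random_walk_setting E \<theta> W M F X P \<longrightarrow>
            (\<forall>x y. W x y \<noteq> 0 \<longrightarrow> adj E x y) \<longrightarrow>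
            large_scale_regular E v0 d R0 \<alpha>0 creg Creg R1 C0 CS dS \<longrightarrow>
            norms_bounded E v0 \<theta> W (mu W) p q \<longrightarrow>
            (\<forall>t>0. heat_kernel \<theta> X P t v0 v0 \<le>
               C3 * R0 powr ((recip p + recip q) * m0 * exp_\<gamma> d p q m0 / (2 * exp_\<beta> d p q m0))
                  * R1 d' powr (m0 / exp_\<beta> d p q m0)
                  * M_zero E v0 \<theta> W (mu W) p q
                      powr ((1 + m0 * exp_\<gamma> d p q m0) / exp_\<beta> d p q m0)
                  * (1 + mu W v0 / \<theta> v0) * t powr (- d / 2)))"
  \<comment> \<open>One dimension \<open>d'\<close> serves both parts; it depends on
    \<open>d\<close>, \<open>p\<close> and \<open>q\<close> only, so it is fixed before
    \<open>m0\<close>.\<close>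
  apply (rule conjI; rule exI[of _ "sobolev_dim d p q"]; rule conjI[OF sobolev_dim(1)[OF assms]]; intro allI impI)
  subgoal by (rule heat_kernel_bound[OF assms])
  subgoal premises prems for m0 \<alpha>0 creg Creg C0 CS dS
    apply (rule ex_forward[OF heat_kernel_bound[OF assms prems, of \<alpha>0 creg Creg C0 CS dS]])
    apply (erule conj_forward, assumption)
    apply (erule all_forward)+
    apply (intro impI)
    subgoal for C3 E v0 \<theta> W M F X P R0 R1
      using nearest_neighbour_moment[of E W m0] by (simp add: random_walk_setting_def)
    done
  done

end
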